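(* Let $X$ be a continuous vector field on $\mathbb{S}^1$. Consider the width $\omega(X)\in[0,+\infty]$ of $X$ and the harmonic Lagrangian vector field $\mathrm{HL}(X)$ on $\mathbb{H}^2$. The following are equivalent: (1) $X$ is a Zygmund vector field. (2) There exists a harmonic Lagrangian vector field $V$ on $\mathbb{H}^2$ which extends continuously to $X$ and such that $\lVert\overline{\partial}V\rVert_\infty$ is finite. (3) $\omega(X)<+\infty$. (4) $\lVert\overline{\partial}\,\mathrm{HL}(X)\rVert_\infty<+\infty$. Moreover: (i) The harmonic Lagrangian extension $V$ as in (2) is unique. (ii) The following estimates hold: $$\tfrac16\lVert\overline{\partial}\,\mathrm{HL}(X)\rVert_\infty\le\omega(X)\le 2\lVert\overline{\partial}\,\mathrm{HL}(X)\rVert_\infty .$$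
   Context: Minkowski space $\mathbb{R}^{1,2}$ is $\mathbb{R}^3$ with $\langle x,y\rangle_{1,2}=-x_0y_0+x_1y_1+x_2y_2$. The hyperbolic plane is $\mathbb{H}^2=\{x\in\mathbb{R}^{1,2}: \langle x,x\rangle_{1,2}=-1,\ x_0>0\}$ with the induced Riemannian metric $g$, Levi-Civita connection $\nabla$ and complex structure $\mathrm{J}_p(v)=p\boxtimes v$, where $\langle x\boxtimes y,v\rangle_{1,2}=\det(x,y,v)$ for all $v$. $\mathrm{grad}$ and $\Delta$ are the gradient and Laplace-Beltrami operator ($\Delta=\mathrm{tr}\,\mathrm{Hess}$) of $\mathbb{H}^2$. Let $\mathbb{D}^2\subset\mathbb{R}^2\cong\mathbb{C}$ be the open unit disk (Klein model), $\mathbb{S}^1=\partial\mathbb{D}^2$, $\Pi:\mathbb{H}^2\to\mathbb{D}^2$, $\Pi(x_0,x_1,x_2)=(x_1/x_0,x_2/x_0)$; for $u:\mathbb{H}^2\to\mathbb{R}$ set $\overline{u}(\eta)=\sqrt{1-|\eta|^2}\,u(\Pi^{-1}(\eta))$. Harmonic Lagrangian. For $(x,v)\in \mathrm{T}\mathbb{H}^2$, identify $\mathrm{T}_x\mathbb{H}^2\times \mathrm{T}_x\mathbb{H}^2\cong \mathrm{T}_{(x,v)}\mathrm{T}\mathbb{H}^2$ by $(w_1,w_2)\mapsto w_1^{\mathcal{H}}+w_2^{\mathcal{V}}$ (horizontal lift of $w_1$ with respect to $\nabla$ plus vertical lift of $w_2$). Put $\mathbb{G}((X_1,X_2),(Y_1,Y_2))=g(X_1,Y_2)+g(X_2,Y_1)$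 and $\Omega((X_1,X_2),(Y_1,Y_2))=g(\mathrm{J}X_1,Y_2)-g(X_2,\mathrm{J}Y_1)$. A smooth vector field $V$ is harmonic Lagrangian if $V:(\mathbb{H}^2,g)\to(\mathrm{T}\mathbb{H}^2,\mathbb{G})$ is a harmonic map (vanishing tension field $\mathrm{tr}_g\nabla^2V$, with $\nabla^2V(X,Y)=\nabla^{\mathbb{G}}_{\mathrm{d}V(X)}\mathrm{d}V(Y)-\mathrm{d}V(\nabla_XY)$) and $V^*\Omega=0$. Extension. A vector field $V$ on $\mathbb{H}^2$ extends continuously to $X$ (a tangent field on $\mathbb{S}^1$ seen as a map $\mathbb{S}^1\to\mathbb{R}^2$) if $\Pi_*V(\eta)=\mathrm{d}_{\Pi^{-1}(\eta)}\Pi(V(\Pi^{-1}(\eta)))$ satisfies $\Pi_*V(\eta_n)\to X(\eta_\infty)$ whenever $\eta_n\in\mathbb{D}^2$ converges to $\eta_\infty\in\mathbb{S}^1$. $\mathrm{HL}(X)$. The support function $\phi_X:\mathbb{S}^1\to\mathbb{R}$ is defined by $X(z)=iz\,\phi_X(z)$. It is known that there is a unique smooth $u_X:\mathbb{H}^2\to\mathbb{R}$ with $\Delta u_X-2u_X=0$ and $\overline{u_X}$ extending continuously to $\overline{\mathbb{D}^2}$ with $\overline{u_X}|_{\mathbb{S}^1}=\phi_X$. Then $\mathrm{HL}(X):=\mathrm{J}\,\mathrm{grad}(u_X)$. $\overline\partial$-operator. $\overline{\partial}V(Y):=\frac12(\nabla_YV+\mathrm{J}\nabla_{\mathrm{J}Y}V)$,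 a $(1,1)$-tensor; $\lVert\overline{\partial}V_p\rVert$ is its operator norm on $(\mathrm{T}_p\mathbb{H}^2,g)$ and $\lVert\overline{\partial}V\rVert_\infty=\sup_{p\in\mathbb{H}^2}\lVert\overline{\partial}V_p\rVert\in[0,+\infty]$. Width. For $z\in\overline{\mathbb{D}^2}$, $\phi_X^-(z)=\sup\{a(z)\}$ over affine $a:\mathbb{R}^2\to\mathbb{R}$ with $a|_{\mathbb{S}^1}\le\phi_X$, and $\phi_X^+(z)=\inf\{a(z)\}$ over affine $a$ with $\phi_X\le a|_{\mathbb{S}^1}$. The width is $\omega(X)=\sup_{\eta\in\mathbb{D}^2}\frac{\phi_X^+(\eta)-\phi_X^-(\eta)}{\sqrt{1-|\eta|^2}}$. Zygmund. For a quadruple $Q=[a,b,c,d]$ of points of $\mathbb{S}^1$ in counterclockwise order, $\mathrm{cr}(Q)=\frac{(b-a)(d-c)}{(c-b)(d-a)}$ and $X[Q]=\frac{X(b)-X(a)}{b-a}-\frac{X(c)-X(b)}{c-b}+\frac{X(d)-X(c)}{d-c}-\frac{X(a)-X(d)}{a-d}$ ($X$ being $\mathbb{C}$-valued). A continuous $X$ is Zygmund if $\sup_{\mathrm{cr}(Q)=1}|X[Q]|<+\infty$. *)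

theory Defs
  imports "HOL-Analysis.Analysis"
begin

section \<open>Pseudo-Riemannian geometry on an open subset of a Euclidean space\<close>

text \<open>
  All manifolds below (the hyperbolic plane and its tangent bundle) carry a global chart, so the
  general notions are set up for a pseudo-Riemannian metric on an open subset of a Euclidean
  space; \<open>g x a b\<close> is the product of the vectors \<open>a\<close>, \<open>b\<close> at the point \<open>x\<close>.
\<close>

type_synonym 'a pmetric = "'a \<Rightarrow> 'a \<Rightarrow> 'a \<Rightarrow> real"

abbreviation ddir :: "('a::real_normed_vector \<Rightarrow> 'b::real_normed_vector) \<Rightarrow> 'a \<Rightarrow> 'a \<Rightarrow> 'b" where
  "ddir f x a \<equiv> frechet_derivative f (at x) a"

text \<open>Intended for open \<open>S\<close> and a finite-dimensional domain.\<close>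

primrec Ck_on :: "nat \<Rightarrow> 'a::real_normed_vector set \<Rightarrow> ('a \<Rightarrow> 'b::real_normed_vector) \<Rightarrow> bool" where
  "Ck_on 0 S f \<longleftrightarrow> continuous_on S f"
| "Ck_on (Suc k) S f \<longleftrightarrow>
     (\<forall>x\<in>S. f differentiable (at x)) \<and> (\<forall>v. Ck_on k S (\<lambda>x. ddir f x v))"

definition smooth_on :: "'a::real_normed_vector set \<Rightarrow> ('a \<Rightarrow> 'b::real_normed_vector) \<Rightarrow> bool" where
  "smooth_on S f \<longleftrightarrow> (\<forall>k. Ck_on k S f)"

text \<open>The vector which the metric associates to a linear form.\<close>

definition sharp :: "'a::euclidean_space pmetric \<Rightarrow> 'a \<Rightarrow> ('a \<Rightarrow> real) \<Rightarrow> 'a" where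
  "sharp g x \<alpha> = (THE w. \<forall>c. g x w c = \<alpha> c)"

text \<open>
  The Christoffel map of the Levi-Civita connection: the value at \<open>x\<close> of \<open>\<nabla>\<^sub>a b\<close> for the constant
  vector fields \<open>a\<close> and \<open>b\<close>, which is determined by the Koszul formula.
\<close>

definition christoffel :: "'a::euclidean_space pmetric \<Rightarrow> 'a \<Rightarrow> 'a \<Rightarrow> 'a \<Rightarrow> 'a" where
  "christoffel g x a b = sharp g x (\<lambda>c.
     (ddir (\<lambda>y. g y b c) x a + ddir (\<lambda>y. g y a c) x b - ddir (\<lambda>y. g y a b) x c) / 2)"

definition cov_deriv ::
  "'a::euclidean_space pmetric \<Rightarrow> ('a \<Rightarrow> 'a) \<Rightarrow> 'a \<Rightarrow> 'a \<Rightarrow> 'a" where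
  "cov_deriv g V x a = ddir V x a + christoffel g x a (V x)"

definition gradient :: "'a::euclidean_space pmetric \<Rightarrow> ('a \<Rightarrow> real) \<Rightarrow> 'a \<Rightarrow> 'a" where
  "gradient g u x = sharp g x (ddir u x)"

text \<open>
  In coordinates this is \<open>g\<^sup>i\<^sup>j B\<^sub>i\<^sub>j\<close>, since \<open>g\<^sup>i\<^sup>j\<close> are the components of the vector dual to the
  \<open>i\<close>-th coordinate form.
\<close>

definition metric_trace ::
  "'a::euclidean_space pmetric \<Rightarrow> 'a \<Rightarrow> ('a \<Rightarrow> 'a \<Rightarrow> 'b::real_vector) \<Rightarrow> 'b" where
  "metric_trace g x B = (\<Sum>b\<in>Basis. B (sharp g x (\<lambda>c. b \<bullet> c)) b)"

definition hessian :: "'a::euclidean_space pmetric \<Rightarrow> ('a \<Rightarrow> real) \<Rightarrow> 'a \<Rightarrow> 'a \<Rightarrow> 'a \<Rightarrow> real" where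
  "hessian g u x a b = ddir (\<lambda>y. ddir u y b) x a - ddir u x (christoffel g x a b)"

definition laplacian :: "'a::euclidean_space pmetric \<Rightarrow> ('a \<Rightarrow> real) \<Rightarrow> 'a \<Rightarrow> real" where
  "laplacian g u x = metric_trace g x (hessian g u x)"

text \<open>
  \<open>\<nabla>\<^sup>2F(a,b) = \<nabla>\<^sup>h\<^bsub>dF(a)\<^esub> dF(b) - dF(\<nabla>\<^sub>a b)\<close> for a map \<open>F\<close> from metric \<open>g\<close> to metric \<open>h\<close>. It is tensorial, so
  that constant fields \<open>a\<close>, \<open>b\<close> suffice.
\<close>

definition second_fundamental_form ::
  "'a::euclidean_space pmetric \<Rightarrow> 'b::euclidean_space pmetric \<Rightarrow> ('a \<Rightarrow> 'b) \<Rightarrow> 'a \<Rightarrow> 'a \<Rightarrow> 'a \<Rightarrow> 'b" where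
  "second_fundamental_form g h F x a b =
     (ddir (\<lambda>y. ddir F y b) x a + christoffel h (F x) (ddir F x a) (ddir F x b))
     - ddir F x (christoffel g x a b)"

definition tension ::
  "'a::euclidean_space pmetric \<Rightarrow> 'b::euclidean_space pmetric \<Rightarrow> ('a \<Rightarrow> 'b) \<Rightarrow> 'a \<Rightarrow> 'b" where
  "tension g h F x = metric_trace g x (second_fundamental_form g h F x)"

definition harmonic_map_on ::
  "'a::euclidean_space set \<Rightarrow> 'a pmetric \<Rightarrow> 'b::euclidean_space pmetric \<Rightarrow> ('a \<Rightarrow> 'b) \<Rightarrow> bool" where
  "harmonic_map_on S g h F \<longleftrightarrow> (\<forall>x\<in>S. tension g h F x = 0)"

subsection \<open>The tangent bundle\<close>

text \<open>
  A point of the tangent bundle is a pair \<open>(x, v)\<close>; a tangent vector at it is again a pair, given by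
  its components in this product chart.
\<close>

definition horizontal_lift :: "'a::euclidean_space pmetric \<Rightarrow> 'a \<times> 'a \<Rightarrow> 'a \<Rightarrow> 'a \<times> 'a" where
  "horizontal_lift g z w = (w, - christoffel g (fst z) w (snd z))"

definition vertical_lift :: "'a::euclidean_space \<Rightarrow> 'a \<times> 'a" where
  "vertical_lift w = (0, w)"

definition hv_split :: "'a::euclidean_space pmetric \<Rightarrow> 'a \<times> 'a \<Rightarrow> 'a \<times> 'a \<Rightarrow> 'a \<times> 'a" where
  "hv_split g z X = (fst X, snd X + christoffel g (fst z) (fst X) (snd z))"

lemma hv_split_iff:
  "hv_split g z X = (w1, w2) \<longleftrightarrow> X = horizontal_lift g z w1 + vertical_lift w2"
  by (cases X) (auto simp: hv_split_def horizontal_lift_def vertical_lift_def)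

definition bundle_metric :: "'a::euclidean_space pmetric \<Rightarrow> ('a \<times> 'a) pmetric" where
  "bundle_metric g z X Y =
     (let (X1, X2) = hv_split g z X; (Y1, Y2) = hv_split g z Y
      in g (fst z) X1 Y2 + g (fst z) X2 Y1)"

definition bundle_form ::
  "'a::euclidean_space pmetric \<Rightarrow> ('a \<Rightarrow> 'a \<Rightarrow> 'a) \<Rightarrow> 'a \<times> 'a \<Rightarrow> 'a \<times> 'a \<Rightarrow> 'a \<times> 'a \<Rightarrow> real" where
  "bundle_form g J z X Y =
     (let (X1, X2) = hv_split g z X; (Y1, Y2) = hv_split g z Y
      in g (fst z) (J (fst z) X1) Y2 - g (fst z) X2 (J (fst z) Y1))"


section \<open>The hyperbolic plane\<close>

text \<open>The coordinates \<open>x\<^sub>0, x\<^sub>1, x\<^sub>2\<close> of Minkowski space are \<open>x $ 1\<close>, \<open>x $ 2\<close>, \<open>x $ 3\<close>.\<close>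

definition mink :: "real^3 \<Rightarrow> real^3 \<Rightarrow> real" where
  "mink x y = - (x$1 * y$1) + x$2 * y$2 + x$3 * y$3"

definition hyp_plane :: "(real^3) set" where
  "hyp_plane = {x. mink x x = -1 \<and> x$1 > 0}"

definition hyp_tangent :: "real^3 \<Rightarrow> (real^3) set" where
  "hyp_tangent p = {v. mink p v = 0}"

definition mink_cross :: "real^3 \<Rightarrow> real^3 \<Rightarrow> real^3" where
  "mink_cross x y = (THE w. \<forall>v. mink w v = det (vector [x, y, v] :: real^3^3))"

definition hyp_J :: "real^3 \<Rightarrow> real^3 \<Rightarrow> real^3" where
  "hyp_J p v = mink_cross p v"

subsection \<open>The Klein model as a global chart\<close>

abbreviation disk :: "complex set" where
  "disk \<equiv> ball 0 1"

abbreviation circle :: "complex set" where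
  "circle \<equiv> sphere 0 1"

definition klein :: "real^3 \<Rightarrow> complex" where
  "klein x = Complex (x$2 / x$1) (x$3 / x$1)"

definition klein_inv :: "complex \<Rightarrow> real^3" where
  "klein_inv \<eta> = (1 / sqrt (1 - (norm \<eta>)\<^sup>2)) *\<^sub>R vector [1, Re \<eta>, Im \<eta>]"

lemma klein_inv_inverse:
  assumes "\<eta> \<in> disk"
  shows "klein_inv \<eta> \<in> hyp_plane" "klein (klein_inv \<eta>) = \<eta>"
proof -
  have n: "norm \<eta> < 1" using assms by simp
  then have "(norm \<eta>)\<^sup>2 < 1" by (simp add: power_less_one_iff abs_square_less_1)
  then have s: "1 - (norm \<eta>)\<^sup>2 > 0" by simp
  have r: "(norm \<eta>)\<^sup>2 = (Re \<eta>)\<^sup>2 + (Im \<eta>)\<^sup>2" by (rule cmod_power2)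
  define t where "t = 1 / sqrt (1 - (norm \<eta>)\<^sup>2)"
  have t: "t > 0" "t\<^sup>2 * (1 - (norm \<eta>)\<^sup>2) = 1"
    using s by (simp_all add: t_def power_divide)
  have k: "klein_inv \<eta> = t *\<^sub>R vector [1, Re \<eta>, Im \<eta>]" by (simp add: klein_inv_def t_def)
  show "klein_inv \<eta> \<in> hyp_plane"
    using t unfolding r by (simp add: k hyp_plane_def mink_def algebra_simps power2_eq_square)
  show "klein (klein_inv \<eta>) = \<eta>"
    using t by (simp add: k klein_def complex_eq_iff)
qed

lemma klein_inverse:
  assumes "p \<in> hyp_plane"
  shows "klein p \<in> disk" "klein_inv (klein p) = p"
proof -
  have p: "p$1 > 0" "(p$1)\<^sup>2 = 1 + (p$2)\<^sup>2 + (p$3)\<^sup>2"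
    using assms by (auto simp: hyp_plane_def mink_def power2_eq_square)
  have "(norm (klein p))\<^sup>2 = ((p$2)\<^sup>2 + (p$3)\<^sup>2) / (p$1)\<^sup>2"
    by (simp add: klein_def cmod_power2 power_divide add_divide_distrib)
  also have "\<dots> = ((p$1)\<^sup>2 - 1) / (p$1)\<^sup>2" using p(2) by simp
  finally have n: "1 - (norm (klein p))\<^sup>2 = 1 / (p$1)\<^sup>2" using p(1) by (simp add: field_simps)
  then have "(norm (klein p))\<^sup>2 < 1" using p(1) by (smt (verit) zero_less_divide_1_iff zero_less_power)
  then show "klein p \<in> disk" by (simp add: abs_square_less_1)
  have "sqrt (1 - (norm (klein p))\<^sup>2) = 1 / p$1" using n p(1) by (simp add: real_sqrt_divide)
  then show "klein_inv (klein p) = p"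
    using p(1) by (simp add: klein_inv_def klein_def vec_eq_iff forall_3)
qed

definition klein_metric :: "complex pmetric" where
  "klein_metric \<eta> a b = mink (ddir klein_inv \<eta> a) (ddir klein_inv \<eta> b)"

definition klein_J :: "complex \<Rightarrow> complex \<Rightarrow> complex" where
  "klein_J \<eta> a = ddir klein (klein_inv \<eta>) (hyp_J (klein_inv \<eta>) (ddir klein_inv \<eta> a))"

text \<open>\<open>\<Pi>\<^sub>*V\<close>, which is also the expression of \<open>V\<close> in the chart.\<close>

definition klein_push :: "(real^3 \<Rightarrow> real^3) \<Rightarrow> complex \<Rightarrow> complex" where
  "klein_push V \<eta> = ddir klein (klein_inv \<eta>) (V (klein_inv \<eta>))"

subsection \<open>Functions and vector fields on the hyperbolic plane\<close>

text \<open>Only the values on \<^const>\<open>hyp_plane\<close> are relevant.\<close>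

definition hyp_smooth :: "(real^3 \<Rightarrow> real) \<Rightarrow> bool" where
  "hyp_smooth u \<longleftrightarrow> smooth_on disk (\<lambda>\<eta>. u (klein_inv \<eta>))"

definition hyp_grad :: "(real^3 \<Rightarrow> real) \<Rightarrow> real^3 \<Rightarrow> real^3" where
  "hyp_grad u p =
     ddir klein_inv (klein p) (gradient klein_metric (\<lambda>\<eta>. u (klein_inv \<eta>)) (klein p))"

definition hyp_laplacian :: "(real^3 \<Rightarrow> real) \<Rightarrow> real^3 \<Rightarrow> real" where
  "hyp_laplacian u p = laplacian klein_metric (\<lambda>\<eta>. u (klein_inv \<eta>)) (klein p)"

definition smooth_vector_field :: "(real^3 \<Rightarrow> real^3) \<Rightarrow> bool" where
  "smooth_vector_field V \<longleftrightarrow>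
     (\<forall>p\<in>hyp_plane. V p \<in> hyp_tangent p) \<and> smooth_on disk (klein_push V)"

definition hyp_nabla :: "real^3 \<Rightarrow> (real^3 \<Rightarrow> real^3) \<Rightarrow> real^3 \<Rightarrow> real^3" where
  "hyp_nabla Y V p =
     ddir klein_inv (klein p) (cov_deriv klein_metric (klein_push V) (klein p) (ddir klein p Y))"

text \<open>The vector field as a map into the tangent bundle, in the charts.\<close>

definition klein_section :: "(real^3 \<Rightarrow> real^3) \<Rightarrow> complex \<Rightarrow> complex \<times> complex" where
  "klein_section V \<eta> = (\<eta>, klein_push V \<eta>)"

definition harmonic_lagrangian :: "(real^3 \<Rightarrow> real^3) \<Rightarrow> bool" where
  "harmonic_lagrangian V \<longleftrightarrow>
     smooth_vector_field V \<and>
     harmonic_map_on disk klein_metric (bundle_metric klein_metric) (klein_section V) \<and>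
     (\<forall>\<eta>\<in>disk. \<forall>a b. bundle_form klein_metric klein_J (klein_section V \<eta>)
        (ddir (klein_section V) \<eta> a) (ddir (klein_section V) \<eta> b) = 0)"

definition dbar :: "(real^3 \<Rightarrow> real^3) \<Rightarrow> real^3 \<Rightarrow> real^3 \<Rightarrow> real^3" where
  "dbar V p Y = (1/2) *\<^sub>R (hyp_nabla Y V p + hyp_J p (hyp_nabla (hyp_J p Y) V p))"

definition dbar_norm_at :: "(real^3 \<Rightarrow> real^3) \<Rightarrow> real^3 \<Rightarrow> ereal" where
  "dbar_norm_at V p =
     (SUP Y\<in>{Y \<in> hyp_tangent p. mink Y Y \<le> 1}. ereal (sqrt (mink (dbar V p Y) (dbar V p Y))))"

definition dbar_norm :: "(real^3 \<Rightarrow> real^3) \<Rightarrow> ereal" where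
  "dbar_norm V = (SUP p\<in>hyp_plane. dbar_norm_at V p)"


section \<open>Vector fields on the circle\<close>

definition circle_vector_field :: "(complex \<Rightarrow> complex) \<Rightarrow> bool" where
  "circle_vector_field X \<longleftrightarrow> (\<forall>z\<in>circle. X z \<bullet> z = 0)"

definition extends_continuously_to :: "(real^3 \<Rightarrow> real^3) \<Rightarrow> (complex \<Rightarrow> complex) \<Rightarrow> bool" where
  "extends_continuously_to V X \<longleftrightarrow>
     (\<forall>z\<in>circle. \<forall>\<eta>. (\<forall>n. \<eta> n \<in> disk) \<and> \<eta> \<longlonglongrightarrow> z \<longrightarrow> (\<lambda>n. klein_push V (\<eta> n)) \<longlonglongrightarrow> X z)"

definition support_fun :: "(complex \<Rightarrow> complex) \<Rightarrow> complex \<Rightarrow> real" where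
  "support_fun X z = (THE r. X z = \<i> * z * complex_of_real r)"

definition klein_rescale :: "(real^3 \<Rightarrow> real) \<Rightarrow> complex \<Rightarrow> real" where
  "klein_rescale u \<eta> = sqrt (1 - (norm \<eta>)\<^sup>2) * u (klein_inv \<eta>)"

definition support_solution :: "(complex \<Rightarrow> complex) \<Rightarrow> (real^3 \<Rightarrow> real) \<Rightarrow> bool" where
  "support_solution X u \<longleftrightarrow>
     hyp_smooth u \<and>
     (\<forall>p\<in>hyp_plane. hyp_laplacian u p - 2 * u p = 0) \<and>
     continuous_on (cball 0 1)
       (\<lambda>\<eta>. if \<eta> \<in> disk then klein_rescale u \<eta> else support_fun X \<eta>)"

text \<open>
  The solution is unique as a function on \<^const>\<open>hyp_plane\<close>; \<^const>\<open>extensional\<close> fixes the irrelevant values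
  elsewhere.
\<close>

definition uX :: "(complex \<Rightarrow> complex) \<Rightarrow> real^3 \<Rightarrow> real" where
  "uX X = (THE u. u \<in> extensional hyp_plane \<and> support_solution X u)"

definition HL :: "(complex \<Rightarrow> complex) \<Rightarrow> real^3 \<Rightarrow> real^3" where
  "HL X p = hyp_J p (hyp_grad (uX X) p)"

definition affine_fun :: "(complex \<Rightarrow> real) \<Rightarrow> bool" where
  "affine_fun a \<longleftrightarrow> (\<exists>l c. linear l \<and> a = (\<lambda>z. l z + c))"

definition phi_minus :: "(complex \<Rightarrow> complex) \<Rightarrow> complex \<Rightarrow> real" where
  "phi_minus X z = Sup {a z |a. affine_fun a \<and> (\<forall>w\<in>circle. a w \<le> support_fun X w)}"

definition phi_plus :: "(complex \<Rightarrow> complex) \<Rightarrow> complex \<Rightarrow> real" where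
  "phi_plus X z = Inf {a z |a. affine_fun a \<and> (\<forall>w\<in>circle. support_fun X w \<le> a w)}"

definition width :: "(complex \<Rightarrow> complex) \<Rightarrow> ereal" where
  "width X = (SUP \<eta>\<in>disk. ereal ((phi_plus X \<eta> - phi_minus X \<eta>) / sqrt (1 - (norm \<eta>)\<^sup>2)))"

definition ccw_quadruple :: "complex \<Rightarrow> complex \<Rightarrow> complex \<Rightarrow> complex \<Rightarrow> bool" where
  "ccw_quadruple a b c d \<longleftrightarrow>
     (\<exists>\<alpha> \<beta> \<gamma> \<delta>. \<alpha> < \<beta> \<and> \<beta> < \<gamma> \<and> \<gamma> < \<delta> \<and> \<delta> < \<alpha> + 2 * pi \<and>
        a = cis \<alpha> \<and> b = cis \<beta> \<and> c = cis \<gamma> \<and> d = cis \<delta>)"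

definition cross_ratio :: "complex \<Rightarrow> complex \<Rightarrow> complex \<Rightarrow> complex \<Rightarrow> complex" where
  "cross_ratio a b c d = ((b - a) * (d - c)) / ((c - b) * (d - a))"

definition quadruple_value ::
  "(complex \<Rightarrow> complex) \<Rightarrow> complex \<Rightarrow> complex \<Rightarrow> complex \<Rightarrow> complex \<Rightarrow> complex" where
  "quadruple_value X a b c d =
     (X b - X a) / (b - a) - (X c - X b) / (c - b) + (X d - X c) / (d - c) - (X a - X d) / (a - d)"

definition zygmund :: "(complex \<Rightarrow> complex) \<Rightarrow> bool" where
  "zygmund X \<longleftrightarrow>
     continuous_on circle X \<and>
     bdd_above {norm (quadruple_value X a b c d) |a b c d.
                  ccw_quadruple a b c d \<and> cross_ratio a b c d = 1}"

end

theory Submission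
  imports Defs "HOL-Complex_Analysis.Cauchy_Integral_Formula"
begin

text \<open>
  All computations take place in the Klein chart, with \<open>q = 1 - |\<eta>|\<^sup>2\<close> (\<open>defect\<close>) and \<open>\<rho>\<close> its square root.
  To a function \<open>u\<close> belongs \<open>f = \<rho> u\<close>, the restriction to an affine plane of the extension of \<open>u\<close> which is
  homogeneous of degree one on the light cone. This is why flat convex geometry enters: the
  flat Hessian \<open>D\<^sup>2f\<close> is \<open>\<rho> (\<nabla>du - u g)\<close>, affine functions \<open>f\<close> correspond to Killing fields, and
  \<open>\<Delta>u = 2u\<close> becomes \<open>tr((I - \<eta>\<eta>\<^sup>T) D\<^sup>2f) = 0\<close>.

  Harmonic Lagrangian fields are the fields \<open>V = J grad u\<close> with \<open>\<Delta>u = 2u\<close> (\<open>harmonic_lagrangianI\<close>,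
  \<open>harmonic_lagrangian_potential\<close>). The Lagrangian condition says that the form dual to \<open>JV\<close> is closed. The
  metric of the tangent bundle is the complete lift of \<open>g\<close>, so its connection is the fibre derivative
  of that of \<open>g\<close>, and the tension field is the vertical lift of \<open>J grad (\<Delta>u - 2u)\<close> (\<open>tension_Wf\<close>). In the chart
  \<open>V = i (f \<eta> + q \<nabla>f)\<close>, and the antiholomorphic part of \<open>\<nabla>V\<close> is \<open>J\<close> applied to \<open>D\<^sup>2f / \<rho>\<close>; hence its norm is
  at most \<open>L\<close> precisely if \<open>|D\<^sup>2f(a,a)| \<le> L \<rho> g(a,a)\<close> (\<open>dbar_norm_le_iff\<close>).

  The Dirichlet problem for \<open>f\<close> is solved by the kernel \<open>K = \<rho>\<^sup>3 / (1 - \<eta>\<cdot>z)\<^sup>2\<close>, uniquely by the maximum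
  principle. The kernel satisfies \<open>|D\<^sup>2K(a,a)| \<le> 3 K g(a,a)\<close> and \<open>q |\<nabla>K| \<le> 7 K\<close>, so both derivatives of a Poisson
  integral of a nonnegative function are controlled by its value. Applied to \<open>f\<close> minus an affine
  function this gives the boundary values of \<open>HL(X)\<close> (\<open>HL_extends\<close>). Conversely the angular component of
  \<open>V\<close> determines the boundary values of \<open>f\<close> by integration along rays, which gives uniqueness
  (\<open>harmonic_lagrangian_unique\<close>).

  For the width, if \<open>|D\<^sup>2f(a,a)| \<le> L \<rho> g(a,a)\<close> then \<open>f + L \<rho>\<close> is concave and \<open>f - L \<rho>\<close> is convex, so that the envelopes
  of \<open>\<phi>\<close> differ by at most \<open>2 L \<rho>\<close> (\<open>width_le_dbar_norm\<close>). If \<open>a \<le> \<phi>\<close> is affine, then \<open>f - a\<close> is a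
  Poisson integral of a nonnegative function, so \<open>|D\<^sup>2f(v,v)| \<le> 3 (f - a) g(v,v)\<close>, and the supremum over \<open>a\<close> bounds
  the Hessian by the gap between the envelopes (\<open>dbar_norm_le_width\<close>, with the constant 3).

  For the Zygmund condition, extend \<open>\<phi>\<close> to \<open>F(v) = |v|\<^sup>2 \<phi>(v\<^sup>2/|v|\<^sup>2)\<close> on the plane. Affine functions become quadratic
  forms, and the quadruples of cross ratio one are the directions of \<open>v, v + w, w, w - v\<close>, for which
  \<open>X[Q] = (F(v+w) + F(v-w) - 2F(v) - 2F(w)) / (2 det(v,w))\<close>. So \<open>X\<close> is Zygmund precisely if \<open>F\<close> satisfies the
  parallelogram law up to a multiple of \<open>|det(v,w)|\<close>, which is visibly invariant under linear maps of
  determinant one. Geometrically the defect compares the two chords over the diagonals of \<open>Q\<close> at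
  their crossing point, which bounds it by the width (\<open>defect4_le_width\<close>). Conversely, such an \<open>F\<close> is
  close to a quadratic form in every unimodular basis (\<open>parallelogram_bound\<close>); the basis adapted to a point
  \<open>\<eta>\<close> yields an affine function within a multiple of \<open>(1 - \<eta>\<cdot>z) / \<rho>\<close> of \<open>\<phi>\<close>, and this function equals \<open>\<rho>\<close> at
  \<open>z = \<eta>\<close> (\<open>affine_approximation\<close>).
\<close>

section \<open>Iterated differentiability\<close>

lemma ddir_eqI: "(f has_derivative f') (at x) \<Longrightarrow> ddir f x v = f' v"
  using frechet_derivative_at by metis

lemma ddir_cong_open:
  assumes "open S" "x \<in> S" "\<And>y. y \<in> S \<Longrightarrow> f y = g y"
  shows "ddir f x v = ddir g x v"
proof -
  have "(f has_derivative D) (at x) \<longleftrightarrow> (g has_derivative D) (at x)" for D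
    using assms has_derivative_transform_within_open by metis
  then show ?thesis by (simp add: frechet_derivative_def)
qed

lemma differentiable_cong_open:
  assumes "open S" "x \<in> S" "\<And>y. y \<in> S \<Longrightarrow> f y = g y"
  shows "f differentiable (at x) \<longleftrightarrow> g differentiable (at x)"
  using assms has_derivative_transform_within_open unfolding differentiable_def by metis

lemma Ck_on_cong:
  assumes "open S" "\<And>y. y \<in> S \<Longrightarrow> f y = g y"
  shows "Ck_on k S f \<longleftrightarrow> Ck_on k S g"
  using assms(2)
proof (induction k arbitrary: f g)
  case 0
  then show ?case by (simp cong: continuous_on_cong)
next
  case (Suc k)
  have "Ck_on k S (\<lambda>x. ddir f x v) \<longleftrightarrow> Ck_on k S (\<lambda>x. ddir g x v)" for v
    by (rule Suc.IH) (use ddir_cong_open[OF assms(1) _ Suc.prems] in auto)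
  then show ?case
    using differentiable_cong_open[OF assms(1) _ Suc.prems] by simp
qed

lemma Ck_on_pred: "Ck_on (Suc k) S f \<Longrightarrow> Ck_on k S f"
proof (induction k arbitrary: f)
  case 0
  then show ?case
    by (auto intro!: differentiable_imp_continuous_on differentiable_at_imp_differentiable_on)
qed auto

lemma smooth_on_cong:
  assumes "open S" "\<And>y. y \<in> S \<Longrightarrow> f y = g y"
  shows "smooth_on S f \<longleftrightarrow> smooth_on S g"
  using Ck_on_cong[where f=f and g=g] assms by (simp add: smooth_on_def)

lemma smooth_on_ddir: "smooth_on S f \<Longrightarrow> smooth_on S (\<lambda>x. ddir f x v)"
  unfolding smooth_on_def using Ck_on.simps(2) by blast

lemma smooth_on_differentiable: "smooth_on S f \<Longrightarrow> x \<in> S \<Longrightarrow> f differentiable (at x)"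
  unfolding smooth_on_def using Ck_on.simps(2) by blast

lemma smooth_on_continuous: "smooth_on S f \<Longrightarrow> continuous_on S f"
  unfolding smooth_on_def using Ck_on.simps(1) by blast

lemma smooth_on_has_derivative: "smooth_on S f \<Longrightarrow> x \<in> S \<Longrightarrow> (f has_derivative ddir f x) (at x)"
  using smooth_on_differentiable frechet_derivative_works by blast

text \<open>Smoothness by coinduction: a class of differentiable functions which is closed under
  directional derivatives consists of smooth functions.\<close>

lemma smooth_on_coinduct:
  assumes "open S" "P f"
    and diff: "\<And>f x. P f \<Longrightarrow> x \<in> S \<Longrightarrow> f differentiable (at x)"
    and closed: "\<And>f v. P f \<Longrightarrow> \<exists>h. P h \<and> (\<forall>x\<in>S. ddir f x v = h x)"
  shows "smooth_on S f"
proof -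
  have "Ck_on k S f" for k
    using assms(2)
  proof (induction k arbitrary: f)
    case 0
    then show ?case using diff
      by (auto intro!: differentiable_imp_continuous_on differentiable_at_imp_differentiable_on)
  next
    case (Suc k)
    have "Ck_on k S (\<lambda>x. ddir f x v)" for v
    proof -
      obtain h where "P h" "\<forall>x\<in>S. ddir f x v = h x" using closed[OF Suc.prems] by blast
      then show ?thesis using Suc.IH Ck_on_cong[OF assms(1), of "\<lambda>x. ddir f x v" h k] by blast
    qed
    then show ?case using diff[OF Suc.prems] by simp
  qed
  then show ?thesis by (simp add: smooth_on_def)
qed

lemma smooth_on_bilinear:
  assumes "open S" "bounded_bilinear bop" "smooth_on S f" "smooth_on S g"
  shows "smooth_on S (\<lambda>x. bop (f x) (g x))"
proof -
  interpret bounded_bilinear bop by fact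
  have "Ck_on k S f \<Longrightarrow> Ck_on k S g \<Longrightarrow> Ck_on k S (\<lambda>x. bop (f x) (g x))"
    and add: "Ck_on k S p \<Longrightarrow> Ck_on k S r \<Longrightarrow> Ck_on k S (\<lambda>x. p x + r x)" for k f g and p r :: "_ \<Rightarrow> 'd"
  proof (induction k arbitrary: f g p r)
    case 0
    { case 1 then show ?case by (simp add: continuous_on) }
    { case 2 then show ?case by (simp add: continuous_on_add) }
  next
    case (Suc k)
    { case 1
      have *: "ddir (\<lambda>x. bop (f x) (g x)) x v = bop (f x) (ddir g x v) + bop (ddir f x v) (g x)"
        if "x \<in> S" for x v
        using 1 that by (intro ddir_eqI FDERIV) (auto simp: frechet_derivative_works)
      have "Ck_on k S (\<lambda>x. bop (f x) (ddir g x v) + bop (ddir f x v) (g x))" for v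
        using 1 Ck_on_pred[OF 1(1)] Ck_on_pred[OF 1(2)] by (intro Suc.IH) auto
      then have "Ck_on k S (\<lambda>x. ddir (\<lambda>x. bop (f x) (g x)) x v)" for v
        by (subst Ck_on_cong[OF assms(1) *])
      moreover have "(\<lambda>x. bop (f x) (g x)) differentiable (at x)" if "x \<in> S" for x
        using 1 that FDERIV unfolding differentiable_def Ck_on.simps by blast
      ultimately show ?case by simp }
    { case 2
      have *: "ddir (\<lambda>x. p x + r x) x v = ddir p x v + ddir r x v" if "x \<in> S" for x v
        using 2 that by (intro ddir_eqI has_derivative_add) (auto simp: frechet_derivative_works)
      have "Ck_on k S (\<lambda>x. ddir p x v + ddir r x v)" for v
        using 2 by (intro Suc.IH) auto
      then have "Ck_on k S (\<lambda>x. ddir (\<lambda>x. p x + r x) x v)" for v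
        by (subst Ck_on_cong[OF assms(1) *])
      then show ?case using 2 by simp }
  qed
  then show ?thesis using assms unfolding smooth_on_def by blast
qed

lemma smooth_on_const: "open S \<Longrightarrow> smooth_on S (\<lambda>x. c)"
proof (rule smooth_on_coinduct[where P="\<lambda>f. \<exists>c. f = (\<lambda>x. c)"])
  fix f :: "'a \<Rightarrow> 'b" and v assume "\<exists>c. f = (\<lambda>x. c)"
  then have "ddir f x v = 0" for x using ddir_eqI[OF has_derivative_const] by metis
  then show "\<exists>h. (\<exists>c. h = (\<lambda>x. c)) \<and> (\<forall>x\<in>S. ddir f x v = h x)" by blast
qed auto

lemma smooth_on_bounded_linear:
  assumes "open S" "bounded_linear h" shows "smooth_on S h"
proof -
  have "Ck_on k S h" for k
  proof (cases k)
    case 0 then show ?thesis using assms linear_continuous_on by auto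
  next
    case (Suc j)
    have "smooth_on S (\<lambda>x. ddir h x v)" for v
      using smooth_on_cong[OF assms(1), of "\<lambda>x. ddir h x v" "\<lambda>x. h v"] smooth_on_const[OF assms(1)]
        ddir_eqI[OF bounded_linear_imp_has_derivative[OF assms(2)]] by metis
    then show ?thesis unfolding Suc
      using bounded_linear_imp_differentiable[OF assms(2)] by (auto simp: smooth_on_def)
  qed
  then show ?thesis by (simp add: smooth_on_def)
qed

lemma smooth_on_scaleR:
  "open S \<Longrightarrow> smooth_on S f \<Longrightarrow> smooth_on S g \<Longrightarrow> smooth_on S (\<lambda>x. f x *\<^sub>R g x)"
  by (rule smooth_on_bilinear[OF _ bounded_bilinear_scaleR])

lemma smooth_on_mult:
  fixes f g :: "'a::real_normed_vector \<Rightarrow> 'b::real_normed_algebra"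
  shows "open S \<Longrightarrow> smooth_on S f \<Longrightarrow> smooth_on S g \<Longrightarrow> smooth_on S (\<lambda>x. f x * g x)"
  by (rule smooth_on_bilinear[OF _ bounded_bilinear_mult])

lemma smooth_on_inner:
  "open S \<Longrightarrow> smooth_on S f \<Longrightarrow> smooth_on S g \<Longrightarrow> smooth_on S (\<lambda>x. f x \<bullet> g x)"
  by (rule smooth_on_bilinear[OF _ bounded_bilinear_inner])

lemma smooth_on_linear_comp:
  assumes "open S" "bounded_linear h" "smooth_on S f"
  shows "smooth_on S (\<lambda>x. h (f x))"
proof -
  interpret bounded_linear h by fact
  have "bounded_bilinear (\<lambda>(c::real) y. c *\<^sub>R h y)"
    using bounded_bilinear.comp[OF bounded_bilinear_scaleR bounded_linear_ident assms(2)] by simp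
  from smooth_on_bilinear[OF assms(1) this smooth_on_const[OF assms(1), of 1] assms(3)]
  show ?thesis by simp
qed

lemma smooth_on_add:
  assumes S: "open S" and f: "smooth_on S f" and g: "smooth_on S g"
  shows "smooth_on S (\<lambda>x. f x + g x)"
proof (rule smooth_on_coinduct[where P="\<lambda>h. \<exists>f g. smooth_on S f \<and> smooth_on S g \<and> h = (\<lambda>x. f x + g x)"])
  show "\<exists>f' g'. smooth_on S f' \<and> smooth_on S g' \<and> (\<lambda>x. f x + g x) = (\<lambda>x. f' x + g' x)"
    using f g by blast
  fix h :: "'a \<Rightarrow> 'b" and v
  assume "\<exists>f g. smooth_on S f \<and> smooth_on S g \<and> h = (\<lambda>x. f x + g x)"
  then obtain f g where h: "smooth_on S f" "smooth_on S g" "h = (\<lambda>x. f x + g x)" by blast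
  show "h differentiable (at x)" if "x \<in> S" for x
    unfolding h(3) using h that by (intro differentiable_add smooth_on_differentiable)
  have "ddir h x v = ddir f x v + ddir g x v" if "x \<in> S" for x
    unfolding h(3) using h that by (intro ddir_eqI has_derivative_add smooth_on_has_derivative)
  then show "\<exists>h'. (\<exists>f g. smooth_on S f \<and> smooth_on S g \<and> h' = (\<lambda>x. f x + g x)) \<and> (\<forall>x\<in>S. ddir h x v = h' x)"
    using h(1,2) smooth_on_ddir by blast
qed fact

lemma smooth_on_diff:
  assumes S: "open S" and f: "smooth_on S f" and g: "smooth_on S g"
  shows "smooth_on S (\<lambda>x. f x - g x)"
  using smooth_on_add[OF S f smooth_on_linear_comp[OF S bounded_linear_minus[OF bounded_linear_ident] g]]
  by simp

subsection \<open>Symmetry of second derivatives\<close>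

lemma ddir_line:
  fixes f :: "'a::real_normed_vector \<Rightarrow> real"
  assumes "f differentiable (at (x + t *\<^sub>R v))"
  shows "((\<lambda>t. f (x + t *\<^sub>R v)) has_real_derivative ddir f (x + t *\<^sub>R v) v) (at t)"
proof -
  have "((\<lambda>t. x + t *\<^sub>R v) has_derivative (\<lambda>t. t *\<^sub>R v)) (at t)"
    by (auto intro!: derivative_eq_intros)
  from diff_chain_at[OF this assms[unfolded frechet_derivative_works]]
  have "((\<lambda>t. f (x + t *\<^sub>R v)) has_derivative (\<lambda>h. ddir f (x + t *\<^sub>R v) (h *\<^sub>R v))) (at t)"
    by (simp add: o_def)
  then show ?thesis
    using linear_frechet_derivative[OF assms]
    by (auto simp: has_field_derivative_def linear_cmul mult.commute fun_eq_iff elim!: has_derivative_eq_rhs)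
qed

text \<open>The second difference of \<open>f\<close> along \<open>h v\<close>, \<open>h w\<close> is symmetric in \<open>v\<close>, \<open>w\<close>, and by the mean value
  theorem it equals \<open>h\<^sup>2\<close> times an iterated derivative at a point close to \<open>x\<close>.\<close>

lemma second_difference:
  fixes f :: "'a::real_normed_vector \<Rightarrow> real"
  assumes S: "ball x e \<subseteq> S" and f: "smooth_on S f"
    and h: "h > 0" "h * (norm v + norm w) < e"
  obtains y where "norm (y - x) \<le> h * (norm v + norm w)"
    "f (x + h *\<^sub>R v + h *\<^sub>R w) - f (x + h *\<^sub>R v) - f (x + h *\<^sub>R w) + f x = h\<^sup>2 * ddir (\<lambda>y. ddir f y v) y w"
proof -
  have bd: "norm (t *\<^sub>R v + r *\<^sub>R w) \<le> h * (norm v + norm w)" if "0 \<le> t" "t \<le> h" "0 \<le> r" "r \<le> h" for t r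
  proof -
    have "norm (t *\<^sub>R v + r *\<^sub>R w) \<le> t * norm v + r * norm w"
      using norm_triangle_ineq[of "t *\<^sub>R v" "r *\<^sub>R w"] that by simp
    also have "\<dots> \<le> h * norm v + h * norm w"
      using that by (intro add_mono mult_right_mono) auto
    finally show ?thesis by (simp add: algebra_simps)
  qed
  have inS: "x + t *\<^sub>R v + r *\<^sub>R w \<in> S" if "0 \<le> t" "t \<le> h" "0 \<le> r" "r \<le> h" for t r
  proof -
    have "dist (x + t *\<^sub>R v + r *\<^sub>R w) x < e"
      using bd[OF that] h by (simp add: dist_norm add.assoc)
    then show ?thesis using S by (auto simp: dist_commute)
  qed
  define G where "G t = f ((x + h *\<^sub>R w) + t *\<^sub>R v) - f (x + t *\<^sub>R v)" for t
  have "\<exists>z>0. z < h \<and> G h - G 0 = (h - 0) * (ddir f ((x + h *\<^sub>R w) + z *\<^sub>R v) v - ddir f (x + z *\<^sub>R v) v)"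
  proof (rule MVT2[OF h(1)])
    fix t assume t: "0 \<le> t" "t \<le> h"
    have "f differentiable (at ((x + h *\<^sub>R w) + t *\<^sub>R v))" "f differentiable (at (x + t *\<^sub>R v))"
      using inS[OF t, of h] inS[OF t, of 0] h smooth_on_differentiable[OF f] by (auto simp: algebra_simps)
    from DERIV_diff[OF ddir_line[OF this(1)] ddir_line[OF this(2)]]
    show "(G has_real_derivative ddir f ((x + h *\<^sub>R w) + t *\<^sub>R v) v - ddir f (x + t *\<^sub>R v) v) (at t)"
      unfolding G_def .
  qed
  then obtain z where z: "0 < z" "z < h"
    "G h - G 0 = h * (ddir f ((x + h *\<^sub>R w) + z *\<^sub>R v) v - ddir f (x + z *\<^sub>R v) v)" by auto
  define H where "H r = ddir f ((x + z *\<^sub>R v) + r *\<^sub>R w) v" for r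
  have "\<exists>r>0. r < h \<and> H h - H 0 = (h - 0) * ddir (\<lambda>y. ddir f y v) ((x + z *\<^sub>R v) + r *\<^sub>R w) w"
  proof (rule MVT2[OF h(1)])
    fix r assume r: "0 \<le> r" "r \<le> h"
    have "(\<lambda>y. ddir f y v) differentiable (at ((x + z *\<^sub>R v) + r *\<^sub>R w))"
      using inS[of z r] z r h smooth_on_differentiable[OF smooth_on_ddir[OF f]] by auto
    from ddir_line[OF this]
    show "(H has_real_derivative ddir (\<lambda>y. ddir f y v) ((x + z *\<^sub>R v) + r *\<^sub>R w) w) (at r)"
      unfolding H_def .
  qed
  then obtain r where r: "0 < r" "r < h" "H h - H 0 = h * ddir (\<lambda>y. ddir f y v) ((x + z *\<^sub>R v) + r *\<^sub>R w) w"
    by auto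
  have e1: "G h - G 0 = f (x + h *\<^sub>R v + h *\<^sub>R w) - f (x + h *\<^sub>R v) - f (x + h *\<^sub>R w) + f x"
    by (simp add: G_def algebra_simps)
  have e2: "H h - H 0 = ddir f ((x + h *\<^sub>R w) + z *\<^sub>R v) v - ddir f (x + z *\<^sub>R v) v"
    by (simp add: H_def algebra_simps)
  have e3: "norm (((x + z *\<^sub>R v) + r *\<^sub>R w) - x) \<le> h * (norm v + norm w)"
    using bd[of z r] z r by (simp add: add.assoc)
  have e4: "f (x + h *\<^sub>R v + h *\<^sub>R w) - f (x + h *\<^sub>R v) - f (x + h *\<^sub>R w) + f x
      = h\<^sup>2 * ddir (\<lambda>y. ddir f y v) ((x + z *\<^sub>R v) + r *\<^sub>R w) w"
    unfolding power2_eq_square using e1 e2 z(3) r(3) by (metis mult.assoc)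
  show thesis using that[OF e3 e4] .
qed

text \<open>Both iterated derivatives are limits of the same second differences.\<close>

lemma ddir_symmetric:
  fixes f :: "'a::real_normed_vector \<Rightarrow> real"
  assumes S: "open S" "x \<in> S" and f: "smooth_on S f"
  shows "ddir (\<lambda>y. ddir f y v) x w = ddir (\<lambda>y. ddir f y w) x v"
proof -
  let ?A = "\<lambda>y. ddir (\<lambda>y. ddir f y v) y w" and ?B = "\<lambda>y. ddir (\<lambda>y. ddir f y w) y v"
  obtain e where e: "e > 0" "ball x e \<subseteq> S" using S open_contains_ball by blast
  define N where "N = norm v + norm w + 1"
  have N: "N > 0" "norm v + norm w \<le> N" by (auto simp: N_def add_nonneg_pos)
  define h where "h n = e / (N * (real n + 2))" for n
  have h: "h n > 0" "h n * N < e" for n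
    using e N by (auto simp: h_def divide_simps add_pos_pos mult_less_cancel_left_pos)
  have hl: "h \<longlonglongrightarrow> 0"
  proof -
    have "(\<lambda>n. (e/N) * (1 / real (n + 2))) \<longlonglongrightarrow> (e/N) * 0"
      by (intro tendsto_mult tendsto_const LIMSEQ_ignore_initial_segment lim_1_over_n)
    moreover have "(e/N) * (1 / real (n + 2)) = h n" for n using N by (simp add: h_def field_simps)
    ultimately show ?thesis by simp
  qed
  have "\<exists>y. norm (y - x) \<le> h n * N \<and> f (x + h n *\<^sub>R v + h n *\<^sub>R w) - f (x + h n *\<^sub>R v) - f (x + h n *\<^sub>R w) + f x = (h n)\<^sup>2 * ?A y" for n
  proof -
    have "h n * (norm v + norm w) \<le> h n * N" using h N by (simp add: mult_left_mono)
    then show ?thesis using second_difference[OF e(2) f h(1)[of n], of v w] h(2)[of n]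
      by (metis order.trans le_less_trans)
  qed
  then obtain y where y: "\<And>n. norm (y n - x) \<le> h n * N"
    "\<And>n. f (x + h n *\<^sub>R v + h n *\<^sub>R w) - f (x + h n *\<^sub>R v) - f (x + h n *\<^sub>R w) + f x = (h n)\<^sup>2 * ?A (y n)" by metis
  have "\<exists>y. norm (y - x) \<le> h n * N \<and> f (x + h n *\<^sub>R w + h n *\<^sub>R v) - f (x + h n *\<^sub>R w) - f (x + h n *\<^sub>R v) + f x = (h n)\<^sup>2 * ?B y" for n
  proof -
    have "h n * (norm w + norm v) \<le> h n * N" using h N by (simp add: mult_left_mono)
    then show ?thesis using second_difference[OF e(2) f h(1)[of n], of w v] h(2)[of n]
      by (metis order.trans le_less_trans)
  qed
  then obtain z where z: "\<And>n. norm (z n - x) \<le> h n * N"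
    "\<And>n. f (x + h n *\<^sub>R w + h n *\<^sub>R v) - f (x + h n *\<^sub>R w) - f (x + h n *\<^sub>R v) + f x = (h n)\<^sup>2 * ?B (z n)" by metis
  have lim: "c \<longlonglongrightarrow> x" if "\<And>n. norm (c n - x) \<le> h n * N" for c
  proof -
    have "(\<lambda>n. h n * N) \<longlonglongrightarrow> 0" using tendsto_mult_right[OF hl, of N] by simp
    then have "(\<lambda>n. c n - x) \<longlonglongrightarrow> 0"
      using that by (intro Lim_null_comparison[of "\<lambda>n. c n - x" "\<lambda>n. h n * N"]) auto
    then show ?thesis by (simp add: LIM_zero_iff)
  qed
  have "isCont ?A x" "isCont ?B x"
    using smooth_on_continuous[OF smooth_on_ddir[OF smooth_on_ddir[OF f]]] S
    by (simp_all add: continuous_on_eq_continuous_at)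
  then have "(\<lambda>n. ?A (y n)) \<longlonglongrightarrow> ?A x" "(\<lambda>n. ?B (z n)) \<longlonglongrightarrow> ?B x"
    using lim[OF y(1)] lim[OF z(1)] by (auto simp: continuous_at_sequentially o_def)
  moreover have "?A (y n) = ?B (z n)" for n
  proof -
    have c: "x + h n *\<^sub>R w + h n *\<^sub>R v = x + h n *\<^sub>R v + h n *\<^sub>R w"
      by (simp add: algebra_simps)
    have "(h n)\<^sup>2 * ?A (y n) = (h n)\<^sup>2 * ?B (z n)"
      using y(2)[of n] z(2)[of n] unfolding c by linarith
    then show ?thesis using h(1)[of n] by simp
  qed
  ultimately show ?thesis using LIMSEQ_unique by auto
qed

section \<open>The hyperbolic plane in the Klein chart\<close>

definition defect :: "complex \<Rightarrow> real" where
  "defect \<eta> = 1 - \<eta> \<bullet> \<eta>"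

definition rho :: "complex \<Rightarrow> real" where
  "rho \<eta> = sqrt (defect \<eta>)"

lemma rho_eq: "sqrt (1 - (norm \<eta>)\<^sup>2) = rho \<eta>"
  by (simp add: rho_def defect_def power2_norm_eq_inner)

lemma in_disk_iff: "\<eta> \<in> disk \<longleftrightarrow> defect \<eta> > 0"
  by (simp add: defect_def flip: power2_norm_eq_inner) (simp add: abs_square_less_1)

lemma disk_pos:
  assumes "\<eta> \<in> disk"
  shows "defect \<eta> > 0" "rho \<eta> > 0" "defect \<eta> \<noteq> 0" "rho \<eta> \<noteq> 0" "rho \<eta> * rho \<eta> = defect \<eta>"
    "(rho \<eta>)\<^sup>2 = defect \<eta>"
proof -
  show "defect \<eta> > 0" using assms in_disk_iff by blast
  then show "rho \<eta> > 0" "defect \<eta> \<noteq> 0" "rho \<eta> \<noteq> 0" "rho \<eta> * rho \<eta> = defect \<eta>" "(rho \<eta>)\<^sup>2 = defect \<eta>"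
    by (auto simp: rho_def)
qed

lemma inner_self_defect: "\<eta> \<bullet> \<eta> = 1 - defect \<eta>"
  by (simp add: defect_def)

lemma defect_le_1: "defect \<eta> \<le> 1"
  by (simp add: defect_def)

lemma has_derivative_defect: "(defect has_derivative (\<lambda>a. - 2 * (\<eta> \<bullet> a))) (at \<eta>)"
  unfolding defect_def by (auto intro!: derivative_eq_intros simp: inner_commute)

lemma has_derivative_rho:
  assumes "\<eta> \<in> disk"
  shows "(rho has_derivative (\<lambda>a. - (\<eta> \<bullet> a) / rho \<eta>)) (at \<eta>)"
  unfolding rho_def using disk_pos[OF assms]
  by (auto intro!: derivative_eq_intros has_derivative_real_sqrt has_derivative_defect simp: rho_def divide_simps)

text \<open>The derivative of the chart \<^const>\<open>klein_inv\<close> and, on tangent vectors, its inverse.\<close>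

definition klein_lift :: "complex \<Rightarrow> complex \<Rightarrow> real^3" where
  "klein_lift \<eta> a = (1 / rho \<eta>) *\<^sub>R vector [(\<eta> \<bullet> a) / defect \<eta>,
     Re a + (\<eta> \<bullet> a) * Re \<eta> / defect \<eta>, Im a + (\<eta> \<bullet> a) * Im \<eta> / defect \<eta>]"

definition klein_drop :: "complex \<Rightarrow> real^3 \<Rightarrow> complex" where
  "klein_drop \<eta> v = rho \<eta> *\<^sub>R (Complex (v$2) (v$3) - (v$1) *\<^sub>R \<eta>)"

lemma klein_inv_nth:
  "klein_inv \<eta> $ 1 = 1 / rho \<eta>" "klein_inv \<eta> $ 2 = Re \<eta> / rho \<eta>" "klein_inv \<eta> $ 3 = Im \<eta> / rho \<eta>"
  by (simp_all add: klein_inv_def rho_eq)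

lemma has_derivative_klein_inv:
  assumes "\<eta> \<in> disk"
  shows "(klein_inv has_derivative klein_lift \<eta>) (at \<eta>)"
proof -
  define E :: "complex \<Rightarrow> real^3" where "E a = vector [0, Re a, Im a]" for a
  have E: "bounded_linear E"
    unfolding linear_conv_bounded_linear[symmetric]
    by (rule linearI) (simp_all add: E_def vec_eq_iff forall_3)
  have k: "klein_inv = (\<lambda>\<eta>. (1 / rho \<eta>) *\<^sub>R (vector [1, 0, 0] + E \<eta>))"
    by (auto simp: fun_eq_iff klein_inv_def rho_eq E_def vec_eq_iff forall_3)
  note p = disk_pos[OF assms]
  show ?thesis unfolding k
    by (rule derivative_eq_intros has_derivative_rho assms refl bounded_linear_imp_has_derivative E p(4))+
       (use p in \<open>auto simp: fun_eq_iff klein_lift_def E_def vec_eq_iff forall_3 divide_simps\<close>)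
qed

lemma ddir_klein_inv: "\<eta> \<in> disk \<Longrightarrow> ddir klein_inv \<eta> a = klein_lift \<eta> a"
  by (rule ddir_eqI[OF has_derivative_klein_inv])

lemma ddir_klein:
  assumes "\<eta> \<in> disk"
  shows "ddir klein (klein_inv \<eta>) v = klein_drop \<eta> v"
proof (rule ddir_eqI)
  note p = disk_pos[OF assms]
  have k: "klein = (\<lambda>x. (x$2 / x$1) *\<^sub>R 1 + (x$3 / x$1) *\<^sub>R \<i>)"
    by (auto simp: fun_eq_iff klein_def complex_eq_iff)
  have nth: "((\<lambda>x. x $ i) has_derivative (\<lambda>v. v $ i)) (at (klein_inv \<eta>))" for i :: 3
    by (rule bounded_linear_imp_has_derivative) (rule bounded_linear_vec_nth)
  have ne: "klein_inv \<eta> $ 1 \<noteq> 0" using p by (simp add: klein_inv_nth)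
  show "(klein has_derivative klein_drop \<eta>) (at (klein_inv \<eta>))"
    unfolding k
    by (rule derivative_eq_intros nth refl ne)+
      (use p in \<open>auto simp: fun_eq_iff klein_drop_def complex_eq_iff klein_inv_nth divide_simps algebra_simps\<close>)
qed

lemma klein_drop_lift:
  assumes "\<eta> \<in> disk" shows "klein_drop \<eta> (klein_lift \<eta> a) = a"
  using disk_pos[OF assms] by (simp add: klein_drop_def klein_lift_def complex_eq_iff field_simps)

lemma mink_klein_lift_base: "\<eta> \<in> disk \<Longrightarrow> mink (klein_inv \<eta>) (klein_lift \<eta> a) = 0"
proof -
  assume "\<eta> \<in> disk"
  note p = disk_pos[OF this]
  have "defect \<eta> = 1 - (Re \<eta> * Re \<eta> + Im \<eta> * Im \<eta>)" by (simp add: defect_def inner_complex_def)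
  then show ?thesis using p
    by (simp add: mink_def klein_lift_def klein_inv_nth divide_simps inner_complex_def)
      (simp add: algebra_simps)
qed

lemma klein_lift_drop:
  assumes "\<eta> \<in> disk" "v \<in> hyp_tangent (klein_inv \<eta>)"
  shows "klein_lift \<eta> (klein_drop \<eta> v) = v"
proof -
  note p = disk_pos[OF assms(1)]
  have d: "defect \<eta> = 1 - (Re \<eta> * Re \<eta> + Im \<eta> * Im \<eta>)" by (simp add: defect_def inner_complex_def)
  have t: "v$1 = Re \<eta> * v$2 + Im \<eta> * v$3"
    using assms(2) p by (simp add: hyp_tangent_def mink_def klein_inv_nth field_simps)
  have i: "\<eta> \<bullet> klein_drop \<eta> v = rho \<eta> * defect \<eta> * v$1"
    unfolding d by (simp add: klein_drop_def inner_complex_def t algebra_simps)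
  show ?thesis unfolding klein_lift_def i using p
    by (simp add: vec_eq_iff forall_3 klein_drop_def algebra_simps)
qed

lemma hyp_tangent_iff_lift:
  assumes "\<eta> \<in> disk"
  shows "hyp_tangent (klein_inv \<eta>) = range (klein_lift \<eta>)"
proof
  show "hyp_tangent (klein_inv \<eta>) \<subseteq> range (klein_lift \<eta>)"
    using klein_lift_drop[OF assms] by (metis rangeI subsetI)
  show "range (klein_lift \<eta>) \<subseteq> hyp_tangent (klein_inv \<eta>)"
    using mink_klein_lift_base[OF assms] by (auto simp: hyp_tangent_def)
qed

lemma hyp_plane_eq: "hyp_plane = klein_inv ` disk"
proof
  show "hyp_plane \<subseteq> klein_inv ` disk" using klein_inverse by (metis imageI subsetI)
qed (use klein_inv_inverse(1) in auto)

subsection \<open>The metric\<close>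

lemma klein_metric_eq:
  assumes "\<eta> \<in> disk"
  shows "klein_metric \<eta> a b = (a \<bullet> b) / defect \<eta> + (\<eta> \<bullet> a) * (\<eta> \<bullet> b) / (defect \<eta>)\<^sup>2"
proof -
  note p = disk_pos[OF assms]
  define A B where "A = \<eta> \<bullet> a" and "B = \<eta> \<bullet> b"
  have m: "mink (vector [A / defect \<eta>, Re a + A * Re \<eta> / defect \<eta>, Im a + A * Im \<eta> / defect \<eta>])
      (vector [B / defect \<eta>, Re b + B * Re \<eta> / defect \<eta>, Im b + B * Im \<eta> / defect \<eta>])
     = - (A * B) / (defect \<eta>)\<^sup>2 + (a + (A / defect \<eta>) *\<^sub>R \<eta>) \<bullet> (b + (B / defect \<eta>) *\<^sub>R \<eta>)"
    by (simp add: mink_def inner_complex_def power2_eq_square)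
  also have "\<dots> = - (A * B) / (defect \<eta>)\<^sup>2 + a \<bullet> b + 2 * A * B / defect \<eta> + A * B * (1 - defect \<eta>) / (defect \<eta>)\<^sup>2"
    by (simp add: inner_add_left inner_add_right inner_commute[of _ \<eta>] A_def[symmetric] B_def[symmetric] inner_self_defect power2_eq_square diff_divide_distrib algebra_simps)
  also have "\<dots> = a \<bullet> b + A * B / defect \<eta>" using p by (simp add: field_simps power2_eq_square)
  finally have m': "mink (vector [A / defect \<eta>, Re a + A * Re \<eta> / defect \<eta>, Im a + A * Im \<eta> / defect \<eta>])
      (vector [B / defect \<eta>, Re b + B * Re \<eta> / defect \<eta>, Im b + B * Im \<eta> / defect \<eta>]) = a \<bullet> b + A * B / defect \<eta>" .
  have s: "mink (r *\<^sub>R x) (t *\<^sub>R y) = r * t * mink x y" for r t x y by (simp add: mink_def algebra_simps)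
  show ?thesis
    unfolding klein_metric_def ddir_klein_inv[OF assms] klein_lift_def A_def[symmetric] B_def[symmetric] s m'
    using p by (simp add: field_simps power2_eq_square)
qed

lemma klein_metric_mink:
  "\<eta> \<in> disk \<Longrightarrow> mink (klein_lift \<eta> a) (klein_lift \<eta> b) = klein_metric \<eta> a b"
  by (simp add: klein_metric_def ddir_klein_inv)

lemma klein_metric_commute: "klein_metric \<eta> a b = klein_metric \<eta> b a"
  by (simp add: klein_metric_def mink_def mult.commute)

lemma klein_metric_linear:
  assumes "\<eta> \<in> disk"
  shows "linear (klein_metric \<eta> a)" "linear (\<lambda>a. klein_metric \<eta> a b)"
  unfolding klein_metric_eq[OF assms]
  by (rule linearI; simp add: inner_add_right inner_add_left algebra_simps add_divide_distrib)+

lemma klein_metric_bilinear_simps: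
  assumes "\<eta> \<in> disk"
  shows "klein_metric \<eta> (a + b) c = klein_metric \<eta> a c + klein_metric \<eta> b c"
    "klein_metric \<eta> (a - b) c = klein_metric \<eta> a c - klein_metric \<eta> b c"
    "klein_metric \<eta> (r *\<^sub>R a) c = r * klein_metric \<eta> a c"
    "klein_metric \<eta> (- a) c = - klein_metric \<eta> a c"
    "klein_metric \<eta> c (a + b) = klein_metric \<eta> c a + klein_metric \<eta> c b"
    "klein_metric \<eta> c (a - b) = klein_metric \<eta> c a - klein_metric \<eta> c b"
    "klein_metric \<eta> c (r *\<^sub>R a) = r * klein_metric \<eta> c a"
    "klein_metric \<eta> c (- a) = - klein_metric \<eta> c a"
  using klein_metric_linear(1)[OF assms, of c] klein_metric_linear(2)[OF assms, of c]
    klein_metric_commute[of \<eta> _ c]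
  by (simp_all add: linear_add linear_diff linear_cmul linear_neg)

lemma klein_metric_pos:
  assumes "\<eta> \<in> disk"
  shows "klein_metric \<eta> a a \<ge> (a \<bullet> a) / defect \<eta>" "klein_metric \<eta> a a \<ge> 0" "klein_metric \<eta> a a = 0 \<Longrightarrow> a = 0"
proof -
  note p = disk_pos[OF assms]
  show 1: "klein_metric \<eta> a a \<ge> (a \<bullet> a) / defect \<eta>"
    using p by (simp add: klein_metric_eq[OF assms])
  have 2: "(a \<bullet> a) / defect \<eta> \<ge> 0" using p by simp
  then show "klein_metric \<eta> a a \<ge> 0" using 1 by linarith
  assume "klein_metric \<eta> a a = 0"
  then have "(a \<bullet> a) / defect \<eta> = 0" using 1 2 by linarith
  then show "a = 0" using p by simp
qed

lemma klein_sharp_eq: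
  assumes "\<eta> \<in> disk" "\<And>c. klein_metric \<eta> w c = \<alpha> c"
  shows "sharp klein_metric \<eta> \<alpha> = w"
  unfolding sharp_def
proof (rule the_equality)
  fix w' assume "\<forall>c. klein_metric \<eta> w' c = \<alpha> c"
  then have "klein_metric \<eta> (w' - w) (w' - w) = 0"
    using assms by (simp add: klein_metric_bilinear_simps)
  then show "w' = w" using klein_metric_pos(3)[OF assms(1)] by fastforce
qed (use assms in auto)

text \<open>The inverse of \<open>(I + \<eta>\<eta>\<^sup>T / q) / q\<close> is \<open>q (I - \<eta>\<eta>\<^sup>T)\<close>.\<close>

lemma klein_metric_sharp:
  assumes "\<eta> \<in> disk"
  shows "klein_metric \<eta> (defect \<eta> *\<^sub>R (A - (\<eta> \<bullet> A) *\<^sub>R \<eta>)) c = A \<bullet> c"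
proof -
  note p = disk_pos[OF assms]
  have "\<eta> \<bullet> (A - (\<eta> \<bullet> A) *\<^sub>R \<eta>) = (\<eta> \<bullet> A) * defect \<eta>"
    by (simp add: inner_diff_right inner_self_defect algebra_simps)
  then show ?thesis
    using p by (simp add: klein_metric_eq[OF assms] inner_diff_left power2_eq_square diff_divide_distrib)
qed

lemma klein_sharp_inner:
  "\<eta> \<in> disk \<Longrightarrow> sharp klein_metric \<eta> (\<lambda>c. A \<bullet> c) = defect \<eta> *\<^sub>R (A - (\<eta> \<bullet> A) *\<^sub>R \<eta>)"
  by (rule klein_sharp_eq[OF _ klein_metric_sharp])

text \<open>The derivative of \<open>\<eta> \<mapsto> g\<^bsub>\<eta>\<^esub>(a, b)\<close> in the direction \<open>v\<close>.\<close>

definition dmetric :: "complex \<Rightarrow> complex \<Rightarrow> complex \<Rightarrow> complex \<Rightarrow> real" where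
  "dmetric \<eta> v a b = 2 * (\<eta> \<bullet> v) * (a \<bullet> b) / (defect \<eta>)\<^sup>2
     + ((v \<bullet> a) * (\<eta> \<bullet> b) + (\<eta> \<bullet> a) * (v \<bullet> b)) / (defect \<eta>)\<^sup>2
     + 4 * (\<eta> \<bullet> v) * (\<eta> \<bullet> a) * (\<eta> \<bullet> b) / (defect \<eta>)^3"

lemma has_derivative_inverse_defect:
  assumes "\<eta> \<in> disk"
  shows "((\<lambda>y. inverse (defect y)) has_derivative (\<lambda>v. 2 * (\<eta> \<bullet> v) * (inverse (defect \<eta>))\<^sup>2)) (at \<eta>)"
  using disk_pos[OF assms]
  by (intro has_derivative_eq_rhs[OF Deriv.has_derivative_inverse[OF _ has_derivative_defect]])
    (auto simp: fun_eq_iff power2_eq_square)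

lemma has_derivative_klein_metric:
  assumes "\<eta> \<in> disk"
  shows "((\<lambda>y. klein_metric y a b) has_derivative (\<lambda>v. dmetric \<eta> v a b)) (at \<eta>)"
proof (rule has_derivative_transform_within_open[OF _ open_ball assms])
  note p = disk_pos[OF assms]
  show "((\<lambda>y. (a \<bullet> b) * inverse (defect y) + ((y \<bullet> a) * (y \<bullet> b)) * (inverse (defect y))\<^sup>2) has_derivative (\<lambda>v. dmetric \<eta> v a b)) (at \<eta>)"
    by (rule has_derivative_eq_rhs,
        (rule has_derivative_add has_derivative_mult has_derivative_const has_derivative_power
          has_derivative_inner_left has_derivative_ident has_derivative_inverse_defect[OF assms])+)
      (use p in \<open>simp add: fun_eq_iff dmetric_def divide_inverse power2_eq_square power3_eq_cube inner_commute algebra_simps\<close>)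
qed (simp add: klein_metric_eq divide_inverse power_inverse)

lemma ddir_klein_metric:
  "\<eta> \<in> disk \<Longrightarrow> ddir (\<lambda>y. klein_metric y a b) \<eta> v = dmetric \<eta> v a b"
  by (rule ddir_eqI[OF has_derivative_klein_metric])

text \<open>The geodesics of the Klein model are straight segments, so its connection is projectively flat.\<close>

definition Gam :: "complex \<Rightarrow> complex \<Rightarrow> complex \<Rightarrow> complex" where
  "Gam \<eta> a b = (1 / defect \<eta>) *\<^sub>R ((\<eta> \<bullet> a) *\<^sub>R b + (\<eta> \<bullet> b) *\<^sub>R a)"

lemma koszul_klein:
  assumes "\<eta> \<in> disk"
  shows "klein_metric \<eta> (Gam \<eta> a b) c = (dmetric \<eta> a b c + dmetric \<eta> b a c - dmetric \<eta> c a b) / 2"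
  using disk_pos[OF assms]
  by (simp add: klein_metric_eq[OF assms] dmetric_def Gam_def inner_add_right inner_add_left
      inner_commute[of c a] inner_commute[of c b] inner_commute[of b a] field_simps power2_eq_square power3_eq_cube)

lemma christoffel_klein:
  assumes "\<eta> \<in> disk"
  shows "christoffel klein_metric \<eta> a b = Gam \<eta> a b"
  unfolding christoffel_def ddir_klein_metric[OF assms]
  by (rule klein_sharp_eq[OF assms koszul_klein[OF assms]])

lemma metric_trace_klein:
  fixes B :: "complex \<Rightarrow> complex \<Rightarrow> 'b::real_vector"
  assumes "\<eta> \<in> disk" "\<And>b. linear (\<lambda>a. B a b)"
  shows "metric_trace klein_metric \<eta> B = defect \<eta> *\<^sub>R
    ((1 - (Re \<eta>)\<^sup>2) *\<^sub>R B 1 1 - (Re \<eta> * Im \<eta>) *\<^sub>R (B 1 \<i> + B \<i> 1) + (1 - (Im \<eta>)\<^sup>2) *\<^sub>R B \<i> \<i>)"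
proof -
  have B: "B a b = Re a *\<^sub>R B 1 b + Im a *\<^sub>R B \<i> b" for a b
  proof -
    have "B a b = B (Re a *\<^sub>R 1 + Im a *\<^sub>R \<i>) b"
      by (rule arg_cong[where f="\<lambda>a. B a b"]) (simp add: complex_eq_iff)
    then show ?thesis by (simp only: linear_add[OF assms(2)] linear_cmul[OF assms(2)])
  qed
  have "metric_trace klein_metric \<eta> B = B (defect \<eta> *\<^sub>R (1 - (\<eta> \<bullet> 1) *\<^sub>R \<eta>)) 1 + B (defect \<eta> *\<^sub>R (\<i> - (\<eta> \<bullet> \<i>) *\<^sub>R \<eta>)) \<i>"
    unfolding metric_trace_def klein_sharp_inner[OF assms(1)] by (simp add: Basis_complex_def)
  also have "\<dots> = defect \<eta> *\<^sub>R
    ((1 - (Re \<eta>)\<^sup>2) *\<^sub>R B 1 1 - (Re \<eta> * Im \<eta>) *\<^sub>R (B 1 \<i> + B \<i> 1) + (1 - (Im \<eta>)\<^sup>2) *\<^sub>R B \<i> \<i>)"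
  proof -
    have "B (defect \<eta> *\<^sub>R (1 - (\<eta> \<bullet> 1) *\<^sub>R \<eta>)) 1 = defect \<eta> *\<^sub>R ((1 - (Re \<eta>)\<^sup>2) *\<^sub>R B 1 1 - (Re \<eta> * Im \<eta>) *\<^sub>R B \<i> 1)"
      by (subst B) (simp add: inner_complex_def power2_eq_square scaleR_diff_right right_diff_distrib mult.assoc)
    moreover have "B (defect \<eta> *\<^sub>R (\<i> - (\<eta> \<bullet> \<i>) *\<^sub>R \<eta>)) \<i> = defect \<eta> *\<^sub>R ((1 - (Im \<eta>)\<^sup>2) *\<^sub>R B \<i> \<i> - (Re \<eta> * Im \<eta>) *\<^sub>R B 1 \<i>)"
      by (subst B) (simp add: inner_complex_def power2_eq_square scaleR_diff_right right_diff_distrib mult.assoc mult.left_commute)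
    ultimately show ?thesis by (simp add: scaleR_add_right scaleR_diff_right)
  qed
  finally show ?thesis .
qed

subsection \<open>The complex structure\<close>

lemma mink_cross_eq:
  "mink_cross x y = vector [- (x$2 * y$3 - x$3 * y$2), x$3 * y$1 - x$1 * y$3, x$1 * y$2 - x$2 * y$1]"
  unfolding mink_cross_def
proof (rule the_equality)
  show "\<forall>v. mink (vector [- (x$2 * y$3 - x$3 * y$2), x$3 * y$1 - x$1 * y$3, x$1 * y$2 - x$2 * y$1]) v
      = det (vector [x, y, v] :: real^3^3)"
    by (auto simp: mink_def det_3 algebra_simps)
  fix w assume w: "\<forall>v. mink w v = det (vector [x, y, v] :: real^3^3)"
  show "w = vector [- (x$2 * y$3 - x$3 * y$2), x$3 * y$1 - x$1 * y$3, x$1 * y$2 - x$2 * y$1]"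
    using w[rule_format, of "vector [1,0,0]"] w[rule_format, of "vector [0,1,0]"] w[rule_format, of "vector [0,0,1]"]
    by (simp add: mink_def det_3 vec_eq_iff forall_3)
qed

lemma hyp_J_tangent: "hyp_J p v \<in> hyp_tangent p"
  by (simp add: hyp_J_def mink_cross_eq hyp_tangent_def mink_def algebra_simps)

lemma i_inner_simps:
  "(\<i> * x) \<bullet> (\<i> * y) = x \<bullet> y" "x \<bullet> (\<i> * y) = - ((\<i> * x) \<bullet> y)" "(\<i> * x) \<bullet> x = 0"
  by (simp_all add: inner_complex_def)

lemma perp_decomp: "(\<eta> \<bullet> a) *\<^sub>R \<eta> + ((\<i> * \<eta>) \<bullet> a) *\<^sub>R (\<i> * \<eta>) = (\<eta> \<bullet> \<eta>) *\<^sub>R a"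
  by (simp add: complex_eq_iff inner_complex_def algebra_simps)

lemma perp_decomp_inner: "(\<eta> \<bullet> a) * (\<eta> \<bullet> b) + ((\<i> * \<eta>) \<bullet> a) * ((\<i> * \<eta>) \<bullet> b) = (\<eta> \<bullet> \<eta>) * (a \<bullet> b)"
  by (simp add: inner_complex_def algebra_simps)

lemma klein_J_eq:
  assumes "\<eta> \<in> disk"
  shows "klein_J \<eta> a = (1 / rho \<eta>) *\<^sub>R (\<i> * a + ((\<i> * \<eta>) \<bullet> a) *\<^sub>R \<eta>)"
proof -
  note p = disk_pos[OF assms]
  define c where "c = (Re \<eta> * Im a - Im \<eta> * Re a) / defect \<eta>"
  have rr: "x / rho \<eta> * (y / rho \<eta>) = x * y / defect \<eta>" for x y using p by simp
  have "mink_cross (klein_inv \<eta>) (klein_lift \<eta> a) = vector [- c, - Im a / defect \<eta>, Re a / defect \<eta>]"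
    unfolding mink_cross_eq klein_lift_def c_def
    using p by (simp add: vec_eq_iff forall_3 klein_inv_nth rr) (simp add: algebra_simps add_divide_distrib diff_divide_distrib)
  then have "klein_J \<eta> a = rho \<eta> *\<^sub>R (Complex (- Im a / defect \<eta>) (Re a / defect \<eta>) + c *\<^sub>R \<eta>)"
    by (simp add: klein_J_def ddir_klein_inv[OF assms] ddir_klein[OF assms] hyp_J_def klein_drop_def)
  also have "\<dots> = (rho \<eta> / defect \<eta>) *\<^sub>R (\<i> * a + ((\<i> * \<eta>) \<bullet> a) *\<^sub>R \<eta>)"
    using p by (simp add: complex_eq_iff c_def inner_complex_def algebra_simps diff_divide_distrib)
  also have "rho \<eta> / defect \<eta> = 1 / rho \<eta>" using p by (simp add: divide_simps)
  finally show ?thesis .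
qed

lemma hyp_J_lift: "\<eta> \<in> disk \<Longrightarrow> hyp_J (klein_inv \<eta>) (klein_lift \<eta> a) = klein_lift \<eta> (klein_J \<eta> a)"
  using klein_lift_drop[OF _ hyp_J_tangent] by (simp add: klein_J_def ddir_klein_inv ddir_klein)

lemma klein_J_linear: "\<eta> \<in> disk \<Longrightarrow> linear (klein_J \<eta>)"
  by (rule linearI) (simp_all add: klein_J_eq inner_add_right algebra_simps)

text \<open>Rotation by a right angle in the chart corresponds to \<open>J\<close> composed with the metric.\<close>

lemma klein_metric_J:
  assumes "\<eta> \<in> disk"
  shows "klein_metric \<eta> (klein_J \<eta> a) b = ((\<i> * a) \<bullet> b) / (rho \<eta>)^3"
proof -
  note p = disk_pos[OF assms]
  define q A B where "q = defect \<eta>" and "A = (\<i> * \<eta>) \<bullet> a" and "B = \<eta> \<bullet> b"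
  have "\<eta> \<bullet> (\<i> * a + A *\<^sub>R \<eta>) = - q * A"
    by (simp add: inner_add_right i_inner_simps A_def inner_self_defect q_def algebra_simps)
  then have "klein_metric \<eta> (\<i> * a + A *\<^sub>R \<eta>) b = (((\<i> * a) \<bullet> b) + A * B) / q + (- q * A) * B / q\<^sup>2"
    unfolding klein_metric_eq[OF assms] by (simp add: inner_add_left q_def B_def)
  also have "\<dots> = ((\<i> * a) \<bullet> b) / q" using p unfolding q_def by (simp add: field_simps power2_eq_square)
  finally show ?thesis
    using p by (simp add: klein_J_eq[OF assms] klein_metric_bilinear_simps[OF assms] A_def[symmetric] q_def power3_eq_cube)
qed

lemma klein_metric_J_J:
  assumes "\<eta> \<in> disk"
  shows "klein_metric \<eta> (klein_J \<eta> a) (klein_J \<eta> b) = klein_metric \<eta> a b"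
proof -
  note p = disk_pos[OF assms]
  define q where "q = defect \<eta>"
  have r4: "(rho \<eta>)^3 * rho \<eta> = q\<^sup>2" using p(5) by (simp add: q_def power2_eq_square power3_eq_cube mult.assoc)
  have "(\<i> * a) \<bullet> klein_J \<eta> b = (a \<bullet> b - ((\<i> * \<eta>) \<bullet> b) * ((\<i> * \<eta>) \<bullet> a)) / rho \<eta>"
    by (simp add: klein_J_eq[OF assms] inner_add_right i_inner_simps(1) inner_commute[of "\<i> * a" \<eta>] i_inner_simps(2))
  also have "a \<bullet> b - ((\<i> * \<eta>) \<bullet> b) * ((\<i> * \<eta>) \<bullet> a) = q * (a \<bullet> b) + (\<eta> \<bullet> a) * (\<eta> \<bullet> b)"
    using perp_decomp_inner[of \<eta> a b] by (simp add: inner_self_defect q_def algebra_simps)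
  finally have "klein_metric \<eta> (klein_J \<eta> a) (klein_J \<eta> b) = (q * (a \<bullet> b) + (\<eta> \<bullet> a) * (\<eta> \<bullet> b)) / q\<^sup>2"
    unfolding klein_metric_J[OF assms] by (simp add: r4[symmetric])
  also have "\<dots> = klein_metric \<eta> a b"
    using p by (simp add: klein_metric_eq[OF assms] q_def add_divide_distrib power2_eq_square)
  finally show ?thesis .
qed

text \<open>\<open>J\<close> is skew for \<open>g\<close> and an isometry.\<close>

lemma klein_J_square: 
  assumes "\<eta> \<in> disk" shows "klein_J \<eta> (klein_J \<eta> a) = - a"
proof -
  note p = disk_pos[OF assms]
  have "klein_metric \<eta> (klein_J \<eta> (klein_J \<eta> a) + a) c = 0" for c
  proof -
    have "klein_metric \<eta> (klein_J \<eta> (klein_J \<eta> a)) c = - ((\<i> * c) \<bullet> klein_J \<eta> a) / (rho \<eta>)^3"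
      unfolding klein_metric_J[OF assms] by (simp add: inner_commute[of _ c] i_inner_simps(2))
    also have "\<dots> = - klein_metric \<eta> (klein_J \<eta> c) (klein_J \<eta> a)"
      unfolding klein_metric_J[OF assms] by simp
    finally show ?thesis
      using klein_metric_commute[of \<eta> a c]
      by (simp add: klein_metric_J_J[OF assms] klein_metric_bilinear_simps[OF assms])
  qed
  then show ?thesis using klein_metric_pos(3)[OF assms] eq_neg_iff_add_eq_0 by blast
qed

subsection \<open>Smooth functions on the disk\<close>

text \<open>The flat gradient in the chart.\<close>

definition nab :: "(complex \<Rightarrow> real) \<Rightarrow> complex \<Rightarrow> complex" where
  "nab u \<eta> = Complex (ddir u \<eta> 1) (ddir u \<eta> \<i>)"

lemma ddir_decomp:
  assumes "f differentiable (at (\<eta>::complex))"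
  shows "ddir f \<eta> a = Re a *\<^sub>R ddir f \<eta> 1 + Im a *\<^sub>R ddir f \<eta> \<i>"
proof -
  have "ddir f \<eta> a = ddir f \<eta> (Re a *\<^sub>R 1 + Im a *\<^sub>R \<i>)"
    by (rule arg_cong[where f="ddir f \<eta>"]) (simp add: complex_eq_iff)
  then show ?thesis
    using linear_frechet_derivative[OF assms] by (simp only: linear_add linear_cmul)
qed

lemma ddir_nab: "u differentiable (at \<eta>) \<Longrightarrow> ddir u \<eta> a = nab u \<eta> \<bullet> a"
  by (subst ddir_decomp) (auto simp: nab_def inner_complex_def)

lemma nab_eqI: "(u has_derivative (\<lambda>a. N \<bullet> a)) (at \<eta>) \<Longrightarrow> nab u \<eta> = N"
  by (simp add: nab_def ddir_eqI[where f'="\<lambda>a. N \<bullet> a"] complex_eq_iff inner_complex_def)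

lemma has_derivative_nab: "smooth_on disk u \<Longrightarrow> \<eta> \<in> disk \<Longrightarrow> (u has_derivative (\<lambda>a. nab u \<eta> \<bullet> a)) (at \<eta>)"
  using smooth_on_has_derivative[of disk u \<eta>] ddir_nab[OF smooth_on_differentiable[of disk u \<eta>]]
  by (metis (no_types, lifting) ext)

lemma smooth_on_nab: assumes "smooth_on disk u" shows "smooth_on disk (nab u)"
proof -
  have "nab u = (\<lambda>\<eta>. ddir u \<eta> 1 *\<^sub>R 1 + ddir u \<eta> \<i> *\<^sub>R \<i>)"
    by (auto simp: nab_def fun_eq_iff complex_eq_iff)
  then show ?thesis
    using assms by (auto intro!: smooth_on_add smooth_on_scaleR smooth_on_ddir smooth_on_const)
qed

lemma nab_symmetric:
  assumes "smooth_on disk u" "\<eta> \<in> disk"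
  shows "ddir (nab u) \<eta> a \<bullet> b = ddir (nab u) \<eta> b \<bullet> a"
proof -
  have *: "ddir (nab u) \<eta> a \<bullet> b = ddir (\<lambda>y. ddir u y b) \<eta> a" for a b
  proof -
    have "((\<lambda>y. nab u y \<bullet> b) has_derivative (\<lambda>a. ddir (nab u) \<eta> a \<bullet> b)) (at \<eta>)"
      by (intro has_derivative_inner_left smooth_on_has_derivative[of disk] smooth_on_nab assms)
    then have "ddir (nab u) \<eta> a \<bullet> b = ddir (\<lambda>y. nab u y \<bullet> b) \<eta> a" by (simp add: ddir_eqI)
    also have "\<dots> = ddir (\<lambda>y. ddir u y b) \<eta> a"
      by (rule ddir_cong_open[OF open_ball assms(2)]) (simp add: ddir_nab smooth_on_differentiable[OF assms(1)])
    finally show ?thesis .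
  qed
  show ?thesis unfolding * by (rule ddir_symmetric[OF open_ball assms(2,1)])
qed

lemma smooth_on_id: "smooth_on disk (\<lambda>\<eta>. \<eta>)"
  by (auto intro!: smooth_on_bounded_linear bounded_linear_ident)

lemma smooth_on_defect: "smooth_on disk defect"
proof -
  have "smooth_on disk (\<lambda>\<eta>. 1 - \<eta> \<bullet> \<eta>)"
    by (intro smooth_on_diff smooth_on_inner smooth_on_const smooth_on_id open_ball)
  then show ?thesis by (simp add: defect_def[abs_def])
qed

text \<open>The functions \<open>g / \<rho>\<^sup>k\<close> with smooth \<open>g\<close> are closed under differentiation.\<close>

lemma has_derivative_div_rho:
  assumes "\<eta> \<in> disk" "(g has_derivative g') (at \<eta>)"
  shows "((\<lambda>\<eta>. (1 / rho \<eta> ^ k) *\<^sub>R g \<eta>) has_derivative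
     (\<lambda>v. (1 / rho \<eta> ^ (k + 2)) *\<^sub>R (defect \<eta> *\<^sub>R g' v + (real k * (\<eta> \<bullet> v)) *\<^sub>R g \<eta>))) (at \<eta>)"
proof -
  note p = disk_pos[OF assms(1)]
  have i: "((\<lambda>\<eta>. inverse (rho \<eta>)) has_derivative (\<lambda>v. (\<eta> \<bullet> v) * inverse (rho \<eta>) ^ 3)) (at \<eta>)"
    by (rule has_derivative_eq_rhs[OF Deriv.has_derivative_inverse[OF _ has_derivative_rho]])
      (use p assms in \<open>auto simp: fun_eq_iff power3_eq_cube field_simps\<close>)
  have "((\<lambda>\<eta>. inverse (rho \<eta>) ^ k *\<^sub>R g \<eta>) has_derivative
     (\<lambda>v. inverse (rho \<eta>) ^ k *\<^sub>R g' v + (real k * ((\<eta> \<bullet> v) * inverse (rho \<eta>) ^ 3) * inverse (rho \<eta>) ^ (k - 1)) *\<^sub>R g \<eta>)) (at \<eta>)"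
    by (rule has_derivative_eq_rhs[OF has_derivative_scaleR[OF has_derivative_power[OF i] assms(2)]]) simp
  moreover have "inverse (rho \<eta>) ^ k = (1 / rho \<eta> ^ (k + 2)) * defect \<eta>"
    using p by (simp add: power_add field_simps power2_eq_square)
  moreover have "real k * ((\<eta> \<bullet> v) * inverse (rho \<eta>) ^ 3) * inverse (rho \<eta>) ^ (k - 1) = (1 / rho \<eta> ^ (k + 2)) * (real k * (\<eta> \<bullet> v))" for v
  proof (cases k)
    case (Suc j) then show ?thesis using p by (simp add: field_simps power_add power3_eq_cube)
  qed simp
  ultimately have "((\<lambda>\<eta>. inverse (rho \<eta>) ^ k *\<^sub>R g \<eta>) has_derivative
     (\<lambda>v. (1 / rho \<eta> ^ (k + 2)) *\<^sub>R (defect \<eta> *\<^sub>R g' v + (real k * (\<eta> \<bullet> v)) *\<^sub>R g \<eta>))) (at \<eta>)"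
    by (simp only: scaleR_add_right scaleR_scaleR)
  then show ?thesis by (simp add: divide_inverse power_inverse)
qed

lemma smooth_on_div_rho:
  assumes "smooth_on disk g"
  shows "smooth_on disk (\<lambda>\<eta>. (1 / rho \<eta> ^ k) *\<^sub>R g \<eta>)"
proof (rule smooth_on_coinduct[where P="\<lambda>f. \<exists>k g. smooth_on disk g \<and> f = (\<lambda>\<eta>. (1 / rho \<eta> ^ k) *\<^sub>R g \<eta>)"])
  show "\<exists>k' g'. smooth_on disk g' \<and> (\<lambda>\<eta>. (1 / rho \<eta> ^ k) *\<^sub>R g \<eta>) = (\<lambda>\<eta>. (1 / rho \<eta> ^ k') *\<^sub>R g' \<eta>)"
    using assms by blast
next
  fix f :: "complex \<Rightarrow> 'a" and x :: complex
  assume "\<exists>k g. smooth_on disk g \<and> f = (\<lambda>\<eta>. (1 / rho \<eta> ^ k) *\<^sub>R g \<eta>)" and x: "x \<in> disk"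
  then obtain k g where g: "smooth_on disk g" "f = (\<lambda>\<eta>. (1 / rho \<eta> ^ k) *\<^sub>R g \<eta>)" by blast
  show "f differentiable (at x)" unfolding g(2)
    using has_derivative_div_rho[OF x smooth_on_has_derivative[OF g(1) x]] by (rule differentiableI)
next
  fix f :: "complex \<Rightarrow> 'a" and v
  assume "\<exists>k g. smooth_on disk g \<and> f = (\<lambda>\<eta>. (1 / rho \<eta> ^ k) *\<^sub>R g \<eta>)"
  then obtain k g where g: "smooth_on disk g" "f = (\<lambda>\<eta>. (1 / rho \<eta> ^ k) *\<^sub>R g \<eta>)" by blast
  let ?h = "\<lambda>\<eta>. defect \<eta> *\<^sub>R ddir g \<eta> v + (real k * (\<eta> \<bullet> v)) *\<^sub>R g \<eta>"
  have "smooth_on disk ?h"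
    by (intro smooth_on_add smooth_on_scaleR smooth_on_defect smooth_on_ddir g open_ball smooth_on_mult
        smooth_on_const smooth_on_inner smooth_on_id)
  moreover have "ddir f x v = (1 / rho x ^ (k + 2)) *\<^sub>R ?h x" if "x \<in> disk" for x
    unfolding g(2) by (rule ddir_eqI[OF has_derivative_div_rho[OF that smooth_on_has_derivative[OF g(1) that]]])
  ultimately show "\<exists>h. (\<exists>k g. smooth_on disk g \<and> h = (\<lambda>\<eta>. (1 / rho \<eta> ^ k) *\<^sub>R g \<eta>)) \<and> (\<forall>x\<in>disk. ddir f x v = h x)"
    by blast
qed simp

lemma smooth_on_rho: "smooth_on disk rho"
proof -
  have "smooth_on disk (\<lambda>\<eta>. (1 / rho \<eta> ^ 1) *\<^sub>R defect \<eta>)" by (rule smooth_on_div_rho[OF smooth_on_defect])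
  then show ?thesis
    using smooth_on_cong[OF open_ball, of 0 1 rho "\<lambda>\<eta>. (1 / rho \<eta> ^ 1) *\<^sub>R defect \<eta>"] disk_pos by (simp add: divide_simps)
qed

subsection \<open>The Laplacian and the Hessian\<close>

text \<open>The flat trace of \<open>(I - \<eta>\<eta>\<^sup>T) B\<close>; the trace with respect to \<open>g\<close> is \<open>q\<close> times this.\<close>

definition Mtr :: "complex \<Rightarrow> (complex \<Rightarrow> complex \<Rightarrow> 'b::real_vector) \<Rightarrow> 'b" where
  "Mtr \<eta> B = (1 - (Re \<eta>)\<^sup>2) *\<^sub>R B 1 1 - (Re \<eta> * Im \<eta>) *\<^sub>R (B 1 \<i> + B \<i> 1) + (1 - (Im \<eta>)\<^sup>2) *\<^sub>R B \<i> \<i>"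

lemma Mtr_add: "Mtr \<eta> (\<lambda>a b. B a b + C a b) = Mtr \<eta> B + Mtr \<eta> C"
  by (simp add: Mtr_def scaleR_add_right)

lemma Mtr_diff: "Mtr \<eta> (\<lambda>a b. B a b - C a b) = Mtr \<eta> B - Mtr \<eta> C"
  by (simp add: Mtr_def algebra_simps)

lemma Mtr_linear: "linear h \<Longrightarrow> Mtr \<eta> (\<lambda>a b. h (B a b)) = h (Mtr \<eta> B)"
  by (simp add: Mtr_def linear_add linear_diff linear_cmul)

lemma Mtr_scaleR: "Mtr \<eta> (\<lambda>a b. c *\<^sub>R B a b) = c *\<^sub>R Mtr \<eta> B"
  by (simp add: Mtr_def algebra_simps)

lemma Mtr_swap: "Mtr \<eta> (\<lambda>a b. B b a) = Mtr \<eta> B"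
  by (simp add: Mtr_def add.commute)

lemma linear_basis: "linear L \<Longrightarrow> L v = Re v *\<^sub>R L 1 + Im v *\<^sub>R L \<i>" for L :: "complex \<Rightarrow> 'b::real_vector"
  using linear_add[of L "Re v *\<^sub>R 1" "Im v *\<^sub>R \<i>"] linear_cmul[of L "Re v" 1] linear_cmul[of L "Im v" \<i>]
    complex_eq[of v] by (simp add: scaleR_conv_of_real mult.commute)

lemma Mtr_inner_left:
  assumes L: "linear L" shows "Mtr \<eta> (\<lambda>a b. (v \<bullet> a) *\<^sub>R L b) = L (v - (\<eta> \<bullet> v) *\<^sub>R \<eta>)"
  unfolding linear_basis[OF L, of "v - (\<eta> \<bullet> v) *\<^sub>R \<eta>"] Mtr_def
  by (simp add: inner_complex_def algebra_simps power2_eq_square)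

lemma perp_defect: "\<eta> - (\<eta> \<bullet> \<eta>) *\<^sub>R \<eta> = defect \<eta> *\<^sub>R \<eta>"
  by (simp add: defect_def algebra_simps)

lemma Mtr_base:
  assumes L: "linear L" shows "Mtr \<eta> (\<lambda>a b. (\<eta> \<bullet> a) *\<^sub>R L b) = defect \<eta> *\<^sub>R L \<eta>"
  unfolding Mtr_inner_left[OF L] perp_defect by (simp add: linear_cmul[OF L])

lemma Mtr_inner: "Mtr \<eta> (\<lambda>a b. a \<bullet> b) = 1 + defect \<eta>"
  by (simp add: Mtr_def defect_def inner_complex_def power2_eq_square)

text \<open>The covariant derivative of the form \<open>\<alpha>\<cdot>\<close>, hence the covariant Hessian of \<open>u\<close> for \<open>\<alpha> = \<nabla>u\<close>.\<close>

definition Hs :: "(complex \<Rightarrow> complex) \<Rightarrow> complex \<Rightarrow> complex \<Rightarrow> complex" where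
  "Hs \<alpha> \<eta> a = ddir \<alpha> \<eta> a - (1 / defect \<eta>) *\<^sub>R ((\<eta> \<bullet> a) *\<^sub>R \<alpha> \<eta> + (\<alpha> \<eta> \<bullet> a) *\<^sub>R \<eta>)"

lemma Hs_inner: "Hs \<alpha> \<eta> a \<bullet> b = ddir \<alpha> \<eta> a \<bullet> b - \<alpha> \<eta> \<bullet> Gam \<eta> a b"
  by (simp add: Hs_def Gam_def inner_diff_left inner_diff_right inner_add_left inner_add_right inner_commute algebra_simps)

lemma linear_Hs: "\<alpha> differentiable (at \<eta>) \<Longrightarrow> linear (Hs \<alpha> \<eta>)"
  by (rule linearI)
    (simp_all add: Hs_def linear_add[OF linear_frechet_derivative] linear_cmul[OF linear_frechet_derivative] inner_add_right algebra_simps)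

lemma hessian_klein:
  assumes "smooth_on disk u" "\<eta> \<in> disk"
  shows "hessian klein_metric u \<eta> a b = Hs (nab u) \<eta> a \<bullet> b"
proof -
  have "((\<lambda>y. nab u y \<bullet> b) has_derivative (\<lambda>a. ddir (nab u) \<eta> a \<bullet> b)) (at \<eta>)"
    by (intro has_derivative_inner_left smooth_on_has_derivative[of disk] smooth_on_nab assms)
  then have "ddir (nab u) \<eta> a \<bullet> b = ddir (\<lambda>y. nab u y \<bullet> b) \<eta> a" by (simp add: ddir_eqI)
  also have "\<dots> = ddir (\<lambda>y. ddir u y b) \<eta> a"
    by (rule ddir_cong_open[OF open_ball assms(2)]) (simp add: ddir_nab smooth_on_differentiable[OF assms(1)])
  finally show ?thesis
    by (simp add: hessian_def christoffel_klein[OF assms(2)] Hs_inner ddir_nab smooth_on_differentiable[OF assms])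
qed

lemma Mtr_Gam:
  assumes "\<eta> \<in> disk" shows "Mtr \<eta> (Gam \<eta>) = 2 *\<^sub>R \<eta>"
proof -
  have "Mtr \<eta> (Gam \<eta>) = (1 / defect \<eta>) *\<^sub>R (Mtr \<eta> (\<lambda>a b. (\<eta> \<bullet> a) *\<^sub>R b) + Mtr \<eta> (\<lambda>a b. (\<eta> \<bullet> b) *\<^sub>R a))"
    by (simp only: Gam_def[abs_def] Mtr_add Mtr_scaleR)
  then show ?thesis
    using disk_pos[OF assms] by (simp add: Mtr_swap[where B="\<lambda>a b. (\<eta> \<bullet> a) *\<^sub>R b"] Mtr_base[OF linear_id[unfolded id_def]] scaleR_add_left[symmetric])
qed

lemma laplacian_klein:
  assumes "smooth_on disk u" "\<eta> \<in> disk"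
  shows "laplacian klein_metric u \<eta> = defect \<eta> * Mtr \<eta> (\<lambda>a b. Hs (nab u) \<eta> a \<bullet> b)"
    and "laplacian klein_metric u \<eta> = defect \<eta> * Mtr \<eta> (\<lambda>a b. ddir (nab u) \<eta> a \<bullet> b) - 2 * defect \<eta> * (\<eta> \<bullet> nab u \<eta>)"
proof -
  have d: "nab u differentiable (at \<eta>)" by (rule smooth_on_differentiable[OF smooth_on_nab[OF assms(1)] assms(2)])
  have "laplacian klein_metric u \<eta> = metric_trace klein_metric \<eta> (\<lambda>a b. Hs (nab u) \<eta> a \<bullet> b)"
    by (simp add: laplacian_def hessian_klein[OF assms] metric_trace_def)
  also have "\<dots> = defect \<eta> * Mtr \<eta> (\<lambda>a b. Hs (nab u) \<eta> a \<bullet> b)"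
  proof -
    have "linear (\<lambda>a. Hs (nab u) \<eta> a \<bullet> b)" for b
      by (rule linearI) (simp_all add: linear_add[OF linear_Hs[OF d]] linear_cmul[OF linear_Hs[OF d]] inner_add_left)
    from metric_trace_klein[OF assms(2) this] show ?thesis by (simp add: Mtr_def)
  qed
  finally show 1: "laplacian klein_metric u \<eta> = defect \<eta> * Mtr \<eta> (\<lambda>a b. Hs (nab u) \<eta> a \<bullet> b)" .
  have "Mtr \<eta> (\<lambda>a b. nab u \<eta> \<bullet> Gam \<eta> a b) = nab u \<eta> \<bullet> (2 *\<^sub>R \<eta>)"
    by (subst Mtr_linear[OF bounded_linear.linear[OF bounded_linear_inner_right]]) (simp add: Mtr_Gam[OF assms(2)])
  then show "laplacian klein_metric u \<eta> = defect \<eta> * Mtr \<eta> (\<lambda>a b. ddir (nab u) \<eta> a \<bullet> b) - 2 * defect \<eta> * (\<eta> \<bullet> nab u \<eta>)"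
    unfolding 1 Hs_inner Mtr_diff by (simp add: inner_commute algebra_simps)
qed

text \<open>The function \<open>f = \<rho> u\<close> is the restriction to an affine plane of the extension of \<open>u\<close> which is
  homogeneous of degree one; its flat Hessian is \<open>\<rho>\<close> times \<open>\<nabla>du - u g\<close>.\<close>

lemma has_derivative_rescale:
  assumes u: "smooth_on disk u" and eta: "\<eta> \<in> disk"
  shows "((\<lambda>y. rho y * u y) has_derivative (\<lambda>a. (rho \<eta> *\<^sub>R nab u \<eta> - (u \<eta> / rho \<eta>) *\<^sub>R \<eta>) \<bullet> a)) (at \<eta>)"
  by (rule has_derivative_eq_rhs[OF has_derivative_mult[OF has_derivative_rho[OF eta] has_derivative_nab[OF u eta]]])
    (simp add: fun_eq_iff inner_diff_left algebra_simps)

lemma smooth_on_rescale: "smooth_on disk u \<Longrightarrow> smooth_on disk (\<lambda>y. rho y * u y)"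
  by (intro smooth_on_mult smooth_on_rho open_ball)

lemma nab_rescale:
  assumes "smooth_on disk u" "\<eta> \<in> disk"
  shows "nab (\<lambda>y. rho y * u y) \<eta> = rho \<eta> *\<^sub>R nab u \<eta> - (u \<eta> / rho \<eta>) *\<^sub>R \<eta>"
  by (rule nab_eqI[OF has_derivative_rescale[OF assms]])

lemma ddir_nab_rescale:
  assumes u: "smooth_on disk u" and eta: "\<eta> \<in> disk"
  shows "ddir (nab (\<lambda>y. rho y * u y)) \<eta> a \<bullet> b = rho \<eta> * (Hs (nab u) \<eta> a \<bullet> b - u \<eta> * klein_metric \<eta> a b)"
proof -
  note p = disk_pos[OF eta]
  let ?N = "nab u"
  have inv: "((\<lambda>y. 1 / rho y) has_derivative (\<lambda>v. (\<eta> \<bullet> v) / rho \<eta> ^ 3)) (at \<eta>)"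
    using has_derivative_div_rho[OF eta has_derivative_const[of "1::real"], of 1] by (simp add: numeral_3_eq_3)
  have "((\<lambda>y. rho y *\<^sub>R ?N y - ((u y * (1 / rho y)) *\<^sub>R y)) has_derivative
    (\<lambda>a. rho \<eta> *\<^sub>R ddir ?N \<eta> a + (- (\<eta> \<bullet> a) / rho \<eta>) *\<^sub>R ?N \<eta>
      - ((u \<eta> * (1 / rho \<eta>)) *\<^sub>R a + (u \<eta> * ((\<eta> \<bullet> a) / rho \<eta> ^ 3) + (?N \<eta> \<bullet> a) * (1 / rho \<eta>)) *\<^sub>R \<eta>))) (at \<eta>)"
    by (intro has_derivative_diff has_derivative_scaleR has_derivative_mult has_derivative_rho eta has_derivative_ident
        has_derivative_nab u inv smooth_on_has_derivative[OF smooth_on_nab])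
  then have "(nab (\<lambda>y. rho y * u y) has_derivative
    (\<lambda>a. rho \<eta> *\<^sub>R ddir ?N \<eta> a + (- (\<eta> \<bullet> a) / rho \<eta>) *\<^sub>R ?N \<eta>
      - ((u \<eta> * (1 / rho \<eta>)) *\<^sub>R a + (u \<eta> * ((\<eta> \<bullet> a) / rho \<eta> ^ 3) + (?N \<eta> \<bullet> a) * (1 / rho \<eta>)) *\<^sub>R \<eta>))) (at \<eta>)"
    by (rule has_derivative_transform_within_open[OF _ open_ball eta]) (simp add: nab_rescale[OF u])
  from ddir_eqI[OF this]
  have *: "ddir (nab (\<lambda>y. rho y * u y)) \<eta> a \<bullet> b = rho \<eta> * (ddir ?N \<eta> a \<bullet> b) - (\<eta> \<bullet> a) / rho \<eta> * (?N \<eta> \<bullet> b)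
     - (u \<eta> / rho \<eta> * (a \<bullet> b) + (u \<eta> * ((\<eta> \<bullet> a) / rho \<eta> ^ 3) + (?N \<eta> \<bullet> a) / rho \<eta>) * (\<eta> \<bullet> b))"
    by (simp add: inner_diff_left inner_add_left)
  have d: "1 / rho \<eta> = rho \<eta> * (1 / defect \<eta>)" "x / rho \<eta> ^ 3 = rho \<eta> * (x / (defect \<eta>)\<^sup>2)" for x
    using p by (simp_all add: divide_simps power2_eq_square power3_eq_cube)
  have d1: "x / rho \<eta> = rho \<eta> * (x / defect \<eta>)" for x using p by (simp add: divide_simps)
  show ?thesis unfolding * d d1 klein_metric_eq[OF eta] Hs_def
    by (simp add: inner_diff_left inner_add_left algebra_simps add_divide_distrib)
qed

lemma Mtr_klein_metric: "\<eta> \<in> disk \<Longrightarrow> defect \<eta> * Mtr \<eta> (klein_metric \<eta>) = 2"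
proof -
  assume eta: "\<eta> \<in> disk"
  note p = disk_pos[OF eta]
  have "klein_metric \<eta> = (\<lambda>a b. (1 / defect \<eta>) *\<^sub>R (a \<bullet> b) + (1 / (defect \<eta>)\<^sup>2) *\<^sub>R ((\<eta> \<bullet> a) *\<^sub>R (\<eta> \<bullet> b)))"
    by (simp add: fun_eq_iff klein_metric_eq[OF eta])
  then have "Mtr \<eta> (klein_metric \<eta>) = Mtr \<eta> (\<lambda>a b. (1 / defect \<eta>) *\<^sub>R (a \<bullet> b) + (1 / (defect \<eta>)\<^sup>2) *\<^sub>R ((\<eta> \<bullet> a) *\<^sub>R (\<eta> \<bullet> b)))"
    by (rule arg_cong)
  also have "\<dots> = (1 / defect \<eta>) * (1 + defect \<eta>) + (1 / (defect \<eta>)\<^sup>2) * (defect \<eta> * (1 - defect \<eta>))"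
    unfolding Mtr_add Mtr_scaleR Mtr_inner Mtr_base[OF bounded_linear.linear[OF bounded_linear_inner_right]] inner_self_defect by simp
  finally show ?thesis using p by (simp add: field_simps power2_eq_square)
qed

text \<open>Tracing the formula for the flat Hessian, with \<open>tr g = 2\<close>.\<close>

lemma laplacian_rescale:
  assumes u: "smooth_on disk u" and eta: "\<eta> \<in> disk"
  shows "laplacian klein_metric u \<eta> - 2 * u \<eta> = rho \<eta> * Mtr \<eta> (\<lambda>a b. ddir (nab (\<lambda>y. rho y * u y)) \<eta> a \<bullet> b)"
proof -
  note p = disk_pos[OF eta]
  have "Mtr \<eta> (\<lambda>a b. rho \<eta> * (Hs (nab u) \<eta> a \<bullet> b - u \<eta> * klein_metric \<eta> a b))
     = rho \<eta> * (Mtr \<eta> (\<lambda>a b. Hs (nab u) \<eta> a \<bullet> b) - u \<eta> * Mtr \<eta> (klein_metric \<eta>))"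
    by (simp add: Mtr_def algebra_simps)
  then have "rho \<eta> * Mtr \<eta> (\<lambda>a b. ddir (nab (\<lambda>y. rho y * u y)) \<eta> a \<bullet> b)
     = rho \<eta> * rho \<eta> * (Mtr \<eta> (\<lambda>a b. Hs (nab u) \<eta> a \<bullet> b) - u \<eta> * Mtr \<eta> (klein_metric \<eta>))"
    unfolding ddir_nab_rescale[OF u eta] by simp
  also have "\<dots> = defect \<eta> * Mtr \<eta> (\<lambda>a b. Hs (nab u) \<eta> a \<bullet> b) - u \<eta> * (defect \<eta> * Mtr \<eta> (klein_metric \<eta>))"
    unfolding p(5) by (simp add: right_diff_distrib)
  finally have "rho \<eta> * Mtr \<eta> (\<lambda>a b. ddir (nab (\<lambda>y. rho y * u y)) \<eta> a \<bullet> b)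
     = defect \<eta> * Mtr \<eta> (\<lambda>a b. Hs (nab u) \<eta> a \<bullet> b) - u \<eta> * (defect \<eta> * Mtr \<eta> (klein_metric \<eta>))" .
  then show ?thesis by (simp add: laplacian_klein(1)[OF u eta] Mtr_klein_metric[OF eta])
qed


section \<open>Vector fields in the Klein chart\<close>

text \<open>The field \<open>J\<alpha>\<^sup>#\<close>, where \<open>\<alpha>\<^sup>#\<close> is the metric dual of the form \<open>\<alpha>\<cdot>\<close>. The factor \<open>\<rho>\<^sup>3\<close> is the inverse of
  the area density of \<open>g\<close>.\<close>

definition Wf :: "(complex \<Rightarrow> complex) \<Rightarrow> complex \<Rightarrow> complex" where
  "Wf \<alpha> \<eta> = rho \<eta> ^ 3 *\<^sub>R (\<i> * \<alpha> \<eta>)"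

lemma rho_power3: "\<eta> \<in> disk \<Longrightarrow> rho \<eta> ^ 3 = rho \<eta> * defect \<eta>"
  using disk_pos[of \<eta>] by (simp add: power3_eq_cube)

lemma defect_div_rho: "\<eta> \<in> disk \<Longrightarrow> defect \<eta> / rho \<eta> = rho \<eta>"
  using disk_pos[of \<eta>] by (simp add: divide_simps)

lemma has_derivative_rho_defect:
  assumes "\<eta> \<in> disk"
  shows "((\<lambda>y. rho y * defect y) has_derivative (\<lambda>a. - 3 * rho \<eta> * (\<eta> \<bullet> a))) (at \<eta>)"
proof -
  note p = disk_pos[OF assms]
  have d: "x / rho \<eta> * defect \<eta> = x * rho \<eta>" for x using defect_div_rho[OF assms] by (metis times_divide_eq_left times_divide_eq_right)
  show ?thesis
    by (rule has_derivative_eq_rhs[OF has_derivative_mult[OF has_derivative_rho[OF assms] has_derivative_defect]])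
      (simp only: d, simp add: fun_eq_iff algebra_simps)
qed

lemma has_derivative_Wf:
  assumes "\<eta> \<in> disk" "(\<alpha> has_derivative \<alpha>') (at \<eta>)"
  shows "(Wf \<alpha> has_derivative (\<lambda>a. \<i> * (rho \<eta> *\<^sub>R (defect \<eta> *\<^sub>R \<alpha>' a - (3 * (\<eta> \<bullet> a)) *\<^sub>R \<alpha> \<eta>)))) (at \<eta>)"
proof (rule has_derivative_transform_within_open[OF _ open_ball assms(1)])
  show "((\<lambda>y. (rho y * defect y) *\<^sub>R (\<i> * \<alpha> y)) has_derivative
     (\<lambda>a. \<i> * (rho \<eta> *\<^sub>R (defect \<eta> *\<^sub>R \<alpha>' a - (3 * (\<eta> \<bullet> a)) *\<^sub>R \<alpha> \<eta>)))) (at \<eta>)"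
    by (rule has_derivative_eq_rhs[OF has_derivative_scaleR[OF has_derivative_rho_defect[OF assms(1)]
          has_derivative_mult_right[OF assms(2)]]]) (simp add: fun_eq_iff algebra_simps)
qed (simp add: Wf_def rho_power3)

lemma klein_J_sharp:
  assumes "\<eta> \<in> disk"
  shows "klein_J \<eta> (defect \<eta> *\<^sub>R (N - (\<eta> \<bullet> N) *\<^sub>R \<eta>)) = rho \<eta> ^ 3 *\<^sub>R (\<i> * N)"
proof -
  note p = disk_pos[OF assms]
  have "(\<i> * \<eta>) \<bullet> (N - (\<eta> \<bullet> N) *\<^sub>R \<eta>) = (\<i> * \<eta>) \<bullet> N" by (simp add: inner_diff_right i_inner_simps)
  moreover have "\<i> * (N - (\<eta> \<bullet> N) *\<^sub>R \<eta>) + ((\<i> * \<eta>) \<bullet> N) *\<^sub>R \<eta> = \<i> * (N - ((\<eta> \<bullet> N) *\<^sub>R \<eta> + ((\<i> * \<eta>) \<bullet> N) *\<^sub>R (\<i> * \<eta>)))"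
    by (simp add: algebra_simps)
  moreover have "\<dots> = defect \<eta> *\<^sub>R (\<i> * N)" unfolding perp_decomp by (simp add: defect_def algebra_simps)
  ultimately have "klein_J \<eta> (N - (\<eta> \<bullet> N) *\<^sub>R \<eta>) = (1 / rho \<eta>) *\<^sub>R defect \<eta> *\<^sub>R (\<i> * N)"
    unfolding klein_J_eq[OF assms] by simp
  also have "\<dots> = rho \<eta> *\<^sub>R (\<i> * N)" by (simp add: defect_div_rho[OF assms])
  finally show ?thesis
    unfolding linear_cmul[OF klein_J_linear[OF assms]] by (simp add: rho_power3[OF assms] mult.commute)
qed

lemma klein_push_J_grad:
  assumes u: "smooth_on disk (\<lambda>\<eta>. u (klein_inv \<eta>))" and eta: "\<eta> \<in> disk"
  shows "klein_push (\<lambda>p. hyp_J p (hyp_grad u p)) \<eta> = Wf (nab (\<lambda>\<eta>. u (klein_inv \<eta>))) \<eta>"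
proof -
  let ?U = "\<lambda>\<eta>. u (klein_inv \<eta>)"
  have "gradient klein_metric ?U \<eta> = defect \<eta> *\<^sub>R (nab ?U \<eta> - (\<eta> \<bullet> nab ?U \<eta>) *\<^sub>R \<eta>)"
    unfolding gradient_def ddir_nab[OF smooth_on_differentiable[OF u eta], abs_def] by (rule klein_sharp_inner[OF eta])
  then show ?thesis
    using klein_J_sharp[OF eta, of "nab ?U \<eta>"]
    by (simp add: klein_push_def hyp_grad_def klein_inv_inverse(2)[OF eta] ddir_klein_inv[OF eta] hyp_J_lift[OF eta]
        ddir_klein[OF eta] klein_drop_lift[OF eta] Wf_def)
qed

subsection \<open>The covariant derivative\<close>

text \<open>The rotation identity \<open>(p\<cdot>a)q - (q\<cdot>a)p = det(p,q) i a\<close> of the plane turns the Christoffel terms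
  of \<open>\<nabla>W\<close> into those of \<open>\<nabla>\<alpha>\<close>.\<close>

lemma rotation_identity: "(p \<bullet> a) *\<^sub>R q - (q \<bullet> a) *\<^sub>R p = (q \<bullet> (\<i> * p)) *\<^sub>R (\<i> * a)"
  by (simp add: complex_eq_iff inner_complex_def algebra_simps)

lemma cov_deriv_Wf:
  assumes eta: "\<eta> \<in> disk" and d: "\<alpha> differentiable (at \<eta>)"
  shows "cov_deriv klein_metric (Wf \<alpha>) \<eta> a = rho \<eta> ^ 3 *\<^sub>R (\<i> * Hs \<alpha> \<eta> a)"
proof -
  note p = disk_pos[OF eta]
  let ?q = "defect \<eta>" and ?r = "rho \<eta>"
  have G: "Gam \<eta> a (Wf \<alpha> \<eta>) = ?r *\<^sub>R ((\<eta> \<bullet> a) *\<^sub>R (\<i> * \<alpha> \<eta>) + (\<eta> \<bullet> (\<i> * \<alpha> \<eta>)) *\<^sub>R a)"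
    using p by (simp add: Gam_def Wf_def rho_power3[OF eta] algebra_simps)
  have "(\<eta> \<bullet> (\<i> * \<alpha> \<eta>)) *\<^sub>R a = - \<i> * ((\<eta> \<bullet> (\<i> * \<alpha> \<eta>)) *\<^sub>R (\<i> * a))" by simp
  also have "\<dots> = - \<i> * ((\<alpha> \<eta> \<bullet> a) *\<^sub>R \<eta> - (\<eta> \<bullet> a) *\<^sub>R \<alpha> \<eta>)" unfolding rotation_identity ..
  finally have e: "(\<eta> \<bullet> (\<i> * \<alpha> \<eta>)) *\<^sub>R a = - \<i> * ((\<alpha> \<eta> \<bullet> a) *\<^sub>R \<eta> - (\<eta> \<bullet> a) *\<^sub>R \<alpha> \<eta>)" .
  have G': "Gam \<eta> a (Wf \<alpha> \<eta>) = \<i> * (?r *\<^sub>R (2 * (\<eta> \<bullet> a)) *\<^sub>R \<alpha> \<eta> - ?r *\<^sub>R (\<alpha> \<eta> \<bullet> a) *\<^sub>R \<eta>)"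
    unfolding G e by (simp add: complex_eq_iff algebra_simps)
  have D: "ddir (Wf \<alpha>) \<eta> a = \<i> * (?r *\<^sub>R (?q *\<^sub>R ddir \<alpha> \<eta> a - (3 * (\<eta> \<bullet> a)) *\<^sub>R \<alpha> \<eta>))"
    by (rule ddir_eqI[OF has_derivative_Wf[OF eta d[unfolded frechet_derivative_works]]])
  have "cov_deriv klein_metric (Wf \<alpha>) \<eta> a = \<i> * ((?r * ?q) *\<^sub>R ddir \<alpha> \<eta> a - (?r * (\<eta> \<bullet> a)) *\<^sub>R \<alpha> \<eta> - (?r * (\<alpha> \<eta> \<bullet> a)) *\<^sub>R \<eta>)"
    unfolding cov_deriv_def christoffel_klein[OF eta] D G' by (simp add: complex_eq_iff algebra_simps)
  also have "\<dots> = (?r * ?q) *\<^sub>R (\<i> * Hs \<alpha> \<eta> a)"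
    using p by (simp add: Hs_def algebra_simps)
  finally show ?thesis by (simp add: rho_power3[OF eta])
qed

subsection \<open>The operator norm of the antiholomorphic part\<close>

definition kdbar :: "(complex \<Rightarrow> complex) \<Rightarrow> complex \<Rightarrow> complex \<Rightarrow> complex" where
  "kdbar W \<eta> a = (1/2) *\<^sub>R (cov_deriv klein_metric W \<eta> a + klein_J \<eta> (cov_deriv klein_metric W \<eta> (klein_J \<eta> a)))"

lemma dbar_lift:
  assumes "\<eta> \<in> disk"
  shows "dbar V (klein_inv \<eta>) (klein_lift \<eta> a) = klein_lift \<eta> (kdbar (klein_push V) \<eta> a)"
proof -
  have l: "linear (klein_lift \<eta>)"
    using has_derivative_linear[OF has_derivative_klein_inv[OF assms]] .
  show ?thesis
    by (simp add: dbar_def hyp_nabla_def klein_inv_inverse(2)[OF assms] ddir_klein_inv[OF assms] hyp_J_lift[OF assms]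
        ddir_klein[OF assms] klein_drop_lift[OF assms] kdbar_def linear_add[OF l] linear_cmul[OF l])
qed

lemma dbar_norm_le_kdbar:
  "dbar_norm V \<le> ereal L \<longleftrightarrow> (\<forall>\<eta>\<in>disk. \<forall>a. klein_metric \<eta> a a \<le> 1 \<longrightarrow>
     sqrt (klein_metric \<eta> (kdbar (klein_push V) \<eta> a) (kdbar (klein_push V) \<eta> a)) \<le> L)"
proof -
  have "dbar_norm_at V (klein_inv \<eta>) \<le> ereal L \<longleftrightarrow> (\<forall>a. klein_metric \<eta> a a \<le> 1 \<longrightarrow>
     sqrt (klein_metric \<eta> (kdbar (klein_push V) \<eta> a) (kdbar (klein_push V) \<eta> a)) \<le> L)" if "\<eta> \<in> disk" for \<eta>
  proof -
    have *: "(\<forall>Y\<in>{Y \<in> range h. P Y}. Q Y) \<longleftrightarrow> (\<forall>a. P (h a) \<longrightarrow> Q (h a))" for h :: "complex \<Rightarrow> real^3" and P Q by auto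
    show ?thesis unfolding dbar_norm_at_def hyp_tangent_iff_lift[OF that] SUP_le_iff *
      by (simp add: klein_metric_mink[OF that] dbar_lift[OF that])
  qed
  then show ?thesis unfolding dbar_norm_def hyp_plane_eq SUP_le_iff by auto
qed

lemma klein_metric_cauchy_schwarz:
  assumes "\<eta> \<in> disk"
  shows "\<bar>klein_metric \<eta> a b\<bar> \<le> sqrt (klein_metric \<eta> a a) * sqrt (klein_metric \<eta> b b)"
proof -
  let ?g = "klein_metric \<eta>"
  have "(?g a b)\<^sup>2 \<le> ?g a a * ?g b b"
  proof (cases "b = 0")
    case True then show ?thesis using klein_metric_bilinear_simps(7)[OF assms, of _ 0] by simp
  next
    case False
    then have b: "?g b b > 0" using klein_metric_pos(2,3)[OF assms, of b] by fastforce
    have "0 \<le> ?g (?g b b *\<^sub>R a - ?g a b *\<^sub>R b) (?g b b *\<^sub>R a - ?g a b *\<^sub>R b)" by (rule klein_metric_pos(2)[OF assms])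
    also have "\<dots> = ?g b b * (?g a a * ?g b b - (?g a b)\<^sup>2)"
      by (simp add: klein_metric_bilinear_simps[OF assms] klein_metric_commute[of \<eta> b a] algebra_simps power2_eq_square)
    finally show ?thesis using b by (simp add: zero_le_mult_iff)
  qed
  then have "sqrt ((?g a b)\<^sup>2) \<le> sqrt (?g a a * ?g b b)" by (rule real_sqrt_le_mono)
  then show ?thesis by (simp add: real_sqrt_mult)
qed

text \<open>A symmetric form which is trace-free with respect to \<open>g\<close> satisfies \<open>B(Ja, c) = B(a, Jc)\<close>.\<close>

lemma trace_free_J:
  assumes eta: "\<eta> \<in> disk" and B: "linear B" and sym: "\<And>a b. B a \<bullet> b = B b \<bullet> a"
    and tr: "Mtr \<eta> (\<lambda>a b. B a \<bullet> b) = 0"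
  shows "B (klein_J \<eta> a) \<bullet> c = B a \<bullet> klein_J \<eta> c"
proof -
  note p = disk_pos[OF eta]
  define E where "E a c = B (klein_J \<eta> a) \<bullet> c - B a \<bullet> klein_J \<eta> c" for a c
  have lin: "linear (\<lambda>a. E a c)" "linear (E a)" for a c
    unfolding E_def
    by (rule linearI; simp add: linear_add[OF B] linear_cmul[OF B] linear_add[OF klein_J_linear[OF eta]]
        linear_cmul[OF klein_J_linear[OF eta]] inner_add_left inner_add_right algebra_simps)+
  have anti: "E c a = - E a c" for a c unfolding E_def using sym[of "klein_J \<eta> c" a] sym[of c] by simp
  have "E 1 1 = 0" "E \<i> \<i> = 0" using anti[of 1 1] anti[of \<i> \<i>] by simp_all
  moreover have "E 1 \<i> = 0"
  proof -
    have J: "klein_J \<eta> 1 = (1 / rho \<eta>) *\<^sub>R (\<i> - Im \<eta> *\<^sub>R \<eta>)" "klein_J \<eta> \<i> = (1 / rho \<eta>) *\<^sub>R (Re \<eta> *\<^sub>R \<eta> - 1)"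
      by (simp_all add: klein_J_eq[OF eta] inner_complex_def complex_eq_iff)
    have Be: "B \<eta> = Re \<eta> *\<^sub>R B 1 + Im \<eta> *\<^sub>R B \<i>" by (rule linear_basis[OF B])
    have e: "v \<bullet> \<eta> = Re \<eta> * (v \<bullet> 1) + Im \<eta> * (v \<bullet> \<i>)" for v by (simp add: inner_complex_def)
    have s: "Re (B \<i>) = Im (B 1)" using sym[of \<i> 1] by (simp add: inner_complex_def)
    have "E 1 \<i> = (1 / rho \<eta>) * Mtr \<eta> (\<lambda>a b. B a \<bullet> b)"
      unfolding E_def J by (simp add: linear_diff[OF B] linear_cmul[OF B] Be e Mtr_def inner_diff_left inner_diff_right
          inner_add_left s power2_eq_square algebra_simps)
    then show ?thesis using tr by simp
  qed
  moreover have "E \<i> 1 = 0" using anti[of \<i> 1] calculation by simp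
  ultimately have "E a c = 0"
    by (subst linear_basis[OF lin(1)], subst (1 2) linear_basis[OF lin(2)]) simp
  then show ?thesis by (simp add: E_def)
qed

text \<open>With \<open>\<Delta>u = 2u\<close> the tensor \<open>B = \<nabla>du - u g\<close> is the trace-free part of \<open>\<nabla>du\<close>. In \<open>\<nabla>W = J\<nabla>du\<close> the part \<open>u J\<close> commutes
  with \<open>J\<close> and cancels, while \<open>JB\<close> anticommutes with \<open>J\<close> and survives.\<close>

lemma kdbar_J_grad:
  assumes u: "smooth_on disk u" and eta: "\<eta> \<in> disk" and lap: "laplacian klein_metric u \<eta> = 2 * u \<eta>"
  defines "f \<equiv> (\<lambda>y. rho y * u y)"
  shows "klein_metric \<eta> (kdbar (Wf (nab u)) \<eta> a) (klein_J \<eta> c) = (ddir (nab f) \<eta> a \<bullet> c) / rho \<eta>"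
proof -
  note p = disk_pos[OF eta]
  define gm where "gm a = (1 / defect \<eta>) *\<^sub>R a + ((\<eta> \<bullet> a) / (defect \<eta>)\<^sup>2) *\<^sub>R \<eta>" for a
  have gm: "gm a \<bullet> b = klein_metric \<eta> a b" for a b
    by (simp add: gm_def klein_metric_eq[OF eta] inner_add_left)
  have dn: "nab u differentiable (at \<eta>)" by (rule smooth_on_differentiable[OF smooth_on_nab[OF u] eta])
  define B where "B a = Hs (nab u) \<eta> a - u \<eta> *\<^sub>R gm a" for a
  have Bi: "B a \<bullet> c = (ddir (nab f) \<eta> a \<bullet> c) / rho \<eta>" for a c
    using p by (simp add: f_def ddir_nab_rescale[OF u eta] B_def inner_diff_left gm)
  have lB: "linear B"
    by (rule linearI) (simp_all add: B_def gm_def linear_add[OF linear_Hs[OF dn]] linear_cmul[OF linear_Hs[OF dn]]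
        inner_add_right algebra_simps add_divide_distrib)
  have sB: "B a \<bullet> b = B b \<bullet> a" for a b
    unfolding Bi f_def using nab_symmetric[OF smooth_on_rescale[OF u] eta] by simp
  have tB: "Mtr \<eta> (\<lambda>a b. B a \<bullet> b) = 0"
  proof -
    have "rho \<eta> * Mtr \<eta> (\<lambda>a b. ddir (nab f) \<eta> a \<bullet> b) = 0"
      using laplacian_rescale[OF u eta] lap by (simp add: f_def)
    then have "Mtr \<eta> (\<lambda>a b. ddir (nab f) \<eta> a \<bullet> b) = 0" using p by simp
    then have "Mtr \<eta> (\<lambda>a b. (1 / rho \<eta>) *\<^sub>R (ddir (nab f) \<eta> a \<bullet> b)) = 0" unfolding Mtr_scaleR by simp
    then show ?thesis by (simp add: Bi)
  qed
  have cov: "cov_deriv klein_metric (Wf (nab u)) \<eta> a = rho \<eta> ^ 3 *\<^sub>R (\<i> * B a) + u \<eta> *\<^sub>R klein_J \<eta> a" for a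
  proof -
    have "defect \<eta> *\<^sub>R (gm a - (\<eta> \<bullet> gm a) *\<^sub>R \<eta>) = a"
      using klein_sharp_eq[OF eta, of a "\<lambda>c. gm a \<bullet> c"] klein_sharp_inner[OF eta, of "gm a"] by (simp add: gm)
    then have "klein_J \<eta> a = rho \<eta> ^ 3 *\<^sub>R (\<i> * gm a)" using klein_J_sharp[OF eta, of "gm a"] by simp
    then show ?thesis
      unfolding cov_deriv_Wf[OF eta dn] by (simp add: B_def algebra_simps)
  qed
  have JP: "klein_metric \<eta> (rho \<eta> ^ 3 *\<^sub>R (\<i> * B a)) (klein_J \<eta> c) = B a \<bullet> c" for a c
    using p klein_metric_J[OF eta, of c "rho \<eta> ^ 3 *\<^sub>R (\<i> * B a)"] inner_commute[of c "B a"]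
    by (simp add: klein_metric_commute[of \<eta> _ "klein_J \<eta> c"] i_inner_simps(1))
  have "klein_metric \<eta> (klein_J \<eta> (rho \<eta> ^ 3 *\<^sub>R (\<i> * B (klein_J \<eta> a)))) (klein_J \<eta> c) = B a \<bullet> c"
  proof -
    have "klein_metric \<eta> (rho \<eta> ^ 3 *\<^sub>R (\<i> * B (klein_J \<eta> a))) c = - klein_metric \<eta> (rho \<eta> ^ 3 *\<^sub>R (\<i> * B (klein_J \<eta> a))) (klein_J \<eta> (klein_J \<eta> c))"
      unfolding klein_J_square[OF eta] klein_metric_bilinear_simps(8)[OF eta] by simp
    also have "\<dots> = - (B a \<bullet> klein_J \<eta> (klein_J \<eta> c))" unfolding JP trace_free_J[OF eta lB sB tB] ..
    also have "\<dots> = B a \<bullet> c" unfolding klein_J_square[OF eta] by simp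
    finally show ?thesis unfolding klein_metric_J_J[OF eta] .
  qed
  then show ?thesis
    unfolding kdbar_def cov Bi[symmetric]
    using JP
    by (simp add: klein_metric_bilinear_simps[OF eta] linear_add[OF klein_J_linear[OF eta]]
        linear_cmul[OF klein_J_linear[OF eta]] linear_diff[OF klein_J_linear[OF eta]] klein_J_square[OF eta])
qed

lemma kdbar_cong:
  assumes "\<eta> \<in> disk" "\<And>y. y \<in> disk \<Longrightarrow> V y = W y"
  shows "kdbar V \<eta> a = kdbar W \<eta> a"
  using assms(2)[OF assms(1)] ddir_cong_open[OF open_ball assms(1), of V W] assms(2)
  by (simp add: kdbar_def cov_deriv_def)

text \<open>The antiholomorphic part is \<open>J\<close> times the symmetric endomorphism of \<open>D\<^sup>2f / \<rho>\<close>. Its norm bounds the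
  quadratic form by the Cauchy-Schwarz inequality, and conversely by polarization.\<close>

lemma dbar_norm_le_iff:
  assumes u: "smooth_on disk u" and lap: "\<And>\<eta>. \<eta> \<in> disk \<Longrightarrow> laplacian klein_metric u \<eta> = 2 * u \<eta>"
    and V: "\<And>\<eta>. \<eta> \<in> disk \<Longrightarrow> klein_push V \<eta> = Wf (nab u) \<eta>"
  shows "dbar_norm V \<le> ereal L \<longleftrightarrow>
    (\<forall>\<eta>\<in>disk. \<forall>a. \<bar>ddir (nab (\<lambda>y. rho y * u y)) \<eta> a \<bullet> a\<bar> \<le> L * rho \<eta> * klein_metric \<eta> a a)"
proof -
  define f where "f = (\<lambda>y. rho y * u y)"
  define P where "P \<eta> a = kdbar (klein_push V) \<eta> a" for \<eta> a
  let ?H = "\<lambda>\<eta> a. ddir (nab f) \<eta> a"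
  have sf: "smooth_on disk f" unfolding f_def by (rule smooth_on_rescale[OF u])
  have key: "klein_metric \<eta> (P \<eta> a) (klein_J \<eta> c) = (?H \<eta> a \<bullet> c) / rho \<eta>" if "\<eta> \<in> disk" for \<eta> a c
    using kdbar_J_grad[OF u that lap[OF that]] kdbar_cong[OF that V] by (simp add: P_def f_def)
  have lH: "linear (?H \<eta>)" if "\<eta> \<in> disk" for \<eta>
    by (rule linear_frechet_derivative[OF smooth_on_differentiable[OF smooth_on_nab[OF sf] that]])
  have "(\<forall>\<eta>\<in>disk. \<forall>a. klein_metric \<eta> a a \<le> 1 \<longrightarrow> sqrt (klein_metric \<eta> (P \<eta> a) (P \<eta> a)) \<le> L) \<longleftrightarrow>
    (\<forall>\<eta>\<in>disk. \<forall>a. \<bar>?H \<eta> a \<bullet> a\<bar> \<le> L * rho \<eta> * klein_metric \<eta> a a)" (is "?A \<longleftrightarrow> ?B")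
  proof
    assume A: ?A
    show ?B
    proof (intro ballI allI)
      fix \<eta> a assume eta: "\<eta> \<in> disk"
      note p = disk_pos[OF eta] and bil = klein_metric_bilinear_simps[OF eta]
      show "\<bar>?H \<eta> a \<bullet> a\<bar> \<le> L * rho \<eta> * klein_metric \<eta> a a"
      proof (cases "a = 0")
        case True then show ?thesis by (simp add: linear_0[OF lH[OF eta]] klein_metric_eq[OF eta])
      next
        case False
        then have g: "klein_metric \<eta> a a > 0" using klein_metric_pos(2,3)[OF eta, of a] by fastforce
        define t where "t = sqrt (klein_metric \<eta> a a)"
        have t: "t > 0" "t * t = klein_metric \<eta> a a" using g by (simp_all add: t_def)
        define b where "b = (1/t) *\<^sub>R a"
        have gb: "klein_metric \<eta> b b = 1" using t g by (simp add: b_def bil divide_simps)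
        have "\<bar>?H \<eta> b \<bullet> b\<bar> / rho \<eta> = \<bar>klein_metric \<eta> (P \<eta> b) (klein_J \<eta> b)\<bar>" using p by (simp add: key[OF eta])
        also have "\<dots> \<le> sqrt (klein_metric \<eta> (P \<eta> b) (P \<eta> b)) * sqrt (klein_metric \<eta> b b)"
          using klein_metric_cauchy_schwarz[OF eta, of "P \<eta> b" "klein_J \<eta> b"] by (simp add: klein_metric_J_J[OF eta])
        also have "\<dots> \<le> L" using A eta gb by simp
        finally have "\<bar>?H \<eta> b \<bullet> b\<bar> \<le> L * rho \<eta>" using p by (simp add: divide_simps)
        moreover have "?H \<eta> b \<bullet> b = (?H \<eta> a \<bullet> a) / (t * t)" by (simp add: b_def linear_cmul[OF lH[OF eta]])
        ultimately show ?thesis using t g by (simp add: divide_simps abs_mult)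
      qed
    qed
  next
    assume B: ?B
    have L: "0 \<le> L"
    proof -
      have "\<bar>?H 0 1 \<bullet> 1\<bar> \<le> L * rho 0 * klein_metric 0 1 1" using B[rule_format, of 0 1] by simp
      then show ?thesis by (simp add: klein_metric_eq rho_def defect_def)
    qed
    show ?A
    proof (intro ballI allI impI)
      fix \<eta> a assume eta: "\<eta> \<in> disk" and a: "klein_metric \<eta> a a \<le> 1"
      note p = disk_pos[OF eta] and bil = klein_metric_bilinear_simps[OF eta]
      define n where "n = sqrt (klein_metric \<eta> (P \<eta> a) (P \<eta> a))"
      show "sqrt (klein_metric \<eta> (P \<eta> a) (P \<eta> a)) \<le> L"
      proof (cases "n = 0")
        case True then show ?thesis using L by (simp add: n_def)
      next
        case False
        then have n: "n > 0" "n * n = klein_metric \<eta> (P \<eta> a) (P \<eta> a)" "klein_metric \<eta> (P \<eta> a) (P \<eta> a) \<noteq> 0"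
          using klein_metric_pos(2)[OF eta, of "P \<eta> a"] by (auto simp: n_def)
        (* the unit vector for which g(P a, J c) is the norm of P a *)
        define c where "c = (1/n) *\<^sub>R (- klein_J \<eta> (P \<eta> a))"
        have Jc: "klein_J \<eta> c = (1/n) *\<^sub>R P \<eta> a"
          by (simp add: c_def linear_cmul[OF klein_J_linear[OF eta]] linear_neg[OF klein_J_linear[OF eta]] klein_J_square[OF eta])
        have gc: "klein_metric \<eta> c c = 1"
          using n klein_metric_J_J[OF eta, of c c] by (simp add: Jc bil divide_simps)
        have "n = klein_metric \<eta> (P \<eta> a) (klein_J \<eta> c)" using n by (simp add: Jc bil divide_simps)
        then have e: "?H \<eta> a \<bullet> c = n * rho \<eta>" using p by (simp add: key[OF eta] divide_simps)
        have "4 * (?H \<eta> a \<bullet> c) = ?H \<eta> (a + c) \<bullet> (a + c) - ?H \<eta> (a - c) \<bullet> (a - c)"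
          using nab_symmetric[OF sf eta, of a c]
          by (simp add: linear_add[OF lH[OF eta]] linear_diff[OF lH[OF eta]] inner_add_left inner_add_right inner_diff_left inner_diff_right)
        also have "\<dots> \<le> L * rho \<eta> * klein_metric \<eta> (a + c) (a + c) + L * rho \<eta> * klein_metric \<eta> (a - c) (a - c)"
          using B[rule_format, OF eta, of "a + c"] B[rule_format, OF eta, of "a - c"] by linarith
        also have "\<dots> = L * rho \<eta> * (2 * klein_metric \<eta> a a + 2 * klein_metric \<eta> c c)"
          by (simp add: bil klein_metric_commute[of \<eta> c a] algebra_simps)
        also have "\<dots> \<le> L * rho \<eta> * 4" using a gc L p by (intro mult_left_mono) auto
        finally have "n * rho \<eta> \<le> L * rho \<eta>" unfolding e by simp
        then show ?thesis using p by (simp add: n_def)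
      qed
    qed
  qed
  then show ?thesis unfolding dbar_norm_le_kdbar P_def f_def .
qed

section \<open>The tangent bundle\<close>

lemma dmetric_swap: "dmetric x v a b = dmetric x v b a"
  by (simp add: dmetric_def inner_commute[of b a] algebra_simps)

lemma Gam_swap: "Gam x a b = Gam x b a"
  by (simp add: Gam_def algebra_simps)

lemma metric_compatible:
  assumes "x \<in> disk"
  shows "klein_metric x a (Gam x b v) + klein_metric x (Gam x a v) b = dmetric x v a b"
proof -
  have "klein_metric x a (Gam x b v) = klein_metric x (Gam x v b) a"
    by (simp add: klein_metric_commute[of x a] Gam_swap)
  moreover have "klein_metric x (Gam x a v) b = klein_metric x (Gam x v a) b" by (simp add: Gam_swap)
  ultimately show ?thesis
    using koszul_klein[OF assms, of v b a] koszul_klein[OF assms, of v a b] dmetric_swap[of x v b a]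
    by (simp add: field_simps)
qed

text \<open>The metric \<open>\<G>\<close> is the complete lift of \<open>g\<close>, its derivative along the fibre coordinate.\<close>

lemma bundle_metric_eq:
  assumes "fst z \<in> disk"
  shows "bundle_metric klein_metric z X Y =
    klein_metric (fst z) (fst X) (snd Y) + klein_metric (fst z) (snd X) (fst Y) + dmetric (fst z) (snd z) (fst X) (fst Y)"
  using metric_compatible[OF assms, of "fst X" "fst Y" "snd z"]
  by (simp add: bundle_metric_def hv_split_def christoffel_klein[OF assms] klein_metric_bilinear_simps[OF assms] Let_def)

text \<open>The derivative of \<open>dmetric x v b c\<close> with respect to \<open>x\<close> in the direction \<open>a\<close>.\<close>

definition ddmetric :: "complex \<Rightarrow> complex \<Rightarrow> complex \<Rightarrow> complex \<Rightarrow> complex \<Rightarrow> real" where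
  "ddmetric x a v b c = (2 * (a \<bullet> v) * (b \<bullet> c) + (v \<bullet> b) * (a \<bullet> c) + (a \<bullet> b) * (v \<bullet> c)) / (defect x)\<^sup>2
     + 4 * (2 * (x \<bullet> v) * (b \<bullet> c) * (x \<bullet> a) + ((v \<bullet> b) * (x \<bullet> c) + (x \<bullet> b) * (v \<bullet> c)) * (x \<bullet> a)
       + (a \<bullet> v) * (x \<bullet> b) * (x \<bullet> c) + (x \<bullet> v) * (a \<bullet> b) * (x \<bullet> c) + (x \<bullet> v) * (x \<bullet> b) * (a \<bullet> c)) / (defect x)^3
     + 24 * (x \<bullet> v) * (x \<bullet> b) * (x \<bullet> c) * (x \<bullet> a) / (defect x)^4"

lemma has_derivative_dmetric:
  assumes "fst z \<in> disk"
  shows "((\<lambda>z. dmetric (fst z) (snd z) b c) has_derivative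
    (\<lambda>A. ddmetric (fst z) (fst A) (snd z) b c + dmetric (fst z) (snd A) b c)) (at z)"
proof -
  note p = disk_pos[OF assms]
  have I: "((\<lambda>z. inverse (defect (fst z))) has_derivative (\<lambda>A. 2 * (fst z \<bullet> fst A) * (inverse (defect (fst z)))\<^sup>2)) (at z)"
    using has_derivative_compose[OF has_derivative_fst[OF has_derivative_ident] has_derivative_inverse_defect[OF assms]] .
  have f: "((\<lambda>z. fst z) has_derivative fst) (at z)" "((\<lambda>z. snd z) has_derivative snd) (at z)"
    by (auto intro!: has_derivative_fst has_derivative_snd simp: has_derivative_ident)
  have "((\<lambda>z. 2 * (fst z \<bullet> snd z) * (b \<bullet> c) * (inverse (defect (fst z)))\<^sup>2
     + ((snd z \<bullet> b) * (fst z \<bullet> c) + (fst z \<bullet> b) * (snd z \<bullet> c)) * (inverse (defect (fst z)))\<^sup>2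
     + 4 * (fst z \<bullet> snd z) * (fst z \<bullet> b) * (fst z \<bullet> c) * (inverse (defect (fst z)))^3) has_derivative
    (\<lambda>A. ddmetric (fst z) (fst A) (snd z) b c + dmetric (fst z) (snd A) b c)) (at z)"
    by (rule has_derivative_eq_rhs,
        (rule has_derivative_add has_derivative_mult has_derivative_const has_derivative_power
          has_derivative_inner_left has_derivative_inner f I)+)
      (simp add: fun_eq_iff ddmetric_def dmetric_def divide_inverse power_inverse[symmetric] power2_eq_square power3_eq_cube
        power4_eq_xxxx inner_commute algebra_simps)
  then show ?thesis by (simp add: dmetric_def divide_inverse power_inverse)
qed

lemma has_derivative_bundle_metric:
  assumes "fst z \<in> disk"
  shows "((\<lambda>z. bundle_metric klein_metric z B C) has_derivative
    (\<lambda>A. dmetric (fst z) (fst A) (fst B) (snd C) + dmetric (fst z) (fst A) (snd B) (fst C)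
       + (ddmetric (fst z) (fst A) (snd z) (fst B) (fst C) + dmetric (fst z) (snd A) (fst B) (fst C)))) (at z)"
proof -
  have o: "open (disk \<times> (UNIV :: complex set))" by (intro open_Times) auto
  have z: "z \<in> disk \<times> UNIV" using assms by (cases z) auto
  have g: "((\<lambda>z. klein_metric (fst z) b c) has_derivative (\<lambda>A. dmetric (fst z) (fst A) b c)) (at z)" for b c
    using has_derivative_compose[OF has_derivative_fst[OF has_derivative_ident] has_derivative_klein_metric[OF assms]] .
  show ?thesis
    by (rule has_derivative_transform_within_open[OF has_derivative_add[OF has_derivative_add[OF g g] has_derivative_dmetric[OF assms]] o z])
      (auto simp: bundle_metric_eq)
qed

text \<open>The derivative of \<open>Gam x a b\<close> with respect to \<open>x\<close> in the direction \<open>v\<close>.\<close>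

definition dGam :: "complex \<Rightarrow> complex \<Rightarrow> complex \<Rightarrow> complex \<Rightarrow> complex" where
  "dGam x v a b = (2 * (x \<bullet> v) / (defect x)\<^sup>2) *\<^sub>R ((x \<bullet> a) *\<^sub>R b + (x \<bullet> b) *\<^sub>R a)
     + (1 / defect x) *\<^sub>R ((v \<bullet> a) *\<^sub>R b + (v \<bullet> b) *\<^sub>R a)"

text \<open>The derivative of the Koszul formula along \<open>v\<close>.\<close>

lemma koszul_derivative:
  assumes "x \<in> disk"
  shows "klein_metric x (dGam x v a b) c + dmetric x v (Gam x a b) c
    = (ddmetric x a v b c + ddmetric x b v a c - ddmetric x c v a b) / 2"
  using disk_pos(3)[OF assms]
  by (simp add: klein_metric_eq[OF assms] dGam_def Gam_def dmetric_def ddmetric_def inner_add_right inner_add_left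
      inner_commute[of c a] inner_commute[of c b] inner_commute[of b a] inner_commute[of c v] inner_commute[of b v] inner_commute[of a v]
      field_simps power2_eq_square power3_eq_cube power4_eq_xxxx)

text \<open>As the metric is a complete lift, its Christoffel map is the fibre derivative of that of \<open>g\<close>; the Koszul
  formula is linear in the metric and its derivative is the preceding identity.\<close>

lemma christoffel_bundle:
  assumes "fst z \<in> disk"
  shows "christoffel (bundle_metric klein_metric) z A B =
    (Gam (fst z) (fst A) (fst B), Gam (fst z) (fst A) (snd B) + Gam (fst z) (snd A) (fst B) + dGam (fst z) (snd z) (fst A) (fst B))"
proof -
  note bil = klein_metric_bilinear_simps[OF assms]
  define w where "w = (Gam (fst z) (fst A) (fst B), Gam (fst z) (fst A) (snd B) + Gam (fst z) (snd A) (fst B) + dGam (fst z) (snd z) (fst A) (fst B))"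
  have K: "bundle_metric klein_metric z w C = (ddir (\<lambda>y. bundle_metric klein_metric y B C) z A
    + ddir (\<lambda>y. bundle_metric klein_metric y A C) z B - ddir (\<lambda>y. bundle_metric klein_metric y A B) z C) / 2" for C
  proof -
    note D = ddir_eqI[OF has_derivative_bundle_metric[OF assms]]
    show ?thesis
      using koszul_derivative[OF assms, of "snd z" "fst A" "fst B" "fst C"]
      by (simp add: bundle_metric_eq[OF assms] D w_def bil koszul_klein[OF assms] dmetric_swap add_divide_distrib diff_divide_distrib)
  qed
  have "sharp (bundle_metric klein_metric) z (\<lambda>C. (ddir (\<lambda>y. bundle_metric klein_metric y B C) z A
    + ddir (\<lambda>y. bundle_metric klein_metric y A C) z B - ddir (\<lambda>y. bundle_metric klein_metric y A B) z C) / 2) = w"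
    unfolding sharp_def
  proof (rule the_equality)
    fix w' assume "\<forall>C. bundle_metric klein_metric z w' C = (ddir (\<lambda>y. bundle_metric klein_metric y B C) z A
    + ddir (\<lambda>y. bundle_metric klein_metric y A C) z B - ddir (\<lambda>y. bundle_metric klein_metric y A B) z C) / 2"
    then have e: "bundle_metric klein_metric z w' C = bundle_metric klein_metric z w C" for C unfolding K by blast
    have "klein_metric (fst z) (fst w' - fst w) c = 0" for c
      using e[of "(0, c)"] by (simp add: bundle_metric_eq[OF assms] bil dmetric_def linear_0[OF klein_metric_linear(1)[OF assms]])
    then have 1: "fst w' = fst w" using klein_metric_pos(3)[OF assms] by fastforce
    have "klein_metric (fst z) (snd w' - snd w) c = 0" for c
      using e[of "(c, 0)"] 1 by (simp add: bundle_metric_eq[OF assms] bil)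
    then have "snd w' = snd w" using klein_metric_pos(3)[OF assms] by fastforce
    with 1 show "w' = w" by (rule prod_eqI)
  qed (use K in blast)
  then show ?thesis by (simp add: christoffel_def w_def)
qed

text \<open>By \<open>g(Ja, \<rho>\<^sup>3 i v) = a\<cdot>v\<close> the pulled back form is the exterior derivative of \<open>\<alpha>\<close>, up to sign.\<close>

lemma bundle_form_Wf:
  assumes eta: "\<eta> \<in> disk" and d: "\<alpha> differentiable (at \<eta>)" and V: "\<And>y. y \<in> disk \<Longrightarrow> klein_push V y = Wf \<alpha> y"
  shows "bundle_form klein_metric klein_J (klein_section V \<eta>) (ddir (klein_section V) \<eta> a) (ddir (klein_section V) \<eta> b)
    = ddir \<alpha> \<eta> b \<bullet> a - ddir \<alpha> \<eta> a \<bullet> b"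
proof -
  note p = disk_pos[OF eta]
  have W: "(klein_push V has_derivative ddir (klein_push V) \<eta>) (at \<eta>)"
  proof -
    have "Wf \<alpha> differentiable (at \<eta>)"
      using has_derivative_Wf[OF eta d[unfolded frechet_derivative_works]] by (rule differentiableI)
    then have "klein_push V differentiable (at \<eta>)"
      using differentiable_cong_open[OF open_ball eta, of "klein_push V" "Wf \<alpha>"] V by blast
    then show ?thesis by (simp add: frechet_derivative_works)
  qed
  have F: "ddir (klein_section V) \<eta> a = (a, ddir (klein_push V) \<eta> a)" for a
    unfolding klein_section_def[abs_def]
    by (rule ddir_eqI) (intro has_derivative_Pair has_derivative_ident W)
  have c: "ddir (klein_push V) \<eta> a + christoffel klein_metric \<eta> a (klein_push V \<eta>) = rho \<eta> ^ 3 *\<^sub>R (\<i> * Hs \<alpha> \<eta> a)" for a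
  proof -
    have "ddir (klein_push V) \<eta> a = ddir (Wf \<alpha>) \<eta> a" by (rule ddir_cong_open[OF open_ball eta V])
    then show ?thesis by (simp add: cov_deriv_Wf[OF eta d, symmetric] cov_deriv_def V[OF eta])
  qed
  have g: "klein_metric \<eta> (klein_J \<eta> a) (rho \<eta> ^ 3 *\<^sub>R (\<i> * v)) = a \<bullet> v" for a v
    using p by (simp add: klein_metric_J[OF eta] i_inner_simps(1))
  show ?thesis
    unfolding F bundle_form_def hv_split_def klein_section_def
    by (simp add: c g klein_metric_commute[of \<eta> "_ *\<^sub>R _"] inner_commute[of _ "Hs _ _ _"] Hs_inner Gam_swap[of \<eta> a b])
qed

text \<open>Symmetry of the Hessian at all points, and of second derivatives of the gradient.\<close>

lemma third_derivative_symmetric: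
  assumes u: "smooth_on disk u" and eta: "\<eta> \<in> disk"
  shows "ddir (\<lambda>y. ddir (nab u) y a) \<eta> c \<bullet> b = ddir (\<lambda>y. ddir (nab u) y b) \<eta> a \<bullet> c"
proof -
  note sn = smooth_on_nab[OF u]
  have in1: "ddir (\<lambda>y. ddir (nab u) y p) \<eta> r \<bullet> s = ddir (\<lambda>y. ddir (nab u) y p \<bullet> s) \<eta> r" for p r s
    by (rule ddir_eqI[symmetric]) (intro has_derivative_inner_left smooth_on_has_derivative[of disk] smooth_on_ddir sn eta)
  have in2: "ddir (nab u) y p \<bullet> s = ddir (\<lambda>y. nab u y \<bullet> s) y p" if "y \<in> disk" for y p s
    by (rule ddir_eqI[symmetric]) (intro has_derivative_inner_left smooth_on_has_derivative[of disk] sn that)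
  have sw: "ddir (\<lambda>y. ddir (nab u) y p) \<eta> r \<bullet> s = ddir (\<lambda>y. ddir (nab u) y s) \<eta> r \<bullet> p" for p r s
    unfolding in1 by (rule ddir_cong_open[OF open_ball eta]) (rule nab_symmetric[OF u])
  have sw2: "ddir (\<lambda>y. ddir (nab u) y p) \<eta> r \<bullet> s = ddir (\<lambda>y. ddir (nab u) y r) \<eta> p \<bullet> s" for p r s
  proof -
    have "ddir (\<lambda>y. ddir (nab u) y p) \<eta> r \<bullet> s = ddir (\<lambda>y. ddir (\<lambda>y. nab u y \<bullet> s) y p) \<eta> r" for p r
      unfolding in1 by (rule ddir_cong_open[OF open_ball eta]) (rule in2)
    moreover have "ddir (\<lambda>y. ddir (\<lambda>y. nab u y \<bullet> s) y p) \<eta> r = ddir (\<lambda>y. ddir (\<lambda>y. nab u y \<bullet> s) y r) \<eta> p"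
      by (rule ddir_symmetric[OF open_ball eta]) (intro smooth_on_inner sn smooth_on_const open_ball)
    ultimately show ?thesis by simp
  qed
  show ?thesis using sw2[of a c b] sw[of c a b] by simp
qed

text \<open>The differential of \<open>\<Delta>u - 2u\<close>, to be compared with the tension field.\<close>

lemma has_derivative_laplacian:
  assumes u: "smooth_on disk u" and eta: "\<eta> \<in> disk"
  defines "\<alpha> \<equiv> nab u"
  shows "((\<lambda>y. laplacian klein_metric u y - 2 * u y) has_derivative (\<lambda>c. (
     defect \<eta> *\<^sub>R Mtr \<eta> (\<lambda>a b. ddir (\<lambda>y. ddir \<alpha> y b) \<eta> a) - (2 * Mtr \<eta> (\<lambda>a b. ddir \<alpha> \<eta> a \<bullet> b)) *\<^sub>R \<eta>
     - (4 * defect \<eta>) *\<^sub>R ddir \<alpha> \<eta> \<eta> + (4 * (\<eta> \<bullet> \<alpha> \<eta>)) *\<^sub>R \<eta> - (2 * defect \<eta>) *\<^sub>R \<alpha> \<eta> - 2 *\<^sub>R \<alpha> \<eta>) \<bullet> c)) (at \<eta>)"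
proof -
  note sn = smooth_on_nab[OF u, folded \<alpha>_def]
  let ?A = "\<lambda>a b y. ddir \<alpha> y a \<bullet> b"
  have dA: "((\<lambda>y. ?A a b y) has_derivative (\<lambda>c. ddir (\<lambda>y. ddir \<alpha> y a) \<eta> c \<bullet> b)) (at \<eta>)" for a b
    by (intro has_derivative_inner_left smooth_on_has_derivative[of disk] smooth_on_ddir sn eta)
  have lin: "linear (ddir \<alpha> \<eta>)" by (rule linear_frechet_derivative[OF smooth_on_differentiable[OF sn eta]])
  have sym: "ddir \<alpha> \<eta> a \<bullet> b = ddir \<alpha> \<eta> b \<bullet> a" for a b unfolding \<alpha>_def by (rule nab_symmetric[OF u eta])
  have re: "((\<lambda>y. Re y) has_derivative Re) (at \<eta>)" "((\<lambda>y. Im y) has_derivative Im) (at \<eta>)"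
    by (auto intro!: bounded_linear_imp_has_derivative bounded_linear_Re bounded_linear_Im)
  have "((\<lambda>y. Mtr y (\<lambda>a b. ?A a b y)) has_derivative
     (\<lambda>c. Mtr \<eta> (\<lambda>a b. ddir (\<lambda>y. ddir \<alpha> y a) \<eta> c \<bullet> b)
       - 2 * (Re \<eta> * Re c * ?A 1 1 \<eta> + (Re c * Im \<eta> + Re \<eta> * Im c) * ?A 1 \<i> \<eta> + Im \<eta> * Im c * ?A \<i> \<i> \<eta>))) (at \<eta>)"
    unfolding Mtr_def real_scaleR_def
    by (rule has_derivative_eq_rhs,
        (rule has_derivative_add has_derivative_diff has_derivative_mult has_derivative_const has_derivative_power re dA)+)
      (simp only: fun_eq_iff sym[of \<i> 1], simp add: algebra_simps)
  moreover have "Re \<eta> * Re c * ?A 1 1 \<eta> + (Re c * Im \<eta> + Re \<eta> * Im c) * ?A 1 \<i> \<eta> + Im \<eta> * Im c * ?A \<i> \<i> \<eta> = ddir \<alpha> \<eta> \<eta> \<bullet> c" for c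
  proof -
    have "ddir \<alpha> \<eta> \<eta> \<bullet> c = (Re \<eta> *\<^sub>R ddir \<alpha> \<eta> 1 + Im \<eta> *\<^sub>R ddir \<alpha> \<eta> \<i>) \<bullet> (Re c *\<^sub>R 1 + Im c *\<^sub>R \<i>)"
      using linear_basis[OF lin, of \<eta>] by (simp add: inner_complex_def)
    also have "\<dots> = Re \<eta> * Re c * ?A 1 1 \<eta> + (Re c * Im \<eta> + Re \<eta> * Im c) * ?A 1 \<i> \<eta> + Im \<eta> * Im c * ?A \<i> \<i> \<eta>"
      unfolding inner_add_left inner_add_right inner_scaleR_left inner_scaleR_right sym[of \<i> 1] by (simp add: algebra_simps)
    finally show ?thesis by simp
  qed
  moreover have "Mtr \<eta> (\<lambda>a b. ddir (\<lambda>y. ddir \<alpha> y a) \<eta> c \<bullet> b) = Mtr \<eta> (\<lambda>a b. ddir (\<lambda>y. ddir \<alpha> y b) \<eta> a) \<bullet> c" for c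
  proof -
    have "(\<lambda>a b. ddir (\<lambda>y. ddir \<alpha> y a) \<eta> c \<bullet> b) = (\<lambda>a b. ddir (\<lambda>y. ddir \<alpha> y b) \<eta> a \<bullet> c)"
      unfolding \<alpha>_def by (intro ext third_derivative_symmetric[OF u eta])
    then show ?thesis
      by (simp only: Mtr_linear[OF bounded_linear.linear[OF bounded_linear_inner_left]])
  qed
  ultimately have T: "((\<lambda>y. Mtr y (\<lambda>a b. ?A a b y)) has_derivative
     (\<lambda>c. Mtr \<eta> (\<lambda>a b. ddir (\<lambda>y. ddir \<alpha> y b) \<eta> a) \<bullet> c - 2 * (ddir \<alpha> \<eta> \<eta> \<bullet> c))) (at \<eta>)" by (simp only:)
  have E: "((\<lambda>y. y \<bullet> \<alpha> y) has_derivative (\<lambda>c. \<eta> \<bullet> ddir \<alpha> \<eta> c + c \<bullet> \<alpha> \<eta>)) (at \<eta>)"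
    by (intro has_derivative_inner has_derivative_ident smooth_on_has_derivative[of disk] sn eta)
  have se: "\<eta> \<bullet> ddir \<alpha> \<eta> c = ddir \<alpha> \<eta> \<eta> \<bullet> c" for c
    using sym[of c \<eta>] by (simp add: inner_commute)
  have "((\<lambda>y. defect y * Mtr y (\<lambda>a b. ?A a b y) - 2 * defect y * (y \<bullet> \<alpha> y) - 2 * u y) has_derivative (\<lambda>c. (
     defect \<eta> *\<^sub>R Mtr \<eta> (\<lambda>a b. ddir (\<lambda>y. ddir \<alpha> y b) \<eta> a) - (2 * Mtr \<eta> (\<lambda>a b. ddir \<alpha> \<eta> a \<bullet> b)) *\<^sub>R \<eta>
     - (4 * defect \<eta>) *\<^sub>R ddir \<alpha> \<eta> \<eta> + (4 * (\<eta> \<bullet> \<alpha> \<eta>)) *\<^sub>R \<eta> - (2 * defect \<eta>) *\<^sub>R \<alpha> \<eta> - 2 *\<^sub>R \<alpha> \<eta>) \<bullet> c)) (at \<eta>)"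
    by (rule has_derivative_eq_rhs,
        (rule has_derivative_diff has_derivative_mult has_derivative_const T E has_derivative_defect
           has_derivative_nab[OF u eta, folded \<alpha>_def])+)
      (simp add: fun_eq_iff inner_diff_left inner_add_left se inner_commute[of _ "\<alpha> \<eta>"] algebra_simps)
  then show ?thesis
    by (rule has_derivative_transform_within_open[OF _ open_ball eta]) (simp add: laplacian_klein(2)[OF u] \<alpha>_def)
qed

text \<open>For trace forms in the plane: \<open>i M A i = - tr(M A) + A M\<close> for symmetric \<open>A\<close>.\<close>

lemma Mtr_rotation:
  assumes lin: "linear A" and sym: "\<And>a b. A a \<bullet> b = A b \<bullet> a"
  shows "\<i> * (A (\<i> * \<eta>) - (\<eta> \<bullet> A (\<i> * \<eta>)) *\<^sub>R \<eta>) = defect \<eta> *\<^sub>R A \<eta> - Mtr \<eta> (\<lambda>a b. A a \<bullet> b) *\<^sub>R \<eta>"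
proof -
  have e: "A \<eta> = Re \<eta> *\<^sub>R A 1 + Im \<eta> *\<^sub>R A \<i>" by (rule linear_basis[OF lin])
  have ie: "A (\<i> * \<eta>) = - Im \<eta> *\<^sub>R A 1 + Re \<eta> *\<^sub>R A \<i>" using linear_basis[OF lin, of "\<i> * \<eta>"] by simp
  have s: "Re (A \<i>) = Im (A 1)" using sym[of \<i> 1] by (simp add: inner_complex_def)
  show ?thesis unfolding e ie
    by (simp add: complex_eq_iff inner_complex_def Mtr_def defect_def s power2_eq_square algebra_simps)
qed

lemma Mtr_scaleR_left: "Mtr \<eta> (\<lambda>a b. B a b *\<^sub>R v) = Mtr \<eta> B *\<^sub>R v"
  by (simp add: Mtr_def algebra_simps)

text \<open>The vertical part of the tension field is \<open>J grad (\<Delta>u - 2u)\<close>; the horizontal part vanishes.\<close>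

lemma tension_Wf:
  assumes u: "smooth_on disk u" and eta: "\<eta> \<in> disk"
    and V: "\<And>y. y \<in> disk \<Longrightarrow> klein_push V y = Wf (nab u) y"
  shows "tension klein_metric (bundle_metric klein_metric) (klein_section V) \<eta> =
    (0, rho \<eta> ^ 3 *\<^sub>R (\<i> * nab (\<lambda>y. laplacian klein_metric u y - 2 * u y) \<eta>))"
proof -
  define \<alpha> where "\<alpha> = nab u"
  note sn = smooth_on_nab[OF u, folded \<alpha>_def] and p = disk_pos[OF eta] and V = V[folded \<alpha>_def]
  define q where "q = defect \<eta>"
  define r where "r = rho \<eta>"
  have qr: "q \<noteq> 0" "r * r = q" "r \<noteq> 0" using p by (auto simp: q_def r_def)
  define A where "A = ddir \<alpha> \<eta>"
  define A2 where "A2 a b = ddir (\<lambda>y. ddir \<alpha> y b) \<eta> a" for a b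
  define al where "al = \<alpha> \<eta>"
  have lA: "linear A" unfolding A_def by (rule linear_frechet_derivative[OF smooth_on_differentiable[OF sn eta]])
  have symA: "A a \<bullet> b = A b \<bullet> a" for a b unfolding \<alpha>_def A_def by (rule nab_symmetric[OF u eta])
  have lA2: "linear (\<lambda>a. A2 a b)" for b
    unfolding A2_def by (rule linear_frechet_derivative[OF smooth_on_differentiable[OF smooth_on_ddir[OF sn] eta]])
  (* all vectors below are i r times a real expression in alpha, so this factor is split off *)
  define w where "w b = q *\<^sub>R A b - (3 * (\<eta> \<bullet> b)) *\<^sub>R al" for b
  have lw: "linear w"
    by (rule linearI) (simp_all add: w_def linear_add[OF lA] linear_cmul[OF lA] inner_add_right algebra_simps)
  have W1: "(klein_push V has_derivative (\<lambda>b. \<i> * (rho y *\<^sub>R (defect y *\<^sub>R ddir \<alpha> y b - (3 * (y \<bullet> b)) *\<^sub>R \<alpha> y)))) (at y)" if "y \<in> disk" for y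
    by (rule has_derivative_transform_within_open[OF has_derivative_Wf[OF that smooth_on_has_derivative[OF sn that]] open_ball that])
      (simp add: V)
  note dW = ddir_eqI[OF W1]
  have dW0: "ddir (klein_push V) \<eta> b = \<i> * (r *\<^sub>R w b)" for b
    unfolding dW[OF eta] by (simp add: w_def r_def q_def A_def al_def)
  define D2 where "D2 a b = q *\<^sub>R A2 a b - (3 * (\<eta> \<bullet> a)) *\<^sub>R A b - (3 * (\<eta> \<bullet> b)) *\<^sub>R A a - (3 * (a \<bullet> b)) *\<^sub>R al
    + (3 / q * ((\<eta> \<bullet> a) * (\<eta> \<bullet> b))) *\<^sub>R al" for a b
  have D2: "((\<lambda>y. ddir (klein_push V) y b) has_derivative (\<lambda>a. \<i> * (r *\<^sub>R D2 a b))) (at \<eta>)" for b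
  proof (rule has_derivative_transform_within_open[OF _ open_ball eta])
    have *: "x / r = r * (x / q)" for x using qr by (simp add: divide_simps)
    show "((\<lambda>y. \<i> * (rho y *\<^sub>R (defect y *\<^sub>R ddir \<alpha> y b - (3 * (y \<bullet> b)) *\<^sub>R \<alpha> y))) has_derivative (\<lambda>a. \<i> * (r *\<^sub>R D2 a b))) (at \<eta>)"
      by (rule has_derivative_eq_rhs,
          (rule has_derivative_mult_right has_derivative_scaleR has_derivative_diff has_derivative_mult has_derivative_const
            has_derivative_rho has_derivative_defect has_derivative_inner_left has_derivative_ident
            smooth_on_has_derivative[OF sn eta] smooth_on_has_derivative[OF smooth_on_ddir[OF sn] eta] eta)+)
        (use qr in \<open>simp add: fun_eq_iff D2_def complex_eq_iff A2_def[symmetric] A_def[symmetric] al_def[symmetric]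
          q_def[symmetric] r_def[symmetric] * algebra_simps\<close>)
  qed (simp add: dW)
  have F: "ddir (klein_section V) y b = (b, ddir (klein_push V) y b)" if "y \<in> disk" for y b
    unfolding klein_section_def[abs_def]
    by (rule ddir_eqI)
      (use W1[OF that] dW[OF that] in \<open>auto intro!: has_derivative_Pair has_derivative_ident\<close>)
  have F2: "ddir (\<lambda>y. ddir (klein_section V) y b) \<eta> a = (0, \<i> * (r *\<^sub>R D2 a b))" for a b
  proof -
    have "ddir (\<lambda>y. ddir (klein_section V) y b) \<eta> a = ddir (\<lambda>y. (b, ddir (klein_push V) y b)) \<eta> a"
      by (rule ddir_cong_open[OF open_ball eta F])
    also have "\<dots> = (0, \<i> * (r *\<^sub>R D2 a b))"
      by (rule ddir_eqI) (intro has_derivative_Pair has_derivative_const D2)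
    finally show ?thesis .
  qed
  define G where "G a b = (\<eta> \<bullet> a) *\<^sub>R w b - (\<eta> \<bullet> (\<i> * w b)) *\<^sub>R (\<i> * a)" for a b
  have Gam_w: "Gam \<eta> a (\<i> * (r *\<^sub>R w b)) = \<i> * (r *\<^sub>R ((1/q) *\<^sub>R G a b))" for a b
    by (simp add: Gam_def G_def q_def complex_eq_iff algebra_simps)
  define C where "C a b = (2 * (\<eta> \<bullet> (\<i> * al)) / q) *\<^sub>R ((\<eta> \<bullet> a) *\<^sub>R b + (\<eta> \<bullet> b) *\<^sub>R a)
    + (((\<i> * al) \<bullet> a) *\<^sub>R b + ((\<i> * al) \<bullet> b) *\<^sub>R a)" for a b
  have Wal: "klein_push V \<eta> = (r * q) *\<^sub>R (\<i> * al)"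
    using V[OF eta] by (simp add: Wf_def rho_power3[OF eta] r_def q_def al_def)
  have dG: "dGam \<eta> (klein_push V \<eta>) a b = \<i> * (r *\<^sub>R (- \<i> * C a b))" for a b
    unfolding Wal dGam_def C_def q_def[symmetric] using qr
    by (simp add: scaleR_add_right algebra_simps power2_eq_square)
  (* i r S is the vertical part of the second fundamental form; its four traces follow *)
  define S where "S a b = D2 a b + (1/q) *\<^sub>R (G a b + G b a) - \<i> * C a b - w (Gam \<eta> a b)" for a b
  have sff: "second_fundamental_form klein_metric (bundle_metric klein_metric) (klein_section V) \<eta> a b
    = (0, \<i> * (r *\<^sub>R S a b))" for a b
  proof -
    have fs: "fst (klein_section V \<eta>) = \<eta>" "snd (klein_section V \<eta>) = klein_push V \<eta>" by (simp_all add: klein_section_def)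
    have "second_fundamental_form klein_metric (bundle_metric klein_metric) (klein_section V) \<eta> a b
     = (0, \<i> * (r *\<^sub>R D2 a b)) + (Gam \<eta> a b, Gam \<eta> a (\<i> * (r *\<^sub>R w b)) + Gam \<eta> (\<i> * (r *\<^sub>R w a)) b + dGam \<eta> (klein_push V \<eta>) a b)
       - (Gam \<eta> a b, \<i> * (r *\<^sub>R w (Gam \<eta> a b)))"
      unfolding second_fundamental_form_def F2 F[OF eta] dW0 christoffel_klein[OF eta]
      using christoffel_bundle[of "klein_section V \<eta>", unfolded fs, OF eta] by simp
    also have "\<dots> = (0, \<i> * (r *\<^sub>R S a b))"
      unfolding Gam_swap[of \<eta> "\<i> * (r *\<^sub>R w a)" b] Gam_w dG S_def by (simp add: algebra_simps)
    finally show ?thesis .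
  qed
  have lG: "linear (\<lambda>a. G a b)" "linear (\<lambda>a. G b a)" "linear (\<lambda>a. C a b)" "linear (\<lambda>a. Gam \<eta> a b)" "linear (\<lambda>a. D2 a b)" for b
    by (rule linearI; simp add: G_def C_def Gam_def D2_def linear_add[OF lw] linear_cmul[OF lw] linear_add[OF lA] linear_cmul[OF lA]
        linear_add[OF lA2] linear_cmul[OF lA2] inner_add_right inner_add_left algebra_simps)+
  have lS: "linear (\<lambda>a. S a b)" for b
    by (rule linearI) (simp_all add: S_def linear_add[OF lG(1)] linear_add[OF lG(2)] linear_add[OF lG(3)] linear_add[OF lG(4)] linear_add[OF lG(5)]
        linear_cmul[OF lG(1)] linear_cmul[OF lG(2)] linear_cmul[OF lG(3)] linear_cmul[OF lG(4)] linear_cmul[OF lG(5)]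
        linear_add[OF lw] linear_cmul[OF lw] algebra_simps)
  have MD2: "Mtr \<eta> D2 = q *\<^sub>R Mtr \<eta> A2 - (6 * q) *\<^sub>R A \<eta> - (6 * q) *\<^sub>R al"
  proof -
    have "D2 = (\<lambda>a b. q *\<^sub>R A2 a b - 3 *\<^sub>R ((\<eta> \<bullet> a) *\<^sub>R A b) - 3 *\<^sub>R ((\<eta> \<bullet> b) *\<^sub>R A a) - 3 *\<^sub>R ((a \<bullet> b) *\<^sub>R al)
        + (3 / q) *\<^sub>R (((\<eta> \<bullet> a) *\<^sub>R (\<eta> \<bullet> b)) *\<^sub>R al))"
      by (simp add: fun_eq_iff D2_def)
    then have "Mtr \<eta> D2 = Mtr \<eta> (\<lambda>a b. q *\<^sub>R A2 a b - 3 *\<^sub>R ((\<eta> \<bullet> a) *\<^sub>R A b) - 3 *\<^sub>R ((\<eta> \<bullet> b) *\<^sub>R A a) - 3 *\<^sub>R ((a \<bullet> b) *\<^sub>R al)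
        + (3 / q) *\<^sub>R (((\<eta> \<bullet> a) *\<^sub>R (\<eta> \<bullet> b)) *\<^sub>R al))" by (rule arg_cong)
    also have "\<dots> = q *\<^sub>R Mtr \<eta> A2 - 3 *\<^sub>R (q *\<^sub>R A \<eta>) - 3 *\<^sub>R (q *\<^sub>R A \<eta>) - 3 *\<^sub>R ((1 + q) *\<^sub>R al)
        + (3 / q) *\<^sub>R ((q *\<^sub>R (1 - q)) *\<^sub>R al)"
      unfolding Mtr_add Mtr_diff Mtr_scaleR Mtr_scaleR_left Mtr_inner Mtr_base[OF lA]
        Mtr_swap[where B="\<lambda>a b. (\<eta> \<bullet> a) *\<^sub>R A b"] Mtr_base[OF bounded_linear.linear[OF bounded_linear_inner_right]]
        inner_self_defect q_def[symmetric] ..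
    also have "\<dots> = q *\<^sub>R Mtr \<eta> A2 - (6 * q) *\<^sub>R A \<eta> - (6 * q) *\<^sub>R al"
      using qr by (simp add: complex_eq_iff algebra_simps)
    finally show ?thesis .
  qed
  have MG: "Mtr \<eta> (\<lambda>a b. (1/q) *\<^sub>R (G a b + G b a)) = 2 *\<^sub>R w \<eta> + (2 * \<i>) * (A (\<i> * \<eta>) - (\<eta> \<bullet> A (\<i> * \<eta>)) *\<^sub>R \<eta>) - (6 * ((\<i> * \<eta>) \<bullet> al)) *\<^sub>R (\<i> * \<eta>)"
  proof -
    define m where "m = A (\<i> * \<eta>) - (\<eta> \<bullet> A (\<i> * \<eta>)) *\<^sub>R \<eta>"
    define k where "k = (\<i> * \<eta>) \<bullet> al"
    define v where "v = (3 * k) *\<^sub>R \<eta> - q *\<^sub>R A (\<i> * \<eta>)"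
    have v: "\<eta> \<bullet> (\<i> * w b) = v \<bullet> b" for b
      using symA[of b "\<i> * \<eta>"] by (simp add: v_def w_def i_inner_simps(2) inner_diff_left inner_diff_right k_def inner_commute[of "\<i> * \<eta>" "A b"])
    have v': "v - (\<eta> \<bullet> v) *\<^sub>R \<eta> = (3 * k * q) *\<^sub>R \<eta> - q *\<^sub>R m"
      by (simp add: v_def m_def inner_diff_right inner_self_defect q_def complex_eq_iff algebra_simps)
    have "Mtr \<eta> G = Mtr \<eta> (\<lambda>a b. (\<eta> \<bullet> a) *\<^sub>R w b) - Mtr \<eta> (\<lambda>a b. (v \<bullet> b) *\<^sub>R (\<i> * a))"
      by (simp only: G_def[abs_def] Mtr_diff v)
    also have "\<dots> = q *\<^sub>R w \<eta> - \<i> * ((3 * k * q) *\<^sub>R \<eta> - q *\<^sub>R m)"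
      unfolding Mtr_base[OF lw] Mtr_swap[where B="\<lambda>a b. (v \<bullet> a) *\<^sub>R (\<i> * b)"]
        Mtr_inner_left[OF bounded_linear.linear[OF bounded_linear_mult_right]] v' q_def ..
    finally have MG1: "Mtr \<eta> G = q *\<^sub>R w \<eta> - \<i> * ((3 * k * q) *\<^sub>R \<eta> - q *\<^sub>R m)" .
    have "Mtr \<eta> (\<lambda>a b. (1/q) *\<^sub>R (G a b + G b a)) = (1/q) *\<^sub>R (Mtr \<eta> G + Mtr \<eta> G)"
      unfolding Mtr_scaleR Mtr_add Mtr_swap[of \<eta> G] ..
    also have "\<dots> = 2 *\<^sub>R w \<eta> + (2 * \<i>) * m - (6 * k) *\<^sub>R (\<i> * \<eta>)"
      unfolding MG1 using qr by (simp add: complex_eq_iff algebra_simps)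
    finally show ?thesis by (simp add: m_def k_def)
  qed
  have MC: "Mtr \<eta> (\<lambda>a b. \<i> * C a b) = - 2 *\<^sub>R al - (2 * ((\<i> * \<eta>) \<bullet> al)) *\<^sub>R (\<i> * \<eta>)"
  proof -
    define k where "k = (\<i> * \<eta>) \<bullet> al"
    have k: "\<eta> \<bullet> (\<i> * al) = - k" by (simp add: k_def i_inner_simps)
    have id: "linear (\<lambda>x::complex. x)" by (simp add: linear_id[unfolded id_def])
    have "Mtr \<eta> C = (2 * (\<eta> \<bullet> (\<i> * al)) / q) *\<^sub>R (q *\<^sub>R \<eta> + q *\<^sub>R \<eta>)
       + (((\<i> * al) - (\<eta> \<bullet> (\<i> * al)) *\<^sub>R \<eta>) + ((\<i> * al) - (\<eta> \<bullet> (\<i> * al)) *\<^sub>R \<eta>))"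
      unfolding C_def[abs_def] Mtr_add Mtr_scaleR Mtr_swap[where B="\<lambda>a b. (\<eta> \<bullet> a) *\<^sub>R b"]
        Mtr_swap[where B="\<lambda>a b. ((\<i> * al) \<bullet> a) *\<^sub>R b"] Mtr_base[OF id] Mtr_inner_left[OF id] q_def ..
    then have "\<i> * Mtr \<eta> C = - 2 *\<^sub>R al - (2 * k) *\<^sub>R (\<i> * \<eta>)"
      unfolding k using qr by (simp add: complex_eq_iff algebra_simps)
    then show ?thesis
      by (simp only: Mtr_linear[OF bounded_linear.linear[OF bounded_linear_mult_right]] k_def)
  qed
  have Mw: "Mtr \<eta> (\<lambda>a b. w (Gam \<eta> a b)) = 2 *\<^sub>R w \<eta>"
    by (simp only: Mtr_linear[OF lw] Mtr_Gam[OF eta] linear_cmul[OF lw])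
  have N: "nab (\<lambda>y. laplacian klein_metric u y - 2 * u y) \<eta> = 
     q *\<^sub>R Mtr \<eta> A2 - (2 * Mtr \<eta> (\<lambda>a b. A a \<bullet> b)) *\<^sub>R \<eta>
     - (4 * q) *\<^sub>R A \<eta> + (4 * (\<eta> \<bullet> al)) *\<^sub>R \<eta> - (2 * q) *\<^sub>R al - 2 *\<^sub>R al"
    using nab_eqI[OF has_derivative_laplacian[OF u eta]] by (simp add: q_def A2_def[abs_def] A_def al_def \<alpha>_def)
  have "Mtr \<eta> S = Mtr \<eta> D2 + Mtr \<eta> (\<lambda>a b. (1/q) *\<^sub>R (G a b + G b a)) - Mtr \<eta> (\<lambda>a b. \<i> * C a b) - Mtr \<eta> (\<lambda>a b. w (Gam \<eta> a b))"
    by (simp only: S_def[abs_def] Mtr_add Mtr_diff)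
  also have "\<dots> = nab (\<lambda>y. laplacian klein_metric u y - 2 * u y) \<eta>"
  proof -
    have rot: "\<i> * (A (\<i> * \<eta>) - (\<eta> \<bullet> A (\<i> * \<eta>)) *\<^sub>R \<eta>) = q *\<^sub>R A \<eta> - Mtr \<eta> (\<lambda>a b. A a \<bullet> b) *\<^sub>R \<eta>"
      unfolding q_def by (rule Mtr_rotation[OF lA symA])
    define k where "k = (\<i> * \<eta>) \<bullet> al"
    have k: "k *\<^sub>R (\<i> * \<eta>) = (1 - q) *\<^sub>R al - (\<eta> \<bullet> al) *\<^sub>R \<eta>"
      using perp_decomp[of \<eta> al] by (simp add: k_def inner_self_defect q_def algebra_simps)
    have k6: "(c * k) *\<^sub>R (\<i> * \<eta>) = c *\<^sub>R ((1 - q) *\<^sub>R al - (\<eta> \<bullet> al) *\<^sub>R \<eta>)" for c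
      by (simp only: scaleR_scaleR[symmetric] k)
    show ?thesis
      unfolding MD2 MG MC Mw N k_def[symmetric] k6 mult.assoc[of 2 "\<i>" "_ - _"] rot
      by (simp add: complex_eq_iff algebra_simps)
  qed
  finally have MS: "Mtr \<eta> S = nab (\<lambda>y. laplacian klein_metric u y - 2 * u y) \<eta>" .
  have "tension klein_metric (bundle_metric klein_metric) (klein_section V) \<eta> = metric_trace klein_metric \<eta> (\<lambda>a b. (0::complex, \<i> * (r *\<^sub>R S a b)))"
    by (simp add: tension_def sff[abs_def])
  also have "\<dots> = q *\<^sub>R Mtr \<eta> (\<lambda>a b. (0::complex, \<i> * (r *\<^sub>R S a b)))"
  proof -
    have "linear (\<lambda>a. (0::complex, \<i> * (r *\<^sub>R S a b)))" for b
      by (rule linearI) (simp_all add: linear_add[OF lS] linear_cmul[OF lS] algebra_simps)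
    from metric_trace_klein[OF eta this] show ?thesis by (simp add: Mtr_def q_def)
  qed
  also have "Mtr \<eta> (\<lambda>a b. (0::complex, \<i> * (r *\<^sub>R S a b))) = (0, \<i> * (r *\<^sub>R Mtr \<eta> S))"
    by (simp add: Mtr_def algebra_simps)
  finally show ?thesis by (simp add: MS rho_power3[OF eta] r_def q_def mult.commute)
qed

section \<open>Potentials\<close>

text \<open>Differentiation under the integral sign for gradients.\<close>

lemma leibniz_inner:
  fixes F :: "complex \<Rightarrow> real \<Rightarrow> real" and G :: "complex \<Rightarrow> real \<Rightarrow> complex"
  assumes S: "open S" "convex S" "x0 \<in> S"
    and d: "\<And>x t. x \<in> S \<Longrightarrow> t \<in> {a..b} \<Longrightarrow> ((\<lambda>x. F x t) has_derivative (\<lambda>v. G x t \<bullet> v)) (at x)"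
    and cF: "\<And>x. x \<in> S \<Longrightarrow> continuous_on {a..b} (F x)"
    and cG: "continuous_on (S \<times> {a..b}) (\<lambda>(x, t). G x t)"
  shows "((\<lambda>x. integral {a..b} (F x)) has_derivative (\<lambda>v. integral {a..b} (G x0) \<bullet> v)) (at x0)"
proof -
  have cG0: "continuous_on {a..b} (G x0)"
  proof -
    have "continuous_on {a..b} (\<lambda>t. (x0, t))" by (intro continuous_on_Pair continuous_on_const continuous_on_id)
    from continuous_on_compose2[OF cG this] S(3) show ?thesis by auto
  qed
  have "((\<lambda>x. integral (cbox a b) (F x)) has_derivative
      blinfun_apply (integral (cbox a b) (\<lambda>t. blinfun_inner_right (G x0 t)))) (at x0 within S)"
  proof (rule leibniz_rule[where fx="\<lambda>x t. blinfun_inner_right (G x t)"])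
    show "((\<lambda>x. F x t) has_derivative blinfun_apply (blinfun_inner_right (G x t))) (at x within S)"
      if "x \<in> S" "t \<in> cbox a b" for x t
      using has_derivative_at_withinI[OF d] that by simp
    show "F x integrable_on cbox a b" if "x \<in> S" for x
      using cF[OF that] by (auto intro: integrable_continuous_real)
    show "continuous_on (S \<times> cbox a b) (\<lambda>(x, t). blinfun_inner_right (G x t))"
      using bounded_linear.continuous_on[OF bounded_linear_blinfun_inner_right cG] by (simp add: case_prod_unfold)
  qed (use S in auto)
  moreover have "integral (cbox a b) (\<lambda>t. blinfun_inner_right (G x0 t)) = blinfun_inner_right (integral (cbox a b) (G x0))"
    using integral_linear[OF integrable_continuous bounded_linear_blinfun_inner_right, of a b "G x0"] cG0 by (simp add: o_def)
  ultimately show ?thesis using at_within_open[OF S(3,1)] by simp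
qed

lemma scaleR_in_disk: "x \<in> disk \<Longrightarrow> 0 \<le> t \<Longrightarrow> t \<le> 1 \<Longrightarrow> t *\<^sub>R x \<in> disk"
  by (simp add: le_less_trans[OF mult_left_le_one_le])

text \<open>The potential is the integral of \<open>\<alpha>\<close> along rays; its derivative is an integral of the exact derivative
  \<open>(t \<alpha>(t x))'\<close>, because \<open>D\<alpha>\<close> is symmetric.\<close>

lemma poincare_disk:
  assumes sm: "smooth_on disk \<alpha>"
    and sym: "\<And>\<eta> a b. \<eta> \<in> disk \<Longrightarrow> ddir \<alpha> \<eta> a \<bullet> b = ddir \<alpha> \<eta> b \<bullet> (a::complex)"
  obtains u where "smooth_on disk u" "\<And>\<eta>. \<eta> \<in> disk \<Longrightarrow> nab u \<eta> = \<alpha> \<eta>"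
proof -
  define G where "G x t = t *\<^sub>R ddir \<alpha> (t *\<^sub>R x) x + \<alpha> (t *\<^sub>R x)" for x t
  define u where "u x = integral {0..1} (\<lambda>t. \<alpha> (t *\<^sub>R x) \<bullet> x)" for x
  have ca: "continuous_on (disk \<times> {0..1}) (\<lambda>z. h (snd z *\<^sub>R fst z))" if "continuous_on disk h" for h :: "complex \<Rightarrow> complex"
    by (rule continuous_on_compose2[OF that]) (auto intro!: continuous_intros dest: scaleR_in_disk simp del: mem_ball)
  have cG: "continuous_on (disk \<times> {0..1}) (\<lambda>(x, t). G x t)"
  proof -
    have "continuous_on (disk \<times> {0..1}) (\<lambda>z. snd z *\<^sub>R (Re (fst z) *\<^sub>R ddir \<alpha> (snd z *\<^sub>R fst z) 1
        + Im (fst z) *\<^sub>R ddir \<alpha> (snd z *\<^sub>R fst z) \<i>) + \<alpha> (snd z *\<^sub>R fst z))"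
      by (intro continuous_intros ca smooth_on_continuous smooth_on_ddir sm)
    moreover have "ddir \<alpha> (t *\<^sub>R x) x = Re x *\<^sub>R ddir \<alpha> (t *\<^sub>R x) 1 + Im x *\<^sub>R ddir \<alpha> (t *\<^sub>R x) \<i>" if "x \<in> disk" "t \<in> {0..1}" for x t
      by (rule ddir_decomp[OF smooth_on_differentiable[OF sm scaleR_in_disk]]) (use that in auto)
    ultimately show ?thesis
    proof (elim continuous_on_eq, goal_cases)
      case (1 z)
      show ?case using 1(1)[of "fst z" "snd z"] 1(2) unfolding G_def case_prod_unfold by (simp add: mem_Times_iff)
    qed
  qed
  have line: "((\<lambda>t. t *\<^sub>R \<alpha> (t *\<^sub>R x)) has_vector_derivative G x t) (at t within {0..1})" if "x \<in> disk" "t \<in> {0..1}" for x t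
  proof -
    have tx: "t *\<^sub>R x \<in> disk" using scaleR_in_disk[of x t] that by simp
    have l: "linear (ddir \<alpha> (t *\<^sub>R x))" by (rule linear_frechet_derivative[OF smooth_on_differentiable[OF sm tx]])
    have "((\<lambda>t. \<alpha> (t *\<^sub>R x)) has_derivative (\<lambda>s. ddir \<alpha> (t *\<^sub>R x) (s *\<^sub>R x))) (at t within {0..1})"
      by (rule has_derivative_compose[where f="\<lambda>t. t *\<^sub>R x", OF _ smooth_on_has_derivative[OF sm tx]]) (auto intro!: derivative_eq_intros)
    then have "((\<lambda>t. \<alpha> (t *\<^sub>R x)) has_vector_derivative ddir \<alpha> (t *\<^sub>R x) x) (at t within {0..1})"
      by (simp add: has_vector_derivative_def linear_cmul[OF l])
    from has_vector_derivative_scaleR[OF _ this, of "\<lambda>t. t" 1] show ?thesis by (simp add: G_def)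
  qed
  have du: "(u has_derivative (\<lambda>v. \<alpha> x \<bullet> v)) (at x)" if x: "x \<in> disk" for x
  proof -
    have "(u has_derivative (\<lambda>v. integral {0..1} (G x) \<bullet> v)) (at x)"
      unfolding u_def[abs_def]
    proof (rule leibniz_inner[OF _ _ x])
      fix y and t :: real assume y: "y \<in> disk" and t: "t \<in> {0..1}"
      have ty: "t *\<^sub>R y \<in> disk" using scaleR_in_disk[OF y] t by simp
      have l: "linear (ddir \<alpha> (t *\<^sub>R y))" by (rule linear_frechet_derivative[OF smooth_on_differentiable[OF sm ty]])
      have "((\<lambda>x. \<alpha> (t *\<^sub>R x)) has_derivative (\<lambda>v. ddir \<alpha> (t *\<^sub>R y) (t *\<^sub>R v))) (at y)"
        by (rule has_derivative_compose[where f="\<lambda>x. t *\<^sub>R x", OF _ smooth_on_has_derivative[OF sm ty]]) (auto intro!: derivative_eq_intros)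
      from has_derivative_inner[OF this has_derivative_ident]
      show "((\<lambda>x. \<alpha> (t *\<^sub>R x) \<bullet> x) has_derivative (\<lambda>v. G y t \<bullet> v)) (at y)"
        by (rule has_derivative_eq_rhs) (simp add: fun_eq_iff G_def linear_cmul[OF l] inner_add_left sym[OF ty, of _ y])
    next
      fix y assume y: "y \<in> disk"
      show "continuous_on {0..1} (\<lambda>t. \<alpha> (t *\<^sub>R y) \<bullet> y)"
        using scaleR_in_disk[OF y]
        by (intro continuous_intros continuous_on_compose2[OF smooth_on_continuous[OF sm]]) auto
    qed (use cG in auto)
    moreover have "(G x has_integral (1 *\<^sub>R \<alpha> (1 *\<^sub>R x) - 0 *\<^sub>R \<alpha> (0 *\<^sub>R x))) {0..1}"
      by (rule fundamental_theorem_of_calculus[OF _ line[OF x]]) auto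
    ultimately show ?thesis by (simp add: integral_unique)
  qed
  have nu: "nab u x = \<alpha> x" if "x \<in> disk" for x by (rule nab_eqI[OF du[OF that]])
  have "smooth_on disk u"
  proof (rule smooth_on_coinduct[where P="\<lambda>h. h = u \<or> smooth_on disk h"])
    fix h x assume h: "h = u \<or> smooth_on disk h" and x: "x \<in> disk"
    show "h differentiable (at x)"
      using h differentiableI[OF du[OF x]] smooth_on_differentiable[OF _ x] by blast
  next
    fix h v assume h: "h = u \<or> smooth_on disk h"
    have "smooth_on disk (\<lambda>x. \<alpha> x \<bullet> v)" by (intro smooth_on_inner sm smooth_on_const open_ball)
    moreover have "\<forall>x\<in>disk. ddir u x v = \<alpha> x \<bullet> v" using ddir_eqI[OF du] by blast
    ultimately show "\<exists>h'. (h' = u \<or> smooth_on disk h') \<and> (\<forall>x\<in>disk. ddir h x v = h' x)"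
      using h smooth_on_ddir[of disk h v] by blast
  qed auto
  then show thesis using that nu by blast
qed

lemma smooth_on_disk_cong:
  "(\<And>y. y \<in> disk \<Longrightarrow> f y = g y) \<Longrightarrow> smooth_on disk g \<Longrightarrow> smooth_on disk f"
  using smooth_on_cong[where S=disk and f=f and g=g] by simp

lemma smooth_on_Wf: "smooth_on disk \<alpha> \<Longrightarrow> smooth_on disk (Wf \<alpha>)"
proof -
  assume a: "smooth_on disk \<alpha>"
  have "smooth_on disk (\<lambda>\<eta>. (rho \<eta> * defect \<eta>) *\<^sub>R (\<i> * \<alpha> \<eta>))"
    by (intro smooth_on_scaleR smooth_on_mult smooth_on_rho smooth_on_defect a smooth_on_const open_ball)
  then show ?thesis
    by (rule smooth_on_disk_cong[rotated]) (simp add: Wf_def rho_power3)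
qed

text \<open>Harmonic Lagrangian fields are exactly the fields \<open>J grad u\<close> with \<open>\<Delta>u = 2u\<close>: being Lagrangian
  means that the dual form is closed, and harmonicity determines \<open>\<Delta>u - 2u\<close> up to a constant, which
  is absorbed by the choice of \<open>u\<close>.\<close>

lemma harmonic_lagrangianI:
  assumes u: "smooth_on disk u" and lap: "\<And>\<eta>. \<eta> \<in> disk \<Longrightarrow> laplacian klein_metric u \<eta> = 2 * u \<eta>"
    and V: "\<And>\<eta>. \<eta> \<in> disk \<Longrightarrow> klein_push V \<eta> = Wf (nab u) \<eta>"
    and T: "\<And>p. p \<in> hyp_plane \<Longrightarrow> V p \<in> hyp_tangent p"
  shows "harmonic_lagrangian V"
proof -
  have "smooth_on disk (klein_push V)"
    by (rule smooth_on_disk_cong[OF _ smooth_on_Wf[OF smooth_on_nab[OF u]]]) (rule V)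
  moreover have "tension klein_metric (bundle_metric klein_metric) (klein_section V) \<eta> = 0" if eta: "\<eta> \<in> disk" for \<eta>
  proof -
    have "((\<lambda>y. laplacian klein_metric u y - 2 * u y) has_derivative (\<lambda>a. 0 \<bullet> a)) (at \<eta>)"
      by (rule has_derivative_transform_within_open[OF _ open_ball eta, of "\<lambda>y. 0"]) (use lap in auto)
    from nab_eqI[OF this]
    have n: "nab (\<lambda>y. laplacian klein_metric u y - 2 * u y) \<eta> = 0" .
    have "tension klein_metric (bundle_metric klein_metric) (klein_section V) \<eta> =
      (0, rho \<eta> ^ 3 *\<^sub>R (\<i> * nab (\<lambda>y. laplacian klein_metric u y - 2 * u y) \<eta>))"
      by (rule tension_Wf[OF u eta]) (rule V)
    then show ?thesis unfolding n by (simp add: zero_prod_def)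
  qed
  moreover have "bundle_form klein_metric klein_J (klein_section V \<eta>) (ddir (klein_section V) \<eta> a) (ddir (klein_section V) \<eta> b) = 0"
    if eta: "\<eta> \<in> disk" for \<eta> a b
    using bundle_form_Wf[OF eta smooth_on_differentiable[OF smooth_on_nab[OF u] eta] V] nab_symmetric[OF u eta, of a b] by simp
  ultimately show ?thesis using T by (simp add: harmonic_lagrangian_def smooth_vector_field_def harmonic_map_on_def)
qed

lemma laplacian_add_const:
  assumes u: "smooth_on disk u" and eta: "\<eta> \<in> disk"
  shows "laplacian klein_metric (\<lambda>y. u y + c) \<eta> = laplacian klein_metric u \<eta>"
    and "nab (\<lambda>y. u y + c) \<eta> = nab u \<eta>"
proof -
  have n: "nab (\<lambda>y. u y + c) y = nab u y" if "y \<in> disk" for y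
    by (rule nab_eqI) (use has_derivative_add[OF has_derivative_nab[OF u that] has_derivative_const, of c] in simp)
  show "nab (\<lambda>y. u y + c) \<eta> = nab u \<eta>" by (rule n[OF eta])
  have "ddir (nab (\<lambda>y. u y + c)) \<eta> a = ddir (nab u) \<eta> a" for a by (rule ddir_cong_open[OF open_ball eta n])
  then show "laplacian klein_metric (\<lambda>y. u y + c) \<eta> = laplacian klein_metric u \<eta>"
    using laplacian_klein(2)[OF smooth_on_add[OF open_ball u smooth_on_const[OF open_ball]] eta]
    by (simp add: laplacian_klein(2)[OF u eta] n[OF eta])
qed

lemma harmonic_lagrangian_potential:
  assumes "harmonic_lagrangian V"
  obtains u where "smooth_on disk u" "\<And>\<eta>. \<eta> \<in> disk \<Longrightarrow> laplacian klein_metric u \<eta> = 2 * u \<eta>"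
    "\<And>\<eta>. \<eta> \<in> disk \<Longrightarrow> klein_push V \<eta> = Wf (nab u) \<eta>"
proof -
  define \<alpha> where "\<alpha> \<eta> = (1 / rho \<eta> ^ 3) *\<^sub>R (- \<i> * klein_push V \<eta>)" for \<eta>
  have sV: "smooth_on disk (klein_push V)" using assms by (simp add: harmonic_lagrangian_def smooth_vector_field_def)
  have sa: "smooth_on disk \<alpha>" unfolding \<alpha>_def[abs_def]
    by (intro smooth_on_div_rho smooth_on_mult smooth_on_const open_ball sV)
  have Va: "klein_push V \<eta> = Wf \<alpha> \<eta>" if "\<eta> \<in> disk" for \<eta>
    using disk_pos[OF that] by (simp add: Wf_def \<alpha>_def)
  have "ddir \<alpha> \<eta> a \<bullet> b = ddir \<alpha> \<eta> b \<bullet> a" if eta: "\<eta> \<in> disk" for \<eta> a b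
    using bundle_form_Wf[OF eta smooth_on_differentiable[OF sa eta] Va, of a b] assms eta
    by (simp add: harmonic_lagrangian_def)
  from poincare_disk[OF sa this] obtain v where v: "smooth_on disk v" "\<And>\<eta>. \<eta> \<in> disk \<Longrightarrow> nab v \<eta> = \<alpha> \<eta>" by blast
  have Vv: "klein_push V \<eta> = Wf (nab v) \<eta>" if "\<eta> \<in> disk" for \<eta> using Va[OF that] v(2)[OF that] by (simp add: Wf_def)
  let ?P = "\<lambda>y. laplacian klein_metric v y - 2 * v y"
  have "(?P has_derivative (\<lambda>h. 0)) (at \<eta>)" if eta: "\<eta> \<in> disk" for \<eta>
  proof -
    note D = has_derivative_laplacian[OF v(1) eta]
    have "tension klein_metric (bundle_metric klein_metric) (klein_section V) \<eta> = 0"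
      using assms eta by (simp add: harmonic_lagrangian_def harmonic_map_on_def)
    then have "nab ?P \<eta> = 0"
      using tension_Wf[OF v(1) eta Vv] disk_pos[OF eta] by (simp add: zero_prod_def)
    then have "(\<lambda>a. nab ?P \<eta> \<bullet> a) = (\<lambda>a. 0)" by simp
    then show ?thesis using D nab_eqI[OF D] by simp
  qed
  from has_derivative_zero_constant[OF convex_ball has_derivative_at_withinI[OF this]]
  have "\<exists>c. \<forall>x\<in>disk. ?P x = c" by blast
  then obtain c where c: "\<And>\<eta>. \<eta> \<in> disk \<Longrightarrow> ?P \<eta> = c" by blast
  show thesis
  proof (rule that)
    show "smooth_on disk (\<lambda>y. v y + c / 2)" by (intro smooth_on_add smooth_on_const open_ball v(1))
    fix \<eta> :: complex assume eta: "\<eta> \<in> disk"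
    show "laplacian klein_metric (\<lambda>y. v y + c / 2) \<eta> = 2 * (v \<eta> + c / 2)"
      using c[OF eta] by (simp add: laplacian_add_const[OF v(1) eta])
    show "klein_push V \<eta> = Wf (nab (\<lambda>y. v y + c / 2)) \<eta>"
      using Vv[OF eta] by (simp add: Wf_def laplacian_add_const[OF v(1) eta])
  qed
qed

section \<open>The equation in the disk\<close>

definition Hess :: "(complex \<Rightarrow> real) \<Rightarrow> complex \<Rightarrow> complex \<Rightarrow> complex \<Rightarrow> real" where
  "Hess f \<eta> a b = ddir (nab f) \<eta> a \<bullet> b"

text \<open>The equation \<open>\<Delta>u = 2u\<close> in terms of \<open>f = \<rho> u\<close>.\<close>

definition klein_harmonic :: "(complex \<Rightarrow> real) \<Rightarrow> bool" where
  "klein_harmonic f \<longleftrightarrow> smooth_on disk f \<and> (\<forall>\<eta>\<in>disk. Mtr \<eta> (Hess f \<eta>) = 0)"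

lemma klein_harmonic_rescale_iff:
  assumes u: "smooth_on disk u"
  shows "klein_harmonic (\<lambda>y. rho y * u y) \<longleftrightarrow> (\<forall>\<eta>\<in>disk. laplacian klein_metric u \<eta> = 2 * u \<eta>)"
proof -
  have "laplacian klein_metric u \<eta> = 2 * u \<eta> \<longleftrightarrow> Mtr \<eta> (Hess (\<lambda>y. rho y * u y) \<eta>) = 0" if "\<eta> \<in> disk" for \<eta>
    unfolding eq_iff_diff_eq_0[of "laplacian klein_metric u \<eta>"] laplacian_rescale[OF u that]
    using disk_pos(4)[OF that] by (simp add: Hess_def[abs_def])
  then show ?thesis using smooth_on_rescale[OF u] by (simp add: klein_harmonic_def)
qed

lemma linear_Hess: "smooth_on disk f \<Longrightarrow> \<eta> \<in> disk \<Longrightarrow> linear (ddir (nab f) \<eta>)"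
  by (rule linear_frechet_derivative[OF smooth_on_differentiable[OF smooth_on_nab]])

text \<open>From \<open>I - \<eta>\<eta>\<^sup>T = q I + (i\<eta>)(i\<eta>)\<^sup>T\<close>: the operator is elliptic inside the disk.\<close>

lemma Mtr_positive:
  assumes lin: "linear A" and sym: "\<And>a b. A a \<bullet> b = A b \<bullet> a"
  shows "Mtr \<eta> (\<lambda>a b. A a \<bullet> b) = defect \<eta> * (A 1 \<bullet> 1 + A \<i> \<bullet> \<i>) + A (\<i> * \<eta>) \<bullet> (\<i> * \<eta>)"
proof -
  have ie: "A (\<i> * \<eta>) = - Im \<eta> *\<^sub>R A 1 + Re \<eta> *\<^sub>R A \<i>" using linear_basis[OF lin, of "\<i> * \<eta>"] by simp
  have s: "Re (A \<i>) = Im (A 1)" using sym[of \<i> 1] by (simp add: inner_complex_def)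
  show ?thesis unfolding ie
    by (simp add: inner_complex_def Mtr_def defect_def s power2_eq_square algebra_simps)
qed

lemma second_order_mvt:
  assumes f: "smooth_on disk f" and x: "x \<in> disk" and xd: "x + d \<in> disk"
  obtains z w where "0 < w" "w < z" "z < 1"
    "f (x + d) = f x + nab f x \<bullet> d + z * Hess f (x + w *\<^sub>R d) d d"
proof -
  have seg: "x + t *\<^sub>R d \<in> disk" if "0 \<le> t" "t \<le> 1" for t
  proof -
    have "(1 - t) *\<^sub>R x + t *\<^sub>R (x + d) \<in> disk" by (rule convexD[OF convex_ball x xd]) (use that in auto)
    then show ?thesis by (simp add: algebra_simps)
  qed
  have d1: "((\<lambda>t. f (x + t *\<^sub>R d)) has_real_derivative nab f (x + t *\<^sub>R d) \<bullet> d) (at t)" if "0 \<le> t" "t \<le> 1" for t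
    using ddir_line[OF smooth_on_differentiable[OF f seg[OF that]]] ddir_nab[OF smooth_on_differentiable[OF f seg[OF that]]] by simp
  have d2: "((\<lambda>t. nab f (x + t *\<^sub>R d) \<bullet> d) has_real_derivative Hess f (x + t *\<^sub>R d) d d) (at t)" if "0 \<le> t" "t \<le> 1" for t
  proof -
    have D: "((\<lambda>y. nab f y \<bullet> d) has_derivative (\<lambda>a. ddir (nab f) (x + t *\<^sub>R d) a \<bullet> d)) (at (x + t *\<^sub>R d))"
      by (intro has_derivative_inner_left smooth_on_has_derivative[of disk] smooth_on_nab f seg that)
    show ?thesis using ddir_line[OF differentiableI[OF D]] by (simp add: ddir_eqI[OF D] Hess_def)
  qed
  obtain z where z: "0 < z" "z < 1" "f (x + 1 *\<^sub>R d) - f (x + 0 *\<^sub>R d) = (1 - 0) * (nab f (x + z *\<^sub>R d) \<bullet> d)"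
    using MVT2[of 0 1 "\<lambda>t. f (x + t *\<^sub>R d)" "\<lambda>t. nab f (x + t *\<^sub>R d) \<bullet> d"] d1 by auto
  obtain w where w: "0 < w" "w < z" "nab f (x + z *\<^sub>R d) \<bullet> d - nab f (x + 0 *\<^sub>R d) \<bullet> d = (z - 0) * Hess f (x + w *\<^sub>R d) d d"
    using MVT2[of 0 z "\<lambda>t. nab f (x + t *\<^sub>R d) \<bullet> d" "\<lambda>t. Hess f (x + t *\<^sub>R d) d d"] d2 z by auto
  show thesis using that[OF w(1,2) z(2)] z(3) w(3) by simp
qed

lemma continuous_Hess: "smooth_on disk f \<Longrightarrow> continuous_on disk (\<lambda>\<eta>. Hess f \<eta> a b)"
  unfolding Hess_def by (intro continuous_intros smooth_on_continuous smooth_on_ddir smooth_on_nab)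

lemma Hess_scaleR: "smooth_on disk f \<Longrightarrow> \<eta> \<in> disk \<Longrightarrow> Hess f \<eta> (c *\<^sub>R a) (c *\<^sub>R a) = c\<^sup>2 * Hess f \<eta> a a"
  using linear_cmul[OF linear_Hess] by (simp add: Hess_def power2_eq_square)

text \<open>At a local maximum the Hessian is not positive in any direction.\<close>

lemma Hess_local_max:
  assumes f: "smooth_on disk f" and m: "m \<in> disk" and max: "\<And>y. y \<in> disk \<Longrightarrow> f y \<le> f m"
  shows "Hess f m a a \<le> 0"
proof (rule ccontr)
  assume "\<not> Hess f m a a \<le> 0"
  then have pos: "Hess f m a a > 0" by simp
  have n0: "nab f m \<bullet> v = 0" for v
  proof -
    have "(\<lambda>v. nab f m \<bullet> v) = (\<lambda>v. 0)"
      by (rule differential_zero_maxmin[OF m open_ball has_derivative_nab[OF f m]]) (use max in auto)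
    then show ?thesis by metis
  qed
  have "isCont (\<lambda>\<eta>. Hess f \<eta> a a) m"
    using continuous_Hess[OF f] m by (simp add: continuous_on_eq_continuous_at)
  then have "((\<lambda>\<eta>. Hess f \<eta> a a) \<longlongrightarrow> Hess f m a a) (nhds m)"
    unfolding isCont_def by (rule iffD1[OF tendsto_at_iff_tendsto_nhds[of "\<lambda>\<eta>. Hess f \<eta> a a"]])
  from order_tendstoD(1)[OF this pos] have "\<forall>\<^sub>F \<eta> in nhds m. Hess f \<eta> a a > 0" .
  moreover have "\<forall>\<^sub>F \<eta> in nhds m. \<eta> \<in> disk" using m by (intro eventually_nhds_in_open) auto
  ultimately have "\<forall>\<^sub>F \<eta> in nhds m. Hess f \<eta> a a > 0 \<and> \<eta> \<in> disk" by eventually_elim simp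
  then obtain e where e: "e > 0" "\<And>\<eta>. dist \<eta> m < e \<Longrightarrow> Hess f \<eta> a a > 0 \<and> \<eta> \<in> disk"
    unfolding eventually_nhds_metric by blast
  define N where "N = norm a + 1"
  define t where "t = e / 2 / N"
  have na: "N > 0" "norm a \<le> N" by (auto simp: N_def add_nonneg_pos)
  have t: "t > 0" using e na by (simp add: t_def)
  have ta: "t * norm a < e"
  proof -
    have "t * norm a \<le> t * N" using t na by simp
    also have "\<dots> = e / 2" using na by (simp add: t_def)
    finally show ?thesis using e by simp
  qed
  have close: "dist (m + w *\<^sub>R (t *\<^sub>R a)) m < e" if "0 \<le> w" "w \<le> 1" for w
  proof -
    have "dist (m + w *\<^sub>R (t *\<^sub>R a)) m = w * (t * norm a)" using that t by (simp add: dist_norm)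
    also have "\<dots> \<le> t * norm a" using that t by (simp add: mult_left_le_one_le)
    finally show ?thesis using ta by simp
  qed
  have "m + t *\<^sub>R a \<in> disk" using e(2)[OF close[of 1]] by simp
  from second_order_mvt[OF f m this] obtain z w where zw: "0 < w" "w < z" "z < 1"
    "f (m + t *\<^sub>R a) = f m + nab f m \<bullet> (t *\<^sub>R a) + z * Hess f (m + w *\<^sub>R (t *\<^sub>R a)) (t *\<^sub>R a) (t *\<^sub>R a)" by blast
  have h: "Hess f (m + w *\<^sub>R (t *\<^sub>R a)) a a > 0" "m + w *\<^sub>R (t *\<^sub>R a) \<in> disk"
    using e(2)[OF close[of w]] zw by auto
  have "f (m + t *\<^sub>R a) > f m"
    unfolding zw(4) Hess_scaleR[OF f h(2)] n0 using zw(1-3) h(1) t by simp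
  then show False using max[OF \<open>m + t *\<^sub>R a \<in> disk\<close>] by simp
qed

text \<open>Subtracting a small multiple of \<open>q\<close>, which vanishes on the circle and has negative definite Hessian, turns
  the equation into a strict inequality, which contradicts an interior maximum.\<close>

lemma maximum_principle:
  assumes f: "klein_harmonic f" and c: "continuous_on (cball 0 1) F"
    and eq: "\<And>\<eta>. \<eta> \<in> disk \<Longrightarrow> F \<eta> = f \<eta>" and bd: "\<And>z. z \<in> circle \<Longrightarrow> F z \<le> 0"
    and eta: "\<eta> \<in> disk"
  shows "f \<eta> \<le> 0"
proof (rule ccontr)
  assume "\<not> f \<eta> \<le> 0"
  define e where "e = f \<eta> / 2"
  have e: "e > 0" using \<open>\<not> f \<eta> \<le> 0\<close> by (simp add: e_def)
  have sf: "smooth_on disk f" using f by (simp add: klein_harmonic_def)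
  define h where "h y = F y - e * defect y" for y
  have "continuous_on (cball 0 1) h" unfolding h_def defect_def by (intro continuous_intros c)
  then obtain m where m: "m \<in> cball 0 1" "\<And>y. y \<in> cball 0 1 \<Longrightarrow> h y \<le> h m"
    using continuous_attains_sup[of "cball (0::complex) 1" h] by auto
  have "h \<eta> > 0"
  proof -
    have "e * defect \<eta> \<le> e" using e defect_le_1[of \<eta>] by simp
    then show ?thesis using e by (simp add: h_def eq[OF eta] e_def)
  qed
  then have hm: "h m > 0" using m(2)[of \<eta>] eta by simp
  have mD: "m \<in> disk"
  proof (rule ccontr)
    assume "m \<notin> disk"
    then have "m \<in> circle" using m(1) by simp
    then have "defect m = 0" "F m \<le> 0" using bd by (simp_all add: defect_def flip: power2_norm_eq_inner)
    then show False using hm by (simp add: h_def)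
  qed
  define k where "k y = f y - e * defect y" for y
  have sk: "smooth_on disk k" unfolding k_def[abs_def]
    by (intro smooth_on_diff smooth_on_mult smooth_on_const smooth_on_defect sf open_ball)
  have nk: "nab k y = nab f y + (2 * e) *\<^sub>R y" if "y \<in> disk" for y
  proof (rule nab_eqI)
    show "(k has_derivative (\<lambda>a. (nab f y + (2 * e) *\<^sub>R y) \<bullet> a)) (at y)" unfolding k_def[abs_def]
      by (rule has_derivative_eq_rhs[OF has_derivative_diff[OF has_derivative_nab[OF sf that] has_derivative_mult_right[OF has_derivative_defect]]])
        (simp add: fun_eq_iff inner_add_left algebra_simps)
  qed
  have Hk: "Hess k m a b = Hess f m a b + 2 * e * (a \<bullet> b)" for a b
  proof -
    have "((\<lambda>y. nab f y + (2 * e) *\<^sub>R y) has_derivative (\<lambda>a. ddir (nab f) m a + (2 * e) *\<^sub>R a)) (at m)"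
      by (intro has_derivative_add has_derivative_scaleR_right has_derivative_ident smooth_on_has_derivative[of disk] smooth_on_nab sf mD)
    then have "(nab k has_derivative (\<lambda>a. ddir (nab f) m a + (2 * e) *\<^sub>R a)) (at m)"
      by (rule has_derivative_transform_within_open[OF _ open_ball mD]) (simp add: nk)
    then show ?thesis unfolding Hess_def ddir_eqI[OF \<open>(nab k has_derivative _) (at m)\<close>] by (simp add: inner_add_left)
  qed
  have "k y \<le> k m" if "y \<in> disk" for y using m(2)[of y] that mD by (simp add: h_def k_def eq[OF that] eq[OF mD])
  from Hess_local_max[OF sk mD this] have "Hess f m a a \<le> - 2 * e * (a \<bullet> a)" for a
    using Hk[of a a] by (metis add_le_cancel_right add.commute diff_add_cancel diff_ge_0_iff_ge minus_mult_left add_uminus_conv_diff uminus_add_conv_diff add_0)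
  note H = this
  have "Mtr m (Hess f m) = defect m * (Hess f m 1 1 + Hess f m \<i> \<i>) + Hess f m (\<i> * m) (\<i> * m)"
    unfolding Hess_def[abs_def] by (rule Mtr_positive[OF linear_Hess[OF sf mD] nab_symmetric[OF sf mD]])
  also have "\<dots> \<le> defect m * (- 4 * e) + 0"
  proof (rule add_mono)
    show "defect m * (Hess f m 1 1 + Hess f m \<i> \<i>) \<le> defect m * (- 4 * e)"
      using H[of 1] H[of \<i>] disk_pos(1)[OF mD] by (intro mult_left_mono) (auto simp: inner_complex_def)
    have "- 2 * e * ((\<i> * m) \<bullet> (\<i> * m)) \<le> 0" using e by (simp add: mult_nonpos_nonneg)
    then show "Hess f m (\<i> * m) (\<i> * m) \<le> 0" using H[of "\<i> * m"] by linarith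
  qed
  also have "\<dots> < 0" using e disk_pos(1)[OF mD] by (simp add: mult_pos_neg)
  finally show False using f mD by (simp add: klein_harmonic_def)
qed

text \<open>A function with nonpositive Hessian lies below its tangent planes.\<close>

lemma below_tangent:
  assumes f: "smooth_on disk f" and H: "\<And>\<eta> a. \<eta> \<in> disk \<Longrightarrow> Hess f \<eta> a a \<le> 0"
    and x: "x \<in> disk" and y: "y \<in> disk"
  shows "f y \<le> f x + nab f x \<bullet> (y - x)"
proof -
  have "x + (y - x) \<in> disk" using y by simp
  from second_order_mvt[OF f x this] obtain z w where zw: "0 < w" "w < z" "z < 1"
    "f (x + (y - x)) = f x + nab f x \<bullet> (y - x) + z * Hess f (x + w *\<^sub>R (y - x)) (y - x) (y - x)" by blast
  have "(1 - w) *\<^sub>R x + w *\<^sub>R y \<in> disk" by (rule convexD[OF convex_ball x y]) (use zw in auto)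
  then have "x + w *\<^sub>R (y - x) \<in> disk" by (simp add: algebra_simps)
  from H[OF this] have "z * Hess f (x + w *\<^sub>R (y - x)) (y - x) (y - x) \<le> 0" using zw by (simp add: mult_nonneg_nonpos)
  then show ?thesis using zw(4) by simp
qed

section \<open>The Poisson integral\<close>

lemma inner_cis_less_1: "\<eta> \<in> disk \<Longrightarrow> norm z = 1 \<Longrightarrow> \<eta> \<bullet> z < 1"
  using norm_cauchy_schwarz[of \<eta> z] by simp

text \<open>The integrals \<open>\<integral> \<psi>(t) (1 - \<eta>\<cdot>cis t)\<^sup>-\<^sup>k dt\<close> are closed under differentiation in \<open>\<eta>\<close>.\<close>

definition Ik :: "nat \<Rightarrow> (real \<Rightarrow> real) \<Rightarrow> complex \<Rightarrow> real" where
  "Ik k \<psi> \<eta> = integral {0..2*pi} (\<lambda>t. \<psi> t / (1 - \<eta> \<bullet> cis t) ^ k)"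

lemma continuous_on_kernel:
  assumes "continuous_on {0..2*pi} \<psi>" "\<eta> \<in> disk"
  shows "continuous_on {0..2*pi} (\<lambda>t. \<psi> t / (1 - \<eta> \<bullet> cis t) ^ k)"
  using inner_cis_less_1[OF assms(2)]
  by (intro continuous_intros assms(1)) (auto simp: less_imp_neq)

lemma has_derivative_Ik:
  assumes psi: "continuous_on {0..2*pi} \<psi>" and eta: "\<eta> \<in> disk"
  shows "(Ik k \<psi> has_derivative (\<lambda>v. real k * Ik (k + 1) (\<lambda>t. \<psi> t * (cis t \<bullet> v)) \<eta>)) (at \<eta>)"
proof -
  let ?G = "\<lambda>x t. (real k * \<psi> t / (1 - x \<bullet> cis t) ^ (k + 1)) *\<^sub>R cis t"
  have G: "continuous_on (disk \<times> {0..2*pi}) (\<lambda>(x, t). ?G x t)"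
    unfolding case_prod_unfold
  proof (intro continuous_intros)
    show "continuous_on (disk \<times> {0..2*pi}) (\<lambda>z. \<psi> (snd z))"
      by (rule continuous_on_compose2[OF psi]) (auto intro!: continuous_intros)
  qed (use inner_cis_less_1 in \<open>force simp: less_imp_neq\<close>)
  have Gx: "continuous_on {0..2*pi} (?G \<eta>)"
    using inner_cis_less_1[OF eta] by (intro continuous_intros psi) (auto simp: less_imp_neq)
  have "(Ik k \<psi> has_derivative (\<lambda>v. integral {0..2*pi} (?G \<eta>) \<bullet> v)) (at \<eta>)"
    unfolding Ik_def[abs_def]
  proof (rule leibniz_inner[OF open_ball convex_ball eta _ continuous_on_kernel[OF psi] G])
    fix x t assume x: "x \<in> disk"
    have ne: "1 - x \<bullet> cis t > 0" using inner_cis_less_1[OF x, of "cis t"] by simp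
    have d: "((\<lambda>x. inverse (1 - x \<bullet> cis t)) has_derivative (\<lambda>v. (v \<bullet> cis t) * inverse (1 - x \<bullet> cis t) ^ 2)) (at x)"
      by (rule has_derivative_eq_rhs[OF Deriv.has_derivative_inverse[OF _ has_derivative_diff[OF has_derivative_const has_derivative_inner_left[OF has_derivative_ident]]]])
        (use ne in \<open>auto simp: fun_eq_iff power2_eq_square\<close>)
    have "((\<lambda>x. \<psi> t * inverse (1 - x \<bullet> cis t) ^ k) has_derivative (\<lambda>v. \<psi> t * (of_nat k * ((v \<bullet> cis t) * inverse (1 - x \<bullet> cis t) ^ 2) * inverse (1 - x \<bullet> cis t) ^ (k - 1)))) (at x)"
      by (rule has_derivative_mult_right[OF has_derivative_power[OF d]])
    note m1 = this
    have m2: "\<psi> t * (of_nat k * ((v \<bullet> cis t) * inverse (1 - x \<bullet> cis t) ^ 2) * inverse (1 - x \<bullet> cis t) ^ (k - 1)) = ?G x t \<bullet> v" for v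
    proof -
      have "\<psi> t * (of_nat k * ((v \<bullet> cis t) * inverse D ^ 2) * inverse D ^ (k - 1)) = real k * \<psi> t / D ^ (k + 1) * (v \<bullet> cis t)" for D :: real
        by (cases k) (simp_all add: power2_eq_square divide_inverse power_inverse)
      then show ?thesis by (simp add: inner_commute)
    qed
    have "(\<lambda>x. \<psi> t / (1 - x \<bullet> cis t) ^ k) = (\<lambda>x. \<psi> t * inverse (1 - x \<bullet> cis t) ^ k)"
      by (simp add: fun_eq_iff divide_inverse power_inverse)
    then show "((\<lambda>x. \<psi> t / (1 - x \<bullet> cis t) ^ k) has_derivative (\<lambda>v. ?G x t \<bullet> v)) (at x)"
      using m1 unfolding m2 by simp
  qed auto
  moreover have "integral {0..2*pi} (?G \<eta>) \<bullet> v = real k * Ik (k + 1) (\<lambda>t. \<psi> t * (cis t \<bullet> v)) \<eta>" for v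
  proof -
    have "integral {0..2*pi} (?G \<eta>) \<bullet> v = integral {0..2*pi} (\<lambda>t. ?G \<eta> t \<bullet> v)"
      using integral_linear[OF integrable_continuous_real[OF Gx] bounded_linear_inner_left[of v]] by (simp add: o_def)
    also have "\<dots> = integral {0..2*pi} (\<lambda>t. real k * (\<psi> t * (cis t \<bullet> v) / (1 - \<eta> \<bullet> cis t) ^ (k + 1)))"
      by (simp add: mult.assoc)
    also have "\<dots> = real k * Ik (k + 1) (\<lambda>t. \<psi> t * (cis t \<bullet> v)) \<eta>"
      unfolding Ik_def by (rule integral_mult_right)
    finally show ?thesis .
  qed
  ultimately show ?thesis by simp
qed

lemma smooth_on_Ik:
  assumes "continuous_on {0..2*pi} \<psi>"
  shows "smooth_on disk (Ik k \<psi>)"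
proof (rule smooth_on_coinduct[where P="\<lambda>f. \<exists>c k \<psi>. continuous_on {0..2*pi} \<psi> \<and> f = (\<lambda>\<eta>. c * Ik k \<psi> \<eta>)"])
  show "\<exists>c k' \<psi>'. continuous_on {0..2*pi} \<psi>' \<and> Ik k \<psi> = (\<lambda>\<eta>. c * Ik k' \<psi>' \<eta>)"
    by (rule exI[of _ 1], rule exI[of _ k], rule exI[of _ \<psi>]) (use assms in simp)
next
  fix f :: "complex \<Rightarrow> real" and x
  assume "\<exists>c k \<psi>. continuous_on {0..2*pi} \<psi> \<and> f = (\<lambda>\<eta>. c * Ik k \<psi> \<eta>)" and x: "x \<in> disk"
  then obtain c k \<psi> where f: "continuous_on {0..2*pi} \<psi>" "f = (\<lambda>\<eta>. c * Ik k \<psi> \<eta>)" by blast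
  show "f differentiable (at x)" unfolding f(2)
    using has_derivative_mult_right[OF has_derivative_Ik[OF f(1) x]] by (rule differentiableI)
next
  fix f :: "complex \<Rightarrow> real" and v
  assume "\<exists>c k \<psi>. continuous_on {0..2*pi} \<psi> \<and> f = (\<lambda>\<eta>. c * Ik k \<psi> \<eta>)"
  then obtain c k \<psi> where f: "continuous_on {0..2*pi} \<psi>" "f = (\<lambda>\<eta>. c * Ik k \<psi> \<eta>)" by blast
  have "ddir f x v = (c * real k) * Ik (k + 1) (\<lambda>t. \<psi> t * (cis t \<bullet> v)) x" if "x \<in> disk" for x
    unfolding f(2) using ddir_eqI[OF has_derivative_mult_right[OF has_derivative_Ik[OF f(1) that]]] by simp
  moreover have "continuous_on {0..2*pi} (\<lambda>t. \<psi> t * (cis t \<bullet> v))" by (intro continuous_intros f(1))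
  ultimately show "\<exists>h. (\<exists>c k \<psi>. continuous_on {0..2*pi} \<psi> \<and> h = (\<lambda>\<eta>. c * Ik k \<psi> \<eta>)) \<and> (\<forall>x\<in>disk. ddir f x v = h x)"
    by blast
qed simp

text \<open>The basic integral; with \<open>\<eta> = 2p / (1 + |p|\<^sup>2)\<close> it is the mean value property of
  \<open>(1 + cnj p z) / (1 - cnj p z)\<close>.\<close>

lemma Ik_1_one:
  assumes eta: "\<eta> \<in> disk"
  shows "Ik 1 (\<lambda>t. 1) \<eta> = 2 * pi / rho \<eta>"
proof -
  note dp = disk_pos[OF eta]
  define p where "p = \<eta> /\<^sub>R (1 + rho \<eta>)"
  have r1: "rho \<eta> \<le> 1" using defect_le_1[of \<eta>] by (simp add: rho_def)
  have pp: "p \<bullet> p = (1 - rho \<eta>) / (1 + rho \<eta>)"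
  proof -
    have "p \<bullet> p = (1 - rho \<eta> * rho \<eta>) / ((1 + rho \<eta>) * (1 + rho \<eta>))"
    proof -
      have "p \<bullet> p = (\<eta> \<bullet> \<eta>) / ((1 + rho \<eta>) * (1 + rho \<eta>))" by (simp add: p_def divide_inverse)
      then show ?thesis using dp by (simp add: inner_self_defect)
    qed
    also have "1 - rho \<eta> * rho \<eta> = (1 - rho \<eta>) * (1 + rho \<eta>)" by (simp add: algebra_simps)
    finally show ?thesis using dp by simp
  qed
  have "p \<bullet> p < 1" unfolding pp using dp by (simp add: divide_less_eq)
  then have np: "norm p < 1" by (simp add: power_less_one_iff abs_square_less_1 flip: power2_norm_eq_inner)
  define h where "h z = (1 + cnj p * z) / (1 - cnj p * z)" for z
  have nz: "1 - cnj p * z \<noteq> 0" if "norm z \<le> 1" for z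
  proof
    assume "1 - cnj p * z = 0"
    then have "norm (cnj p * z) = 1" by (metis eq_iff_diff_eq_0 norm_one)
    moreover have "norm (cnj p * z) \<le> norm p" using that by (simp add: norm_mult mult_left_le)
    ultimately show False using np by simp
  qed
  have "h holomorphic_on cball 0 1" unfolding h_def
    by (intro holomorphic_intros) (use nz in auto)
  then have "((\<lambda>u. h u / (u - 0)) has_contour_integral 2 * complex_of_real pi * \<i> * h 0) (circlepath 0 1)"
    by (intro Cauchy_integral_circlepath_simple) auto
  then have "((\<lambda>t. h (0 + of_real 1 * cis t) / (0 + of_real 1 * cis t - 0) * of_real 1 * \<i> * cis t) has_integral 2 * complex_of_real pi * \<i> * h 0) {0..2*pi}"
    unfolding circlepath_def by (subst (asm) has_contour_integral_part_circlepath_iff) (simp only: mult_pos_pos pi_gt_zero zero_less_numeral)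
  moreover have "h (0 + of_real 1 * cis t) / (0 + of_real 1 * cis t - 0) * of_real 1 * \<i> * cis t = \<i> * h (cis t)" for t
    by simp
  ultimately have "((\<lambda>t. \<i> * h (cis t)) has_integral 2 * complex_of_real pi * \<i> * h 0) {0..2*pi}" by (simp only:)
  then have "((\<lambda>t. \<i> * h (cis t)) has_integral \<i> * (2 * complex_of_real pi)) {0..2*pi}"
    by (simp add: h_def mult_ac)
  from has_integral_mult_right[OF this, of "- \<i>"]
  have "((\<lambda>t. h (cis t)) has_integral (2 * complex_of_real pi)) {0..2*pi}" by simp
  from has_integral_Re[OF this] have "((\<lambda>t. Re (h (cis t))) has_integral 2 * pi) {0..2*pi}" by simp
  from has_integral_mult_right[OF this, of "1 / rho \<eta>"]
  have I: "((\<lambda>t. 1 / rho \<eta> * Re (h (cis t))) has_integral 2 * pi / rho \<eta>) {0..2*pi}" by simp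
  have "1 / rho \<eta> * Re (h (cis t)) = 1 / (1 - \<eta> \<bullet> cis t)" for t
  proof -
    define z where "z = cis t"
    have z: "z * cnj z = 1" "norm z = 1" by (simp_all add: z_def cis_cnj cis_mult)
    have D: "1 - \<eta> \<bullet> z > 0" using inner_cis_less_1[OF eta z(2)] by simp
    have e: "\<eta> = (1 + rho \<eta>) *\<^sub>R p" using dp by (simp add: p_def)
    have N: "(norm (1 - cnj p * z))\<^sup>2 = 2 * (1 - \<eta> \<bullet> z) / (1 + rho \<eta>)"
    proof -
      have zz: "(Re z)\<^sup>2 + (Im z)\<^sup>2 = 1" using z(2) by (metis cmod_power2 power_one)
      have "(norm (1 - cnj p * z))\<^sup>2 = 1 + (p \<bullet> p) * ((Re z)\<^sup>2 + (Im z)\<^sup>2) - 2 * (p \<bullet> z)"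
        unfolding cmod_power2 inner_complex_def by (simp add: power2_eq_square algebra_simps)
      also have "\<dots> = 1 + p \<bullet> p - 2 * (p \<bullet> z)" by (simp add: zz)
      also have "p \<bullet> z = (\<eta> \<bullet> z) / (1 + rho \<eta>)" using dp by (simp add: p_def divide_inverse)
      also have "1 + p \<bullet> p = 2 / (1 + rho \<eta>)" unfolding pp using dp by (simp add: divide_simps)
      finally show ?thesis by (simp add: diff_divide_distrib right_diff_distrib)
    qed
    have "Re (h z) = Re ((1 + cnj p * z) * cnj (1 - cnj p * z)) / (norm (1 - cnj p * z))\<^sup>2"
    proof -
      have "h z = ((1 + cnj p * z) * cnj (1 - cnj p * z)) / of_real ((norm (1 - cnj p * z))\<^sup>2)"
        unfolding h_def by (subst complex_div_cnj) simp
      then show ?thesis by (simp only: Re_divide_of_real)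
    qed
    also have "Re ((1 + cnj p * z) * cnj (1 - cnj p * z)) = 1 - p \<bullet> p"
    proof -
      have "(cnj p * z) * cnj (cnj p * z) = (p * cnj p) * (z * cnj z)" by (simp add: mult_ac)
      also have "\<dots> = of_real (p \<bullet> p)" unfolding z(1) by (simp add: complex_mult_cnj inner_complex_def power2_eq_square)
      finally have "Re ((cnj p * z) * cnj (cnj p * z)) = p \<bullet> p" by simp
      then show ?thesis by (simp add: algebra_simps)
    qed
    also have "1 - p \<bullet> p = 2 * rho \<eta> / (1 + rho \<eta>)" unfolding pp using dp by (simp add: divide_simps)
    finally show ?thesis unfolding N z_def[symmetric] using dp(2) D by (simp add: divide_simps) (simp add: algebra_simps)
  qed
  then have "((\<lambda>t. 1 / (1 - \<eta> \<bullet> cis t) ^ 1) has_integral 2 * pi / rho \<eta>) {0..2*pi}" using I by simp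
  then show ?thesis unfolding Ik_def by (rule integral_unique)
qed

text \<open>The kernel is \<open>\<rho>\<^sup>3 / (2\<pi> (1 - \<eta>\<cdot>z)\<^sup>2)\<close>; one factor \<open>\<rho>\<close> is kept apart because the solution \<open>u\<close> is the other one.\<close>

definition poisson :: "(complex \<Rightarrow> real) \<Rightarrow> complex \<Rightarrow> real" where
  "poisson \<phi> \<eta> = rho \<eta> * (defect \<eta> / (2 * pi) * Ik 2 (\<lambda>t. \<phi> (cis t)) \<eta>)"

lemma continuous_on_cis: "continuous_on circle \<phi> \<Longrightarrow> continuous_on A (\<lambda>t. \<phi> (cis t))"
  by (rule continuous_on_compose2) (auto intro!: continuous_intros)

lemma Ik_add:
  assumes "continuous_on {0..2*pi} \<psi>" "continuous_on {0..2*pi} \<psi>'" "\<eta> \<in> disk"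
  shows "Ik k (\<lambda>t. \<psi> t + \<psi>' t) \<eta> = Ik k \<psi> \<eta> + Ik k \<psi>' \<eta>"
  unfolding Ik_def add_divide_distrib
  by (intro integral_add integrable_continuous_real continuous_on_kernel assms)

lemma Ik_cmult: "Ik k (\<lambda>t. c * \<psi> t) \<eta> = c * Ik k \<psi> \<eta>"
  unfolding Ik_def by (simp flip: times_divide_eq_right)

lemma Ik_mono:
  assumes "continuous_on {0..2*pi} \<psi>" "continuous_on {0..2*pi} \<psi>'" "\<eta> \<in> disk" "\<And>t. \<psi> t \<le> \<psi>' t"
  shows "Ik k \<psi> \<eta> \<le> Ik k \<psi>' \<eta>"
  unfolding Ik_def
  using inner_cis_less_1[OF assms(3)]
  by (intro integral_le integrable_continuous_real continuous_on_kernel assms divide_right_mono)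
    (simp add: less_imp_le)

text \<open>The Poisson integral reproduces affine functions; the linear part follows from the
  constant one by differentiation in \<open>\<eta>\<close>.\<close>

lemma poisson_affine:
  assumes eta: "\<eta> \<in> disk"
  shows "poisson (\<lambda>z. l \<bullet> z + c) \<eta> = l \<bullet> \<eta> + c"
proof -
  note p = disk_pos[OF eta]
  have l: "Ik 2 (\<lambda>t. cis t \<bullet> v) \<eta> = 2 * pi * (\<eta> \<bullet> v) / rho \<eta> ^ 3" for v
  proof -
    have "((\<lambda>\<eta>. 2 * pi * (1 / rho \<eta> ^ 1) *\<^sub>R (1::real)) has_derivative
       (\<lambda>v. 2 * pi * (1 / rho \<eta> ^ (1 + 2)) *\<^sub>R (defect \<eta> *\<^sub>R 0 + (real 1 * (\<eta> \<bullet> v)) *\<^sub>R 1))) (at \<eta>)"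
      using has_derivative_mult_right[OF has_derivative_div_rho[OF eta has_derivative_const[of "1::real"], of 1], of "2 * pi"] by simp
    then have "(Ik 1 (\<lambda>t. 1) has_derivative (\<lambda>v. 2 * pi * (1 / rho \<eta> ^ (1 + 2)) *\<^sub>R (defect \<eta> *\<^sub>R 0 + (real 1 * (\<eta> \<bullet> v)) *\<^sub>R 1))) (at \<eta>)"
      by (rule has_derivative_transform_within_open[OF _ open_ball eta]) (simp add: Ik_1_one[unfolded One_nat_def])
    from ddir_eqI[OF this, of v] show ?thesis
      using ddir_eqI[OF has_derivative_Ik[OF _ eta, of "\<lambda>t. 1" 1], of v] by (simp add: numeral_3_eq_3 numeral_2_eq_2)
  qed
  have one: "Ik 2 (\<lambda>t. 1) \<eta> = 2 * pi / rho \<eta> ^ 3"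
  proof -
    have "Ik 2 (\<lambda>t. 1) \<eta> = Ik 1 (\<lambda>t. 1) \<eta> + Ik 2 (\<lambda>t. cis t \<bullet> \<eta>) \<eta>"
    proof -
      have "1 / (1 - \<eta> \<bullet> cis t) ^ 2 = 1 / (1 - \<eta> \<bullet> cis t) ^ 1 + (cis t \<bullet> \<eta>) / (1 - \<eta> \<bullet> cis t) ^ 2" for t
        using inner_cis_less_1[OF eta, of "cis t"] by (simp add: inner_commute[of _ \<eta>] divide_simps power2_eq_square)
      then have "Ik 2 (\<lambda>t. 1) \<eta> = integral {0..2*pi} (\<lambda>t. 1 / (1 - \<eta> \<bullet> cis t) ^ 1 + (cis t \<bullet> \<eta>) / (1 - \<eta> \<bullet> cis t) ^ 2)"
        unfolding Ik_def by simp
      also have "\<dots> = Ik 1 (\<lambda>t. 1) \<eta> + Ik 2 (\<lambda>t. cis t \<bullet> \<eta>) \<eta>"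
        unfolding Ik_def by (intro integral_add integrable_continuous_real continuous_on_kernel eta continuous_intros)
      finally show ?thesis .
    qed
    also have "\<dots> = 2 * pi / rho \<eta> + 2 * pi * (1 - defect \<eta>) / rho \<eta> ^ 3"
      by (simp only: Ik_1_one[OF eta] l inner_self_defect)
    also have "2 * pi / rho \<eta> = 2 * pi * defect \<eta> / rho \<eta> ^ 3"
      using p by (simp add: power3_eq_cube divide_simps)
    finally show ?thesis by (simp add: add_divide_distrib[symmetric] algebra_simps)
  qed
  have "Ik 2 (\<lambda>t. l \<bullet> cis t + c) \<eta> = Ik 2 (\<lambda>t. cis t \<bullet> l) \<eta> + c * Ik 2 (\<lambda>t. 1) \<eta>"
    using Ik_add[OF _ _ eta, of "\<lambda>t. cis t \<bullet> l" "\<lambda>t. c * 1" 2] Ik_cmult[of 2 c "\<lambda>t. 1" \<eta>]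
    by (simp add: inner_commute[of l] continuous_intros)
  also have "\<dots> = 2 * pi / rho \<eta> ^ 3 * (l \<bullet> \<eta> + c)" unfolding l one by (simp add: inner_commute algebra_simps add_divide_distrib)
  finally have "poisson (\<lambda>z. l \<bullet> z + c) \<eta> = rho \<eta> * defect \<eta> / rho \<eta> ^ 3 * (l \<bullet> \<eta> + c)"
    by (simp add: poisson_def)
  also have "rho \<eta> * defect \<eta> / rho \<eta> ^ 3 = 1" using p by (simp add: rho_power3[OF eta])
  finally show ?thesis by simp
qed

text \<open>Used to bring integrals with different exponents under one integral sign.\<close>

lemma Ik_lift:
  assumes "\<eta> \<in> disk"
  shows "Ik k \<psi> \<eta> = Ik (k + j) (\<lambda>t. \<psi> t * (1 - \<eta> \<bullet> cis t) ^ j) \<eta>"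
  unfolding Ik_def
proof (rule integral_cong)
  fix t :: real
  show "\<psi> t / (1 - \<eta> \<bullet> cis t) ^ k = \<psi> t * (1 - \<eta> \<bullet> cis t) ^ j / (1 - \<eta> \<bullet> cis t) ^ (k + j)"
    using inner_cis_less_1[OF assms, of "cis t"] by (simp add: power_add)
qed

context
  fixes \<phi> :: "complex \<Rightarrow> real"
  assumes phi: "continuous_on circle \<phi>"
begin

lemma cont_phi: "continuous_on {0..2*pi} (\<lambda>t. \<phi> (cis t))"
  by (rule continuous_on_cis[OF phi])

lemma smooth_on_poisson_quotient: "smooth_on disk (\<lambda>\<eta>. defect \<eta> / (2 * pi) * Ik 2 (\<lambda>t. \<phi> (cis t)) \<eta>)"
proof -
  have "smooth_on disk (\<lambda>\<eta>. (1 / (2 * pi)) * (defect \<eta> * Ik 2 (\<lambda>t. \<phi> (cis t)) \<eta>))"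
    by (intro smooth_on_mult smooth_on_const smooth_on_defect smooth_on_Ik cont_phi open_ball)
  then show ?thesis by simp
qed

lemma smooth_on_poisson: "smooth_on disk (poisson \<phi>)"
  unfolding poisson_def[abs_def] by (rule smooth_on_rescale[OF smooth_on_poisson_quotient])

lemma has_derivative_poisson:
  assumes eta: "\<eta> \<in> disk"
  shows "(poisson \<phi> has_derivative (\<lambda>a. (1 / (2 * pi)) * (rho \<eta> * defect \<eta> * (2 * Ik 3 (\<lambda>t. \<phi> (cis t) * (cis t \<bullet> a)) \<eta>)
     + (- 3 * rho \<eta> * (\<eta> \<bullet> a)) * Ik 2 (\<lambda>t. \<phi> (cis t)) \<eta>))) (at \<eta>)"
proof -
  have I: "(Ik 2 (\<lambda>t. \<phi> (cis t)) has_derivative (\<lambda>a. 2 * Ik 3 (\<lambda>t. \<phi> (cis t) * (cis t \<bullet> a)) \<eta>)) (at \<eta>)"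
    using has_derivative_Ik[OF cont_phi eta, of 2] by (simp add: numeral_3_eq_3 numeral_2_eq_2)
  have "poisson \<phi> = (\<lambda>y. (1 / (2 * pi)) * ((rho y * defect y) * Ik 2 (\<lambda>t. \<phi> (cis t)) y))"
    by (simp add: fun_eq_iff poisson_def)
  then show ?thesis
    using has_derivative_mult_right[OF has_derivative_mult[OF has_derivative_rho_defect[OF eta] I], of "1 / (2 * pi)"] by simp
qed

lemma nab_poisson:
  assumes eta: "\<eta> \<in> disk"
  shows "nab (poisson \<phi>) \<eta> \<bullet> a = (1 / (2 * pi)) * (rho \<eta> * defect \<eta> * (2 * Ik 3 (\<lambda>t. \<phi> (cis t) * (cis t \<bullet> a)) \<eta>)
     + (- 3 * rho \<eta> * (\<eta> \<bullet> a)) * Ik 2 (\<lambda>t. \<phi> (cis t)) \<eta>)"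
  using ddir_nab[OF differentiableI[OF has_derivative_poisson[OF eta]]] ddir_eqI[OF has_derivative_poisson[OF eta]] by simp

end

text \<open>The Hessian of the Poisson kernel, times \<open>2\<pi> (1 - \<eta>\<cdot>z)\<^sup>4\<close>, is a form of rank one minus its trace part.\<close>

definition kernel_form :: "complex \<Rightarrow> complex \<Rightarrow> complex \<Rightarrow> real" where
  "kernel_form \<eta> z a = z \<bullet> a - (1 - \<eta> \<bullet> z) * (\<eta> \<bullet> a) / defect \<eta>"

definition kernel_Hess :: "complex \<Rightarrow> complex \<Rightarrow> complex \<Rightarrow> complex \<Rightarrow> real" where
  "kernel_Hess \<eta> z a b = 6 * rho \<eta> ^ 3 * (kernel_form \<eta> z a * kernel_form \<eta> z b)
     - 3 * rho \<eta> ^ 3 * klein_metric \<eta> a b * (1 - \<eta> \<bullet> z)\<^sup>2"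

lemma Hess_eqI:
  assumes f: "smooth_on disk f" and eta: "\<eta> \<in> disk" and D: "((\<lambda>y. nab f y \<bullet> b) has_derivative L) (at \<eta>)"
  shows "Hess f \<eta> a b = L a"
proof -
  have "((\<lambda>y. nab f y \<bullet> b) has_derivative (\<lambda>a. ddir (nab f) \<eta> a \<bullet> b)) (at \<eta>)"
    by (intro has_derivative_inner_left smooth_on_has_derivative[of disk] smooth_on_nab f eta)
  from has_derivative_unique[OF this D] show ?thesis by (simp add: Hess_def fun_eq_iff)
qed

lemma Hess_poisson:
  assumes phi: "continuous_on circle \<phi>" and eta: "\<eta> \<in> disk"
  shows "Hess (poisson \<phi>) \<eta> a b = Ik 4 (\<lambda>t. \<phi> (cis t) * kernel_Hess \<eta> (cis t) a b) \<eta> / (2 * pi)"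
proof -
  note p = disk_pos[OF eta] and c = cont_phi[OF phi]
  let ?psi = "\<lambda>t. \<phi> (cis t)"
  have cb: "continuous_on {0..2*pi} (\<lambda>t. ?psi t * (cis t \<bullet> b))" by (intro continuous_intros c)
  have I2: "(Ik 2 ?psi has_derivative (\<lambda>a. 2 * Ik 3 (\<lambda>t. ?psi t * (cis t \<bullet> a)) \<eta>)) (at \<eta>)"
    using has_derivative_Ik[OF c eta, of 2] by (simp add: numeral_3_eq_3 numeral_2_eq_2)
  have I3: "(Ik 3 (\<lambda>t. ?psi t * (cis t \<bullet> b)) has_derivative (\<lambda>a. 3 * Ik 4 (\<lambda>t. ?psi t * (cis t \<bullet> b) * (cis t \<bullet> a)) \<eta>)) (at \<eta>)"
    using has_derivative_Ik[OF cb eta, of 3] by (simp add: eval_nat_numeral)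
  have rb: "((\<lambda>y. - 3 * rho y * (y \<bullet> b)) has_derivative (\<lambda>a. - 3 * rho \<eta> * (a \<bullet> b) + 3 * ((\<eta> \<bullet> a) * (\<eta> \<bullet> b)) / rho \<eta>)) (at \<eta>)"
    by (rule has_derivative_eq_rhs[OF has_derivative_mult[OF has_derivative_mult_right[OF has_derivative_rho[OF eta]] has_derivative_inner_left[OF has_derivative_ident]]])
      (simp add: fun_eq_iff)
  have D: "((\<lambda>y. nab (poisson \<phi>) y \<bullet> b) has_derivative (\<lambda>a. (1 / (2 * pi)) * (
     (rho \<eta> * defect \<eta> * (2 * (3 * Ik 4 (\<lambda>t. ?psi t * (cis t \<bullet> b) * (cis t \<bullet> a)) \<eta>)) + (- 3 * rho \<eta> * (\<eta> \<bullet> a)) * (2 * Ik 3 (\<lambda>t. ?psi t * (cis t \<bullet> b)) \<eta>))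
     + ((- 3 * rho \<eta> * (\<eta> \<bullet> b)) * (2 * Ik 3 (\<lambda>t. ?psi t * (cis t \<bullet> a)) \<eta>)
       + (- 3 * rho \<eta> * (a \<bullet> b) + 3 * ((\<eta> \<bullet> a) * (\<eta> \<bullet> b)) / rho \<eta>) * Ik 2 ?psi \<eta>)))) (at \<eta>)"
  proof (rule has_derivative_transform_within_open[OF _ open_ball eta])
    show "((\<lambda>y. (1 / (2 * pi)) * ((rho y * defect y) * (2 * Ik 3 (\<lambda>t. ?psi t * (cis t \<bullet> b)) y)
     + (- 3 * rho y * (y \<bullet> b)) * Ik 2 ?psi y)) has_derivative (\<lambda>a. (1 / (2 * pi)) * (
     (rho \<eta> * defect \<eta> * (2 * (3 * Ik 4 (\<lambda>t. ?psi t * (cis t \<bullet> b) * (cis t \<bullet> a)) \<eta>)) + (- 3 * rho \<eta> * (\<eta> \<bullet> a)) * (2 * Ik 3 (\<lambda>t. ?psi t * (cis t \<bullet> b)) \<eta>))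
     + ((- 3 * rho \<eta> * (\<eta> \<bullet> b)) * (2 * Ik 3 (\<lambda>t. ?psi t * (cis t \<bullet> a)) \<eta>)
       + (- 3 * rho \<eta> * (a \<bullet> b) + 3 * ((\<eta> \<bullet> a) * (\<eta> \<bullet> b)) / rho \<eta>) * Ik 2 ?psi \<eta>)))) (at \<eta>)"
      by (intro has_derivative_mult_right has_derivative_add has_derivative_mult has_derivative_rho_defect[OF eta] I3 I2 rb)
  qed (simp add: nab_poisson[OF phi])
  have e3: "Ik 3 (\<lambda>t. ?psi t * (cis t \<bullet> v)) \<eta> = Ik 4 (\<lambda>t. ?psi t * (cis t \<bullet> v) * (1 - \<eta> \<bullet> cis t) ^ 1) \<eta>" for v
    using Ik_lift[OF eta, of 3 _ 1] by (simp add: eval_nat_numeral)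
  have e2: "Ik 2 ?psi \<eta> = Ik 4 (\<lambda>t. ?psi t * (1 - \<eta> \<bullet> cis t) ^ 2) \<eta>"
    using Ik_lift[OF eta, of 2 _ 2] by (simp add: eval_nat_numeral)
  have lin: "c1 * Ik 4 f1 \<eta> + c2 * Ik 4 f2 \<eta> + (c3 * Ik 4 f3 \<eta> + c4 * Ik 4 f4 \<eta>) = Ik 4 (\<lambda>t. c1 * f1 t + c2 * f2 t + (c3 * f3 t + c4 * f4 t)) \<eta>"
    if "continuous_on {0..2*pi} f1" "continuous_on {0..2*pi} f2" "continuous_on {0..2*pi} f3" "continuous_on {0..2*pi} f4" for c1 c2 c3 c4 f1 f2 f3 f4
    using that by (simp add: Ik_add[OF _ _ eta] Ik_cmult continuous_intros)
  have "Hess (poisson \<phi>) \<eta> a b = (1 / (2 * pi)) * (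
     (6 * (rho \<eta> * defect \<eta>)) * Ik 4 (\<lambda>t. ?psi t * (cis t \<bullet> b) * (cis t \<bullet> a)) \<eta> + (- 6 * rho \<eta> * (\<eta> \<bullet> a)) * Ik 4 (\<lambda>t. ?psi t * (cis t \<bullet> b) * (1 - \<eta> \<bullet> cis t) ^ 1) \<eta>
     + ((- 6 * rho \<eta> * (\<eta> \<bullet> b)) * Ik 4 (\<lambda>t. ?psi t * (cis t \<bullet> a) * (1 - \<eta> \<bullet> cis t) ^ 1) \<eta>
       + (- 3 * rho \<eta> * (a \<bullet> b) + 3 * ((\<eta> \<bullet> a) * (\<eta> \<bullet> b)) / rho \<eta>) * Ik 4 (\<lambda>t. ?psi t * (1 - \<eta> \<bullet> cis t) ^ 2) \<eta>))"
    unfolding Hess_eqI[OF smooth_on_poisson[OF phi] eta D] e3 e2 by (simp only: mult.assoc[symmetric]) simp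
  also have "\<dots> = (1 / (2 * pi)) * Ik 4 (\<lambda>t. (6 * (rho \<eta> * defect \<eta>)) * (?psi t * (cis t \<bullet> b) * (cis t \<bullet> a))
       + (- 6 * rho \<eta> * (\<eta> \<bullet> a)) * (?psi t * (cis t \<bullet> b) * (1 - \<eta> \<bullet> cis t) ^ 1)
     + ((- 6 * rho \<eta> * (\<eta> \<bullet> b)) * (?psi t * (cis t \<bullet> a) * (1 - \<eta> \<bullet> cis t) ^ 1)
       + (- 3 * rho \<eta> * (a \<bullet> b) + 3 * ((\<eta> \<bullet> a) * (\<eta> \<bullet> b)) / rho \<eta>) * (?psi t * (1 - \<eta> \<bullet> cis t) ^ 2))) \<eta>"
    by (subst lin) (intro continuous_intros c refl)+
  also have "(\<lambda>t. (6 * (rho \<eta> * defect \<eta>)) * (?psi t * (cis t \<bullet> b) * (cis t \<bullet> a))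
       + (- 6 * rho \<eta> * (\<eta> \<bullet> a)) * (?psi t * (cis t \<bullet> b) * (1 - \<eta> \<bullet> cis t) ^ 1)
     + ((- 6 * rho \<eta> * (\<eta> \<bullet> b)) * (?psi t * (cis t \<bullet> a) * (1 - \<eta> \<bullet> cis t) ^ 1)
       + (- 3 * rho \<eta> * (a \<bullet> b) + 3 * ((\<eta> \<bullet> a) * (\<eta> \<bullet> b)) / rho \<eta>) * (?psi t * (1 - \<eta> \<bullet> cis t) ^ 2)))
     = (\<lambda>t. ?psi t * kernel_Hess \<eta> (cis t) a b)"
  proof
    fix t
    define D where "D = 1 - \<eta> \<bullet> cis t"
    define q where "q = defect \<eta>"
    have q: "q \<noteq> 0" "x / rho \<eta> = rho \<eta> * (x / q)" for x using p by (simp_all add: q_def divide_simps)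
    show "(6 * (rho \<eta> * defect \<eta>)) * (?psi t * (cis t \<bullet> b) * (cis t \<bullet> a))
       + (- 6 * rho \<eta> * (\<eta> \<bullet> a)) * (?psi t * (cis t \<bullet> b) * (1 - \<eta> \<bullet> cis t) ^ 1)
     + ((- 6 * rho \<eta> * (\<eta> \<bullet> b)) * (?psi t * (cis t \<bullet> a) * (1 - \<eta> \<bullet> cis t) ^ 1)
       + (- 3 * rho \<eta> * (a \<bullet> b) + 3 * ((\<eta> \<bullet> a) * (\<eta> \<bullet> b)) / rho \<eta>) * (?psi t * (1 - \<eta> \<bullet> cis t) ^ 2))
       = ?psi t * kernel_Hess \<eta> (cis t) a b"
      unfolding kernel_Hess_def kernel_form_def rho_power3[OF eta] klein_metric_eq[OF eta] D_def[symmetric] q_def[symmetric] q(2)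
      using q(1) by (simp add: field_simps power2_eq_square)
  qed
  finally show ?thesis by simp
qed

text \<open>The dual norm of the kernel form is \<open>1 - \<eta>\<cdot>z\<close>.\<close>

lemma kernel_form_norm:
  assumes eta: "\<eta> \<in> disk" and z: "norm z = 1"
  defines "m \<equiv> z - ((1 - \<eta> \<bullet> z) / defect \<eta>) *\<^sub>R \<eta>"
  shows "kernel_form \<eta> z a = m \<bullet> a" "m \<bullet> m - (\<eta> \<bullet> m)\<^sup>2 = (1 - \<eta> \<bullet> z)\<^sup>2 / defect \<eta>"
proof -
  show "kernel_form \<eta> z a = m \<bullet> a" by (simp add: kernel_form_def m_def inner_diff_left)
  define D q where "D = 1 - \<eta> \<bullet> z" and "q = defect \<eta>"
  have q: "q \<noteq> 0" using disk_pos[OF eta] by (simp add: q_def)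
  have zz: "z \<bullet> z = 1" using z by (simp flip: power2_norm_eq_inner)
  have ez: "\<eta> \<bullet> z = 1 - D" by (simp add: D_def)
  have ee: "\<eta> \<bullet> \<eta> = 1 - q" by (simp add: q_def inner_self_defect)
  have "(z - k *\<^sub>R \<eta>) \<bullet> (z - k *\<^sub>R \<eta>) = 1 - 2 * k * (1 - D) + k\<^sup>2 * (1 - q)" for k
    by (simp add: inner_diff_left inner_diff_right inner_commute[of z \<eta>] zz ez ee)
      (simp add: power2_eq_square algebra_simps)
  then have mm: "m \<bullet> m = 1 - 2 * (D / q) * (1 - D) + (D / q)\<^sup>2 * (1 - q)"
    unfolding m_def D_def[symmetric] q_def[symmetric] by this
  have em: "\<eta> \<bullet> m = (1 - D) - (D / q) * (1 - q)"
    unfolding m_def D_def[symmetric] q_def[symmetric]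
    by (simp add: inner_diff_right ez ee)
  show "m \<bullet> m - (\<eta> \<bullet> m)\<^sup>2 = (1 - \<eta> \<bullet> z)\<^sup>2 / defect \<eta>"
    unfolding mm em D_def[symmetric] q_def[symmetric] using q by (simp add: field_simps power2_eq_square)
qed

lemma kernel_form_bound:
  assumes eta: "\<eta> \<in> disk" and z: "norm z = 1"
  shows "(kernel_form \<eta> z a)\<^sup>2 \<le> (1 - \<eta> \<bullet> z)\<^sup>2 * klein_metric \<eta> a a"
proof -
  note p = disk_pos[OF eta]
  define m where "m = z - ((1 - \<eta> \<bullet> z) / defect \<eta>) *\<^sub>R \<eta>"
  note n = kernel_form_norm[OF eta z, folded m_def]
  define s where "s = defect \<eta> *\<^sub>R (m - (\<eta> \<bullet> m) *\<^sub>R \<eta>)"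
  have s: "klein_metric \<eta> s c = m \<bullet> c" for c unfolding s_def by (rule klein_metric_sharp[OF eta])
  have "klein_metric \<eta> s s = defect \<eta> * (m \<bullet> m - (\<eta> \<bullet> m)\<^sup>2)"
    unfolding s by (simp add: s_def inner_diff_right power2_eq_square inner_commute)
  also have "\<dots> = (1 - \<eta> \<bullet> z)\<^sup>2" unfolding n(2) using p by simp
  finally have ss: "klein_metric \<eta> s s = (1 - \<eta> \<bullet> z)\<^sup>2" .
  have "(m \<bullet> a)\<^sup>2 \<le> (sqrt (klein_metric \<eta> s s) * sqrt (klein_metric \<eta> a a))\<^sup>2"
    using klein_metric_cauchy_schwarz[OF eta, of s a] unfolding s by (metis abs_ge_zero power2_abs power_mono)
  also have "\<dots> = (1 - \<eta> \<bullet> z)\<^sup>2 * klein_metric \<eta> a a"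
    using klein_metric_pos(2)[OF eta, of a] by (simp add: ss power_mult_distrib)
  finally show ?thesis unfolding n(1) .
qed

lemma Mtr_kernel_Hess:
  assumes eta: "\<eta> \<in> disk" and z: "norm z = 1"
  shows "Mtr \<eta> (kernel_Hess \<eta> z) = 0"
proof -
  note p = disk_pos[OF eta]
  define m where "m = z - ((1 - \<eta> \<bullet> z) / defect \<eta>) *\<^sub>R \<eta>"
  note n = kernel_form_norm[OF eta z, folded m_def]
  have "kernel_Hess \<eta> z = (\<lambda>a b. (6 * rho \<eta> ^ 3) *\<^sub>R ((m \<bullet> a) *\<^sub>R (m \<bullet> b)) - (3 * rho \<eta> ^ 3 * (1 - \<eta> \<bullet> z)\<^sup>2) *\<^sub>R klein_metric \<eta> a b)"
    by (simp add: fun_eq_iff kernel_Hess_def n)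
  then have "Mtr \<eta> (kernel_Hess \<eta> z) = Mtr \<eta> (\<lambda>a b. (6 * rho \<eta> ^ 3) *\<^sub>R ((m \<bullet> a) *\<^sub>R (m \<bullet> b)) - (3 * rho \<eta> ^ 3 * (1 - \<eta> \<bullet> z)\<^sup>2) *\<^sub>R klein_metric \<eta> a b)"
    by (rule arg_cong)
  also have "\<dots> = (6 * rho \<eta> ^ 3) *\<^sub>R (m \<bullet> (m - (\<eta> \<bullet> m) *\<^sub>R \<eta>)) - (3 * rho \<eta> ^ 3 * (1 - \<eta> \<bullet> z)\<^sup>2) *\<^sub>R Mtr \<eta> (klein_metric \<eta>)"
    unfolding Mtr_diff Mtr_scaleR Mtr_inner_left[OF bounded_linear.linear[OF bounded_linear_inner_right]] ..
  also have "m \<bullet> (m - (\<eta> \<bullet> m) *\<^sub>R \<eta>) = (1 - \<eta> \<bullet> z)\<^sup>2 / defect \<eta>"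
    unfolding n(2)[symmetric] by (simp add: inner_diff_right power2_eq_square inner_commute)
  also have "Mtr \<eta> (klein_metric \<eta>) = 2 / defect \<eta>" using Mtr_klein_metric[OF eta] p by (simp add: field_simps)
  finally show ?thesis by simp
qed

lemma klein_harmonic_poisson:
  assumes phi: "continuous_on circle \<phi>"
  shows "klein_harmonic (poisson \<phi>)"
  unfolding klein_harmonic_def
proof (intro conjI ballI smooth_on_poisson[OF phi])
  fix \<eta> :: complex assume eta: "\<eta> \<in> disk"
  note c = cont_phi[OF phi]
  have kf: "continuous_on {0..2*pi} (\<lambda>t. kernel_form \<eta> (cis t) a)" for a
    unfolding kernel_form_def using disk_pos[OF eta] by (intro continuous_intros) auto
  have kc: "continuous_on {0..2*pi} (\<lambda>t. \<phi> (cis t) * kernel_Hess \<eta> (cis t) a b)" for a b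
    unfolding kernel_Hess_def by (intro continuous_intros c kf)
  have "Mtr \<eta> (Hess (poisson \<phi>) \<eta>) = Mtr \<eta> (\<lambda>a b. Ik 4 (\<lambda>t. \<phi> (cis t) * kernel_Hess \<eta> (cis t) a b) \<eta> / (2 * pi))"
    by (simp add: Hess_poisson[OF phi eta] Mtr_def)
  also have "\<dots> = Mtr \<eta> (\<lambda>a b. Ik 4 (\<lambda>t. \<phi> (cis t) * kernel_Hess \<eta> (cis t) a b) \<eta>) / (2 * pi)"
    by (simp add: Mtr_def add_divide_distrib diff_divide_distrib distrib_left)
  also have "Mtr \<eta> (\<lambda>a b. Ik 4 (\<lambda>t. \<phi> (cis t) * kernel_Hess \<eta> (cis t) a b) \<eta>)
     = Ik 4 (\<lambda>t. \<phi> (cis t) * Mtr \<eta> (kernel_Hess \<eta> (cis t))) \<eta>"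
  proof -
    have "Ik 4 (\<lambda>t. \<phi> (cis t) * Mtr \<eta> (kernel_Hess \<eta> (cis t))) \<eta>
      = Ik 4 (\<lambda>t. (1 - (Re \<eta>)\<^sup>2) * (\<phi> (cis t) * kernel_Hess \<eta> (cis t) 1 1)
         + ((- (Re \<eta> * Im \<eta>)) * (\<phi> (cis t) * kernel_Hess \<eta> (cis t) 1 \<i>)
         + ((- (Re \<eta> * Im \<eta>)) * (\<phi> (cis t) * kernel_Hess \<eta> (cis t) \<i> 1)
         + (1 - (Im \<eta>)\<^sup>2) * (\<phi> (cis t) * kernel_Hess \<eta> (cis t) \<i> \<i>)))) \<eta>"
      by (rule arg_cong[where f="\<lambda>f. Ik 4 f \<eta>"]) (simp add: fun_eq_iff Mtr_def algebra_simps)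
    also have "\<dots> = Mtr \<eta> (\<lambda>a b. Ik 4 (\<lambda>t. \<phi> (cis t) * kernel_Hess \<eta> (cis t) a b) \<eta>)"
    proof -
      have "Ik 4 (\<lambda>t. c1 * f1 t + (c2 * f2 t + (c3 * f3 t + c4 * f4 t))) \<eta> = c1 * Ik 4 f1 \<eta> + (c2 * Ik 4 f2 \<eta> + (c3 * Ik 4 f3 \<eta> + c4 * Ik 4 f4 \<eta>))"
        if "continuous_on {0..2*pi} f1" "continuous_on {0..2*pi} f2" "continuous_on {0..2*pi} f3" "continuous_on {0..2*pi} f4" for c1 c2 c3 c4 f1 f2 f3 f4
        using that by (simp add: Ik_add[OF _ _ eta] Ik_cmult continuous_intros)
      then show ?thesis by (simp only: kc) (simp add: Mtr_def algebra_simps)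
    qed
    finally show ?thesis ..
  qed
  also have "\<dots> = 0" by (simp add: Mtr_kernel_Hess[OF eta] Ik_def)
  finally show "Mtr \<eta> (Hess (poisson \<phi>) \<eta>) = 0" by simp
qed

text \<open>The rank one part lies between \<open>0\<close> and \<open>6 K g\<close>, so the Hessian of the kernel lies between \<open>-3 K g\<close> and \<open>3 K g\<close>.\<close>

lemma Hess_poisson_bound:
  assumes phi: "continuous_on circle \<phi>" and eta: "\<eta> \<in> disk" and pos: "\<And>z. z \<in> circle \<Longrightarrow> 0 \<le> \<phi> z"
  shows "\<bar>Hess (poisson \<phi>) \<eta> a a\<bar> \<le> 3 * poisson \<phi> \<eta> * klein_metric \<eta> a a"
proof -
  note c = cont_phi[OF phi] and p = disk_pos[OF eta]
  let ?g = "klein_metric \<eta> a a"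
  have kf: "continuous_on {0..2*pi} (\<lambda>t. kernel_form \<eta> (cis t) a)" for a
    unfolding kernel_form_def using p by (intro continuous_intros) auto
  have kc: "continuous_on {0..2*pi} (\<lambda>t. \<phi> (cis t) * kernel_Hess \<eta> (cis t) a a)"
    unfolding kernel_Hess_def by (intro continuous_intros c kf)
  have g: "?g \<ge> 0" by (rule klein_metric_pos(2)[OF eta])
  have ub: "\<bar>kernel_Hess \<eta> (cis t) a a\<bar> \<le> 3 * rho \<eta> ^ 3 * ?g * (1 - \<eta> \<bullet> cis t)\<^sup>2" for t
  proof -
    have "0 \<le> 6 * rho \<eta> ^ 3 * (kernel_form \<eta> (cis t) a)\<^sup>2" using p by simp
    moreover have "6 * rho \<eta> ^ 3 * (kernel_form \<eta> (cis t) a)\<^sup>2 \<le> 6 * rho \<eta> ^ 3 * ((1 - \<eta> \<bullet> cis t)\<^sup>2 * ?g)"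
      using p kernel_form_bound[OF eta, of "cis t" a] by (intro mult_left_mono) auto
    ultimately show ?thesis by (simp add: kernel_Hess_def power2_eq_square abs_le_iff algebra_simps)
  qed
  have P: "Ik 4 (\<lambda>t. (3 * rho \<eta> ^ 3 * ?g) * (\<phi> (cis t) * (1 - \<eta> \<bullet> cis t)\<^sup>2)) \<eta> = 2 * pi * (3 * poisson \<phi> \<eta> * ?g)"
    using Ik_lift[OF eta, of 2 "\<lambda>t. \<phi> (cis t)" 2] by (simp add: Ik_cmult poisson_def rho_power3[OF eta])
  have cD: "continuous_on {0..2*pi} (\<lambda>t. K * (\<phi> (cis t) * (1 - \<eta> \<bullet> cis t)\<^sup>2))" for K by (intro continuous_intros c)
  have b: "\<phi> (cis t) * kernel_Hess \<eta> (cis t) a a \<le> (3 * rho \<eta> ^ 3 * ?g) * (\<phi> (cis t) * (1 - \<eta> \<bullet> cis t)\<^sup>2)"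
    "- (3 * rho \<eta> ^ 3 * ?g) * (\<phi> (cis t) * (1 - \<eta> \<bullet> cis t)\<^sup>2) \<le> \<phi> (cis t) * kernel_Hess \<eta> (cis t) a a" for t
  proof -
    have "\<bar>\<phi> (cis t) * kernel_Hess \<eta> (cis t) a a\<bar> \<le> \<phi> (cis t) * (3 * rho \<eta> ^ 3 * ?g * (1 - \<eta> \<bullet> cis t)\<^sup>2)"
      using pos[of "cis t"] ub[of t] by (simp add: abs_mult mult_left_mono)
    then show "\<phi> (cis t) * kernel_Hess \<eta> (cis t) a a \<le> (3 * rho \<eta> ^ 3 * ?g) * (\<phi> (cis t) * (1 - \<eta> \<bullet> cis t)\<^sup>2)"
      "- (3 * rho \<eta> ^ 3 * ?g) * (\<phi> (cis t) * (1 - \<eta> \<bullet> cis t)\<^sup>2) \<le> \<phi> (cis t) * kernel_Hess \<eta> (cis t) a a"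
      by (simp_all add: abs_le_iff algebra_simps)
  qed
  have "Ik 4 (\<lambda>t. \<phi> (cis t) * kernel_Hess \<eta> (cis t) a a) \<eta> \<le> 2 * pi * (3 * poisson \<phi> \<eta> * ?g)"
    unfolding P[symmetric] by (rule Ik_mono[OF kc cD eta b(1)])
  moreover have "- (2 * pi * (3 * poisson \<phi> \<eta> * ?g)) \<le> Ik 4 (\<lambda>t. \<phi> (cis t) * kernel_Hess \<eta> (cis t) a a) \<eta>"
    using Ik_mono[OF cD kc eta b(2), of 4] Ik_cmult[of 4 "- 1" "\<lambda>t. (3 * rho \<eta> ^ 3 * ?g) * (\<phi> (cis t) * (1 - \<eta> \<bullet> cis t)\<^sup>2)" \<eta>] P by simp
  ultimately show ?thesis unfolding Hess_poisson[OF phi eta] by (simp add: abs_le_iff divide_simps mult_ac)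
qed

text \<open>The gradient of the kernel is \<open>K (2 z / (1 - \<eta>\<cdot>z) - 3 \<eta> / q)\<close>; as \<open>q \<le> 2 (1 - \<eta>\<cdot>z)\<close>, multiplication by \<open>q\<close> leaves
  at most \<open>(4 + 3) K\<close>.\<close>

lemma nab_poisson_bound:
  assumes phi: "continuous_on circle \<phi>" and eta: "\<eta> \<in> disk" and pos: "\<And>z. z \<in> circle \<Longrightarrow> 0 \<le> \<phi> z"
  shows "defect \<eta> * norm (nab (poisson \<phi>) \<eta>) \<le> 7 * poisson \<phi> \<eta>"
proof -
  note c = cont_phi[OF phi] and p = disk_pos[OF eta]
  have ub: "defect \<eta> * (nab (poisson \<phi>) \<eta> \<bullet> a) \<le> 7 * poisson \<phi> \<eta> * norm a" for a
  proof -
    have e2: "Ik 2 (\<lambda>t. \<phi> (cis t)) \<eta> = Ik 3 (\<lambda>t. \<phi> (cis t) * (1 - \<eta> \<bullet> cis t)) \<eta>"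
      using Ik_lift[OF eta, of 2 "\<lambda>t. \<phi> (cis t)" 1] by simp
    have c1: "continuous_on {0..2*pi} (\<lambda>t. K * (\<phi> (cis t) * (1 - \<eta> \<bullet> cis t)))" for K by (intro continuous_intros c)
    have c2: "continuous_on {0..2*pi} (\<lambda>t. K * (\<phi> (cis t) * (cis t \<bullet> a)))" for K by (intro continuous_intros c)
    have "2 * pi * (defect \<eta> * (nab (poisson \<phi>) \<eta> \<bullet> a)) = (2 * defect \<eta> * rho \<eta> ^ 3) * Ik 3 (\<lambda>t. \<phi> (cis t) * (cis t \<bullet> a)) \<eta>
        + (- 3 * rho \<eta> ^ 3 * (\<eta> \<bullet> a)) * Ik 3 (\<lambda>t. \<phi> (cis t) * (1 - \<eta> \<bullet> cis t)) \<eta>"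
      unfolding nab_poisson[OF phi eta] e2 by (simp add: rho_power3[OF eta] algebra_simps)
    also have "\<dots> = Ik 3 (\<lambda>t. (2 * defect \<eta> * rho \<eta> ^ 3) * (\<phi> (cis t) * (cis t \<bullet> a)) + (- 3 * rho \<eta> ^ 3 * (\<eta> \<bullet> a)) * (\<phi> (cis t) * (1 - \<eta> \<bullet> cis t))) \<eta>"
      unfolding Ik_add[OF c2 c1 eta] Ik_cmult ..
    also have "\<dots> \<le> Ik 3 (\<lambda>t. (7 * rho \<eta> ^ 3 * norm a) * (\<phi> (cis t) * (1 - \<eta> \<bullet> cis t))) \<eta>"
    proof (rule Ik_mono[OF continuous_on_add[OF c2 c1] c1 eta])
      fix t
      define D where "D = 1 - \<eta> \<bullet> cis t"
      have n: "norm \<eta> < 1" using eta by simp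
      have D: "1 - norm \<eta> \<le> D" using norm_cauchy_schwarz[of \<eta> "cis t"] by (simp add: D_def)
      have q: "defect \<eta> \<le> 2 * D"
      proof -
        have "defect \<eta> = (1 - norm \<eta>) * (1 + norm \<eta>)" by (simp add: defect_def power2_norm_eq_inner[symmetric] power2_eq_square algebra_simps)
        also have "\<dots> \<le> D * 2" using n D by (intro mult_mono) auto
        finally show ?thesis by simp
      qed
      have "2 * defect \<eta> * (cis t \<bullet> a) \<le> 2 * (2 * D) * norm a"
      proof -
        have "2 * defect \<eta> * (cis t \<bullet> a) \<le> 2 * defect \<eta> * norm a"
          using norm_cauchy_schwarz[of "cis t" a] p by (intro mult_left_mono) auto
        also have "\<dots> \<le> 2 * (2 * D) * norm a" using q by (intro mult_right_mono) auto
        finally show ?thesis .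
      qed
      moreover have "- 3 * (\<eta> \<bullet> a) * D \<le> 3 * norm a * D"
      proof -
        have "- (\<eta> \<bullet> a) \<le> norm \<eta> * norm a" using norm_cauchy_schwarz[of "- \<eta>" a] by simp
        also have "\<dots> \<le> norm a" using n by (simp add: mult_left_le_one_le)
        finally have "- (\<eta> \<bullet> a) * D \<le> norm a * D" using D n by (intro mult_right_mono) auto
        then show ?thesis by linarith
      qed
      ultimately have "2 * defect \<eta> * (cis t \<bullet> a) - 3 * (\<eta> \<bullet> a) * D \<le> 7 * norm a * D" by (simp add: algebra_simps)
      then have "(rho \<eta> ^ 3 * \<phi> (cis t)) * (2 * defect \<eta> * (cis t \<bullet> a) - 3 * (\<eta> \<bullet> a) * D) \<le> (rho \<eta> ^ 3 * \<phi> (cis t)) * (7 * norm a * D)"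
        using p pos[of "cis t"] by (intro mult_left_mono) auto
      then show "(2 * defect \<eta> * rho \<eta> ^ 3) * (\<phi> (cis t) * (cis t \<bullet> a)) + (- 3 * rho \<eta> ^ 3 * (\<eta> \<bullet> a)) * (\<phi> (cis t) * (1 - \<eta> \<bullet> cis t))
         \<le> (7 * rho \<eta> ^ 3 * norm a) * (\<phi> (cis t) * (1 - \<eta> \<bullet> cis t))"
        unfolding D_def[symmetric] by (simp add: algebra_simps)
    qed
    also have "\<dots> = 2 * pi * (7 * poisson \<phi> \<eta> * norm a)"
      unfolding Ik_cmult e2[symmetric] by (simp add: poisson_def rho_power3[OF eta])
    finally show ?thesis by (simp add: mult_ac)
  qed
  let ?N = "nab (poisson \<phi>) \<eta>"
  show ?thesis
  proof (cases "?N = 0")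
    case True
    have "0 \<le> Ik 2 (\<lambda>t. \<phi> (cis t)) \<eta>"
      using Ik_mono[of "\<lambda>t. 0" "\<lambda>t. \<phi> (cis t)" \<eta> 2] c eta pos by (simp add: Ik_def)
    then show ?thesis using True p by (simp add: poisson_def)
  next
    case False
    have "defect \<eta> * norm ?N * norm ?N \<le> 7 * poisson \<phi> \<eta> * norm ?N"
      using ub[of ?N] by (simp add: power2_norm_eq_inner[symmetric] power2_eq_square)
    then show ?thesis using False by simp
  qed
qed

section \<open>Boundary values\<close>

lemma poisson_add_affine:
  assumes phi: "continuous_on circle \<phi>" and eta: "\<eta> \<in> disk"
  shows "poisson (\<lambda>z. \<phi> z + (l \<bullet> z + c)) \<eta> = poisson \<phi> \<eta> + (l \<bullet> \<eta> + c)"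
proof -
  have "poisson (\<lambda>z. \<phi> z + (l \<bullet> z + c)) \<eta> = poisson \<phi> \<eta> + poisson (\<lambda>z. l \<bullet> z + c) \<eta>"
    unfolding poisson_def
    by (subst Ik_add[OF cont_phi[OF phi] _ eta]) (auto intro!: continuous_intros simp: algebra_simps)
  then show ?thesis by (simp add: poisson_affine[OF eta])
qed

lemma nab_poisson_add_affine:
  assumes phi: "continuous_on circle \<phi>" and eta: "\<eta> \<in> disk"
  shows "nab (poisson (\<lambda>z. \<phi> z + (l \<bullet> z + c))) \<eta> = nab (poisson \<phi>) \<eta> + l"
proof (rule nab_eqI)
  have "((\<lambda>y. poisson \<phi> y + (l \<bullet> y + c)) has_derivative (\<lambda>a. nab (poisson \<phi>) \<eta> \<bullet> a + (l \<bullet> a + 0))) (at \<eta>)"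
    by (intro has_derivative_add has_derivative_nab smooth_on_poisson phi eta has_derivative_inner_right has_derivative_ident has_derivative_const)
  then have "((\<lambda>y. poisson \<phi> y + (l \<bullet> y + c)) has_derivative (\<lambda>a. (nab (poisson \<phi>) \<eta> + l) \<bullet> a)) (at \<eta>)"
    by (simp add: inner_add_left)
  then show "(poisson (\<lambda>z. \<phi> z + (l \<bullet> z + c)) has_derivative (\<lambda>a. (nab (poisson \<phi>) \<eta> + l) \<bullet> a)) (at \<eta>)"
    by (rule has_derivative_transform_within_open[OF _ open_ball eta]) (simp add: poisson_add_affine[OF phi])
qed

lemma continuous_circle_bounded:
  fixes \<phi> :: "complex \<Rightarrow> real"
  assumes "continuous_on circle \<phi>"
  shows "\<exists>B. \<forall>z\<in>circle. \<bar>\<phi> z\<bar> \<le> B"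
proof -
  have "bounded (\<phi> ` circle)" by (intro compact_imp_bounded compact_continuous_image assms compact_sphere)
  then show ?thesis by (simp add: bounded_iff)
qed

lemma poisson_mono:
  assumes "continuous_on circle \<phi>" "continuous_on circle \<psi>" "\<eta> \<in> disk" "\<And>z. z \<in> circle \<Longrightarrow> \<phi> z \<le> \<psi> z"
  shows "poisson \<phi> \<eta> \<le> poisson \<psi> \<eta>"
  unfolding poisson_def using disk_pos[OF assms(3)] assms(4)
  by (intro mult_left_mono Ik_mono cont_phi assms) auto

lemma poisson_le_affine:
  assumes phi: "continuous_on circle \<phi>" and eta: "\<eta> \<in> disk" and le: "\<And>z. z \<in> circle \<Longrightarrow> \<phi> z \<le> l \<bullet> z + c"
  shows "poisson \<phi> \<eta> \<le> l \<bullet> \<eta> + c"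
  using poisson_mono[OF phi _ eta le] unfolding poisson_affine[OF eta] by (simp add: continuous_intros)

lemma affine_le_poisson:
  assumes phi: "continuous_on circle \<phi>" and eta: "\<eta> \<in> disk" and le: "\<And>z. z \<in> circle \<Longrightarrow> l \<bullet> z + c \<le> \<phi> z"
  shows "l \<bullet> \<eta> + c \<le> poisson \<phi> \<eta>"
  using poisson_mono[OF _ phi eta le] unfolding poisson_affine[OF eta] by (simp add: continuous_intros)

text \<open>Near a boundary point, a continuous function is within \<open>e\<close> of its value up to a multiple of
  the affine function which vanishes there.\<close>

lemma boundary_modulus:
  assumes phi: "continuous_on circle \<phi>" and z0: "z0 \<in> circle" and e: "e > (0::real)"
  obtains M where "M \<ge> 0" "\<And>z. z \<in> circle \<Longrightarrow> \<bar>\<phi> z - \<phi> z0\<bar> \<le> e + M * (1 - z0 \<bullet> z)"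
proof -
  obtain d where d: "d > 0" "\<And>z. z \<in> circle \<Longrightarrow> dist z z0 < d \<Longrightarrow> dist (\<phi> z) (\<phi> z0) < e"
    using phi z0 e unfolding continuous_on_iff by metis
  obtain B where "\<forall>z\<in>circle. \<bar>\<phi> z\<bar> \<le> B" using continuous_circle_bounded[OF phi] by blast
  then have B: "\<bar>\<phi> z\<bar> \<le> B" if "z \<in> circle" for z using that by blast
  have B0: "B \<ge> 0" using B[OF z0] by linarith
  have sq: "(dist z z0)\<^sup>2 = 2 * (1 - z0 \<bullet> z)" if "z \<in> circle" for z
  proof -
    have "z \<bullet> z = 1" "z0 \<bullet> z0 = 1" using that z0 by (simp_all flip: power2_norm_eq_inner)
    then show ?thesis
      by (simp add: dist_norm power2_norm_eq_inner inner_diff_left inner_diff_right inner_commute[of z z0])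
  qed
  show thesis
  proof (rule that)
    show "4 * B / d\<^sup>2 \<ge> 0" using B0 by simp
    fix z assume z: "z \<in> circle"
    have nn: "1 - z0 \<bullet> z \<ge> 0" using sq[OF z] by (smt (verit) zero_le_power2)
    show "\<bar>\<phi> z - \<phi> z0\<bar> \<le> e + 4 * B / d\<^sup>2 * (1 - z0 \<bullet> z)"
    proof (cases "dist z z0 < d")
      case True
      have "4 * B / d\<^sup>2 * (1 - z0 \<bullet> z) \<ge> 0" using B0 nn by simp
      then show ?thesis using d(2)[OF z True] by (simp add: dist_real_def)
    next
      case False
      then have "d\<^sup>2 \<le> 2 * (1 - z0 \<bullet> z)" unfolding sq[OF z, symmetric] using d(1) by (intro power_mono) auto
      then have "2 * B * d\<^sup>2 \<le> 2 * B * (2 * (1 - z0 \<bullet> z))" using B0 by (intro mult_left_mono) auto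
      then have "2 * B \<le> 4 * B / d\<^sup>2 * (1 - z0 \<bullet> z)" using d(1) by (simp add: divide_simps mult_ac)
      moreover have "\<bar>\<phi> z - \<phi> z0\<bar> \<le> 2 * B" using B[OF z] B[OF z0] by linarith
      ultimately show ?thesis using e by linarith
    qed
  qed
qed

text \<open>The affine bounds on \<open>\<phi>\<close> pass to the Poisson integral. After adding the upper bound, the boundary
  values are nonnegative and the gradient estimate applies.\<close>

lemma poisson_boundary_estimate:
  assumes phi: "continuous_on circle \<phi>" and eta: "\<eta> \<in> disk"
    and M: "\<And>z. z \<in> circle \<Longrightarrow> \<bar>\<phi> z - \<phi> z0\<bar> \<le> e + M * (1 - z0 \<bullet> z)" and M0: "M \<ge> 0" and z0: "z0 \<in> circle"
  shows "\<bar>poisson \<phi> \<eta> - \<phi> z0\<bar> \<le> e + M * (1 - z0 \<bullet> \<eta>)"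
    and "defect \<eta> * norm (nab (poisson \<phi>) \<eta>) \<le> 14 * (e + M * (1 - z0 \<bullet> \<eta>)) + M * defect \<eta>"
proof -
  have "poisson \<phi> \<eta> \<le> (- M *\<^sub>R z0) \<bullet> \<eta> + (\<phi> z0 + e + M)"
    by (rule poisson_le_affine[OF phi eta]) (use M in \<open>fastforce simp: abs_le_iff algebra_simps\<close>)
  moreover have "(M *\<^sub>R z0) \<bullet> \<eta> + (\<phi> z0 - e - M) \<le> poisson \<phi> \<eta>"
    by (rule affine_le_poisson[OF phi eta]) (use M in \<open>fastforce simp: abs_le_iff algebra_simps\<close>)
  ultimately show 1: "\<bar>poisson \<phi> \<eta> - \<phi> z0\<bar> \<le> e + M * (1 - z0 \<bullet> \<eta>)"
    by (simp add: abs_le_iff algebra_simps)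
  define c where "c = e + M - \<phi> z0"
  define \<psi> where "\<psi> z = \<phi> z + ((- M *\<^sub>R z0) \<bullet> z + c)" for z
  have psi: "continuous_on circle \<psi>" unfolding \<psi>_def by (intro continuous_intros phi)
  have pos: "\<psi> z \<ge> 0" if "z \<in> circle" for z using M[OF that] by (simp add: \<psi>_def c_def abs_le_iff algebra_simps)
  have P: "poisson \<psi> y = poisson \<phi> y + ((- M *\<^sub>R z0) \<bullet> y + c)" if "y \<in> disk" for y
    unfolding \<psi>_def[abs_def] by (rule poisson_add_affine[OF phi that])
  have N: "nab (poisson \<psi>) \<eta> = nab (poisson \<phi>) \<eta> + (- M *\<^sub>R z0)"
    unfolding \<psi>_def[abs_def] by (rule nab_poisson_add_affine[OF phi eta])
  have "defect \<eta> * norm (nab (poisson \<phi>) \<eta>) \<le> defect \<eta> * (norm (nab (poisson \<psi>) \<eta>) + M)"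
  proof (rule mult_left_mono)
    have "nab (poisson \<phi>) \<eta> = nab (poisson \<psi>) \<eta> + M *\<^sub>R z0" unfolding N by simp
    then show "norm (nab (poisson \<phi>) \<eta>) \<le> norm (nab (poisson \<psi>) \<eta>) + M"
      using norm_triangle_ineq[of "nab (poisson \<psi>) \<eta>" "M *\<^sub>R z0"] M0 z0 by simp
  qed (use disk_pos[OF eta] in simp)
  also have "\<dots> = defect \<eta> * norm (nab (poisson \<psi>) \<eta>) + M * defect \<eta>" by (simp add: algebra_simps)
  also have "\<dots> \<le> 7 * poisson \<psi> \<eta> + M * defect \<eta>" using nab_poisson_bound[OF psi eta pos] by simp
  also have "poisson \<psi> \<eta> \<le> 2 * (e + M * (1 - z0 \<bullet> \<eta>))"
    using 1 unfolding P[OF eta] by (simp add: c_def abs_le_iff algebra_simps)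
  finally show "defect \<eta> * norm (nab (poisson \<phi>) \<eta>) \<le> 14 * (e + M * (1 - z0 \<bullet> \<eta>)) + M * defect \<eta>" by simp
qed

text \<open>The right-hand side is the larger of the two preceding bounds; at \<open>\<eta> = z0\<close> it equals \<open>14 e\<close>.\<close>

lemma tendsto_by_modulus:
  fixes f :: "complex \<Rightarrow> 'b::real_normed_vector"
  assumes z0: "z0 \<in> circle"
    and bd: "\<And>e. e > 0 \<Longrightarrow> \<exists>M. \<forall>\<eta>\<in>disk. norm (f \<eta> - l) \<le> 14 * (e + M * (1 - z0 \<bullet> \<eta>)) + M * defect \<eta>"
  shows "(f \<longlongrightarrow> l) (at z0 within disk)"
proof (rule tendstoI)
  fix e :: real assume e: "e > 0"
  then have "e / 28 > 0" by simp
  from bd[OF this] obtain M where M: "\<forall>\<eta>\<in>disk. norm (f \<eta> - l) \<le> 14 * (e/28 + M * (1 - z0 \<bullet> \<eta>)) + M * defect \<eta>"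
    by blast
  have L: "((\<lambda>\<eta>. 14 * (e/28 + M * (1 - z0 \<bullet> \<eta>)) + M * (1 - \<eta> \<bullet> \<eta>)) \<longlongrightarrow> 14 * (e/28 + M * (1 - z0 \<bullet> z0)) + M * (1 - z0 \<bullet> z0)) (at z0 within disk)"
    by (intro tendsto_intros)
  have "z0 \<bullet> z0 = 1" using z0 by (simp flip: power2_norm_eq_inner)
  then have "14 * (e/28 + M * (1 - z0 \<bullet> z0)) + M * (1 - z0 \<bullet> z0) < e" using e by simp
  from order_tendstoD(2)[OF L this]
  have "\<forall>\<^sub>F \<eta> in at z0 within disk. 14 * (e/28 + M * (1 - z0 \<bullet> \<eta>)) + M * (1 - \<eta> \<bullet> \<eta>) < e" .
  moreover have "\<forall>\<^sub>F \<eta> in at z0 within disk. \<eta> \<in> disk" by (simp add: eventually_at_filter)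
  ultimately show "\<forall>\<^sub>F \<eta> in at z0 within disk. dist (f \<eta>) l < e"
  proof eventually_elim
    case (elim \<eta>)
    then show ?case using M[rule_format, of \<eta>] by (simp add: dist_norm defect_def)
  qed
qed

lemma poisson_tendsto:
  assumes phi: "continuous_on circle \<phi>" and z0: "z0 \<in> circle"
  shows "(poisson \<phi> \<longlongrightarrow> \<phi> z0) (at z0 within disk)"
    and "((\<lambda>\<eta>. defect \<eta> *\<^sub>R nab (poisson \<phi>) \<eta>) \<longlongrightarrow> 0) (at z0 within disk)"
proof -
  show "(poisson \<phi> \<longlongrightarrow> \<phi> z0) (at z0 within disk)"
  proof (rule tendsto_by_modulus[OF z0])
    fix e :: real assume "e > 0"
    from boundary_modulus[OF phi z0 this] obtain M where M: "M \<ge> 0"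
      "\<And>z. z \<in> circle \<Longrightarrow> \<bar>\<phi> z - \<phi> z0\<bar> \<le> e + M * (1 - z0 \<bullet> z)" by blast
    have "norm (poisson \<phi> \<eta> - \<phi> z0) \<le> 14 * (e + M * (1 - z0 \<bullet> \<eta>)) + M * defect \<eta>" if eta: "\<eta> \<in> disk" for \<eta>
    proof -
      have "0 \<le> e + M * (1 - z0 \<bullet> \<eta>)" "0 \<le> M * defect \<eta>"
        using M(1) \<open>e > 0\<close> inner_cis_less_1[OF eta, of z0] z0 disk_pos[OF eta] by (auto simp: inner_commute)
      moreover have "\<bar>poisson \<phi> \<eta> - \<phi> z0\<bar> \<le> e + M * (1 - z0 \<bullet> \<eta>)"
        by (rule poisson_boundary_estimate(1)[OF phi eta M(2) M(1) z0])
      moreover have "A \<le> 14 * A + B" if "0 \<le> A" "0 \<le> B" for A B :: real using that by simp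
      ultimately show ?thesis unfolding real_norm_def by (rule_tac order_trans)
    qed
    then show "\<exists>M. \<forall>\<eta>\<in>disk. norm (poisson \<phi> \<eta> - \<phi> z0) \<le> 14 * (e + M * (1 - z0 \<bullet> \<eta>)) + M * defect \<eta>" by blast
  qed
  show "((\<lambda>\<eta>. defect \<eta> *\<^sub>R nab (poisson \<phi>) \<eta>) \<longlongrightarrow> 0) (at z0 within disk)"
  proof (rule tendsto_by_modulus[OF z0])
    fix e :: real assume "e > 0"
    from boundary_modulus[OF phi z0 this] obtain M where M: "M \<ge> 0"
      "\<And>z. z \<in> circle \<Longrightarrow> \<bar>\<phi> z - \<phi> z0\<bar> \<le> e + M * (1 - z0 \<bullet> z)" by blast
    have "norm (defect \<eta> *\<^sub>R nab (poisson \<phi>) \<eta> - 0) \<le> 14 * (e + M * (1 - z0 \<bullet> \<eta>)) + M * defect \<eta>" if eta: "\<eta> \<in> disk" for \<eta>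
      using poisson_boundary_estimate(2)[OF phi eta M(2) M(1) z0] disk_pos[OF eta] by simp
    then show "\<exists>M. \<forall>\<eta>\<in>disk. norm (defect \<eta> *\<^sub>R nab (poisson \<phi>) \<eta> - 0) \<le> 14 * (e + M * (1 - z0 \<bullet> \<eta>)) + M * defect \<eta>" by blast
  qed
qed

lemma continuous_on_extension:
  fixes f \<phi> :: "complex \<Rightarrow> real"
  assumes f: "continuous_on disk f" and phi: "continuous_on circle \<phi>"
    and lim: "\<And>z. z \<in> circle \<Longrightarrow> (f \<longlongrightarrow> \<phi> z) (at z within disk)"
  shows "continuous_on (cball 0 1) (\<lambda>\<eta>. if \<eta> \<in> disk then f \<eta> else \<phi> \<eta>)"
  unfolding continuous_on_def
proof
  fix x :: complex assume x: "x \<in> cball 0 1"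
  let ?F = "\<lambda>\<eta>. if \<eta> \<in> disk then f \<eta> else \<phi> \<eta>"
  show "(?F \<longlongrightarrow> ?F x) (at x within cball 0 1)"
  proof (cases "x \<in> disk")
    case True
    have "continuous_on disk ?F" using f by (rule continuous_on_eq) simp
    then have "isCont ?F x" using True by (simp only: continuous_on_eq_continuous_at[OF open_ball])
    then show ?thesis unfolding isCont_def by (rule tendsto_within_subset) simp
  next
    case False
    then have xc: "x \<in> circle" using x by simp
    have ev: "\<forall>\<^sub>F \<eta> in at x within S. \<eta> \<in> S" for S by (simp add: eventually_at_filter)
    have u: "cball 0 1 = disk \<union> circle" by auto
    have "(?F \<longlongrightarrow> \<phi> x) (at x within disk)"
      by (rule Lim_transform_eventually[OF lim[OF xc]]) (use ev[of disk] in \<open>rule eventually_mono, simp\<close>)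
    moreover have "(?F \<longlongrightarrow> \<phi> x) (at x within circle)"
      by (rule Lim_transform_eventually[of \<phi>]) (use phi xc ev[of circle] in \<open>auto simp: continuous_on_def elim: eventually_mono\<close>)
    ultimately show ?thesis unfolding u using False by (simp add: Lim_within_Un)
  qed
qed

lemma klein_harmonic_diff:
  assumes f: "klein_harmonic f" and g: "klein_harmonic g"
  shows "klein_harmonic (\<lambda>y. f y - g y)"
proof -
  have sf: "smooth_on disk f" "smooth_on disk g" using f g by (simp_all add: klein_harmonic_def)
  have s: "smooth_on disk (\<lambda>y. f y - g y)" by (intro smooth_on_diff sf open_ball)
  have n: "nab (\<lambda>y. f y - g y) y = nab f y - nab g y" if "y \<in> disk" for y
    by (rule nab_eqI) (use has_derivative_diff[OF has_derivative_nab[OF sf(1) that] has_derivative_nab[OF sf(2) that]] in \<open>simp add: inner_diff_left\<close>)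
  have "Hess (\<lambda>y. f y - g y) \<eta> a b = Hess f \<eta> a b - Hess g \<eta> a b" if eta: "\<eta> \<in> disk" for \<eta> a b
  proof (rule Hess_eqI[OF s eta])
    have "((\<lambda>y. (nab f y - nab g y) \<bullet> b) has_derivative (\<lambda>a. (ddir (nab f) \<eta> a - ddir (nab g) \<eta> a) \<bullet> b)) (at \<eta>)"
      by (intro has_derivative_inner_left has_derivative_diff smooth_on_has_derivative[of disk] smooth_on_nab sf eta)
    then have "((\<lambda>y. (nab f y - nab g y) \<bullet> b) has_derivative (\<lambda>a. Hess f \<eta> a b - Hess g \<eta> a b)) (at \<eta>)"
      by (simp add: Hess_def inner_diff_left)
    then show "((\<lambda>y. nab (\<lambda>y. f y - g y) y \<bullet> b) has_derivative (\<lambda>a. Hess f \<eta> a b - Hess g \<eta> a b)) (at \<eta>)"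
      by (rule has_derivative_transform_within_open[OF _ open_ball eta]) (simp add: n)
  qed
  then have "Hess (\<lambda>y. f y - g y) \<eta> = (\<lambda>a b. Hess f \<eta> a b - Hess g \<eta> a b)" if "\<eta> \<in> disk" for \<eta>
    using that by (intro ext)
  then have "Mtr \<eta> (Hess (\<lambda>y. f y - g y) \<eta>) = Mtr \<eta> (Hess f \<eta>) - Mtr \<eta> (Hess g \<eta>)" if "\<eta> \<in> disk" for \<eta>
    using that by (simp only: Mtr_diff)
  then show ?thesis using f g s by (simp add: klein_harmonic_def)
qed

lemma dirichlet_unique:
  assumes f: "klein_harmonic f" and c: "continuous_on (cball 0 1) (\<lambda>\<eta>. if \<eta> \<in> disk then f \<eta> else \<phi> \<eta>)"
    and g: "klein_harmonic g" and c': "continuous_on (cball 0 1) (\<lambda>\<eta>. if \<eta> \<in> disk then g \<eta> else \<phi> \<eta>)"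
    and eta: "\<eta> \<in> disk"
  shows "f \<eta> = g \<eta>"
proof -
  have "f \<eta> - g \<eta> \<le> 0"
    by (rule maximum_principle[OF klein_harmonic_diff[OF f g] continuous_on_diff[OF c c'] _ _ eta]) auto
  moreover have "g \<eta> - f \<eta> \<le> 0"
    by (rule maximum_principle[OF klein_harmonic_diff[OF g f] continuous_on_diff[OF c' c] _ _ eta]) auto
  ultimately show ?thesis by linarith
qed

section \<open>The harmonic Lagrangian extension\<close>

lemma support_fun_props:
  assumes "circle_vector_field X" "z \<in> circle"
  shows "support_fun X z = (\<i> * z) \<bullet> X z" "X z = \<i> * z * complex_of_real (support_fun X z)"
proof -
  have zz: "z \<bullet> z = 1" using assms(2) by (simp flip: power2_norm_eq_inner)
  have "X z \<bullet> z = 0" using assms by (simp add: circle_vector_field_def)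
  then have "(1::real) *\<^sub>R X z = ((\<i> * z) \<bullet> X z) *\<^sub>R (\<i> * z)"
    using perp_decomp[of z "X z"] by (simp add: zz inner_commute)
  then have e: "X z = \<i> * z * complex_of_real ((\<i> * z) \<bullet> X z)" by (simp add: scaleR_conv_of_real mult_ac)
  have "z \<noteq> 0" using assms(2) by auto
  then show 1: "support_fun X z = (\<i> * z) \<bullet> X z"
    unfolding support_fun_def using e by (intro the_equality) (metis, metis complex_i_not_zero mult_cancel_left mult_eq_0_iff of_real_eq_iff)
  show "X z = \<i> * z * complex_of_real (support_fun X z)" unfolding 1 by (rule e)
qed

lemma continuous_on_support_fun:
  assumes "circle_vector_field X" "continuous_on circle X"
  shows "continuous_on circle (support_fun X)"
proof -
  have "continuous_on circle (\<lambda>z. (\<i> * z) \<bullet> X z)" by (intro continuous_intros assms)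
  then show ?thesis by (rule continuous_on_eq) (simp add: support_fun_props(1)[OF assms(1)])
qed

lemma support_solution_iff:
  "support_solution X u \<longleftrightarrow> smooth_on disk (\<lambda>\<eta>. u (klein_inv \<eta>)) \<and> klein_harmonic (\<lambda>\<eta>. rho \<eta> * u (klein_inv \<eta>)) \<and>
     continuous_on (cball 0 1) (\<lambda>\<eta>. if \<eta> \<in> disk then rho \<eta> * u (klein_inv \<eta>) else support_fun X \<eta>)"
proof -
  have "(\<forall>p\<in>hyp_plane. hyp_laplacian u p - 2 * u p = 0) \<longleftrightarrow> (\<forall>\<eta>\<in>disk. laplacian klein_metric (\<lambda>\<eta>. u (klein_inv \<eta>)) \<eta> = 2 * u (klein_inv \<eta>))"
    unfolding hyp_plane_eq by (auto simp: hyp_laplacian_def klein_inv_inverse(2))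
  moreover have "klein_rescale u = (\<lambda>\<eta>. rho \<eta> * u (klein_inv \<eta>))" by (simp add: fun_eq_iff klein_rescale_def rho_eq)
  ultimately show ?thesis
    unfolding support_solution_def hyp_smooth_def
    using klein_harmonic_rescale_iff[of "\<lambda>\<eta>. u (klein_inv \<eta>)"] by metis
qed

context
  fixes X :: "complex \<Rightarrow> complex"
  assumes X: "circle_vector_field X" "continuous_on circle X"
begin

lemma phi_cont: "continuous_on circle (support_fun X)"
  by (rule continuous_on_support_fun[OF X])

lemma poisson_extension:
  "continuous_on (cball 0 1) (\<lambda>\<eta>. if \<eta> \<in> disk then poisson (support_fun X) \<eta> else support_fun X \<eta>)"
  by (intro continuous_on_extension smooth_on_continuous smooth_on_poisson phi_cont poisson_tendsto(1))

lemma uX_poisson: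
  shows "smooth_on disk (\<lambda>\<eta>. uX X (klein_inv \<eta>))"
    and "\<And>\<eta>. \<eta> \<in> disk \<Longrightarrow> rho \<eta> * uX X (klein_inv \<eta>) = poisson (support_fun X) \<eta>"
    and "\<And>\<eta>. \<eta> \<in> disk \<Longrightarrow> laplacian klein_metric (\<lambda>\<eta>. uX X (klein_inv \<eta>)) \<eta> = 2 * uX X (klein_inv \<eta>)"
proof -
  let ?P = "poisson (support_fun X)"
  have sol: "rho \<eta> * u (klein_inv \<eta>) = ?P \<eta>" if "support_solution X u" "\<eta> \<in> disk" for u \<eta>
    using that(1) unfolding support_solution_iff
    by (intro dirichlet_unique[OF _ _ klein_harmonic_poisson[OF phi_cont] poisson_extension that(2)]) auto
  define u0 where "u0 p = (if p \<in> hyp_plane then ?P (klein p) / rho (klein p) else undefined)" for p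
  have u0: "u0 (klein_inv \<eta>) = defect \<eta> / (2 * pi) * Ik 2 (\<lambda>t. support_fun X (cis t)) \<eta>" if "\<eta> \<in> disk" for \<eta>
    using klein_inv_inverse[OF that] disk_pos[OF that] by (simp add: u0_def poisson_def)
  have s0: "smooth_on disk (\<lambda>\<eta>. u0 (klein_inv \<eta>))"
    by (rule smooth_on_disk_cong[OF _ smooth_on_poisson_quotient[OF phi_cont]]) (rule u0)
  have e0: "rho \<eta> * u0 (klein_inv \<eta>) = ?P \<eta>" if "\<eta> \<in> disk" for \<eta> by (simp add: u0[OF that] poisson_def)
  have sm0: "smooth_on disk (\<lambda>\<eta>. rho \<eta> * u0 (klein_inv \<eta>))" by (rule smooth_on_rescale[OF s0])
  have n0: "nab (\<lambda>\<eta>. rho \<eta> * u0 (klein_inv \<eta>)) \<eta> = nab ?P \<eta>" if "\<eta> \<in> disk" for \<eta>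
    unfolding nab_def using ddir_cong_open[OF open_ball that e0] by simp
  have "Hess (\<lambda>\<eta>. rho \<eta> * u0 (klein_inv \<eta>)) \<eta> a b = Hess ?P \<eta> a b" if "\<eta> \<in> disk" for \<eta> a b
    unfolding Hess_def using ddir_cong_open[OF open_ball that n0] by simp
  then have "klein_harmonic (\<lambda>\<eta>. rho \<eta> * u0 (klein_inv \<eta>))"
    using klein_harmonic_poisson[OF phi_cont] sm0 by (simp add: klein_harmonic_def Mtr_def)
  moreover have "continuous_on (cball 0 1) (\<lambda>\<eta>. if \<eta> \<in> disk then rho \<eta> * u0 (klein_inv \<eta>) else support_fun X \<eta>)"
    by (rule continuous_on_eq[OF poisson_extension]) (use e0 in auto)
  ultimately have sol0: "support_solution X u0" using s0 by (simp add: support_solution_iff)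
  have "support_solution X (uX X)"
  proof -
    have "uX X \<in> extensional hyp_plane \<and> support_solution X (uX X)"
      unfolding uX_def
    proof (rule theI[where P="\<lambda>u. u \<in> extensional hyp_plane \<and> support_solution X u"])
      show "u0 \<in> extensional hyp_plane \<and> support_solution X u0" using sol0 by (auto simp: extensional_def u0_def)
      fix u assume u: "u \<in> extensional hyp_plane \<and> support_solution X u"
      have "u p = u0 p" for p
      proof (cases "p \<in> hyp_plane")
        case True
        have d: "klein p \<in> disk" "klein_inv (klein p) = p" using klein_inverse[OF True] by auto
        have "rho (klein p) * u p = rho (klein p) * u0 p"
          using sol[OF conjunct2[OF u] d(1)] e0[OF d(1)] d(2) by simp
        then show ?thesis using disk_pos[OF d(1)] by simp
      next
        case False then show ?thesis using u by (simp add: extensional_def u0_def)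
      qed
      then show "u = u0" by blast
    qed
    then show ?thesis by blast
  qed
  note S = this
  show s: "smooth_on disk (\<lambda>\<eta>. uX X (klein_inv \<eta>))" using S by (simp add: support_solution_iff)
  show "rho \<eta> * uX X (klein_inv \<eta>) = ?P \<eta>" if "\<eta> \<in> disk" for \<eta> by (rule sol[OF S that])
  show "laplacian klein_metric (\<lambda>\<eta>. uX X (klein_inv \<eta>)) \<eta> = 2 * uX X (klein_inv \<eta>)" if "\<eta> \<in> disk" for \<eta>
    using S klein_harmonic_rescale_iff[OF s] that by (simp add: support_solution_iff)
qed

end

lemma nab_cong: "\<eta> \<in> disk \<Longrightarrow> (\<And>y. y \<in> disk \<Longrightarrow> f y = g y) \<Longrightarrow> nab f \<eta> = nab g \<eta>"
  unfolding nab_def using ddir_cong_open[OF open_ball, of \<eta> 0 1 f g] by simp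

text \<open>In terms of \<open>f\<close> the field is regular up to the boundary, where only the term \<open>i f \<eta>\<close> remains.\<close>

lemma Wf_rescale:
  assumes u: "smooth_on disk u" and eta: "\<eta> \<in> disk"
  shows "Wf (nab u) \<eta> = \<i> * ((rho \<eta> * u \<eta>) *\<^sub>R \<eta> + defect \<eta> *\<^sub>R nab (\<lambda>y. rho y * u y) \<eta>)"
proof -
  note p = disk_pos[OF eta]
  have "defect \<eta> * (u \<eta> / rho \<eta>) = rho \<eta> * u \<eta>" using defect_div_rho[OF eta] by (metis mult.commute times_divide_eq_left times_divide_eq_right)
  then show ?thesis
    by (simp add: Wf_def nab_rescale[OF u eta] rho_power3[OF eta] scaleR_diff_right mult.commute)
qed

lemma extends_continuously_iff:
  "extends_continuously_to V X \<longleftrightarrow> (\<forall>z\<in>circle. (klein_push V \<longlongrightarrow> X z) (at z within disk))"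
proof -
  have "disk - {z} = disk" if "z \<in> circle" for z :: complex using that by auto
  then show ?thesis
    unfolding extends_continuously_to_def tendsto_at_iff_sequentially o_def by auto
qed

context
  fixes X :: "complex \<Rightarrow> complex"
  assumes X: "circle_vector_field X" "continuous_on circle X"
begin

lemma klein_push_HL:
  assumes eta: "\<eta> \<in> disk"
  shows "klein_push (HL X) \<eta> = Wf (nab (\<lambda>\<eta>. uX X (klein_inv \<eta>))) \<eta>"
  using klein_push_J_grad[OF uX_poisson(1)[OF X] eta] by (simp add: HL_def[abs_def])

lemma rescale_uX:
  assumes eta: "\<eta> \<in> disk"
  shows "nab (\<lambda>y. rho y * uX X (klein_inv y)) \<eta> = nab (poisson (support_fun X)) \<eta>"
  by (rule nab_cong[OF eta]) (rule uX_poisson(2)[OF X])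

lemma klein_push_HL_poisson:
  assumes eta: "\<eta> \<in> disk"
  shows "klein_push (HL X) \<eta> = \<i> * (poisson (support_fun X) \<eta> *\<^sub>R \<eta> + defect \<eta> *\<^sub>R nab (poisson (support_fun X)) \<eta>)"
  unfolding klein_push_HL[OF eta] Wf_rescale[OF uX_poisson(1)[OF X] eta] rescale_uX[OF eta] uX_poisson(2)[OF X eta] ..

lemma HL_tangent: "HL X p \<in> hyp_tangent p"
  by (simp add: HL_def hyp_J_tangent)

lemma HL_harmonic_lagrangian: "harmonic_lagrangian (HL X)"
  by (rule harmonic_lagrangianI[OF uX_poisson(1)[OF X] uX_poisson(3)[OF X]]) (use klein_push_HL HL_tangent in auto)

lemma HL_extends: "extends_continuously_to (HL X) X"
  unfolding extends_continuously_iff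
proof
  fix z :: complex assume z: "z \<in> circle"
  note t = poisson_tendsto[OF continuous_on_support_fun[OF X] z]
  let ?W = "\<lambda>\<eta>. \<i> * (poisson (support_fun X) \<eta> *\<^sub>R \<eta> + defect \<eta> *\<^sub>R nab (poisson (support_fun X)) \<eta>)"
  have L: "(?W \<longlongrightarrow> \<i> * (support_fun X z *\<^sub>R z + 0)) (at z within disk)"
    by (intro tendsto_intros t)
  have e: "\<i> * (support_fun X z *\<^sub>R z + 0) = X z"
    using support_fun_props(2)[OF X(1) z] by (simp add: scaleR_conv_of_real mult_ac)
  have "\<forall>\<^sub>F \<eta> in at z within disk. \<eta> \<in> disk" by (simp add: eventually_at_filter)
  then have "\<forall>\<^sub>F \<eta> in at z within disk. ?W \<eta> = klein_push (HL X) \<eta>"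
    by (rule eventually_mono) (simp only: klein_push_HL_poisson)
  from Lim_transform_eventually[OF L this]
  show "(klein_push (HL X) \<longlongrightarrow> X z) (at z within disk)" unfolding e .
qed

lemma dbar_norm_HL_le_iff:
  "dbar_norm (HL X) \<le> ereal L \<longleftrightarrow>
    (\<forall>\<eta>\<in>disk. \<forall>a. \<bar>Hess (poisson (support_fun X)) \<eta> a a\<bar> \<le> L * rho \<eta> * klein_metric \<eta> a a)"
proof -
  have "ddir (nab (\<lambda>y. rho y * uX X (klein_inv y))) \<eta> a = ddir (nab (poisson (support_fun X))) \<eta> a" if "\<eta> \<in> disk" for \<eta> a
    by (rule ddir_cong_open[OF open_ball that]) (rule rescale_uX)
  note dd = this
  have "dbar_norm (HL X) \<le> ereal L \<longleftrightarrow> (\<forall>\<eta>\<in>disk. \<forall>a. \<bar>ddir (nab (\<lambda>y. rho y * uX X (klein_inv y))) \<eta> a \<bullet> a\<bar>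
      \<le> L * rho \<eta> * klein_metric \<eta> a a)"
    by (rule dbar_norm_le_iff[OF uX_poisson(1)[OF X]]) (rule uX_poisson(3)[OF X] klein_push_HL, assumption)+
  also have "\<dots> \<longleftrightarrow> (\<forall>\<eta>\<in>disk. \<forall>a. \<bar>Hess (poisson (support_fun X)) \<eta> a a\<bar> \<le> L * rho \<eta> * klein_metric \<eta> a a)"
    unfolding Hess_def by (intro ball_cong refl) (simp only: dd)
  finally show ?thesis .
qed

end

text \<open>Conversely the boundary values of \<open>V = J grad u\<close> determine those of \<open>\<rho> u\<close>: along a ray,
  \<open>(u - c/\<rho>)'\<close> has the sign of \<open>\<rho>\<^sup>3 \<nabla>u\<cdot>\<eta> - c |\<eta>|\<^sup>2\<close>, where \<open>\<rho>\<^sup>3 \<nabla>u\<cdot>\<eta>\<close> is the angular component of \<open>V\<close>.\<close>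

lemma potential_upper_bound:
  assumes u: "smooth_on disk u" and z0: "z0 \<in> circle" and d: "0 < d" "d < 1"
    and h: "\<And>\<eta>. \<eta> \<in> disk \<Longrightarrow> dist \<eta> z0 < d \<Longrightarrow> rho \<eta> ^ 3 * (nab u \<eta> \<bullet> \<eta>) \<le> c * (\<eta> \<bullet> \<eta>)"
  obtains B where "\<And>\<eta>. \<eta> \<in> disk \<Longrightarrow> dist \<eta> z0 < d / 2 \<Longrightarrow> rho \<eta> * u \<eta> \<le> c + B * rho \<eta>"
proof -
  define t0 where "t0 = 1 - d / 2"
  have t0: "0 < t0" "t0 < 1" using d by (simp_all add: t0_def)
  have sub: "cball 0 t0 \<subseteq> disk" using t0 by auto
  have cr: "continuous_on (cball 0 t0) (\<lambda>y. u y - c / rho y)"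
    by (intro continuous_intros continuous_on_subset[OF smooth_on_continuous[OF u] sub]
        continuous_on_subset[OF smooth_on_continuous[OF smooth_on_rho] sub]) (use sub disk_pos in blast)
  have "bounded ((\<lambda>y. u y - c / rho y) ` cball 0 t0)"
    by (intro compact_imp_bounded compact_continuous_image cr compact_cball)
  then obtain B where B: "\<forall>x\<in>(\<lambda>y. u y - c / rho y) ` cball 0 t0. norm x \<le> B" unfolding bounded_iff by blast
  show thesis
  proof (rule that)
    fix \<eta> :: complex assume eta: "\<eta> \<in> disk" and de: "dist \<eta> z0 < d / 2"
    have ne: "norm \<eta> < 1" using eta by simp
    have "u (1 *\<^sub>R \<eta>) - c / rho (1 *\<^sub>R \<eta>) \<le> u (t0 *\<^sub>R \<eta>) - c / rho (t0 *\<^sub>R \<eta>)"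
    proof (rule DERIV_nonpos_imp_nonincreasing[where f="\<lambda>t. u (t *\<^sub>R \<eta>) - c / rho (t *\<^sub>R \<eta>)" and a=t0 and b=1])
      show "t0 \<le> 1" using t0 by simp
      fix t assume t: "t0 \<le> t" "t \<le> 1"
      define y where "y = t *\<^sub>R \<eta>"
      have y: "y \<in> disk" unfolding y_def by (rule scaleR_in_disk[OF eta]) (use t t0 in auto)
      note p = disk_pos[OF y]
      have "dist y \<eta> = (1 - t) * norm \<eta>"
      proof -
        have "y - \<eta> = - ((1 - t) *\<^sub>R \<eta>)" by (simp add: y_def algebra_simps)
        then show ?thesis using t by (simp add: dist_norm)
      qed
      also have "\<dots> \<le> 1 - t" using t ne by (simp add: mult_left_le)
      also have "\<dots> \<le> d / 2" using t by (simp add: t0_def)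
      finally have "dist y z0 < d" using de dist_triangle[of y z0 \<eta>] by simp
      then have hy: "rho y ^ 3 * (nab u y \<bullet> y) \<le> c * (y \<bullet> y)" by (rule h[OF y])
      have D1: "((\<lambda>t. u (0 + t *\<^sub>R \<eta>)) has_real_derivative nab u y \<bullet> \<eta>) (at t)"
        using ddir_line[of u 0 t \<eta>] smooth_on_differentiable[OF u y] ddir_nab[OF smooth_on_differentiable[OF u y]] by (simp add: y_def)
      have r: "((\<lambda>y. (1 / rho y ^ 1) *\<^sub>R (1::real)) has_derivative (\<lambda>v. (y \<bullet> v) / rho y ^ 3)) (at y)"
        using has_derivative_div_rho[OF y has_derivative_const[of "1::real"], of 1] by (simp add: numeral_3_eq_3)
      have D2: "((\<lambda>t. 1 / rho (0 + t *\<^sub>R \<eta>)) has_real_derivative (y \<bullet> \<eta>) / rho y ^ 3) (at t)"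
        using ddir_line[of "\<lambda>y. (1 / rho y ^ 1) *\<^sub>R (1::real)" 0 t \<eta>] differentiableI[OF r] ddir_eqI[OF r] by (simp add: y_def)
      have D: "((\<lambda>t. u (t *\<^sub>R \<eta>) - c / rho (t *\<^sub>R \<eta>)) has_real_derivative nab u y \<bullet> \<eta> - c * ((y \<bullet> \<eta>) / rho y ^ 3)) (at t)"
        using DERIV_diff[OF D1 DERIV_cmult[OF D2, of c]] by simp
      have "nab u y \<bullet> \<eta> - c * ((y \<bullet> \<eta>) / rho y ^ 3) = (rho y ^ 3 * (nab u y \<bullet> y) - c * (y \<bullet> y)) / (t * rho y ^ 3)"
        using p t t0 by (simp add: y_def[of] divide_simps) (simp add: algebra_simps)
      also have "\<dots> \<le> 0" using hy p t t0 by (intro divide_nonpos_pos) auto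
      finally show "\<exists>z. ((\<lambda>t. u (t *\<^sub>R \<eta>) - c / rho (t *\<^sub>R \<eta>)) has_real_derivative z) (at t) \<and> z \<le> 0" using D by blast
    qed
    moreover have "u (t0 *\<^sub>R \<eta>) - c / rho (t0 *\<^sub>R \<eta>) \<le> B"
    proof -
      have "t0 *\<^sub>R \<eta> \<in> cball 0 t0" using ne t0 by (simp add: mult_left_le)
      then have "norm (u (t0 *\<^sub>R \<eta>) - c / rho (t0 *\<^sub>R \<eta>)) \<le> B" using B by blast
      then show ?thesis by simp
    qed
    ultimately have "u \<eta> \<le> c / rho \<eta> + B" by simp
    then have "rho \<eta> * u \<eta> \<le> rho \<eta> * (c / rho \<eta> + B)" using disk_pos[OF eta] by (intro mult_left_mono) auto
    then show "rho \<eta> * u \<eta> \<le> c + B * rho \<eta>" using disk_pos[OF eta] by (simp add: algebra_simps)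
  qed
qed

lemma rho_tendsto_0: "z0 \<in> circle \<Longrightarrow> (rho \<longlongrightarrow> 0) (at z0 within disk)"
proof -
  assume z0: "z0 \<in> circle"
  have "((\<lambda>\<eta>. sqrt (1 - \<eta> \<bullet> \<eta>)) \<longlongrightarrow> sqrt (1 - z0 \<bullet> z0)) (at z0 within disk)" by (intro tendsto_intros)
  moreover have "z0 \<bullet> z0 = 1" using z0 by (simp flip: power2_norm_eq_inner)
  ultimately show ?thesis by (simp add: rho_def[abs_def] defect_def[abs_def])
qed

lemma potential_eventually_less:
  assumes u: "smooth_on disk u" and z0: "z0 \<in> circle"
    and h: "((\<lambda>\<eta>. rho \<eta> ^ 3 * (nab u \<eta> \<bullet> \<eta>)) \<longlongrightarrow> l) (at z0 within disk)" and l: "l < k"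
  shows "\<forall>\<^sub>F \<eta> in at z0 within disk. rho \<eta> * u \<eta> < k"
proof -
  define c where "c = (l + k) / 2"
  have c: "l < c" "c < k" using l by (simp_all add: c_def)
  have zz: "z0 \<bullet> z0 = 1" using z0 by (simp flip: power2_norm_eq_inner)
  have "((\<lambda>\<eta>. rho \<eta> ^ 3 * (nab u \<eta> \<bullet> \<eta>) - c * (\<eta> \<bullet> \<eta>)) \<longlongrightarrow> l - c * (z0 \<bullet> z0)) (at z0 within disk)"
    by (intro tendsto_intros h)
  from order_tendstoD(2)[OF this, of 0] have "\<forall>\<^sub>F \<eta> in at z0 within disk. rho \<eta> ^ 3 * (nab u \<eta> \<bullet> \<eta>) - c * (\<eta> \<bullet> \<eta>) < 0"
    using c zz by simp
  then obtain d0 where d0: "d0 > 0" "\<And>\<eta>. \<eta> \<in> disk \<Longrightarrow> \<eta> \<noteq> z0 \<Longrightarrow> dist \<eta> z0 < d0 \<Longrightarrow> rho \<eta> ^ 3 * (nab u \<eta> \<bullet> \<eta>) - c * (\<eta> \<bullet> \<eta>) < 0"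
    unfolding eventually_at by blast
  define d where "d = min d0 (1/2)"
  have d: "0 < d" "d < 1" using d0 by (auto simp: d_def)
  have "rho \<eta> ^ 3 * (nab u \<eta> \<bullet> \<eta>) \<le> c * (\<eta> \<bullet> \<eta>)" if "\<eta> \<in> disk" "dist \<eta> z0 < d" for \<eta>
    using d0(2)[OF that(1)] that z0 by (force simp: d_def)
  from potential_upper_bound[OF u z0 d this] obtain B where
    B: "\<And>\<eta>. \<eta> \<in> disk \<Longrightarrow> dist \<eta> z0 < d / 2 \<Longrightarrow> rho \<eta> * u \<eta> \<le> c + B * rho \<eta>" by blast
  have "((\<lambda>\<eta>. c + B * rho \<eta>) \<longlongrightarrow> c + B * 0) (at z0 within disk)" by (intro tendsto_intros rho_tendsto_0 z0)
  from order_tendstoD(2)[OF this, of k] have "\<forall>\<^sub>F \<eta> in at z0 within disk. c + B * rho \<eta> < k" using c by simp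
  moreover have "\<forall>\<^sub>F \<eta> in at z0 within disk. \<eta> \<in> disk \<and> dist \<eta> z0 < d / 2"
    unfolding eventually_at using d by (intro exI[of _ "d/2"]) auto
  ultimately show ?thesis by eventually_elim (use B in fastforce)
qed

lemma potential_tendsto:
  assumes u: "smooth_on disk u" and z0: "z0 \<in> circle"
    and h: "((\<lambda>\<eta>. rho \<eta> ^ 3 * (nab u \<eta> \<bullet> \<eta>)) \<longlongrightarrow> l) (at z0 within disk)"
  shows "((\<lambda>\<eta>. rho \<eta> * u \<eta>) \<longlongrightarrow> l) (at z0 within disk)"
proof (rule order_tendstoI)
  fix k assume "l < k"
  then show "\<forall>\<^sub>F \<eta> in at z0 within disk. rho \<eta> * u \<eta> < k" by (rule potential_eventually_less[OF u z0 h])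
next
  fix k assume k: "k < l"
  have s: "smooth_on disk (\<lambda>y. - u y)"
    by (rule smooth_on_linear_comp[OF open_ball bounded_linear_minus[OF bounded_linear_ident] u])
  have n: "nab (\<lambda>y. - u y) y = - nab u y" if "y \<in> disk" for y
    by (rule nab_eqI) (use has_derivative_minus[OF has_derivative_nab[OF u that]] in simp)
  have "((\<lambda>\<eta>. - (rho \<eta> ^ 3 * (nab u \<eta> \<bullet> \<eta>))) \<longlongrightarrow> - l) (at z0 within disk)" by (intro tendsto_intros h)
  then have "((\<lambda>\<eta>. rho \<eta> ^ 3 * (nab (\<lambda>y. - u y) \<eta> \<bullet> \<eta>)) \<longlongrightarrow> - l) (at z0 within disk)"
    by (rule Lim_transform_eventually) (simp add: eventually_at_filter n)
  from potential_eventually_less[OF s z0 this, of "- k"] k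
  show "\<forall>\<^sub>F \<eta> in at z0 within disk. k < rho \<eta> * u \<eta>" by simp
qed

text \<open>The potential of \<open>V\<close> solves the same Dirichlet problem as \<open>u\<^sub>X\<close>.\<close>

theorem harmonic_lagrangian_unique:
  assumes X: "circle_vector_field X" "continuous_on circle X"
    and V: "harmonic_lagrangian V" and ext: "extends_continuously_to V X" and p: "p \<in> hyp_plane"
  shows "V p = HL X p"
proof -
  from harmonic_lagrangian_potential[OF V] obtain u where u: "smooth_on disk u"
    "\<And>\<eta>. \<eta> \<in> disk \<Longrightarrow> laplacian klein_metric u \<eta> = 2 * u \<eta>" "\<And>\<eta>. \<eta> \<in> disk \<Longrightarrow> klein_push V \<eta> = Wf (nab u) \<eta>" by blast
  let ?phi = "support_fun X"
  have "((\<lambda>\<eta>. rho \<eta> * u \<eta>) \<longlongrightarrow> ?phi z) (at z within disk)" if z: "z \<in> circle" for z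
  proof (rule potential_tendsto[OF u(1) z])
    have "((\<lambda>\<eta>. (- \<i> * klein_push V \<eta>) \<bullet> \<eta>) \<longlongrightarrow> (- \<i> * X z) \<bullet> z) (at z within disk)"
      using ext z unfolding extends_continuously_iff by (intro tendsto_intros) auto
    moreover have "(- \<i> * X z) \<bullet> z = ?phi z"
      unfolding support_fun_props(1)[OF X(1) z] by (simp add: inner_complex_def)
    ultimately have "((\<lambda>\<eta>. (- \<i> * klein_push V \<eta>) \<bullet> \<eta>) \<longlongrightarrow> ?phi z) (at z within disk)" by simp
    then show "((\<lambda>\<eta>. rho \<eta> ^ 3 * (nab u \<eta> \<bullet> \<eta>)) \<longlongrightarrow> ?phi z) (at z within disk)"
      by (rule Lim_transform_eventually) (simp add: eventually_at_filter u(3) Wf_def)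
  qed
  then have c: "continuous_on (cball 0 1) (\<lambda>\<eta>. if \<eta> \<in> disk then rho \<eta> * u \<eta> else ?phi \<eta>)"
    by (intro continuous_on_extension smooth_on_continuous smooth_on_rescale u continuous_on_support_fun X)
  have f: "klein_harmonic (\<lambda>\<eta>. rho \<eta> * u \<eta>)" using klein_harmonic_rescale_iff[OF u(1)] u(2) by simp
  have eq: "rho \<eta> * u \<eta> = poisson ?phi \<eta>" if "\<eta> \<in> disk" for \<eta>
    by (rule dirichlet_unique[OF f c klein_harmonic_poisson[OF continuous_on_support_fun[OF X]] poisson_extension[OF X] that])
  define \<eta> where "\<eta> = klein p"
  have d: "\<eta> \<in> disk" "klein_inv \<eta> = p" using klein_inverse[OF p] by (auto simp: \<eta>_def)
  have n: "nab (\<lambda>y. rho y * u y) \<eta> = nab (poisson ?phi) \<eta>" by (rule nab_cong[OF d(1)]) (rule eq)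
  have "klein_push V \<eta> = klein_push (HL X) \<eta>"
    unfolding u(3)[OF d(1)] Wf_rescale[OF u(1) d(1)] klein_push_HL_poisson[OF X d(1)] eq[OF d(1)] n ..
  then have "klein_drop \<eta> (V p) = klein_drop \<eta> (HL X p)"
    unfolding klein_push_def ddir_klein[OF d(1)] unfolding d(2) .
  moreover have "V p \<in> hyp_tangent (klein_inv \<eta>)"
    using V p d(2) by (simp add: harmonic_lagrangian_def smooth_vector_field_def)
  moreover have "HL X p \<in> hyp_tangent (klein_inv \<eta>)" using HL_tangent[OF X] d(2) by simp
  ultimately show ?thesis using klein_lift_drop[OF d(1)] by metis
qed

lemma dbar_norm_cong:
  assumes "\<And>p. p \<in> hyp_plane \<Longrightarrow> V p = W p"
  shows "dbar_norm V = dbar_norm W"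
proof -
  have kp: "klein_push V \<eta> = klein_push W \<eta>" if "\<eta> \<in> disk" for \<eta>
    using assms[OF klein_inv_inverse(1)[OF that]] by (simp add: klein_push_def)
  have "dbar V p Y = dbar W p Y" if p: "p \<in> hyp_plane" for p Y
  proof -
    have d: "klein p \<in> disk" using klein_inverse[OF p] by auto
    have "ddir (klein_push V) (klein p) b = ddir (klein_push W) (klein p) b" for b
      by (rule ddir_cong_open[OF open_ball d]) (rule kp)
    then have "hyp_nabla Y V p = hyp_nabla Y W p" for Y by (simp add: hyp_nabla_def cov_deriv_def kp[OF d])
    then show ?thesis by (simp add: dbar_def)
  qed
  then have "dbar_norm_at V p = dbar_norm_at W p" if "p \<in> hyp_plane" for p
    using that by (simp add: dbar_norm_at_def)
  then show ?thesis by (simp add: dbar_norm_def)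
qed

section \<open>The width\<close>

lemma affine_fun_iff: "affine_fun a \<longleftrightarrow> (\<exists>l c. a = (\<lambda>z. l \<bullet> z + c))"
proof
  assume "affine_fun a"
  then obtain L c where L: "linear L" "a = (\<lambda>z. L z + c)" unfolding affine_fun_def by blast
  have "L z = Complex (L 1) (L \<i>) \<bullet> z" for z using linear_basis[OF L(1), of z] by (simp add: inner_complex_def mult_ac)
  then have "a = (\<lambda>z. Complex (L 1) (L \<i>) \<bullet> z + c)" unfolding L(2) fun_eq_iff add_right_cancel by blast
  then show "\<exists>l c. a = (\<lambda>z. l \<bullet> z + c)" by blast
next
  assume "\<exists>l c. a = (\<lambda>z. l \<bullet> z + c)"
  then show "affine_fun a" unfolding affine_fun_def using bounded_linear.linear[OF bounded_linear_inner_right] by blast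
qed

context
  fixes X :: "complex \<Rightarrow> complex"
  assumes X: "circle_vector_field X" "continuous_on circle X"
begin

private abbreviation "P \<equiv> poisson (support_fun X)"
private abbreviation "lower_set \<eta> \<equiv> {a \<eta> |a. affine_fun a \<and> (\<forall>w\<in>circle. a w \<le> support_fun X w)}"
private abbreviation "upper_set \<eta> \<equiv> {a \<eta> |a. affine_fun a \<and> (\<forall>w\<in>circle. support_fun X w \<le> a w)}"

lemma lower_set_le: "\<eta> \<in> disk \<Longrightarrow> y \<in> lower_set \<eta> \<Longrightarrow> y \<le> P \<eta>"
  using affine_le_poisson[OF continuous_on_support_fun[OF X]] by (auto simp: affine_fun_iff)

lemma le_upper_set: "\<eta> \<in> disk \<Longrightarrow> y \<in> upper_set \<eta> \<Longrightarrow> P \<eta> \<le> y"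
  using poisson_le_affine[OF continuous_on_support_fun[OF X]] by (auto simp: affine_fun_iff)

lemma sets_nonempty: "lower_set \<eta> \<noteq> {}" "upper_set \<eta> \<noteq> {}"
proof -
  obtain B where B: "\<forall>z\<in>circle. \<bar>support_fun X z\<bar> \<le> B"
    using continuous_circle_bounded[OF continuous_on_support_fun[OF X]] by blast
  have "affine_fun (\<lambda>z. c)" for c unfolding affine_fun_iff by (intro exI[of _ 0] exI[of _ c]) simp
  moreover have "- B \<le> support_fun X w" "support_fun X w \<le> B" if "w \<in> circle" for w using B[rule_format, OF that] by auto
  ultimately have "- B \<in> lower_set \<eta>" "B \<in> upper_set \<eta>" by (auto intro: exI[of _ "\<lambda>z. - B"] exI[of _ "\<lambda>z. B"])
  then show "lower_set \<eta> \<noteq> {}" "upper_set \<eta> \<noteq> {}" by blast+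
qed

lemma phi_minus_upper: "\<eta> \<in> disk \<Longrightarrow> y \<in> lower_set \<eta> \<Longrightarrow> y \<le> phi_minus X \<eta>"
  unfolding phi_minus_def by (rule cSup_upper[OF _ bdd_aboveI[OF lower_set_le]])

lemma phi_plus_lower: "\<eta> \<in> disk \<Longrightarrow> y \<in> upper_set \<eta> \<Longrightarrow> phi_plus X \<eta> \<le> y"
  unfolding phi_plus_def by (rule cInf_lower[OF _ bdd_belowI[OF le_upper_set]])

lemma phi_minus_least: "(\<And>y. y \<in> lower_set \<eta> \<Longrightarrow> y \<le> K) \<Longrightarrow> phi_minus X \<eta> \<le> K"
  unfolding phi_minus_def by (rule cSup_least[OF sets_nonempty(1)])

lemma phi_plus_greatest: "(\<And>y. y \<in> upper_set \<eta> \<Longrightarrow> K \<le> y) \<Longrightarrow> K \<le> phi_plus X \<eta>"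
  unfolding phi_plus_def by (rule cInf_greatest[OF sets_nonempty(2)])

lemma poisson_le_phi_plus: "\<eta> \<in> disk \<Longrightarrow> P \<eta> \<le> phi_plus X \<eta>"
  by (rule phi_plus_greatest) (rule le_upper_set)

lemma width_le_iff: "width X \<le> ereal w \<longleftrightarrow> (\<forall>\<eta>\<in>disk. phi_plus X \<eta> - phi_minus X \<eta> \<le> w * rho \<eta>)"
  unfolding width_def SUP_le_iff using disk_pos(2) by (auto simp: rho_eq divide_le_eq)

text \<open>The Hessian is controlled by the gap between the two convex envelopes, because \<open>f - a\<close> is the Poisson
  integral of a nonnegative function for every affine \<open>a \<le> \<phi>\<close>.\<close>

lemma Hess_le_gap:
  assumes eta: "\<eta> \<in> disk"
  shows "\<bar>Hess P \<eta> v v\<bar> \<le> 3 * (P \<eta> - phi_minus X \<eta>) * klein_metric \<eta> v v"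
proof -
  note phi = continuous_on_support_fun[OF X]
  have b: "\<bar>Hess P \<eta> v v\<bar> \<le> 3 * (P \<eta> - y) * klein_metric \<eta> v v" if "y \<in> lower_set \<eta>" for y
  proof -
    from that obtain l c where lc: "y = l \<bullet> \<eta> + c" "\<And>w. w \<in> circle \<Longrightarrow> l \<bullet> w + c \<le> support_fun X w"
      by (auto simp: affine_fun_iff)
    define \<psi> where "\<psi> z = support_fun X z + ((- l) \<bullet> z + (- c))" for z
    have psi: "continuous_on circle \<psi>" unfolding \<psi>_def by (intro continuous_intros phi)
    have pos: "\<psi> z \<ge> 0" if "z \<in> circle" for z using lc(2)[OF that] by (simp add: \<psi>_def)
    have Pp: "poisson \<psi> z = P z + ((- l) \<bullet> z + (- c))" if "z \<in> disk" for z
      unfolding \<psi>_def[abs_def] by (rule poisson_add_affine[OF phi that])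
    have N: "nab (poisson \<psi>) z = nab P z + (- l)" if "z \<in> disk" for z
      unfolding \<psi>_def[abs_def] by (rule nab_poisson_add_affine[OF phi that])
    have "ddir (nab (poisson \<psi>)) \<eta> v = ddir (nab P) \<eta> v"
    proof (rule ddir_eqI)
      have "((\<lambda>z. nab P z + (- l)) has_derivative (\<lambda>a. ddir (nab P) \<eta> a + 0)) (at \<eta>)"
        by (intro has_derivative_add has_derivative_const smooth_on_has_derivative[of disk] smooth_on_nab smooth_on_poisson phi eta)
      then have "((\<lambda>z. nab P z + (- l)) has_derivative (ddir (nab P) \<eta>)) (at \<eta>)" by simp
      then show "(nab (poisson \<psi>) has_derivative (ddir (nab P) \<eta>)) (at \<eta>)"
        by (rule has_derivative_transform_within_open[OF _ open_ball eta]) (simp add: N)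
    qed
    moreover have "poisson \<psi> \<eta> = P \<eta> - y" unfolding Pp[OF eta] by (simp add: lc(1))
    ultimately show ?thesis
      using Hess_poisson_bound[OF psi eta pos, of v] by (simp only: Hess_def)
  qed
  show ?thesis
  proof (cases "klein_metric \<eta> v v = 0")
    case True
    obtain y where "y \<in> lower_set \<eta>" using sets_nonempty(1) by blast
    then show ?thesis using b[of y] by (simp add: True)
  next
    case False
    then have g: "klein_metric \<eta> v v > 0" using klein_metric_pos(2)[OF eta, of v] by simp
    have "phi_minus X \<eta> \<le> P \<eta> - \<bar>Hess P \<eta> v v\<bar> / (3 * klein_metric \<eta> v v)"
    proof (rule phi_minus_least)
      fix y assume "y \<in> lower_set \<eta>"
      from b[OF this] have "\<bar>Hess P \<eta> v v\<bar> / (3 * klein_metric \<eta> v v) \<le> P \<eta> - y" using g by (subst pos_divide_le_eq) (simp_all add: algebra_simps)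
      then show "y \<le> P \<eta> - \<bar>Hess P \<eta> v v\<bar> / (3 * klein_metric \<eta> v v)" by linarith
    qed
    then have "\<bar>Hess P \<eta> v v\<bar> / (3 * klein_metric \<eta> v v) \<le> P \<eta> - phi_minus X \<eta>" by linarith
    then show ?thesis using g by (subst (asm) pos_divide_le_eq) (simp_all add: algebra_simps)
  qed
qed

lemma dbar_norm_le_width:
  assumes "width X \<le> ereal w"
  shows "dbar_norm (HL X) \<le> ereal (3 * w)"
  unfolding dbar_norm_HL_le_iff[OF X]
proof (intro ballI allI)
  fix \<eta> a assume eta: "\<eta> \<in> disk"
  have "P \<eta> - phi_minus X \<eta> \<le> w * rho \<eta>"
    using assms eta poisson_le_phi_plus[OF eta] unfolding width_le_iff by fastforce
  then have "3 * (P \<eta> - phi_minus X \<eta>) * klein_metric \<eta> a a \<le> 3 * (w * rho \<eta>) * klein_metric \<eta> a a"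
    using klein_metric_pos(2)[OF eta] by (intro mult_right_mono mult_left_mono) auto
  then show "\<bar>Hess P \<eta> a a\<bar> \<le> 3 * w * rho \<eta> * klein_metric \<eta> a a"
    using Hess_le_gap[OF eta, of a] by (simp add: mult_ac)
qed

end

text \<open>Adding \<open>L \<rho>\<close> makes \<open>f\<close> concave, so that its tangent planes dominate the boundary values.\<close>

lemma concave_majorant:
  assumes u: "smooth_on disk u" and H: "\<And>\<eta> a. \<eta> \<in> disk \<Longrightarrow> Hess (\<lambda>y. rho y * u y) \<eta> a a \<le> L * rho \<eta> * klein_metric \<eta> a a"
    and lim: "\<And>z. z \<in> circle \<Longrightarrow> ((\<lambda>y. rho y * u y) \<longlongrightarrow> \<psi> z) (at z within disk)" and x: "x \<in> disk"
  obtains a where "affine_fun a" "\<And>z. z \<in> circle \<Longrightarrow> \<psi> z \<le> a z" "a x = rho x * u x + L * rho x"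
proof -
  define w where "w = (\<lambda>y. rho y * (u y + L))"
  have uL: "smooth_on disk (\<lambda>y. u y + L)" by (intro smooth_on_add u smooth_on_const open_ball)
  have sw: "smooth_on disk w" unfolding w_def by (rule smooth_on_rescale[OF uL])
  have Hw: "Hess w \<eta> a a \<le> 0" if eta: "\<eta> \<in> disk" for \<eta> a
  proof -
    have "ddir (nab (\<lambda>y. u y + L)) \<eta> a = ddir (nab u) \<eta> a"
      by (rule ddir_cong_open[OF open_ball eta]) (rule laplacian_add_const(2)[OF u])
    then have "Hs (nab (\<lambda>y. u y + L)) \<eta> a = Hs (nab u) \<eta> a" by (simp add: Hs_def laplacian_add_const(2)[OF u eta])
    then have "Hess w \<eta> a a = Hess (\<lambda>y. rho y * u y) \<eta> a a - L * rho \<eta> * klein_metric \<eta> a a"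
      unfolding Hess_def w_def ddir_nab_rescale[OF uL eta] ddir_nab_rescale[OF u eta] by (simp add: algebra_simps)
    then show ?thesis using H[OF eta, of a] by simp
  qed
  define a where "a = (\<lambda>z. nab w x \<bullet> z + (w x - nab w x \<bullet> x))"
  have "\<psi> z \<le> a z" if z: "z \<in> circle" for z
  proof (rule tendsto_le)
    show "at z within disk \<noteq> bot"
    proof -
      have "z islimpt disk" using z by (simp add: islimpt_ball)
      then show ?thesis by (simp add: trivial_limit_within)
    qed
    have "((\<lambda>y. rho y * u y + L * rho y) \<longlongrightarrow> \<psi> z + L * 0) (at z within disk)"
      by (intro tendsto_intros lim z rho_tendsto_0)
    then show "((\<lambda>y. w y) \<longlongrightarrow> \<psi> z) (at z within disk)" by (simp add: w_def algebra_simps)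
    show "(a \<longlongrightarrow> a z) (at z within disk)" unfolding a_def by (intro tendsto_intros)
    have "w y \<le> a y" if "y \<in> disk" for y using below_tangent[OF sw Hw x that] by (simp add: a_def inner_diff_right)
    then show "\<forall>\<^sub>F y in at z within disk. w y \<le> a y" by (simp add: eventually_at_filter)
  qed
  moreover have "affine_fun a" unfolding affine_fun_iff a_def by blast
  moreover have "a x = rho x * u x + L * rho x" by (simp add: a_def w_def algebra_simps)
  ultimately show thesis using that by blast
qed

lemma affine_fun_uminus: "affine_fun a \<Longrightarrow> affine_fun (\<lambda>z. - a z)"
  unfolding affine_fun_iff by (metis inner_minus_left minus_add_distrib)

lemma width_le_dbar_norm:
  assumes X: "circle_vector_field X" "continuous_on circle X" and L: "dbar_norm (HL X) \<le> ereal L"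
  shows "width X \<le> ereal (2 * L)"
  unfolding width_le_iff[OF X]
proof
  fix x :: complex assume x: "x \<in> disk"
  let ?P = "poisson (support_fun X)"
  define u where "u \<eta> = uX X (klein_inv \<eta>)" for \<eta>
  have u: "smooth_on disk u" "\<And>\<eta>. \<eta> \<in> disk \<Longrightarrow> rho \<eta> * u \<eta> = ?P \<eta>"
    using uX_poisson[OF X] by (auto simp: u_def[abs_def])
  have dn: "ddir (nab (\<lambda>y. rho y * u y)) \<eta> a = ddir (nab ?P) \<eta> a" if "\<eta> \<in> disk" for \<eta> a
    by (rule ddir_cong_open[OF open_ball that]) (rule nab_cong[OF _ u(2)])
  have H: "\<bar>Hess (\<lambda>y. rho y * u y) \<eta> a a\<bar> \<le> L * rho \<eta> * klein_metric \<eta> a a" if "\<eta> \<in> disk" for \<eta> a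
    using L that unfolding dbar_norm_HL_le_iff[OF X] Hess_def dn[OF that] by blast
  have lim: "((\<lambda>y. rho y * u y) \<longlongrightarrow> support_fun X z) (at z within disk)" if "z \<in> circle" for z
    by (rule Lim_transform_eventually[OF poisson_tendsto(1)[OF continuous_on_support_fun[OF X] that]])
      (simp add: eventually_at_filter u(2))
  obtain a where a: "affine_fun a" "\<And>z. z \<in> circle \<Longrightarrow> support_fun X z \<le> a z" "a x = rho x * u x + L * rho x"
    by (rule concave_majorant[OF u(1) abs_le_D1[OF H] lim x]) blast+
  have mu: "smooth_on disk (\<lambda>y. - u y)"
    by (rule smooth_on_linear_comp[OF open_ball bounded_linear_minus[OF bounded_linear_ident] u(1)])
  have mH: "Hess (\<lambda>y. rho y * - u y) \<eta> a a = - Hess (\<lambda>y. rho y * u y) \<eta> a a" if eta: "\<eta> \<in> disk" for \<eta> a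
  proof (rule Hess_eqI[where L="\<lambda>b. - Hess (\<lambda>y. rho y * u y) \<eta> b a", OF smooth_on_rescale[OF mu] eta])
    have n: "nab (\<lambda>y. rho y * - u y) y = - nab (\<lambda>y. rho y * u y) y" if "y \<in> disk" for y
      by (rule nab_eqI) (use has_derivative_minus[OF has_derivative_nab[OF smooth_on_rescale[OF u(1)] that]] in simp)
    have "((\<lambda>y. - (nab (\<lambda>y. rho y * u y) y \<bullet> a)) has_derivative (\<lambda>b. - (ddir (nab (\<lambda>y. rho y * u y)) \<eta> b \<bullet> a))) (at \<eta>)"
      by (intro has_derivative_minus has_derivative_inner_left smooth_on_has_derivative[of disk] smooth_on_nab smooth_on_rescale u(1) eta)
    then show "((\<lambda>y. nab (\<lambda>y. rho y * - u y) y \<bullet> a) has_derivative (\<lambda>b. - Hess (\<lambda>y. rho y * u y) \<eta> b a)) (at \<eta>)"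
      unfolding Hess_def by (rule has_derivative_transform_within_open[OF _ open_ball eta]) (simp only: n inner_minus_left)
  qed
  have mH': "Hess (\<lambda>y. rho y * - u y) \<eta> a a \<le> L * rho \<eta> * klein_metric \<eta> a a" if eta: "\<eta> \<in> disk" for \<eta> a
    using H[OF eta, of a] mH[OF eta, of a] by linarith
  have mlim: "((\<lambda>y. rho y * - u y) \<longlongrightarrow> - support_fun X z) (at z within disk)" if "z \<in> circle" for z
    using tendsto_minus[OF lim[OF that]] by simp
  obtain b where b: "affine_fun b" "\<And>z. z \<in> circle \<Longrightarrow> - support_fun X z \<le> b z" "b x = rho x * - u x + L * rho x"
    by (rule concave_majorant[OF mu mH' mlim x]) blast+
  have "phi_plus X x \<le> a x" by (rule phi_plus_lower[OF X x]) (use a in blast)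
  moreover have "- b x \<le> phi_minus X x"
  proof (rule phi_minus_upper[OF X x], rule CollectI, rule exI[of _ "\<lambda>z. - b z"], intro conjI ballI)
    fix z assume "z \<in> circle"
    from b(2)[OF this] show "- b z \<le> support_fun X z" by linarith
  qed (use affine_fun_uminus[OF b(1)] in auto)
  ultimately show "phi_plus X x - phi_minus X x \<le> 2 * L * rho x" unfolding a(3) b(3) by simp
qed

section \<open>Zygmund fields and the parallelogram law\<close>

text \<open>The point \<open>v\<^sup>2 / |v|\<^sup>2\<close> of the circle.\<close>

definition sq :: "complex \<Rightarrow> complex" where
  "sq v = v / cnj v"


definition area :: "complex \<Rightarrow> complex \<Rightarrow> real" where
  "area v w = Im (cnj v * w)"

text \<open>The extension of \<open>\<phi>\<close> to the light cone, which is parametrised by \<open>v \<mapsto> (|v|\<^sup>2, v\<^sup>2)\<close>. It is even and homogeneous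
  of degree two, and a quadratic form if \<open>\<phi>\<close> is affine.\<close>

definition homog :: "(complex \<Rightarrow> real) \<Rightarrow> complex \<Rightarrow> real" where
  "homog \<phi> v = (norm v)\<^sup>2 * \<phi> (sq v)"

definition defect4 :: "(complex \<Rightarrow> real) \<Rightarrow> complex \<Rightarrow> complex \<Rightarrow> real" where
  "defect4 \<phi> v w = homog \<phi> (v + w) + homog \<phi> (v - w) - 2 * homog \<phi> v - 2 * homog \<phi> w"

lemma norm_sq: "v \<noteq> 0 \<Longrightarrow> norm (sq v) = 1"
  by (simp add: sq_def norm_divide)

lemma sq_scale: "c \<noteq> (0::real) \<Longrightarrow> sq (c *\<^sub>R v) = sq v"
  by (simp add: sq_def scaleR_conv_of_real)

lemma homog_scale: "homog \<phi> (c *\<^sub>R v) = c\<^sup>2 * homog \<phi> v"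
  by (cases "c = 0") (simp_all add: homog_def sq_scale power_mult_distrib)

lemma homog_minus: "homog \<phi> (- v) = homog \<phi> v"
  using homog_scale[of \<phi> "- 1" v] by simp

lemma area_self: "area v v = 0"
  by (simp add: area_def)

lemma area_add: "area (u + v) w = area u w + area v w" "area w (u + v) = area w u + area w v"
  and area_diff: "area (u - v) w = area u w - area v w" "area w (u - v) = area w u - area w v"
  and area_minus: "area (- v) w = - area v w" "area w (- v) = - area w v"
  and area_scale: "area (c *\<^sub>R v) w = c * area v w" "area w (c *\<^sub>R v) = c * area w v"
  and area_commute: "area w v = - area v w"
  by (simp_all add: area_def algebra_simps)

lemma sq_diff:
  assumes "v \<noteq> 0" "w \<noteq> 0"
  shows "sq w - sq v = 2 * \<i> * of_real (area v w) / (cnj v * cnj w)"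
proof -
  have "sq w - sq v = (w * cnj v - v * cnj w) / (cnj v * cnj w)"
    using assms by (simp add: sq_def field_simps)
  also have "w * cnj v - v * cnj w = 2 * \<i> * of_real (area v w)"
    by (simp add: complex_eq_iff area_def)
  finally show ?thesis .
qed

context
  fixes X :: "complex \<Rightarrow> complex"
  assumes X: "circle_vector_field X"
begin

private abbreviation "F \<equiv> homog (support_fun X)"

lemma field_sq: "v \<noteq> 0 \<Longrightarrow> X (sq v) = \<i> * of_real (F v) / (cnj v)\<^sup>2"
proof -
  assume v: "v \<noteq> 0"
  have "X (sq v) = \<i> * sq v * of_real (support_fun X (sq v))"
    by (rule support_fun_props(2)[OF X]) (simp add: norm_sq[OF v])
  moreover have "of_real ((norm v)\<^sup>2) = v * cnj v" by (simp only: complex_norm_square)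
  ultimately show ?thesis using v by (simp add: homog_def sq_def power2_eq_square del: of_real_power)
qed

lemma divided_difference:
  assumes "v \<noteq> 0" "w \<noteq> 0" "area v w \<noteq> 0"
  shows "(X (sq w) - X (sq v)) / (sq w - sq v)
    = (of_real (F w) * (cnj v / cnj w) - of_real (F v) * (cnj w / cnj v)) / (2 * of_real (area v w))"
  unfolding sq_diff[OF assms(1,2)] field_sq[OF assms(1)] field_sq[OF assms(2)]
  using assms by (simp add: field_simps power2_eq_square)

text \<open>Each divided difference is a combination of the two values of \<open>F\<close>, and in the alternating sum the
  coefficients become constant.\<close>

lemma quadruple_value_parallelogram:
  assumes D: "area v w \<noteq> 0"
  shows "quadruple_value X (sq v) (sq (v + w)) (sq w) (sq (w - v)) = of_real (defect4 (support_fun X) v w / (2 * area v w))"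
proof -
  have ne: "v \<noteq> 0" "w \<noteq> 0" using D by (auto simp: area_def)
  have ne2: "v + w \<noteq> 0" "w - v \<noteq> 0"
    using D area_minus(2)[of v v] area_self[of v] by (auto simp: add_eq_0_iff)
  have a: "area v (v + w) = area v w" "area (v + w) w = area v w" "area w (w - v) = area v w" "area (w - v) v = - area v w"
    by (simp_all add: area_add area_diff area_self area_commute[of w v])
  have c: "cnj v \<noteq> 0" "cnj w \<noteq> 0" "cnj v + cnj w \<noteq> 0" "cnj w - cnj v \<noteq> 0"
    using ne ne2 by (simp_all flip: complex_cnj_add complex_cnj_diff)
  let ?D = "of_real (area v w) :: complex"
  define p r f1 f2 f3 f4 where "p = cnj v" and "r = cnj w" and "f1 = (of_real (F v) :: complex)" and "f2 = (of_real (F (v + w)) :: complex)"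
    and "f3 = (of_real (F w) :: complex)" and "f4 = (of_real (F (w - v)) :: complex)"
  have "quadruple_value X (sq v) (sq (v + w)) (sq w) (sq (w - v)) =
     (f2 * (p / (p + r)) - f1 * ((p + r) / p)) / (2 * ?D) - (f3 * ((p + r) / r) - f2 * (r / (p + r))) / (2 * ?D)
     + (f4 * (r / (r - p)) - f3 * ((r - p) / r)) / (2 * ?D) - (f1 * ((r - p) / p) - f4 * (p / (r - p))) / (2 * (- ?D))"
    using D ne ne2 unfolding quadruple_value_def
    by (simp add: divided_difference a p_def r_def f1_def f2_def f3_def f4_def)
  also have "\<dots> = ((f2 * (p / (p + r)) - f1 * ((p + r) / p)) - (f3 * ((p + r) / r) - f2 * (r / (p + r)))
     + (f4 * (r / (r - p)) - f3 * ((r - p) / r)) + (f1 * ((r - p) / p) - f4 * (p / (r - p)))) / (2 * ?D)"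
    by (simp add: add_divide_distrib diff_divide_distrib)
  also have "(f2 * (p / (p + r)) - f1 * ((p + r) / p)) - (f3 * ((p + r) / r) - f2 * (r / (p + r)))
     + (f4 * (r / (r - p)) - f3 * ((r - p) / r)) + (f1 * ((r - p) / p) - f4 * (p / (r - p)))
     = f2 + f4 - 2 * f1 - 2 * f3"
  proof -
    have nz: "p \<noteq> 0" "r \<noteq> 0" "p + r \<noteq> 0" "r - p \<noteq> 0" using c by (simp_all add: p_def r_def)
    have h: "p / (p + r) = 1 - r / (p + r)" "r / (r - p) = 1 + p / (r - p)" "(p + r) / p = 1 + r / p"
      "(p + r) / r = p / r + 1" "(r - p) / r = 1 - p / r" "(r - p) / p = r / p - 1"
      using nz by (simp_all add: field_simps)
    show ?thesis unfolding h by (simp add: algebra_simps)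
  qed
  finally show ?thesis
    using homog_minus[of "support_fun X" "v - w"] by (simp add: defect4_def f1_def f2_def f3_def f4_def)
qed

end

lemma cross_ratio_parallelogram:
  assumes D: "area v w \<noteq> 0"
  shows "cross_ratio (sq v) (sq (v + w)) (sq w) (sq (w - v)) = 1"
proof -
  have ne: "v \<noteq> 0" "w \<noteq> 0" using D by (auto simp: area_def)
  have ne2: "v + w \<noteq> 0" "w - v \<noteq> 0"
    using D area_minus(2)[of v v] area_self[of v] by (auto simp: add_eq_0_iff)
  have a: "area v (v + w) = area v w" "area (v + w) w = area v w" "area w (w - v) = area v w" "area v (w - v) = area v w"
    by (simp_all add: area_add area_diff area_self area_commute[of w v])
  have c: "cnj v \<noteq> 0" "cnj w \<noteq> 0" "cnj (v + w) \<noteq> 0" "cnj (w - v) \<noteq> 0"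
    using ne ne2 by (simp_all only: complex_cnj_zero_iff not_False_eq_True)
  show ?thesis
    unfolding cross_ratio_def sq_diff[OF ne(1) ne2(1)] sq_diff[OF ne(2) ne2(2)] sq_diff[OF ne2(1) ne(2)] sq_diff[OF ne(1) ne2(2)] a
    using D c by (simp del: complex_cnj_add complex_cnj_diff)
qed

lemma Arg_less:
  assumes "Im x > 0" "Im y > 0" "area x y > 0"
  shows "Arg x < Arg y"
proof (rule ccontr)
  assume n: "\<not> Arg x < Arg y"
  have A: "0 < Arg x" "Arg x < pi" "0 < Arg y" "Arg y < pi" using assms Arg_lt_pi by auto
  have "x = of_real (norm x) * cis (Arg x)" "y = of_real (norm y) * cis (Arg y)"
    using rcis_cmod_Arg[of x] rcis_cmod_Arg[of y] by (simp_all add: rcis_def)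
  then have "cnj x * y = of_real (norm x * norm y) * cis (Arg y - Arg x)"
    by (metis (no_types, opaque_lifting) cis_cnj cis_mult complex_cnj_complex_of_real complex_cnj_mult mult.assoc mult.left_commute of_real_mult uminus_add_conv_diff)
  then have e: "area x y = norm x * norm y * sin (Arg y - Arg x)" by (simp add: area_def)
  have "sin (Arg x - Arg y) \<ge> 0" using n A by (intro sin_ge_zero) auto
  then have "sin (Arg y - Arg x) \<le> 0" using sin_minus[of "Arg x - Arg y"] by simp
  then have "area x y \<le> 0" unfolding e by (simp add: mult_nonneg_nonpos)
  then show False using assms by simp
qed

lemma sq_mult: "sq (v * w) = sq v * sq w"
  by (simp add: sq_def)

lemma sq_eq_cis: "v \<noteq> 0 \<Longrightarrow> sq v = cis (2 * Arg v)"
proof -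
  assume v: "v \<noteq> 0"
  have "v = of_real (norm v) * cis (Arg v)" using rcis_cmod_Arg[of v] by (simp add: rcis_def)
  then have "sq v = sq (of_real (norm v) * cis (Arg v))" by simp
  also have "\<dots> = cis (Arg v) / cnj (cis (Arg v))" using v by (simp add: sq_def)
  also have "\<dots> = cis (2 * Arg v)" by (simp add: cis_cnj cis_divide)
  finally show ?thesis .
qed

text \<open>After division by \<open>v\<close>, the arguments of \<open>1 + z\<close>, \<open>z\<close>, \<open>z - 1\<close> increase in \<open>(0, \<pi>)\<close> for \<open>z\<close> in the upper half plane.\<close>

lemma ccw_parallelogram:
  assumes D: "area v w > 0"
  shows "ccw_quadruple (sq v) (sq (v + w)) (sq w) (sq (w - v))"
proof -
  have v: "v \<noteq> 0" using D by (auto simp: area_def)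
  define z where "z = w / v"
  have w: "w = v * z" using v by (simp add: z_def)
  have "area v w = (norm v)\<^sup>2 * Im z"
    unfolding w area_def cmod_power2 by (simp add: power2_eq_square algebra_simps)
  then have z: "Im z > 0" using D by (simp add: zero_less_mult_iff)
  have s: "sq (v + w) = sq v * sq (1 + z)" "sq w = sq v * sq z" "sq (w - v) = sq v * sq (z - 1)"
    unfolding w sq_mult[symmetric] by (simp_all add: algebra_simps)
  have nz: "1 + z \<noteq> 0" "z \<noteq> 0" "z - 1 \<noteq> 0" using z by (auto simp: complex_eq_iff)
  have o1: "Arg (1 + z) < Arg z" by (rule Arg_less) (use z in \<open>simp_all add: area_def algebra_simps\<close>)
  have o2: "Arg z < Arg (z - 1)" by (rule Arg_less) (use z in \<open>simp_all add: area_def algebra_simps\<close>)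
  have o0: "0 < Arg (1 + z)" "Arg (z - 1) < pi" using z Arg_lt_pi[of "1 + z"] Arg_lt_pi[of "z - 1"] by auto
  let ?t = "2 * Arg v"
  show ?thesis
    unfolding ccw_quadruple_def s sq_eq_cis[OF v] sq_eq_cis[OF nz(1)] sq_eq_cis[OF nz(2)] sq_eq_cis[OF nz(3)] cis_mult
    by (intro exI[of _ ?t] exI[of _ "?t + 2 * Arg (1 + z)"] exI[of _ "?t + 2 * Arg z"] exI[of _ "?t + 2 * Arg (z - 1)"])
      (use o0 o1 o2 in auto)
qed

lemma defect4_minus: "defect4 \<phi> v (- w) = defect4 \<phi> v w"
  by (simp add: defect4_def homog_minus)

text \<open>For independent vectors this is the Zygmund condition, with a change of sign of \<open>w\<close> if the orientation is
  wrong; for dependent ones the defect vanishes by homogeneity.\<close>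

lemma zygmund_parallelogram:
  assumes X: "circle_vector_field X" and zyg: "zygmund X"
  shows "\<exists>M. \<forall>v w. \<bar>defect4 (support_fun X) v w\<bar> \<le> M * \<bar>area v w\<bar>"
proof -
  from zyg obtain M0 where M0: "\<And>a b c d. ccw_quadruple a b c d \<Longrightarrow> cross_ratio a b c d = 1 \<Longrightarrow> norm (quadruple_value X a b c d) \<le> M0"
    unfolding zygmund_def bdd_above_def by blast
  define M where "M = max 0 M0"
  have pos: "\<bar>defect4 (support_fun X) v w\<bar> \<le> 2 * M * area v w" if D: "area v w > 0" for v w
  proof -
    have D': "area v w \<noteq> 0" using D by simp
    have "norm (quadruple_value X (sq v) (sq (v + w)) (sq w) (sq (w - v))) \<le> M0"
      by (rule M0[OF ccw_parallelogram[OF D] cross_ratio_parallelogram[OF D']])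
    then have "\<bar>defect4 (support_fun X) v w\<bar> / (2 * area v w) \<le> M"
      unfolding quadruple_value_parallelogram[OF X D'] norm_of_real using D by (simp add: M_def)
    then show ?thesis using D by (simp add: divide_le_eq mult_ac)
  qed
  have "\<bar>defect4 (support_fun X) v w\<bar> \<le> 2 * M * \<bar>area v w\<bar>" for v w
  proof (cases "area v w" "0::real" rule: linorder_cases)
    case greater then show ?thesis using pos by simp
  next
    case less
    then have "area v (- w) > 0" by (simp add: area_minus)
    from pos[OF this] less show ?thesis by (simp add: defect4_minus area_minus)
  next
    case equal
    show ?thesis
    proof (cases "v = 0")
      case True then show ?thesis by (simp add: defect4_def homog_minus area_def) (simp add: homog_def)
    next
      case False
      define c where "c = Re (w / v)"
      have "Im (w / v) = area v w / (norm v)\<^sup>2"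
        by (simp add: area_def Im_divide cmod_power2 mult.commute)
      then have "w / v = of_real c" using equal by (simp add: c_def complex_eq_iff)
      then have w: "w = c *\<^sub>R v" using False by (simp add: scaleR_conv_of_real field_simps)
      have "v + w = (1 + c) *\<^sub>R v" "v - w = (1 - c) *\<^sub>R v" unfolding w by (simp_all add: algebra_simps)
      then have "defect4 (support_fun X) v w = ((1 + c)\<^sup>2 + (1 - c)\<^sup>2 - 2 - 2 * c\<^sup>2) * homog (support_fun X) v"
        unfolding defect4_def by (simp only: homog_scale) (simp add: w homog_scale algebra_simps)
      also have "(1 + c)\<^sup>2 + (1 - c)\<^sup>2 - 2 - 2 * c\<^sup>2 = 0" by (simp add: power2_eq_square algebra_simps)
      finally show ?thesis by (simp add: equal)
    qed
  qed
  then show ?thesis by blast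
qed

section \<open>The approximate parallelogram law on a normalised function\<close>

text \<open>At a maximum \<open>s\<close> of \<open>|G(1,\<cdot>)|\<close>, reflect the nearest of the points \<open>-1, 0, 1\<close> in \<open>s\<close>: the law gives
  \<open>2 |G(1,s)| \<le> |G(1,s)| + M + M/2\<close>, as the values at these points are at most \<open>M\<close>.\<close>

lemma parallelogram_segment:
  fixes G :: "real \<Rightarrow> real \<Rightarrow> real"
  assumes par: "\<And>x y x' y'. \<bar>G (x + x') (y + y') + G (x - x') (y - y') - 2 * G x y - 2 * G x' y'\<bar> \<le> M * \<bar>x * y' - y * x'\<bar>"
    and hom: "\<And>c x y. G (c * x) (c * y) = c\<^sup>2 * G x y"
    and zero: "G 1 0 = 0" "G 0 1 = 0" "G 1 1 = 0"
    and cont: "continuous_on {-1..1} (G 1)" and t: "t \<in> {-1..1}"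
  shows "\<bar>G 1 t\<bar> \<le> 3/2 * M"
proof -
  have M: "M \<ge> 0" using par[of 1 0 0 1] by simp
  have m1: "\<bar>G 1 (-1)\<bar> \<le> M" using par[of 1 0 0 1] zero by simp
  have "continuous_on {-1..1} (\<lambda>t. \<bar>G 1 t\<bar>)" by (intro continuous_intros cont)
  then obtain s where s: "s \<in> {-1..1}" "\<And>t. t \<in> {-1..1} \<Longrightarrow> \<bar>G 1 t\<bar> \<le> \<bar>G 1 s\<bar>"
    using continuous_attains_sup[of "{-1..1}" "\<lambda>t. \<bar>G 1 t\<bar>"] by auto
  have step: "2 * \<bar>G 1 s\<bar> \<le> \<bar>G 1 (s + h)\<bar> + \<bar>G 1 (s - h)\<bar> + M * h" if "h \<ge> 0" for h
  proof -
    have "G 0 h = 0" using hom[of h 0 1] zero by simp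
    then show ?thesis using par[of 1 0 s h] that by simp
  qed
  have "\<bar>G 1 s\<bar> \<le> 3/2 * M"
  proof (cases "s \<ge> 0")
    case True
    then consider "s \<le> 1/2" | "s \<ge> 1/2" by linarith
    then show ?thesis
    proof cases
      case 1
      have "2 * \<bar>G 1 s\<bar> \<le> \<bar>G 1 (s + s)\<bar> + \<bar>G 1 (s - s)\<bar> + M * s" by (rule step) (use True in simp)
      moreover have "\<bar>G 1 (s + s)\<bar> \<le> \<bar>G 1 s\<bar>" using 1 True by (intro s(2)) auto
      moreover have "M * s \<le> M * (1/2)" using 1 M by (intro mult_left_mono) auto
      ultimately show ?thesis using zero M by simp
    next
      case 2
      have "2 * \<bar>G 1 s\<bar> \<le> \<bar>G 1 (s + (1 - s))\<bar> + \<bar>G 1 (s - (1 - s))\<bar> + M * (1 - s)" by (rule step) (use s(1) in simp)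
      moreover have "\<bar>G 1 (s - (1 - s))\<bar> \<le> \<bar>G 1 s\<bar>" using 2 s(1) by (intro s(2)) auto
      moreover have "M * (1 - s) \<le> M * (1/2)" using 2 M by (intro mult_left_mono) auto
      ultimately show ?thesis using zero M by simp
    qed
  next
    case False
    then consider "s \<ge> - 1/2" | "s \<le> - 1/2" by linarith
    then show ?thesis
    proof cases
      case 1
      have "2 * \<bar>G 1 s\<bar> \<le> \<bar>G 1 (s + (- s))\<bar> + \<bar>G 1 (s - (- s))\<bar> + M * (- s)" by (rule step) (use False in simp)
      moreover have "\<bar>G 1 (s - (- s))\<bar> \<le> \<bar>G 1 s\<bar>" using 1 False by (intro s(2)) auto
      moreover have "M * (- s) \<le> M * (1/2)" using 1 M by (intro mult_left_mono) auto
      ultimately show ?thesis using zero M by simp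
    next
      case 2
      have "2 * \<bar>G 1 s\<bar> \<le> \<bar>G 1 (s + (1 + s))\<bar> + \<bar>G 1 (s - (1 + s))\<bar> + M * (1 + s)" by (rule step) (use s(1) in simp)
      moreover have "\<bar>G 1 (s + (1 + s))\<bar> \<le> \<bar>G 1 s\<bar>" using 2 s(1) by (intro s(2)) auto
      moreover have "M * (1 + s) \<le> M * (1/2)" using 2 M by (intro mult_left_mono) auto
      ultimately show ?thesis using m1 M by simp
    qed
  qed
  then show ?thesis using s(2)[OF t] by linarith
qed

lemma parallelogram_bound:
  fixes G :: "real \<Rightarrow> real \<Rightarrow> real"
  assumes par: "\<And>x y x' y'. \<bar>G (x + x') (y + y') + G (x - x') (y - y') - 2 * G x y - 2 * G x' y'\<bar> \<le> M * \<bar>x * y' - y * x'\<bar>"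
    and hom: "\<And>c x y. G (c * x) (c * y) = c\<^sup>2 * G x y"
    and zero: "G 1 0 = 0" "G 0 1 = 0" "G 1 1 = 0"
    and cont: "continuous_on {-1..1} (G 1)" "continuous_on {-1..1} (\<lambda>t. G t 1)"
  shows "\<bar>G x y\<bar> \<le> 3/2 * M * (x\<^sup>2 + y\<^sup>2)"
proof -
  have M: "M \<ge> 0" using par[of 1 0 0 1] by simp
  have r1: "\<bar>G 1 t\<bar> \<le> 3/2 * M" if "t \<in> {-1..1}" for t
    by (rule parallelogram_segment[OF par hom zero cont(1) that])
  have r2: "\<bar>G t 1\<bar> \<le> 3/2 * M" if "t \<in> {-1..1}" for t
  proof (rule parallelogram_segment[of "\<lambda>x y. G y x", OF _ hom zero(2,1,3) cont(2) that])
    fix x y x' y'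
    show "\<bar>G (y + y') (x + x') + G (y - y') (x - x') - 2 * G y x - 2 * G y' x'\<bar> \<le> M * \<bar>x * y' - y * x'\<bar>"
      using par[of y y' x x'] by (simp add: abs_minus_commute mult.commute)
  qed
  show ?thesis
  proof (cases "\<bar>y\<bar> \<le> \<bar>x\<bar>")
    case True
    show ?thesis
    proof (cases "x = 0")
      case True2: True
      then show ?thesis using True hom[of 0 0 0] by simp
    next
      case False
      have "y / x \<in> {-1..1}" using True False by (auto simp: abs_le_iff divide_simps split: if_splits)
      from r1[OF this] have "x\<^sup>2 * \<bar>G 1 (y / x)\<bar> \<le> x\<^sup>2 * (3/2 * M)" by (intro mult_left_mono) auto
      moreover have "G x y = x\<^sup>2 * G 1 (y / x)" using hom[of x 1 "y / x"] False by simp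
      moreover have "0 \<le> 3/2 * M * y\<^sup>2" using M by simp
      ultimately show ?thesis by (simp add: abs_mult algebra_simps)
    qed
  next
    case False
    then have y: "y \<noteq> 0" by auto
    have "x / y \<in> {-1..1}" using False y by (auto simp: abs_le_iff divide_simps split: if_splits)
    from r2[OF this] have "y\<^sup>2 * \<bar>G (x / y) 1\<bar> \<le> y\<^sup>2 * (3/2 * M)" by (intro mult_left_mono) auto
    moreover have "G x y = y\<^sup>2 * G (x / y) 1" using hom[of y "x / y" 1] y by simp
    moreover have "0 \<le> 3/2 * M * x\<^sup>2" using M by simp
    ultimately show ?thesis by (simp add: abs_mult algebra_simps)
  qed
qed

section \<open>Zygmund fields and the width\<close>

lemma continuous_on_homog:
  assumes phi: "continuous_on circle \<phi>" and f: "continuous_on S f" and ne: "\<And>t. t \<in> S \<Longrightarrow> f t \<noteq> 0"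
  shows "continuous_on S (\<lambda>t. homog \<phi> (f t))"
proof -
  have "continuous_on S (\<lambda>t. sq (f t))" unfolding sq_def by (intro continuous_intros f) (use ne in auto)
  then have "continuous_on S (\<lambda>t. \<phi> (sq (f t)))"
    by (rule continuous_on_compose2[OF phi]) (use ne in \<open>auto simp: norm_sq\<close>)
  then show ?thesis unfolding homog_def by (intro continuous_intros f)
qed

lemma unit_square_root:
  obtains s where "norm s = 1" "cis t = s\<^sup>2"
  by (rule that[of "cis (t / 2)"]) (simp_all add: Complex.DeMoivre)

text \<open>A point of the hyperbolic plane is a positive quadratic form of determinant one, in the affine picture
  the function \<open>(1 - \<eta>\<cdot>z) / \<rho>\<close>. In an orthonormal basis \<open>e\<^sub>1\<close>, \<open>e\<^sub>2\<close> of this form, \<open>F\<close> is compared with the quadratic form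
  which agrees with it at \<open>e\<^sub>1\<close>, \<open>e\<^sub>2\<close> and \<open>e\<^sub>1 + e\<^sub>2\<close>.\<close>

lemma affine_approximation:
  assumes phi: "continuous_on circle \<phi>" and M: "\<And>v w. \<bar>defect4 \<phi> v w\<bar> \<le> M * \<bar>area v w\<bar>"
    and eta: "\<eta> \<in> disk"
  obtains a where "affine_fun a" "\<And>z. z \<in> circle \<Longrightarrow> \<bar>\<phi> z - a z\<bar> \<le> 3/2 * M * ((1 - \<eta> \<bullet> z) / rho \<eta>)"
proof -
  note p = disk_pos[OF eta]
  define r where "r = norm \<eta>"
  have r: "0 \<le> r" "r < 1" using eta by (simp_all add: r_def)
  obtain s where s: "norm s = 1" "cis (Arg \<eta>) = s\<^sup>2" by (rule unit_square_root)
  have es: "\<eta> = of_real r * s\<^sup>2" using rcis_cmod_Arg[of \<eta>] by (simp add: rcis_def r_def s(2))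
  have ss: "cnj s * s = 1" "s * cnj s = 1" using s(1) complex_norm_square[of s] by (simp_all add: mult.commute)
  have rr: "rho \<eta> * rho \<eta> = (1 - r) * (1 + r)"
    using p(5) by (simp add: defect_def r_def power2_norm_eq_inner[symmetric] power2_eq_square algebra_simps)
  (* the form has the eigenvalues (1 - r) / rho and (1 + r) / rho along s and i s *)
  define k where "k = sqrt ((1 + r) / rho \<eta>)"
  have k: "k > 0" "k\<^sup>2 = (1 + r) / rho \<eta>" using p r by (simp_all add: k_def)
  have k': "1 / k\<^sup>2 = (1 - r) / rho \<eta>" unfolding k(2) using rr p r by (simp add: divide_simps)
  define e1 e2 where "e1 = k *\<^sub>R s" and "e2 = (1 / k) *\<^sub>R (\<i> * s)"
  have "area s (\<i> * s) = Re (cnj s * s)" by (simp add: area_def)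
  then have a12: "area e1 e2 = 1" using k ss by (simp add: e1_def e2_def area_scale)
  let ?F = "homog \<phi>"
  define A C B where "A = ?F e1" and "C = ?F e2" and "B = ?F (e1 + e2) - A - C"
  define G where "G x y = ?F (x *\<^sub>R e1 + y *\<^sub>R e2) - (A * x\<^sup>2 + B * (x * y) + C * y\<^sup>2)" for x y
  have G: "\<bar>G x y\<bar> \<le> 3/2 * M * (x\<^sup>2 + y\<^sup>2)" for x y
  proof (rule parallelogram_bound)
    fix x y x' y'
    let ?v = "x *\<^sub>R e1 + y *\<^sub>R e2" and ?w = "x' *\<^sub>R e1 + y' *\<^sub>R e2"
    have "area ?v ?w = x * y' - y * x'"
      using a12 by (simp add: area_add area_scale area_self area_commute[of e2 e1])
    moreover have "(x + x') *\<^sub>R e1 + (y + y') *\<^sub>R e2 = ?v + ?w" "(x - x') *\<^sub>R e1 + (y - y') *\<^sub>R e2 = ?v - ?w"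
      by (simp_all add: algebra_simps)
    then have "G (x + x') (y + y') + G (x - x') (y - y') - 2 * G x y - 2 * G x' y' = defect4 \<phi> ?v ?w"
      unfolding G_def defect4_def by (simp add: power2_eq_square algebra_simps)
    ultimately show "\<bar>G (x + x') (y + y') + G (x - x') (y - y') - 2 * G x y - 2 * G x' y'\<bar> \<le> M * \<bar>x * y' - y * x'\<bar>"
      using M[of ?v ?w] by simp
  next
    fix c x y
    have "(c * x) *\<^sub>R e1 + (c * y) *\<^sub>R e2 = c *\<^sub>R (x *\<^sub>R e1 + y *\<^sub>R e2)" by (simp add: algebra_simps)
    then show "G (c * x) (c * y) = c\<^sup>2 * G x y"
      unfolding G_def by (simp only: homog_scale) (simp add: power2_eq_square algebra_simps)
  next
    have ne1: "e1 + t *\<^sub>R e2 \<noteq> 0" for t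
    proof
      assume "e1 + t *\<^sub>R e2 = 0"
      then have "area (e1 + t *\<^sub>R e2) e2 = area 0 e2" by simp
      then show False using a12 by (simp add: area_add area_scale area_self) (simp add: area_def)
    qed
    have ne2: "t *\<^sub>R e1 + e2 \<noteq> 0" for t
    proof
      assume "t *\<^sub>R e1 + e2 = 0"
      then have "area e1 (t *\<^sub>R e1 + e2) = area e1 0" by simp
      then show False using a12 by (simp add: area_add area_scale area_self) (simp add: area_def)
    qed
    show "continuous_on {-1..1} (G 1)" unfolding G_def
      by (intro continuous_intros continuous_on_homog[OF phi]) (use ne1 in auto)
    show "continuous_on {-1..1} (\<lambda>t. G t 1)" unfolding G_def
      by (intro continuous_intros continuous_on_homog[OF phi]) (use ne2 in auto)
  qed (simp_all add: G_def A_def B_def C_def)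
  define a where "a z = ((A / (2 * k\<^sup>2) - C * k\<^sup>2 / 2) * Re ((cnj s)\<^sup>2 * z) + B / 2 * Im ((cnj s)\<^sup>2 * z)) + (A / (2 * k\<^sup>2) + C * k\<^sup>2 / 2)" for z
  have "linear (\<lambda>z. (A / (2 * k\<^sup>2) - C * k\<^sup>2 / 2) * Re ((cnj s)\<^sup>2 * z) + B / 2 * Im ((cnj s)\<^sup>2 * z))"
    by (rule linearI) (simp_all add: algebra_simps)
  then have "affine_fun a" unfolding affine_fun_def a_def by blast
  moreover have "\<bar>\<phi> z - a z\<bar> \<le> 3/2 * M * ((1 - \<eta> \<bullet> z) / rho \<eta>)" if z: "z \<in> circle" for z
  proof -
    obtain v where v: "norm v = 1" "cis (Arg z) = v\<^sup>2" by (rule unit_square_root)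
    have zv: "z = v\<^sup>2" using rcis_cmod_Arg[of z] z by (simp add: rcis_def v(2))
    have vv: "v * cnj v = 1" using v(1) complex_norm_square[of v] by simp
    have "v \<noteq> 0" using v(1) by auto
    then have "sq v = z" unfolding zv sq_def using vv by (simp add: power2_eq_square divide_simps mult_ac)
    then have Fv: "?F v = \<phi> z" by (simp add: homog_def v(1))
    define m where "m = cnj s * v"
    have m2: "(cnj s)\<^sup>2 * z = m\<^sup>2" by (simp add: m_def zv power_mult_distrib)
    have "norm m = 1" by (simp add: m_def norm_mult s(1) v(1))
    then have mm: "(Re m)\<^sup>2 + (Im m)\<^sup>2 = 1" by (metis cmod_power2 power_one)
    define x y where "x = Re m / k" and "y = k * Im m"
    have "x *\<^sub>R e1 + y *\<^sub>R e2 = m * s"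
      using k by (simp add: x_def y_def e1_def e2_def complex_eq_iff)
    also have "m * s = v" using ss by (simp add: m_def mult_ac)
    finally have xy: "x *\<^sub>R e1 + y *\<^sub>R e2 = v" .
    have Rm: "Re (m\<^sup>2) = (Re m)\<^sup>2 - (Im m)\<^sup>2" "Im (m\<^sup>2) = 2 * (Re m * Im m)" by (simp_all add: power2_eq_square)
    have h: "(Re m)\<^sup>2 = (1 + Re (m\<^sup>2)) / 2" "(Im m)\<^sup>2 = (1 - Re (m\<^sup>2)) / 2" "Re m * Im m = Im (m\<^sup>2) / 2"
      unfolding Rm using mm by simp_all
    have "x\<^sup>2 = (Re m)\<^sup>2 * (1 / k\<^sup>2)" "y\<^sup>2 = k\<^sup>2 * (Im m)\<^sup>2" "x * y = Re m * Im m"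
      using k(1) by (simp_all add: x_def y_def power_divide power_mult_distrib)
    then have q: "x\<^sup>2 = (1 + Re (m\<^sup>2)) / 2 * (1 / k\<^sup>2)" "y\<^sup>2 = k\<^sup>2 * ((1 - Re (m\<^sup>2)) / 2)" "x * y = Im (m\<^sup>2) / 2"
      unfolding h by this
    have az: "A * x\<^sup>2 + B * (x * y) + C * y\<^sup>2 = a z"
      unfolding a_def m2 q by (simp add: algebra_simps add_divide_distrib diff_divide_distrib)
    have ez: "\<eta> \<bullet> z = r * Re (m\<^sup>2)"
    proof -
      have "\<eta> \<bullet> z = Re (cnj \<eta> * z)" by (simp add: inner_complex_def)
      also have "cnj \<eta> * z = of_real r * ((cnj s)\<^sup>2 * z)" by (subst es) (simp add: mult_ac)
      finally show ?thesis unfolding m2 by simp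
    qed
    have "x\<^sup>2 + y\<^sup>2 = (1 - \<eta> \<bullet> z) / rho \<eta>"
      unfolding q ez unfolding k' unfolding k(2) using p(2) by (simp add: field_simps)
    then show ?thesis using G[of x y] unfolding G_def xy az Fv by simp
  qed
  ultimately show thesis using that by blast
qed

lemma width_le_of_parallelogram:
  assumes X: "circle_vector_field X" "continuous_on circle X"
    and M: "\<And>v w. \<bar>defect4 (support_fun X) v w\<bar> \<le> M * \<bar>area v w\<bar>"
  shows "width X \<le> ereal (3 * M)"
  unfolding width_le_iff[OF X]
proof
  fix \<eta> :: complex assume eta: "\<eta> \<in> disk"
  note p = disk_pos[OF eta]
  obtain a where a: "affine_fun a" "\<And>z. z \<in> circle \<Longrightarrow> \<bar>support_fun X z - a z\<bar> \<le> 3/2 * M * ((1 - \<eta> \<bullet> z) / rho \<eta>)"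
    by (rule affine_approximation[OF continuous_on_support_fun[OF X] M eta]) blast
  obtain l c where lc: "a = (\<lambda>z. l \<bullet> z + c)" using a(1) unfolding affine_fun_iff by blast
  have af: "affine_fun (\<lambda>z. a z + K * ((1 - \<eta> \<bullet> z) / rho \<eta>))" for K
    unfolding affine_fun_iff lc
    by (rule exI[of _ "l - (K / rho \<eta>) *\<^sub>R \<eta>"], rule exI[of _ "c + K / rho \<eta>"])
      (simp add: fun_eq_iff inner_diff_left diff_divide_distrib algebra_simps)
  have ee: "(1 - \<eta> \<bullet> \<eta>) / rho \<eta> = rho \<eta>" using defect_div_rho[OF eta] by (simp add: defect_def)
  have "phi_plus X \<eta> \<le> a \<eta> + (3/2 * M) * ((1 - \<eta> \<bullet> \<eta>) / rho \<eta>)"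
  proof (rule phi_plus_lower[OF X eta], rule CollectI, rule exI[of _ "\<lambda>z. a z + (3/2 * M) * ((1 - \<eta> \<bullet> z) / rho \<eta>)"], intro conjI ballI)
    fix w assume "w \<in> circle"
    from a(2)[OF this] show "support_fun X w \<le> a w + (3/2 * M) * ((1 - \<eta> \<bullet> w) / rho \<eta>)" by linarith
  qed (rule refl, rule af)
  moreover have "a \<eta> + (- (3/2 * M)) * ((1 - \<eta> \<bullet> \<eta>) / rho \<eta>) \<le> phi_minus X \<eta>"
  proof (rule phi_minus_upper[OF X eta], rule CollectI, rule exI[of _ "\<lambda>z. a z + (- (3/2 * M)) * ((1 - \<eta> \<bullet> z) / rho \<eta>)"], intro conjI ballI)
    fix w assume "w \<in> circle"
    from a(2)[OF this] show "a w + (- (3/2 * M)) * ((1 - \<eta> \<bullet> w) / rho \<eta>) \<le> support_fun X w" by linarith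
  qed (rule refl, rule af)
  ultimately show "phi_plus X \<eta> - phi_minus X \<eta> \<le> 3 * M * rho \<eta>" unfolding ee by simp
qed

text \<open>The diagonals of the quadrilateral \<open>Q\<close> meet at \<open>\<eta>\<close>, where the chords of the graph of \<open>\<phi>\<close> over both of them lie between
  the two envelopes. The weights of the end points of the chords are \<open>|v|\<^sup>2, |w|\<^sup>2\<close> and \<open>|v+w|\<^sup>2, |v-w|\<^sup>2\<close>.\<close>

lemma defect4_le_width:
  assumes X: "circle_vector_field X" "continuous_on circle X" and w: "width X \<le> ereal W" and D: "area v w \<noteq> 0"
  shows "\<bar>defect4 (support_fun X) v w\<bar> \<le> 4 * W * \<bar>area v w\<bar>"
proof -
  let ?phi = "support_fun X" and ?F = "homog (support_fun X)"
  have ne: "v \<noteq> 0" "w \<noteq> 0" using D by (auto simp: area_def)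
  have ne2: "v + w \<noteq> 0" "v - w \<noteq> 0"
    using D area_minus(2)[of v v] area_self[of v] by (auto simp: add_eq_0_iff)
  define n where "n = (norm v)\<^sup>2 + (norm w)\<^sup>2"
  have n: "n > 0" using ne by (simp add: n_def add_pos_pos)
  have n2: "(norm (v + w))\<^sup>2 + (norm (v - w))\<^sup>2 = 2 * n" unfolding n_def cmod_power2 by (simp add: power2_eq_square algebra_simps)
  define \<eta> where "\<eta> = (v\<^sup>2 + w\<^sup>2) / of_real n"
  have sqv: "(norm v)\<^sup>2 *\<^sub>R sq v = v\<^sup>2" if "v \<noteq> 0" for v
    using that complex_norm_square[of v] by (simp add: scaleR_conv_of_real sq_def power2_eq_square)
  have "(norm (v\<^sup>2 + w\<^sup>2))\<^sup>2 = n\<^sup>2 - 4 * (area v w)\<^sup>2"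
    unfolding n_def cmod_power2 area_def by (simp add: power2_eq_square algebra_simps)
  moreover have "\<eta> \<bullet> \<eta> = (norm (v\<^sup>2 + w\<^sup>2))\<^sup>2 / n\<^sup>2"
    using n by (simp add: \<eta>_def power2_norm_eq_inner[symmetric] norm_divide power_divide)
  ultimately have df: "defect \<eta> = (2 * area v w / n)\<^sup>2"
    using n by (simp add: defect_def power_divide power_mult_distrib diff_divide_distrib)
  then have "defect \<eta> > 0" using D n by simp
  then have eta: "\<eta> \<in> disk" using in_disk_iff by blast
  have rho: "rho \<eta> = 2 * \<bar>area v w\<bar> / n" unfolding rho_def df using n by (simp add: abs_mult)
  have gap: "phi_plus X \<eta> - phi_minus X \<eta> \<le> W * rho \<eta>" using w eta unfolding width_le_iff[OF X] by blast
  have av: "a \<eta> = ((norm p)\<^sup>2 * a (sq p) + (norm r)\<^sup>2 * a (sq r)) / ((norm p)\<^sup>2 + (norm r)\<^sup>2)"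
    if af: "affine_fun a" and pr: "p \<noteq> 0" "r \<noteq> 0" "p\<^sup>2 + r\<^sup>2 = of_real ((norm p)\<^sup>2 + (norm r)\<^sup>2) * \<eta>" for a p r
  proof -
    obtain l c where lc: "a = (\<lambda>z. l \<bullet> z + c)" using af unfolding affine_fun_iff by blast
    have N: "(norm p)\<^sup>2 + (norm r)\<^sup>2 > 0" using pr(1,2) by (simp add: add_pos_pos)
    have "(norm p)\<^sup>2 * (l \<bullet> sq p) + (norm r)\<^sup>2 * (l \<bullet> sq r) = l \<bullet> ((norm p)\<^sup>2 *\<^sub>R sq p + (norm r)\<^sup>2 *\<^sub>R sq r)"
      by (simp add: inner_add_right)
    also have "\<dots> = ((norm p)\<^sup>2 + (norm r)\<^sup>2) * (l \<bullet> \<eta>)"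
      unfolding sqv[OF pr(1)] sqv[OF pr(2)] pr(3) scaleR_conv_of_real[symmetric] by simp
    finally have e: "(norm p)\<^sup>2 * a (sq p) + (norm r)\<^sup>2 * a (sq r) = ((norm p)\<^sup>2 + (norm r)\<^sup>2) * a \<eta>"
      unfolding lc by (simp add: algebra_simps)
    show ?thesis unfolding e using pr(1) by simp
  qed
  have between: "phi_minus X \<eta> \<le> (?F p + ?F r) / ((norm p)\<^sup>2 + (norm r)\<^sup>2)" "(?F p + ?F r) / ((norm p)\<^sup>2 + (norm r)\<^sup>2) \<le> phi_plus X \<eta>"
    if pr: "p \<noteq> 0" "r \<noteq> 0" "p\<^sup>2 + r\<^sup>2 = of_real ((norm p)\<^sup>2 + (norm r)\<^sup>2) * \<eta>" for p r
  proof -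
    have c: "sq p \<in> circle" "sq r \<in> circle" using pr by (simp_all add: norm_sq)
    show "phi_minus X \<eta> \<le> (?F p + ?F r) / ((norm p)\<^sup>2 + (norm r)\<^sup>2)"
    proof (rule phi_minus_least[OF X])
      fix y assume "y \<in> {a \<eta> |a. affine_fun a \<and> (\<forall>w\<in>circle. a w \<le> ?phi w)}"
      then obtain a where a: "y = a \<eta>" "affine_fun a" "\<forall>w\<in>circle. a w \<le> ?phi w" by blast
      show "y \<le> (?F p + ?F r) / ((norm p)\<^sup>2 + (norm r)\<^sup>2)"
        unfolding a(1) av[OF a(2) pr] homog_def using a(3) c by (intro divide_right_mono add_mono mult_left_mono) auto
    qed
    show "(?F p + ?F r) / ((norm p)\<^sup>2 + (norm r)\<^sup>2) \<le> phi_plus X \<eta>"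
    proof (rule phi_plus_greatest[OF X])
      fix y assume "y \<in> {a \<eta> |a. affine_fun a \<and> (\<forall>w\<in>circle. ?phi w \<le> a w)}"
      then obtain a where a: "y = a \<eta>" "affine_fun a" "\<forall>w\<in>circle. ?phi w \<le> a w" by blast
      show "(?F p + ?F r) / ((norm p)\<^sup>2 + (norm r)\<^sup>2) \<le> y"
        unfolding a(1) av[OF a(2) pr] homog_def using a(3) c by (intro divide_right_mono add_mono mult_left_mono) auto
    qed
  qed
  have e: "v\<^sup>2 + w\<^sup>2 = of_real ((norm v)\<^sup>2 + (norm w)\<^sup>2) * \<eta>" using n by (simp add: \<eta>_def n_def[symmetric] del: of_real_add of_real_power)
  have e2: "(v + w)\<^sup>2 + (v - w)\<^sup>2 = of_real ((norm (v + w))\<^sup>2 + (norm (v - w))\<^sup>2) * \<eta>"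
  proof -
    have "(v + w)\<^sup>2 + (v - w)\<^sup>2 = 2 * (v\<^sup>2 + w\<^sup>2)" by (simp add: power2_eq_square algebra_simps)
    also have "\<dots> = of_real (2 * n) * \<eta>" using n by (simp add: \<eta>_def)
    finally show ?thesis unfolding n2 .
  qed
  note b1 = between[OF ne e, folded n_def] and b2 = between[OF ne2 e2, unfolded n2]
  have "\<bar>(?F (v + w) + ?F (v - w)) / (2 * n) - (?F v + ?F w) / n\<bar> \<le> W * rho \<eta>"
    using b1 b2 gap by (auto simp: abs_le_iff)
  moreover have "(?F (v + w) + ?F (v - w)) / (2 * n) - (?F v + ?F w) / n = defect4 ?phi v w / (2 * n)"
    using n by (simp add: defect4_def field_simps)
  ultimately have "\<bar>defect4 ?phi v w\<bar> / (2 * n) \<le> W * (2 * \<bar>area v w\<bar> / n)" using n by (simp add: rho)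
  then show ?thesis using n by (simp add: divide_simps mult_ac)
qed

lemma cross_ratio_1_unique:
  assumes "cross_ratio a b c d = 1" "cross_ratio a b c d' = 1" "a \<noteq> c"
  shows "d = d'"
proof -
  have e: "(b - a) * (d - c) = (c - b) * (d - a)" "(b - a) * (d' - c) = (c - b) * (d' - a)" and ba: "b \<noteq> a"
    using assms by (auto simp: cross_ratio_def divide_eq_1_iff)
  have "(b - a) * (d - d') = (c - b) * (d - d')" using e by algebra
  then consider "d = d'" | "b - a = c - b" by (metis mult_right_cancel right_minus_eq)
  then show ?thesis
  proof cases
    case 2
    then have "(b - a) * (d - c) = (b - a) * (d - a)" using e(1) by simp
    then show ?thesis using ba assms(3) by simp
  qed
qed

text \<open>Expanding \<open>cis(\<beta>/2)\<close> in \<open>cis(\<alpha>/2)\<close> and \<open>cis(\<gamma>/2)\<close> gives vectors \<open>v\<close>, \<open>u\<close> with the directions \<open>a\<close>, \<open>c\<close> whose sum has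
  the direction \<open>b\<close>; the cross ratio then forces \<open>d\<close> to be the direction of \<open>u - v\<close>.\<close>

lemma zygmund_of_width:
  assumes X: "circle_vector_field X" "continuous_on circle X" and w: "width X \<le> ereal W"
  shows "zygmund X"
  unfolding zygmund_def
proof (intro conjI X(2) bdd_aboveI)
  fix y assume "y \<in> {norm (quadruple_value X a b c d) |a b c d. ccw_quadruple a b c d \<and> cross_ratio a b c d = 1}"
  then obtain a b c d where Q: "y = norm (quadruple_value X a b c d)" "ccw_quadruple a b c d" "cross_ratio a b c d = 1" by blast
  from Q(2) obtain \<alpha> \<beta> \<gamma> \<delta> where o: "\<alpha> < \<beta>" "\<beta> < \<gamma>" "\<gamma> < \<delta>" "\<delta> < \<alpha> + 2 * pi"
    and abcd: "a = cis \<alpha>" "b = cis \<beta>" "c = cis \<gamma>" "d = cis \<delta>" unfolding ccw_quadruple_def by blast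
  define s1 s2 s3 where "s1 = sin ((\<gamma> - \<beta>) / 2)" and "s2 = sin ((\<beta> - \<alpha>) / 2)" and "s3 = sin ((\<gamma> - \<alpha>) / 2)"
  have s: "s1 > 0" "s2 > 0" "s3 > 0" unfolding s1_def s2_def s3_def using o by (auto intro!: sin_gt_zero)
  define v u where "v = (s1 / s3) *\<^sub>R cis (\<alpha> / 2)" and "u = (s2 / s3) *\<^sub>R cis (\<gamma> / 2)"
  have sc: "sq (cis (t / 2)) = cis t" for t by (simp add: sq_def cis_cnj cis_divide)
  have a: "sq v = a" "sq u = c" unfolding v_def u_def abcd using s by (simp_all add: sq_scale sc)
  have vu: "v + u = cis (\<beta> / 2)"
  proof -
    have "s1 *\<^sub>R cis (\<alpha> / 2) + s2 *\<^sub>R cis (\<gamma> / 2) = s3 *\<^sub>R cis (\<beta> / 2)"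
    proof -
      define x y z where "x = \<alpha> / 2" and "y = \<beta> / 2" and "z = \<gamma> / 2"
      have d: "(\<gamma> - \<beta>) / 2 = z - y" "(\<beta> - \<alpha>) / 2 = y - x" "(\<gamma> - \<alpha>) / 2 = z - x" by (simp_all add: x_def y_def z_def diff_divide_distrib)
      have "sin (z - y) * cos x + sin (y - x) * cos z = sin (z - x) * cos y" "sin (z - y) * sin x + sin (y - x) * sin z = sin (z - x) * sin y"
        by (simp_all add: sin_diff algebra_simps)
      then show ?thesis unfolding s1_def s2_def s3_def d x_def[symmetric] y_def[symmetric] z_def[symmetric] by (simp add: complex_eq_iff)
    qed
    then have "(1 / s3) *\<^sub>R (s1 *\<^sub>R cis (\<alpha> / 2) + s2 *\<^sub>R cis (\<gamma> / 2)) = cis (\<beta> / 2)" using s by simp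
    then show ?thesis by (simp add: v_def u_def scaleR_add_right)
  qed
  have b: "sq (v + u) = b" unfolding vu abcd by (rule sc)
  have "area (cis (\<alpha> / 2)) (cis (\<gamma> / 2)) = s3"
    unfolding area_def cis_cnj cis_mult s3_def by (simp add: diff_divide_distrib)
  then have "area v u = (s1 / s3) * ((s2 / s3) * s3)" by (simp add: v_def u_def area_scale)
  then have D: "area v u \<noteq> 0" using s by simp
  have ne: "v \<noteq> 0" "u \<noteq> 0" using D by (auto simp: area_def)
  have "sq u - sq v \<noteq> 0" unfolding sq_diff[OF ne] using D ne by simp
  then have "sq v \<noteq> sq u" by auto
  then have d: "sq (u - v) = d"
    using cross_ratio_1_unique[OF cross_ratio_parallelogram[OF D, unfolded a b] Q(3)] a by simp
  have "y = \<bar>defect4 (support_fun X) v u / (2 * area v u)\<bar>"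
    unfolding Q(1) quadruple_value_parallelogram[OF X(1) D, unfolded a b d] by (rule norm_of_real)
  also have "\<dots> = \<bar>defect4 (support_fun X) v u\<bar> / (2 * \<bar>area v u\<bar>)" by (simp add: abs_mult)
  also have "\<dots> \<le> (4 * W * \<bar>area v u\<bar>) / (2 * \<bar>area v u\<bar>)"
    by (intro divide_right_mono defect4_le_width[OF X w D]) simp
  also have "\<dots> = 2 * W" using D by simp
  finally show "y \<le> 2 * W" .
qed

section \<open>The characterization\<close>

lemma dbar_norm_HL_nonneg:
  assumes X: "circle_vector_field X" "continuous_on circle X"
  shows "0 \<le> dbar_norm (HL X)"
proof (rule ccontr)
  assume "\<not> 0 \<le> dbar_norm (HL X)"
  then obtain L where L: "dbar_norm (HL X) \<le> ereal L" "L < 0"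
    by (metis ereal_dense2 linorder_not_le order_less_imp_le zero_ereal_def less_ereal.simps(1))
  have "\<bar>Hess (poisson (support_fun X)) 0 1 1\<bar> \<le> L * rho 0 * klein_metric 0 1 1"
    using L(1) unfolding dbar_norm_HL_le_iff[OF X] by (metis centre_in_ball zero_less_one)
  then show False using L(2) by (simp add: klein_metric_eq rho_def defect_def)
qed

theorem theorem1p6:
  fixes X :: "complex \<Rightarrow> complex"
  assumes "circle_vector_field X" and "continuous_on circle X"
  shows "(zygmund X \<longleftrightarrow>
            (\<exists>V. harmonic_lagrangian V \<and> extends_continuously_to V X \<and> dbar_norm V < \<infinity>))
       \<and> (zygmund X \<longleftrightarrow> width X < \<infinity>)
       \<and> (zygmund X \<longleftrightarrow> dbar_norm (HL X) < \<infinity>)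
       \<and> (\<forall>V W. harmonic_lagrangian V \<and> extends_continuously_to V X \<and> dbar_norm V < \<infinity> \<longrightarrow>
                harmonic_lagrangian W \<and> extends_continuously_to W X \<and> dbar_norm W < \<infinity> \<longrightarrow>
                (\<forall>p\<in>hyp_plane. V p = W p))
       \<and> ereal (1/6) * dbar_norm (HL X) \<le> width X
       \<and> width X \<le> 2 * dbar_norm (HL X)"
proof -
  let ?d = "dbar_norm (HL X)"
  have d0: "0 \<le> ?d" by (rule dbar_norm_HL_nonneg[OF assms])
  have upper: "width X \<le> 2 * ?d"
  proof (cases ?d)
    case (real L)
    then show ?thesis using width_le_dbar_norm[OF assms, of L] by simp
  qed (use d0 in auto)
  have lower: "ereal (1/6) * ?d \<le> width X"
  proof (cases "width X")
    case (real w)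
    then have d: "?d \<le> ereal (3 * w)" using dbar_norm_le_width[OF assms, of w] by simp
    then obtain L where L: "?d = ereal L" using d0 by (cases ?d) auto
    then have "L \<le> 3 * w" "0 \<le> L" using d d0 by simp_all
    then show ?thesis using L real by simp
  next
    case MInf
    then have "?d \<le> ereal (3 * (- 1))" by (intro dbar_norm_le_width[OF assms]) simp
    then have "?d < 0" by (rule le_less_trans) simp
    then show ?thesis using d0 by simp
  qed auto
  have wd: "width X < \<infinity> \<longleftrightarrow> ?d < \<infinity>"
  proof
    assume "width X < \<infinity>"
    then show "?d < \<infinity>" using lower by (cases ?d) auto
  next
    assume "?d < \<infinity>"
    then show "width X < \<infinity>" using upper d0 by (cases ?d) auto
  qed
  have zw: "zygmund X \<longleftrightarrow> width X < \<infinity>"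
  proof
    assume z: "zygmund X"
    obtain M where M: "\<forall>v w. \<bar>defect4 (support_fun X) v w\<bar> \<le> M * \<bar>area v w\<bar>"
      using zygmund_parallelogram[OF assms(1) z] by blast
    from M[rule_format] have "width X \<le> ereal (3 * M)" by (rule width_le_of_parallelogram[OF assms])
    then show "width X < \<infinity>" by (rule le_less_trans) simp
  next
    assume "width X < \<infinity>"
    then obtain w where "width X \<le> ereal w" by (cases "width X") auto
    then show "zygmund X" by (rule zygmund_of_width[OF assms])
  qed
  have ex: "?d < \<infinity> \<longleftrightarrow> (\<exists>V. harmonic_lagrangian V \<and> extends_continuously_to V X \<and> dbar_norm V < \<infinity>)"
  proof
    assume "\<exists>V. harmonic_lagrangian V \<and> extends_continuously_to V X \<and> dbar_norm V < \<infinity>"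
    then obtain V where V: "harmonic_lagrangian V" "extends_continuously_to V X" "dbar_norm V < \<infinity>" by blast
    have "dbar_norm V = ?d" by (rule dbar_norm_cong) (rule harmonic_lagrangian_unique[OF assms V(1,2)])
    then show "?d < \<infinity>" using V(3) by simp
  qed (use HL_harmonic_lagrangian[OF assms] HL_extends[OF assms] in blast)
  have uniq: "V p = W p" if "harmonic_lagrangian V" "extends_continuously_to V X" "harmonic_lagrangian W" "extends_continuously_to W X" "p \<in> hyp_plane" for V W p
    using harmonic_lagrangian_unique[OF assms that(1,2,5)] harmonic_lagrangian_unique[OF assms that(3,4,5)] by simp
  show ?thesis
  proof (intro conjI allI impI ballI)
    show "zygmund X \<longleftrightarrow> (\<exists>V. harmonic_lagrangian V \<and> extends_continuously_to V X \<and> dbar_norm V < \<infinity>)"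
      using zw wd ex by simp
    show "zygmund X \<longleftrightarrow> ?d < \<infinity>" using zw wd by simp
  qed (use zw lower upper in \<open>auto intro: uniq\<close>)
qed

end
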